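(* Assume that the Hamiltonian $H$, its flow $\mathcal H$ and the Lagrangian submanifold $\Lambda$ satisfy Assumptions (A1), (A2), (A3) of the context, and that the reference trajectory satisfies the Pontryagin Maximum Principle with multiplier $p_0\in\{0,1\}$ as described there. Let $\xi:[0,T]\to M$ be an admissible trajectory, with associated control $\upsilon$, whose graph is contained in $\mathcal U$, and let $\rho(t):=(\pi\mathcal H_t)^{-1}(\xi(t))$ for $t\in[0,T]$. Then $$p_0\bigl(J(T,\xi,\upsilon)-J(\widehat T,\widehat\xi,\widehat\upsilon)\bigr)\ \ge\ \beta(\xi(T))+\theta(T,\rho(T))-\beta(\widehat x_f)-\theta(\widehat T,\widehat\ell_0).$$
   Context: **Problem.** $M$ is an $n$-dimensional connected paracompact smooth manifold (with a Riemannian distance), $N_0,N_f\subseteq M$ are smooth connected embedded submanifolds, $U\subseteq\mathbb R^m$. The functions $c_0,c_f,f^0$ and the control-dependent vector field $f$ are defined on open sets and are $C^\infty$. Minimise $$J(T,\xi,\upsilon)=c_0(\xi(0))+c_f(\xi(T))+\int_0^T f^0(\xi(t),\upsilon(t))\,dt$$ subject to $\dot\xi(t)=f(\xi(t),\upsilon(t))$ for a.e. $t\in[0,T]$, $\xi(t)\in M$, $\xi(0)\in N_0$, $\xi(T)\in N_f$, $\upsilon\in L^\infty([0,T],U)$. The final time $T$ is either fixed or variable. A pair $(\xi,\upsilon)$ satisfying all these constraints is admissible; $\xi$ is then an admissible trajectory and $\upsilon$ an associated control. **Symplectic notation.** $\pi:T^*M\to M$ is the cotangent bundle, $\boldsymbol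 s$ the Liouville form $\boldsymbol s(\ell)=\ell\circ\pi_*$, $\boldsymbol\sigma=d\boldsymbol s$. For a time-dependent Hamiltonian $H_t$ the Hamiltonian vector field $\overrightarrow{H}_t$ is defined by $\langle dH_t(\ell),\cdot\rangle=\boldsymbol\sigma_\ell(\cdot,\overrightarrow{H}_t(\ell))$. The flow of $\dot\lambda=\overrightarrow{H}_t(\lambda)$, $\lambda(0)=\ell$, is $\mathcal H(t,\ell)=\mathcal H_t(\ell)$. **Reference extremal (PMP).** A reference admissible triple $(\widehat T,\widehat\xi,\widehat\upsilon)$ is given, $\widehat x_0=\widehat\xi(0)$, $\widehat x_f=\widehat\xi(\widehat T)$. With $p_0\in\{0,1\}$ let $F(\ell,u)=\langle\ell,f(\pi\ell,u)\rangle-p_0f^0(\pi\ell,u)$, $\widehat F_t(\ell)=F(\ell,\widehat\upsilon(t))$, $F_{\max}(\ell)=\sup_{u\in U}F(\ell,u)$ (possibly $+\infty$). It is assumed that there is a non-trivial couple $(p_0,\widehat\lambda)$, with $\widehat\lambda:[0,\widehat T]\to T^*M$, $\pi\circ\widehat\lambda=\widehat\xi$, such that $\dot{\widehat\lambda}(t)=\overrightarrow{\widehat F}_t(\widehat\lambda(t))$ a.e., $\widehat\lambda(0)=p_0\,dc_0(\widehat x_0)$ on $T_{\widehat x_0}N_0$, $\widehat\lambda(\widehat T)=-p_0\,dc_f(\widehat x_f)$ on $T_{\widehat x_f}N_f$, and $\widehat F_t(\widehat\lambda(t))=\max_{u\in U}F(\widehat\lambda(t),u)=F_{\max}(\widehat\lambda(t))$;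 moreover $\widehat F_t(\widehat\lambda(t))$ is constant, and zero when $T$ is variable. Put $\widehat\ell_0=\widehat\lambda(0)$, $\widehat\ell_f=\widehat\lambda(\widehat T)$. Let $\alpha,\beta$ be smooth functions on $M$, locally defined near $\widehat x_0$ and $\widehat x_f$ respectively, with $\alpha=p_0c_0$ on $N_0$, $d\alpha(\widehat x_0)=\widehat\ell_0$, $\beta=p_0c_f$ on $N_f$, $d\beta(\widehat x_f)=-\widehat\ell_f$ (where $\beta$ is evaluated, points are understood to lie in its domain). $\Lambda\subset T^*M$ is the graph of $d\alpha$ on a contractible neighbourhood of $\widehat x_0$. **Lipschitz–Carathéodory.** For an open interval $J$ and finite-dimensional Riemannian smooth manifolds $X,Y$, a map $G:J\times X\to Y$ is Lipschitz–Carathéodory if: for a.e. $t$, $G(t,\cdot)$ is locally Lipschitz; for each $x$, $G(\cdot,x)$ is bounded measurable; for each compact $K\subseteq X$ there is an essentially bounded measurable $m$ with $d_Y(G(t,x),G(t,y))\le m(t)d_X(x,y)$ for $x,y\in K$. **Assumptions on $H$.** $J\supset[0,\widehat T]$ is an open interval, $\mathcal O\subseteq T^*M$ is open, $\mathcal O\supset\Lambda$, and $H:J\times\mathcal O\to\mathbb R$ is a time-dependent Hamiltonian. (A1) The flow $(t,\ell)\in J\times\Lambda\mapsto\mathcal H(t,\ell)\in T^*M$ is well defined and Lipschitz continuous, and the function $(t,\ell)\in J\times\Lambda\mapsto\langle\mathcal H_t(\ell),\pi_*\overrightarrow H_t\circ\mathcal H_t(\ell)\rangle-H_t\circ\mathcal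 H_t(\ell)$ is Lipschitz–Carathéodory. (A2) $H_t(\mathcal H_t(\ell))\ge F_{\max}(\mathcal H_t(\ell))$ for $(t,\ell)\in J\times\Lambda$; and for a.e. $t\in[0,\widehat T]$, $H_t(\widehat\lambda(t))=\widehat F_t(\widehat\lambda(t))=F_{\max}(\widehat\lambda(t))$ and $\overrightarrow H_t(\widehat\lambda(t))=\overrightarrow{\widehat F}_t(\widehat\lambda(t))$. (Consequently $\mathcal H_t(\widehat\ell_0)=\widehat\lambda(t)$ on $[0,\widehat T]$.) Fix a compact interval $I=[0,T_1]\subset J$ with $T_1>\widehat T$; $\Lambda$ is replaced by its intersection with a suitable open neighbourhood of $\widehat\ell_0$ so that $\mathcal H$ is defined on $I\times\Lambda$ and the flow of $\overrightarrow{\widehat F}_t$ is defined on $[0,\widehat T]\times\Lambda$. (A3) The map $(t,\ell)\in I\times\Lambda\mapsto(t,\pi\mathcal H_t(\ell))\in I\times M$ is bi-Lipschitz (Lipschitz with Lipschitz inverse) from $I\times\Lambda$ onto an open set $\mathcal U$ of $I\times M$ containing the graph of $\widehat\xi$. **The function $\theta$.** $\theta(t,\ell)=\alpha(\pi\ell)+\int_0^t\bigl(\langle\mathcal H_s(\ell),\pi_*\overrightarrow H_s\circ\mathcal H_s(\ell)\rangle-H_s\circ\mathcal H_s(\ell)\bigr)ds$. *)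

theory Defs
  imports "HOL-Analysis.Analysis"
begin

section \<open>Smooth functions between Euclidean spaces\<close>

text \<open>To be used on open \<open>S\<close>: all iterated directional derivatives up to order \<open>k\<close> exist and are
  continuous, i.e. the function is of class \<open>C^k\<close>.\<close>

primrec Ck_on :: "nat \<Rightarrow> 'a::euclidean_space set \<Rightarrow> ('a \<Rightarrow> 'b::euclidean_space) \<Rightarrow> bool" where
  "Ck_on 0 S g \<longleftrightarrow> continuous_on S g"
| "Ck_on (Suc k) S g \<longleftrightarrow>
     (\<forall>x\<in>S. g differentiable (at x)) \<and> (\<forall>v. Ck_on k S (\<lambda>x. frechet_derivative g (at x) v))"

definition smooth_on :: "'a::euclidean_space set \<Rightarrow> ('a \<Rightarrow> 'b::euclidean_space) \<Rightarrow> bool" where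
  "smooth_on S g \<longleftrightarrow> (\<forall>k. Ck_on k S g)"

definition abs_continuous_on :: "real set \<Rightarrow> (real \<Rightarrow> 'b::real_normed_vector) \<Rightarrow> bool" where
  "abs_continuous_on S g \<longleftrightarrow>
     (\<forall>\<epsilon>>0. \<exists>\<delta>>0. \<forall>(n::nat) a b.
        (\<forall>i<n. a i \<le> b i \<and> {a i..b i} \<subseteq> S) \<and>
        (\<forall>i<n. \<forall>j<n. i \<noteq> j \<longrightarrow> {a i<..<b i} \<inter> {a j<..<b j} = {}) \<and>
        (\<Sum>i<n. b i - a i) < \<delta>
        \<longrightarrow> (\<Sum>i<n. norm (g (b i) - g (a i))) < \<epsilon>)"


section \<open>Smooth manifolds\<close>

text \<open>A chart is a pair (domain, coordinate map); the values of the coordinate map outside the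
  domain are irrelevant. The dimension of the manifold is \<open>DIM('e)\<close>.\<close>

type_synonym ('p, 'e) chart = "'p set \<times> ('p \<Rightarrow> 'e)"

abbreviation dom_of :: "('p, 'e) chart \<Rightarrow> 'p set" where "dom_of c \<equiv> fst c"
abbreviation crd :: "('p, 'e) chart \<Rightarrow> 'p \<Rightarrow> 'e" where "crd c \<equiv> snd c"

definition crd_inv :: "('p, 'e) chart \<Rightarrow> 'e \<Rightarrow> 'p" where
  "crd_inv c = inv_into (dom_of c) (crd c)"

definition transition :: "('p, 'e) chart \<Rightarrow> ('p, 'e) chart \<Rightarrow> 'e \<Rightarrow> 'e" where
  "transition c c' = crd c' \<circ> crd_inv c"

definition carrier_of :: "('p, 'e) chart set \<Rightarrow> 'p set" where
  "carrier_of A = (\<Union>c\<in>A. dom_of c)"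

definition smooth_atlas :: "('p, 'e::euclidean_space) chart set \<Rightarrow> bool" where
  "smooth_atlas A \<longleftrightarrow>
     (\<forall>c\<in>A. inj_on (crd c) (dom_of c) \<and> open (crd c ` dom_of c)) \<and>
     (\<forall>c\<in>A. \<forall>c'\<in>A. open (crd c ` (dom_of c \<inter> dom_of c')) \<and>
        smooth_on (crd c ` (dom_of c \<inter> dom_of c')) (transition c c'))"

definition mtop :: "('p, 'e::euclidean_space) chart set \<Rightarrow> 'p topology" where
  "mtop A = topology (\<lambda>W. W \<subseteq> carrier_of A \<and> (\<forall>c\<in>A. open (crd c ` (W \<inter> dom_of c))))"

lemma openin_mtop:
  assumes "smooth_atlas A"
  shows "openin (mtop A) W \<longleftrightarrow>
    W \<subseteq> carrier_of A \<and> (\<forall>c\<in>A. open (crd c ` (W \<inter> dom_of c)))"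
proof -
  let ?P = "\<lambda>W. W \<subseteq> carrier_of A \<and> (\<forall>c\<in>A. open (crd c ` (W \<inter> dom_of c)))"
  have "istopology ?P"
    unfolding istopology_def
  proof (intro conjI allI impI)
    fix S T assume S: "?P S" and T: "?P T"
    have "crd c ` (S \<inter> T \<inter> dom_of c) = crd c ` (S \<inter> dom_of c) \<inter> crd c ` (T \<inter> dom_of c)"
      if "c \<in> A" for c
      using assms that by (fastforce simp: smooth_atlas_def inj_on_def)
    then show "\<forall>c\<in>A. open (crd c ` (S \<inter> T \<inter> dom_of c))"
      using S T by auto
  next
    fix \<K> assume K: "\<forall>S\<in>\<K>. ?P S"
    have "crd c ` (\<Union>\<K> \<inter> dom_of c) = (\<Union>S\<in>\<K>. crd c ` (S \<inter> dom_of c))" for c :: "('a,'b) chart"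
      by auto
    then show "\<forall>c\<in>A. open (crd c ` (\<Union>\<K> \<inter> dom_of c))"
      using K by (metis (no_types, lifting) open_UN)
  qed auto
  then show ?thesis
    by (simp add: mtop_def)
qed

definition paracompact_space :: "'p topology \<Rightarrow> bool" where
  "paracompact_space T \<longleftrightarrow>
     (\<forall>\<C>. (\<forall>W\<in>\<C>. openin T W) \<and> \<Union>\<C> = topspace T \<longrightarrow>
        (\<exists>\<D>. (\<forall>W\<in>\<D>. openin T W \<and> (\<exists>W'\<in>\<C>. W \<subseteq> W')) \<and> \<Union>\<D> = topspace T \<and>
             locally_finite_in T \<D>))"

definition connected_paracompact_manifold :: "('p, 'e::euclidean_space) chart set \<Rightarrow> bool" where
  "connected_paracompact_manifold A \<longleftrightarrow>
     smooth_atlas A \<and> Hausdorff_space (mtop A) \<and> paracompact_space (mtop A) \<and>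
     connected_space (mtop A)"


section \<open>Tangent vectors, differentials, forms\<close>

text \<open>A tangent vector at \<open>x\<close> is the family of its components in the charts around \<open>x\<close>, subject to
  the transformation law under change of charts (and 0 at all other charts).\<close>

type_synonym ('p, 'e) tvec = "('p, 'e) chart \<Rightarrow> 'e"

definition tangent_space :: "('p, 'e::euclidean_space) chart set \<Rightarrow> 'p \<Rightarrow> ('p, 'e) tvec set" where
  "tangent_space A x =
     {v. (\<forall>c\<in>A. \<forall>c'\<in>A. x \<in> dom_of c \<and> x \<in> dom_of c' \<longrightarrow>
            v c' = frechet_derivative (transition c c') (at (crd c x)) (v c)) \<and>
         (\<forall>c. \<not> (c \<in> A \<and> x \<in> dom_of c) \<longrightarrow> v c = 0)}"

text \<open>The tangent vector at \<open>x\<close> whose component in the chart \<open>c\<close> is \<open>a\<close>.\<close>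

definition tvec_of ::
  "('p, 'e::euclidean_space) chart set \<Rightarrow> ('p, 'e) chart \<Rightarrow> 'p \<Rightarrow> 'e \<Rightarrow> ('p, 'e) tvec" where
  "tvec_of A c x a =
     (\<lambda>c'. if c' \<in> A \<and> x \<in> dom_of c'
           then frechet_derivative (transition c c') (at (crd c x)) a else 0)"

definition some_chart :: "('p, 'e) chart set \<Rightarrow> 'p \<Rightarrow> ('p, 'e) chart" where
  "some_chart A x = (SOME c. c \<in> A \<and> x \<in> dom_of c)"

definition mdifferentiable_at ::
  "('p, 'e::euclidean_space) chart set \<Rightarrow> ('p \<Rightarrow> real) \<Rightarrow> 'p \<Rightarrow> bool" where
  "mdifferentiable_at A h x \<longleftrightarrow>
     (\<forall>c\<in>A. x \<in> dom_of c \<longrightarrow> (h \<circ> crd_inv c) differentiable (at (crd c x)))"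

definition msmooth_on ::
  "('p, 'e::euclidean_space) chart set \<Rightarrow> 'p set \<Rightarrow> ('p \<Rightarrow> real) \<Rightarrow> bool" where
  "msmooth_on A W h \<longleftrightarrow>
     (\<forall>c\<in>A. smooth_on (crd c ` (W \<inter> dom_of c)) (h \<circ> crd_inv c))"

definition differential ::
  "('p, 'e::euclidean_space) chart set \<Rightarrow> ('p \<Rightarrow> real) \<Rightarrow> 'p \<Rightarrow> ('p, 'e) tvec \<Rightarrow> real" where
  "differential A h x v =
     (if v \<in> tangent_space A x
      then let c = some_chart A x in frechet_derivative (h \<circ> crd_inv c) (at (crd c x)) (v c)
      else 0)"

definition pushforward ::
  "('p, 'e::euclidean_space) chart set \<Rightarrow> ('q, 'd::euclidean_space) chart set \<Rightarrow> ('p \<Rightarrow> 'q) \<Rightarrow>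
   'p \<Rightarrow> ('p, 'e) tvec \<Rightarrow> ('q, 'd) tvec" where
  "pushforward A B h x v =
     (let c = some_chart A x in
      (\<lambda>c'. if c' \<in> B \<and> h x \<in> dom_of c'
            then frechet_derivative (crd c' \<circ> h \<circ> crd_inv c) (at (crd c x)) (v c) else 0))"

text \<open>The exterior derivative of a 1-form, with the convention
  \<open>d\<omega>(v,w) = D\<omega>(v)\<cdot>w - D\<omega>(w)\<cdot>v\<close> in coordinates, so that \<open>d(p dq) = dp \<and> dq\<close>.\<close>

definition ext_deriv ::
  "('p, 'e::euclidean_space) chart set \<Rightarrow> ('p \<Rightarrow> ('p, 'e) tvec \<Rightarrow> real) \<Rightarrow>
   'p \<Rightarrow> ('p, 'e) tvec \<Rightarrow> ('p, 'e) tvec \<Rightarrow> real" where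
  "ext_deriv A \<omega> x v w =
     (let c = some_chart A x;
          comp = (\<lambda>a z. \<omega> (crd_inv c z) (tvec_of A c (crd_inv c z) a))
      in frechet_derivative (comp (w c)) (at (crd c x)) (v c) -
         frechet_derivative (comp (v c)) (at (crd c x)) (w c))"


section \<open>Curves\<close>

definition mcontinuous_curve ::
  "('p, 'e::euclidean_space) chart set \<Rightarrow> real set \<Rightarrow> (real \<Rightarrow> 'p) \<Rightarrow> bool" where
  "mcontinuous_curve A S \<gamma> \<longleftrightarrow> continuous_map (top_of_set S) (mtop A) \<gamma>"

text \<open>For a non-compact interval this is local absolute continuity.\<close>

definition mabs_continuous_curve ::
  "('p, 'e::euclidean_space) chart set \<Rightarrow> real set \<Rightarrow> (real \<Rightarrow> 'p) \<Rightarrow> bool" where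
  "mabs_continuous_curve A S \<gamma> \<longleftrightarrow>
     mcontinuous_curve A S \<gamma> \<and>
     (\<forall>c\<in>A. \<forall>a b. {a..b} \<subseteq> S \<and> \<gamma> ` {a..b} \<subseteq> dom_of c \<longrightarrow>
        abs_continuous_on {a..b} (crd c \<circ> \<gamma>))"

definition has_velocity ::
  "('p, 'e::euclidean_space) chart set \<Rightarrow> (real \<Rightarrow> 'p) \<Rightarrow> real \<Rightarrow> ('p, 'e) tvec \<Rightarrow> bool" where
  "has_velocity A \<gamma> t v \<longleftrightarrow>
     v \<in> tangent_space A (\<gamma> t) \<and>
     (\<forall>c\<in>A. \<gamma> t \<in> dom_of c \<longrightarrow> ((crd c \<circ> \<gamma>) has_vector_derivative v c) (at t))"

text \<open>Caratheodory solutions on \<open>S\<close>, with values in \<open>W\<close>, of the equation given by the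
  time-dependent vector field \<open>X\<close> (only its values on \<open>S \<times> W\<close> matter).\<close>

definition solves ::
  "('p, 'e::euclidean_space) chart set \<Rightarrow> 'p set \<Rightarrow> (real \<Rightarrow> 'p \<Rightarrow> ('p, 'e) tvec) \<Rightarrow>
   real set \<Rightarrow> (real \<Rightarrow> 'p) \<Rightarrow> bool" where
  "solves A W X S \<gamma> \<longleftrightarrow>
     \<gamma> ` S \<subseteq> W \<and> mabs_continuous_curve A S \<gamma> \<and>
     (AE t in lebesgue_on S. has_velocity A \<gamma> t (X t (\<gamma> t)))"

text \<open>The flow from time 0 is well defined on \<open>S \<times> K\<close>, and it is \<open>\<Phi>\<close>: for each initial point in \<open>K\<close>
  there is exactly one solution on \<open>S\<close>.\<close>

definition is_flow ::
  "('p, 'e::euclidean_space) chart set \<Rightarrow> 'p set \<Rightarrow> (real \<Rightarrow> 'p \<Rightarrow> ('p, 'e) tvec) \<Rightarrow>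
   real set \<Rightarrow> 'p set \<Rightarrow> (real \<Rightarrow> 'p \<Rightarrow> 'p) \<Rightarrow> bool" where
  "is_flow A W X S K \<Phi> \<longleftrightarrow>
     (\<forall>x\<in>K. \<Phi> 0 x = x \<and> solves A W X S (\<lambda>t. \<Phi> t x) \<and>
        (\<forall>S' \<gamma>. is_interval S' \<and> 0 \<in> S' \<and> S' \<subseteq> S \<and> solves A W X S' \<gamma> \<and> \<gamma> 0 = x
            \<longrightarrow> (\<forall>t\<in>S'. \<gamma> t = \<Phi> t x)))"


section \<open>Embedded submanifolds\<close>

text \<open>\<open>d\<close> ranges over the charts compatible with the atlas; \<open>k\<close> is the dimension of \<open>N\<close>.\<close>

definition embedded_submanifold :: "('p, 'e::euclidean_space) chart set \<Rightarrow> 'p set \<Rightarrow> bool" where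
  "embedded_submanifold A N \<longleftrightarrow>
     N \<subseteq> carrier_of A \<and>
     (\<exists>k. \<forall>x\<in>N. \<exists>d S. smooth_atlas (insert d A) \<and> dom_of d \<subseteq> carrier_of A \<and> x \<in> dom_of d \<and>
        subspace S \<and> dim S = k \<and> crd d ` (N \<inter> dom_of d) = crd d ` dom_of d \<inter> S)"

text \<open>Velocities at \<open>x\<close> of the smooth curves lying in \<open>N\<close>.\<close>

definition submanifold_tangent_space ::
  "('p, 'e::euclidean_space) chart set \<Rightarrow> 'p set \<Rightarrow> 'p \<Rightarrow> ('p, 'e) tvec set" where
  "submanifold_tangent_space A N x =
     {v. \<exists>\<gamma> \<epsilon>. \<epsilon> > 0 \<and> \<gamma> ` {-\<epsilon><..<\<epsilon>} \<subseteq> N \<and> \<gamma> 0 = x \<and>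
          mcontinuous_curve A {-\<epsilon><..<\<epsilon>} \<gamma> \<and>
          (\<forall>c\<in>A. smooth_on {t\<in>{-\<epsilon><..<\<epsilon>}. \<gamma> t \<in> dom_of c} (crd c \<circ> \<gamma>)) \<and>
          has_velocity A \<gamma> 0 v}"


section \<open>Riemannian metrics and distances\<close>

type_synonym ('p, 'e) metric_tensor = "'p \<Rightarrow> ('p, 'e) tvec \<Rightarrow> ('p, 'e) tvec \<Rightarrow> real"

definition riemannian_metric ::
  "('p, 'e::euclidean_space) chart set \<Rightarrow> ('p, 'e) metric_tensor \<Rightarrow> bool" where
  "riemannian_metric A g \<longleftrightarrow>
     (\<forall>x\<in>carrier_of A. \<forall>u\<in>tangent_space A x. \<forall>v\<in>tangent_space A x.
        g x u v = g x v u \<and>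
        (u \<noteq> (\<lambda>_. 0) \<longrightarrow> g x u u > 0) \<and>
        (\<forall>w\<in>tangent_space A x. \<forall>r s.
           g x (\<lambda>c. r *\<^sub>R u c + s *\<^sub>R v c) w = r * g x u w + s * g x v w)) \<and>
     (\<forall>c\<in>A. \<forall>a b. smooth_on (crd c ` dom_of c)
        (\<lambda>z. g (crd_inv c z) (tvec_of A c (crd_inv c z) a) (tvec_of A c (crd_inv c z) b)))"

definition velocity ::
  "('p, 'e::euclidean_space) chart set \<Rightarrow> (real \<Rightarrow> 'p) \<Rightarrow> real \<Rightarrow> ('p, 'e) tvec" where
  "velocity A \<gamma> t =
     (\<lambda>c. if c \<in> A \<and> \<gamma> t \<in> dom_of c then vector_derivative (crd c \<circ> \<gamma>) (at t) else 0)"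

definition piecewise_C1_curve ::
  "('p, 'e::euclidean_space) chart set \<Rightarrow> (real \<Rightarrow> 'p) \<Rightarrow> bool" where
  "piecewise_C1_curve A \<gamma> \<longleftrightarrow>
     mcontinuous_curve A {0..1} \<gamma> \<and>
     (\<forall>c\<in>A. \<forall>a b. {a..b} \<subseteq> {0..1} \<and> \<gamma> ` {a..b} \<subseteq> dom_of c \<longrightarrow>
        (crd c \<circ> \<gamma>) piecewise_C1_differentiable_on {a..b})"

text \<open>Infimum of the lengths \<open>l\<close> of the rectifiable curves joining the two points. The library's
  notion of piecewise C1 does not bound the derivative at the break points, so that
  integrability of the speed is part of the condition.\<close>

definition riemannian_dist ::
  "('p, 'e::euclidean_space) chart set \<Rightarrow> ('p, 'e) metric_tensor \<Rightarrow> 'p \<Rightarrow> 'p \<Rightarrow> real" where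
  "riemannian_dist A g x y =
     Inf {l. \<exists>\<gamma>. piecewise_C1_curve A \<gamma> \<and> \<gamma> 0 = x \<and> \<gamma> 1 = y \<and>
              ((\<lambda>t. sqrt (g (\<gamma> t) (velocity A \<gamma> t) (velocity A \<gamma> t))) has_integral l) {0..1}}"

text \<open>Maps \<open>S \<times> X \<rightarrow> Y\<close>, where \<open>X\<close> is a set of points of the space \<open>T\<close>, with distance \<open>d\<close>.\<close>

definition lipschitz_caratheodory ::
  "'p topology \<Rightarrow> ('p \<Rightarrow> 'p \<Rightarrow> real) \<Rightarrow> real set \<Rightarrow> 'p set \<Rightarrow>
   (real \<Rightarrow> 'p \<Rightarrow> 'y::metric_space) \<Rightarrow> bool" where
  "lipschitz_caratheodory T d S X G \<longleftrightarrow>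
     (AE t in lebesgue_on S. \<forall>x\<in>X. \<exists>W L. openin T W \<and> x \<in> W \<and>
        (\<forall>y\<in>W \<inter> X. \<forall>z\<in>W \<inter> X. dist (G t y) (G t z) \<le> L * d y z)) \<and>
     (\<forall>x\<in>X. (\<lambda>t. G t x) \<in> borel_measurable (lebesgue_on S) \<and> bounded ((\<lambda>t. G t x) ` S)) \<and>
     (\<forall>K. compactin T K \<and> K \<subseteq> X \<longrightarrow>
        (\<exists>m::real \<Rightarrow> real. m \<in> borel_measurable (lebesgue_on S) \<and>
           (\<exists>C. AE t in lebesgue_on S. \<bar>m t\<bar> \<le> C) \<and>
           (AE t in lebesgue_on S. \<forall>x\<in>K. \<forall>y\<in>K. dist (G t x) (G t y) \<le> m t * d x y)))"


section \<open>The cotangent bundle and its symplectic structure\<close>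

text \<open>Covectors at \<open>x\<close> are the linear functionals on the tangent space, extended by 0 outside it so
  that equality of covectors is equality of functions.\<close>

type_synonym ('p, 'e) cot = "'p \<times> (('p, 'e) tvec \<Rightarrow> real)"

definition cotangent_space ::
  "('p, 'e::euclidean_space) chart set \<Rightarrow> 'p \<Rightarrow> (('p, 'e) tvec \<Rightarrow> real) set" where
  "cotangent_space A x =
     {l. (\<forall>u\<in>tangent_space A x. \<forall>v\<in>tangent_space A x. \<forall>r s.
            l (\<lambda>c. r *\<^sub>R u c + s *\<^sub>R v c) = r * l u + s * l v) \<and>
         (\<forall>u. u \<notin> tangent_space A x \<longrightarrow> l u = 0)}"

text \<open>The natural coordinates \<open>(q, p)\<close>; the dual space of \<open>'e\<close> is identified with \<open>'e\<close> via the
  inner product.\<close>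

definition cot_chart ::
  "('p, 'e::euclidean_space) chart set \<Rightarrow> ('p, 'e) chart \<Rightarrow> (('p, 'e) cot, 'e \<times> 'e) chart" where
  "cot_chart A c =
     ({(x, l). x \<in> dom_of c \<and> l \<in> cotangent_space A x},
      (\<lambda>(x, l). (crd c x, \<Sum>b\<in>Basis. l (tvec_of A c x b) *\<^sub>R b)))"

definition cot_atlas ::
  "('p, 'e::euclidean_space) chart set \<Rightarrow> (('p, 'e) cot, 'e \<times> 'e) chart set" where
  "cot_atlas A = cot_chart A ` A"

definition proj_push ::
  "('p, 'e::euclidean_space) chart set \<Rightarrow> ('p, 'e) cot \<Rightarrow> (('p, 'e) cot, 'e \<times> 'e) tvec \<Rightarrow>
   ('p, 'e) tvec" where
  "proj_push A = pushforward (cot_atlas A) A fst"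

definition liouville_form ::
  "('p, 'e::euclidean_space) chart set \<Rightarrow> ('p, 'e) cot \<Rightarrow> (('p, 'e) cot, 'e \<times> 'e) tvec \<Rightarrow> real"
  where "liouville_form A l w = snd l (proj_push A l w)"

definition symplectic_form ::
  "('p, 'e::euclidean_space) chart set \<Rightarrow> ('p, 'e) cot \<Rightarrow> (('p, 'e) cot, 'e \<times> 'e) tvec \<Rightarrow>
   (('p, 'e) cot, 'e \<times> 'e) tvec \<Rightarrow> real" where
  "symplectic_form A = ext_deriv (cot_atlas A) (liouville_form A)"

text \<open>Meaningful at the points where \<open>h\<close> is differentiable.\<close>

definition hamiltonian_vector ::
  "('p, 'e::euclidean_space) chart set \<Rightarrow> (('p, 'e) cot \<Rightarrow> real) \<Rightarrow> ('p, 'e) cot \<Rightarrow>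
   (('p, 'e) cot, 'e \<times> 'e) tvec" where
  "hamiltonian_vector A h l =
     (THE X. X \<in> tangent_space (cot_atlas A) l \<and>
        (\<forall>v\<in>tangent_space (cot_atlas A) l.
           differential (cot_atlas A) h l v = symplectic_form A l v X))"

definition graph_differential ::
  "('p, 'e::euclidean_space) chart set \<Rightarrow> ('p \<Rightarrow> real) \<Rightarrow> 'p set \<Rightarrow> ('p, 'e) cot set" where
  "graph_differential A a V = (\<lambda>x. (x, differential A a x)) ` V"


section \<open>The optimal control problem\<close>

text \<open>\<open>final_time\<close> is \<open>Some T\<close> if the final time is fixed to be \<open>T\<close> and \<open>None\<close> if it is variable.
  The running cost and the controlled vector field are defined on the open set \<open>dyn_dom\<close>.\<close>

record ('p, 'e, 'u) control_problem =
  atlas :: "('p, 'e) chart set"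
  init_mfd :: "'p set"
  final_mfd :: "'p set"
  ctrl_set :: "'u set"
  init_dom :: "'p set"
  init_cost :: "'p \<Rightarrow> real"
  final_dom :: "'p set"
  final_cost :: "'p \<Rightarrow> real"
  dyn_dom :: "('p \<times> 'u) set"
  run_cost :: "'p \<Rightarrow> 'u \<Rightarrow> real"
  dyn :: "'p \<Rightarrow> 'u \<Rightarrow> ('p, 'e) tvec"
  final_time :: "real option"

definition control_problem ::
  "('p, 'e::euclidean_space, 'u::euclidean_space) control_problem \<Rightarrow> bool" where
  "control_problem P \<longleftrightarrow>
     connected_paracompact_manifold (atlas P) \<and>
     embedded_submanifold (atlas P) (init_mfd P) \<and>
     connectedin (mtop (atlas P)) (init_mfd P) \<and>
     embedded_submanifold (atlas P) (final_mfd P) \<and>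
     connectedin (mtop (atlas P)) (final_mfd P) \<and>
     openin (mtop (atlas P)) (init_dom P) \<and> init_mfd P \<subseteq> init_dom P \<and>
     msmooth_on (atlas P) (init_dom P) (init_cost P) \<and>
     openin (mtop (atlas P)) (final_dom P) \<and> final_mfd P \<subseteq> final_dom P \<and>
     msmooth_on (atlas P) (final_dom P) (final_cost P) \<and>
     openin (prod_topology (mtop (atlas P)) euclidean) (dyn_dom P) \<and>
     carrier_of (atlas P) \<times> ctrl_set P \<subseteq> dyn_dom P \<and>
     (\<forall>(x, u)\<in>dyn_dom P. dyn P x u \<in> tangent_space (atlas P) x) \<and>
     (\<forall>c\<in>atlas P.
        smooth_on ((\<lambda>(x, u). (crd c x, u)) ` {(x, u)\<in>dyn_dom P. x \<in> dom_of c})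
          (\<lambda>(z, u). run_cost P (crd_inv c z) u) \<and>
        smooth_on ((\<lambda>(x, u). (crd c x, u)) ` {(x, u)\<in>dyn_dom P. x \<in> dom_of c})
          (\<lambda>(z, u). dyn P (crd_inv c z) u c))"

text \<open>Essentially bounded controls with values in the control set.\<close>

definition control_fun ::
  "('p, 'e::euclidean_space, 'u::euclidean_space) control_problem \<Rightarrow> real \<Rightarrow> (real \<Rightarrow> 'u) \<Rightarrow> bool"
  where
  "control_fun P T \<upsilon> \<longleftrightarrow>
     \<upsilon> \<in> borel_measurable (lebesgue_on {0..T}) \<and>
     (\<exists>C. AE t in lebesgue_on {0..T}. norm (\<upsilon> t) \<le> C) \<and>
     (AE t in lebesgue_on {0..T}. \<upsilon> t \<in> ctrl_set P)"

definition admissible ::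
  "('p, 'e::euclidean_space, 'u::euclidean_space) control_problem \<Rightarrow> real \<Rightarrow> (real \<Rightarrow> 'p) \<Rightarrow>
   (real \<Rightarrow> 'u) \<Rightarrow> bool" where
  "admissible P T \<xi> \<upsilon> \<longleftrightarrow>
     0 < T \<and> (\<forall>T\<^sub>f. final_time P = Some T\<^sub>f \<longrightarrow> T = T\<^sub>f) \<and>
     control_fun P T \<upsilon> \<and>
     solves (atlas P) (carrier_of (atlas P)) (\<lambda>t x. dyn P x (\<upsilon> t)) {0..T} \<xi> \<and>
     \<xi> 0 \<in> init_mfd P \<and> \<xi> T \<in> final_mfd P"

text \<open>The control need not stay in a compact subset of the domain of the running cost, so that
  admissibility does not imply that the integral in the cost exists.\<close>

definition finite_cost ::
  "('p, 'e, 'u) control_problem \<Rightarrow> real \<Rightarrow> (real \<Rightarrow> 'p) \<Rightarrow> (real \<Rightarrow> 'u) \<Rightarrow> bool" where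
  "finite_cost P T \<xi> \<upsilon> \<longleftrightarrow>
     (\<lambda>t. run_cost P (\<xi> t) (\<upsilon> t)) absolutely_integrable_on {0..T}"

definition cost ::
  "('p, 'e, 'u) control_problem \<Rightarrow> real \<Rightarrow> (real \<Rightarrow> 'p) \<Rightarrow> (real \<Rightarrow> 'u) \<Rightarrow> real" where
  "cost P T \<xi> \<upsilon> =
     init_cost P (\<xi> 0) + final_cost P (\<xi> T) + integral {0..T} (\<lambda>t. run_cost P (\<xi> t) (\<upsilon> t))"


section \<open>The Pontryagin Maximum Principle\<close>

definition pre_ham ::
  "('p, 'e, 'u) control_problem \<Rightarrow> real \<Rightarrow> ('p, 'e) cot \<Rightarrow> 'u \<Rightarrow> real" where
  "pre_ham P p\<^sub>0 l u = snd l (dyn P (fst l) u) - p\<^sub>0 * run_cost P (fst l) u"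

definition max_ham ::
  "('p, 'e, 'u) control_problem \<Rightarrow> real \<Rightarrow> ('p, 'e) cot \<Rightarrow> ereal" where
  "max_ham P p\<^sub>0 l = (SUP u\<in>ctrl_set P. ereal (pre_ham P p\<^sub>0 l u))"

definition pmp_extremal ::
  "('p, 'e::euclidean_space, 'u::euclidean_space) control_problem \<Rightarrow> real \<Rightarrow> real \<Rightarrow>
   (real \<Rightarrow> 'p) \<Rightarrow> (real \<Rightarrow> 'u) \<Rightarrow> (real \<Rightarrow> ('p, 'e) cot) \<Rightarrow> bool" where
  "pmp_extremal P p\<^sub>0 T \<xi> \<upsilon> \<eta> \<longleftrightarrow>
     p\<^sub>0 \<in> {0, 1} \<and>
     (p\<^sub>0 \<noteq> 0 \<or> (\<exists>t\<in>{0..T}. snd (\<eta> t) \<noteq> (\<lambda>_. 0))) \<and>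
     (\<forall>t\<in>{0..T}. fst (\<eta> t) = \<xi> t) \<and>
     solves (cot_atlas (atlas P)) (carrier_of (cot_atlas (atlas P)))
       (\<lambda>t. hamiltonian_vector (atlas P) (\<lambda>l. pre_ham P p\<^sub>0 l (\<upsilon> t))) {0..T} \<eta> \<and>
     (\<forall>v\<in>submanifold_tangent_space (atlas P) (init_mfd P) (\<xi> 0).
        snd (\<eta> 0) v = p\<^sub>0 * differential (atlas P) (init_cost P) (\<xi> 0) v) \<and>
     (\<forall>v\<in>submanifold_tangent_space (atlas P) (final_mfd P) (\<xi> T).
        snd (\<eta> T) v = - p\<^sub>0 * differential (atlas P) (final_cost P) (\<xi> T) v) \<and>
     (AE t in lebesgue_on {0..T}. ereal (pre_ham P p\<^sub>0 (\<eta> t) (\<upsilon> t)) = max_ham P p\<^sub>0 (\<eta> t)) \<and>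
     (\<exists>k. (AE t in lebesgue_on {0..T}. pre_ham P p\<^sub>0 (\<eta> t) (\<upsilon> t) = k) \<and>
          (final_time P = None \<longrightarrow> k = 0))"

text \<open>\<open>\<langle>\<Phi>\<^sub>t(l), \<pi>\<^sub>* X\<^sub>t(\<Phi>\<^sub>t(l))\<rangle> - H\<^sub>t(\<Phi>\<^sub>t(l))\<close>, with \<open>X\<close> the Hamiltonian vector field of \<open>H\<close>.\<close>

definition lagrangian_along ::
  "('p, 'e::euclidean_space) chart set \<Rightarrow> (real \<Rightarrow> ('p, 'e) cot \<Rightarrow> real) \<Rightarrow>
   (real \<Rightarrow> ('p, 'e) cot \<Rightarrow> ('p, 'e) cot) \<Rightarrow> real \<Rightarrow> ('p, 'e) cot \<Rightarrow> real" where
  "lagrangian_along A H \<Phi> t l =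
     snd (\<Phi> t l) (proj_push A (\<Phi> t l) (hamiltonian_vector A (H t) (\<Phi> t l))) - H t (\<Phi> t l)"

definition theta ::
  "('p, 'e::euclidean_space) chart set \<Rightarrow> ('p \<Rightarrow> real) \<Rightarrow> (real \<Rightarrow> ('p, 'e) cot \<Rightarrow> real) \<Rightarrow>
   (real \<Rightarrow> ('p, 'e) cot \<Rightarrow> ('p, 'e) cot) \<Rightarrow> real \<Rightarrow> ('p, 'e) cot \<Rightarrow> real" where
  "theta A a H \<Phi> t l = a (fst l) + integral {0..t} (\<lambda>s. lagrangian_along A H \<Phi> s l)"

end

theory Submission
  imports Defs
begin

text \<open>
  The proof is a verification argument. Write \<open>x(t, l) = \<pi> \<H>\<^sub>t(l)\<close> and let \<open>p(t, l)\<close> be the covector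
  part of \<open>\<H>\<^sub>t(l)\<close>. Because \<open>\<Lambda>\<close> is the graph of an exact form, the one-form \<open>p dx - H dt\<close>, pulled back
  to \<open>I \<times> \<Lambda>\<close>, is the differential of \<open>\<theta>\<close>. Along the lift \<open>(t, \<rho> t)\<close> of an admissible trajectory this
  gives \<open>d/dt \<theta>(t, \<rho> t) = \<langle>p, \<xi>'\<rangle> - H \<le> p\<^sub>0 f\<^sup>0(\<xi>, \<upsilon>)\<close>, since \<open>H\<close> majorises the maximised Hamiltonian
  on the flow. Along the reference extremal, which is itself a flow line, equality holds. Integrating
  both, and using that \<open>\<alpha>\<close> and \<open>\<beta>\<close> extend \<open>p\<^sub>0 c\<^sub>0\<close> and \<open>p\<^sub>0 c\<^sub>f\<close>, yields the inequality.

  The difficulty is regularity. The flow is only Lipschitz in \<open>l\<close>, so \<open>p dx - H dt\<close> cannot be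
  differentiated, and the times at which a flow line has a velocity depend on its starting point, so
  that the chain rule fails for the moving point \<open>\<rho> t\<close>. Two devices replace the exterior calculus.

  Spatial exactness (\<open>d\<theta>\<^sub>t = p dx\<close> at every \<open>t\<close>, \<open>exact_everywhere\<close>) is true at time \<open>0\<close> and is transported
  in time by \<open>generating_function_estimate\<close>: along a segment of starting points of length \<open>b\<close> the defect
  at a later time is \<open>O(b\<^sup>2)\<close>. The defect is averaged over the segment, so that Fubini and the
  \<open>L\<^sup>1\<close>-continuity of translations can be used instead of derivatives of the flow in \<open>l\<close>.

  The derivative of \<open>\<theta>(t, \<rho> t)\<close> is replaced by a two-sided bound on \<open>\<theta>(v, \<rho> v) - \<theta>(u, \<rho> u)\<close> for
  \<open>u \<le> s \<le> v\<close> near a good time \<open>s\<close> (\<open>value_along_curve_le\<close>). From \<open>(u, \<rho> u)\<close> one moves first in time with the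
  starting point fixed, where \<open>\<theta>\<close> is an integral and \<open>H\<close> is bounded below by the pre-Hamiltonian with
  the frozen control \<open>\<upsilon> s\<close>, and then in space at time \<open>v\<close>, where exactness applies. Such bounds at
  almost every \<open>s\<close> integrate by \<open>abs_continuous_increment_le_integral\<close>, since \<open>\<theta>(t, \<rho> t)\<close> is absolutely
  continuous.

  Both steps take place in charts, where the Riemannian distances of the assumptions have to be
  compared with norms (\<open>rdist_upper\<close>, \<open>rdist_lower\<close>) and Hamiltonian fields have to take their canonical
  form (\<open>hamiltonian_vector_chart\<close>); \<open>flow_in_box\<close> collects the resulting coordinate description.
\<close>

section \<open>Increments of absolutely continuous functions\<close>

text \<open>A continuous function that grows faster than \<open>C + e\<close> crosses every level \<open>y\<close> between its end values;
  after subtracting the linear part, the last point below such a level violates the Dini bound, so it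
  lies in \<open>N\<close>. The image of \<open>N\<close> is null by the pointwise Lipschitz condition, so some level is free.\<close>
lemma dini_bound_imp_increment_bound:
 fixes \<phi> :: "real => real"
 assumes "a \<le> b" and cont: "continuous_on {a..b} \<phi>"
  and ptl: "\<And>r. r \<in> {a..b} ==>
   \<exists>B d. d > 0 \<and> (\<forall>r'\<in>{a..b}. \<bar>r' - r\<bar> < d --> \<bar>\<phi> r' - \<phi> r\<bar> \<le> B * \<bar>r' - r\<bar>)"
  and N: "negligible N"
  and dini: "\<And>r e. r \<in> {a..<b} - N ==> e > 0 ==>
   \<exists>r'\<in>{r<..b}. \<phi> r' - \<phi> r \<le> (C + e) * (r' - r)"
 shows "\<phi> b - \<phi> a \<le> C * (b - a)"
proof (rule ccontr)
 assume "\<not> ?thesis"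
 then have gt: "\<phi> b - \<phi> a > C * (b - a)" by simp
 then have "a < b" using \<open>a \<le> b\<close> by (cases "a = b") auto
 define X where "X = \<phi> b - \<phi> a - C * (b - a)"
 define e where "e = X / (2 * (b - a))"
 have "X > 0" using gt by (simp add: X_def)
 then have "e > 0" using \<open>a < b\<close> by (simp add: e_def)
 have e: "2 * e * (b - a) = X" using \<open>a < b\<close> by (simp add: e_def field_simps)
 \<comment> \<open>\<open>\<psi>\<close> still increases from \<open>a\<close> to \<open>b\<close>, but the Dini bound provides, to the right of every good point, a value that is not larger.\<close>
 define \<psi> where "\<psi> r = \<phi> r - (C + e) * r" for r
 have "\<psi> b - \<psi> a = e * (b - a)" unfolding \<psi>_def using e unfolding X_def by (simp add: algebra_simps)
 then have lt: "\<psi> a < \<psi> b" using \<open>e > 0\<close> \<open>a < b\<close> by (smt (verit) mult_pos_pos)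
 have cont\<psi>: "continuous_on {a..b} \<psi>" unfolding \<psi>_def by (intro continuous_intros cont)
 have "negligible (\<psi> ` (N \<inter> {a..b}))"
 proof (rule negligible_locally_Lipschitz_image)
  show "negligible (N \<inter> {a..b})" using N negligible_Int by blast
  fix r assume r: "r \<in> N \<inter> {a..b}"
  then obtain B d where d: "d > 0" "\<forall>r'\<in>{a..b}. \<bar>r' - r\<bar> < d --> \<bar>\<phi> r' - \<phi> r\<bar> \<le> B * \<bar>r' - r\<bar>"
   using ptl by blast
  have "norm (\<psi> r' - \<psi> r) \<le> (B + \<bar>C + e\<bar>) * norm (r' - r)" if "r' \<in> N \<inter> {a..b} \<inter> ball r d" for r'
  proof -
   have "\<psi> r' - \<psi> r = (\<phi> r' - \<phi> r) - (C + e) * (r' - r)" by (simp add: \<psi>_def algebra_simps)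
   then have "\<bar>\<psi> r' - \<psi> r\<bar> \<le> \<bar>\<phi> r' - \<phi> r\<bar> + \<bar>C + e\<bar> * \<bar>r' - r\<bar>"
    by (metis abs_mult abs_triangle_ineq4)
   moreover have "\<bar>\<phi> r' - \<phi> r\<bar> \<le> B * \<bar>r' - r\<bar>" using d that by (auto simp: dist_real_def)
   ultimately show ?thesis by (simp add: algebra_simps)
  qed
  then show "\<exists>T B. open T \<and> r \<in> T \<and> (\<forall>y\<in>N \<inter> {a..b} \<inter> T. norm (\<psi> y - \<psi> r) \<le> B * norm (y - r))"
   using \<open>d > 0\<close> by (metis open_ball centre_in_ball)
 qed simp
 moreover have "\<not> negligible {\<psi> a<..<\<psi> b}"
  using lt by (metis open_not_negligible open_greaterThanLessThan greaterThanLessThan_empty_iff not_le)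
 ultimately have "\<not> {\<psi> a<..<\<psi> b} \<subseteq> \<psi> ` (N \<inter> {a..b})" using negligible_subset by blast
 then obtain y where y: "\<psi> a < y" "y < \<psi> b" "y \<notin> \<psi> ` (N \<inter> {a..b})"
  unfolding subset_iff greaterThanLessThan_iff by blast
 define S where "S = {r\<in>{a..b}. \<psi> r \<le> y}"
 have "closed S" unfolding S_def
  using continuous_closed_preimage[OF cont\<psi> _ closed_atMost[of y]]
  by (simp add: vimage_def Int_def)
 have "a \<in> S" using y \<open>a < b\<close> by (simp add: S_def)
 have "bdd_above S" unfolding S_def by (rule bdd_aboveI[of _ b]) auto
 define r where "r = Sup S"
 have rS: "r \<in> S" unfolding r_def using closed_contains_Sup[OF _ \<open>bdd_above S\<close> \<open>closed S\<close>] \<open>a \<in> S\<close> by blast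
 have above: "\<psi> r' > y" if "r < r'" "r' \<le> b" for r'
 proof (rule ccontr)
  assume "\<not> ?thesis"
  then have "r' \<in> S" using that rS by (auto simp: S_def)
  then have "r' \<le> r" unfolding r_def using \<open>bdd_above S\<close> by (rule cSup_upper)
  then show False using that by simp
 qed
 have rb: "r < b" using rS y unfolding S_def by (cases "r = b") auto
 have rab: "r \<in> {a..b}" using rS by (simp add: S_def)
 have "\<psi> r \<ge> y"
 proof (rule tendsto_lowerbound)
  show "(\<psi> \<longlongrightarrow> \<psi> r) (at r within {r..b})"
   using cont\<psi> rab by (meson atLeastatMost_subset_iff atLeastAtMost_iff continuous_on_def tendsto_within_subset order_refl)
  show "\<forall>\<^sub>F r' in at r within {r..b}. y \<le> \<psi> r'"
   unfolding eventually_at_filter using above by (auto intro!: always_eventually less_imp_le)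
  show "at r within {r..b} \<noteq> bot"
   using rb by (simp add: trivial_limit_within islimpt_Icc)
 qed
 then have "\<psi> r = y" using rS by (simp add: S_def)
 then have "r \<notin> N" using y rab by auto
 with dini[of r "e/2"] rab rb \<open>e > 0\<close> obtain r' where r': "r < r'" "r' \<le> b"
  "\<phi> r' - \<phi> r \<le> (C + e/2) * (r' - r)" by auto
 moreover have "(e/2) * (r' - r) > 0" using r' \<open>e > 0\<close> by simp
 moreover have "\<psi> r' - \<psi> r = (\<phi> r' - \<phi> r) - (C + e/2) * (r' - r) - (e/2) * (r' - r)"
  unfolding \<psi>_def by (simp add: algebra_simps)
 ultimately have "\<psi> r' < \<psi> r" by linarith
 with above[of r'] r' \<open>\<psi> r = y\<close> show False by auto
qed

text \<open>Intervals tagged in a null set can be forced into an open set of small measure, where absolute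
  continuity makes the sum of the increments small. This is what lets a gauge ignore the exceptional set.\<close>
lemma abs_continuous_null_tags:
 fixes f :: "real => 'b::real_normed_vector"
 assumes f: "abs_continuous_on {a..b} f" and N: "negligible N" and e: "e > 0"
 shows "\<exists>\<gamma>. gauge \<gamma> \<and> (\<forall>p. p tagged_partial_division_of {a..b} \<and> \<gamma> fine p \<and> (\<forall>z\<in>p. fst z \<in> N) -->
    (\<Sum>(x,K)\<in>p. norm (f (Sup K) - f (Inf K))) < e)"
proof -
 from f[unfolded abs_continuous_on_def, rule_format, OF e]
 obtain \<delta> where \<delta>: "\<delta> > 0" and close: "\<forall>(n::nat) u v.
    (\<forall>i<n. u i \<le> v i \<and> {u i..v i} \<subseteq> {a..b}) \<and>
    (\<forall>i<n. \<forall>j<n. i \<noteq> j --> {u i<..<v i} \<inter> {u j<..<v j} = {}) \<and>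
    (\<Sum>i<n. v i - u i) < \<delta>
    --> (\<Sum>i<n. norm (f (v i) - f (u i))) < e"
  by (elim exE conjE)
 have N0: "N \<in> null_sets lebesgue" using N negligible_iff_null_sets by blast
 obtain G where G: "open G" "N \<subseteq> G" "G - N \<in> lmeasurable" "emeasure lebesgue (G - N) < ennreal \<delta>"
  using sets_lebesgue_outer_open[OF null_setsD2[OF N0] \<delta>] .
 have GN: "G = (G - N) \<union> N" using G by auto
 have Gm: "G \<in> lmeasurable"
  by (subst GN, intro fmeasurable.Un G) (use N negligible_iff_measure in blast)
 have "measure lebesgue G = measure lebesgue (G - N)"
  using measure_Un_null_set[of "G - N" lebesgue N] N0 G(3) GN by (metis fmeasurableD)
 then have Gs: "measure lebesgue G < \<delta>"
  using G(3,4) \<delta> by (simp add: emeasure_eq_measure2 ennreal_less_iff)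
 define \<gamma> where "\<gamma> x = (if x \<in> N then G else UNIV)" for x
 show ?thesis
 proof (intro exI[of _ \<gamma>] conjI allI impI; (elim conjE)?)
  show "gauge \<gamma>" unfolding gauge_def \<gamma>_def using G by auto
  fix p assume p: "p tagged_partial_division_of {a..b}" "\<gamma> fine p" "\<forall>z\<in>p. fst z \<in> N"
  have "finite p" using p(1) by (rule tagged_partial_division_ofD(1))
  then obtain h where h: "bij_betw h {..<card p} p"
   using ex_bij_betw_nat_finite[of p] by (auto simp: atLeast0LessThan)
  have hp: "h i \<in> p" if "i < card p" for i using h that by (auto simp: bij_betw_def)
  have K: "\<exists>u v. snd z = {u..v} \<and> u \<le> v \<and> {u..v} \<subseteq> {a..b} \<and> {u..v} \<subseteq> G" if "z \<in> p" for z
  proof -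
   obtain x K where z: "z = (x,K)" by force
   have 1: "x \<in> K" "K \<subseteq> {a..b}" "\<exists>u v. K = cbox u v" using p(1) that unfolding z tagged_partial_division_of_def by blast+
   have "K \<subseteq> G" using p(2,3) that unfolding z fine_def \<gamma>_def by fastforce
   then show ?thesis using 1 unfolding z by (auto simp: cbox_interval)
  qed
  define u where "u i = Inf (snd (h i))" for i
  define v where "v i = Sup (snd (h i))" for i
  have uv: "snd (h i) = {u i..v i} \<and> u i \<le> v i \<and> {u i..v i} \<subseteq> {a..b} \<and> {u i..v i} \<subseteq> G" if "i < card p" for i
   using K[OF hp[OF that]] by (auto simp: u_def v_def)
  have eq: "(\<Sum>(x,K)\<in>p. norm (f (Sup K) - f (Inf K))) = (\<Sum>i<card p. norm (f (v i) - f (u i)))"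
   using sum.reindex_bij_betw[OF h, of "\<lambda>(x,K). norm (f (Sup K) - f (Inf K))"]
   by (simp add: case_prod_beta u_def v_def)
  have "(\<Sum>i<card p. norm (f (v i) - f (u i))) < e"
  proof (rule close[rule_format], intro conjI)
   show "\<forall>i<card p. u i \<le> v i \<and> {u i..v i} \<subseteq> {a..b}" using uv by blast
   show dis: "\<forall>i<card p. \<forall>j<card p. i \<noteq> j --> {u i<..<v i} \<inter> {u j<..<v j} = {}"
   proof (intro allI impI)
    fix i j assume ij: "i < card p" "j < card p" "i \<noteq> j"
    then have "h i \<noteq> h j" using h by (auto simp: bij_betw_def inj_on_def)
    then have "interior (snd (h i)) \<inter> interior (snd (h j)) = {}"
     using p(1) hp[OF ij(1)] hp[OF ij(2)] unfolding tagged_partial_division_of_def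
     by (metis prod.collapse)
    then show "{u i<..<v i} \<inter> {u j<..<v j} = {}" using uv ij by (metis interior_atLeastAtMost_real)
   qed
   have "(\<Sum>i<card p. v i - u i) = (\<Sum>i<card p. measure lebesgue {u i<..<v i})"
    using uv by (intro sum.cong) auto
   also have "\<dots> = measure lebesgue (\<Union>i<card p. {u i<..<v i})"
    using dis by (intro measure_UNION'[symmetric]) (auto simp: pairwise_def disjnt_def)
   also have "\<dots> \<le> measure lebesgue G" (is "measure _ ?U \<le> _")
   proof -
    have sub: "?U \<subseteq> G"
    proof (rule UN_least)
     fix i assume "i \<in> {..<card p}"
     then have "{u i..v i} \<subseteq> G" using uv by simp
     then show "{u i<..<v i} \<subseteq> G" by (rule subset_trans[rotated]) auto
    qed
    then show ?thesis using Gm by (intro measure_mono_fmeasurable) auto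
   qed
   finally show "(\<Sum>i<card p. v i - u i) < \<delta>" using Gs by simp
  qed
  then show "(\<Sum>(x,K)\<in>p. norm (f (Sup K) - f (Inf K))) < e" using eq by simp
 qed
qed


lemma additive_tagged_division_increments:
 fixes f :: "real => 'b::real_normed_vector"
 assumes "a \<le> b" "p tagged_division_of {a..b}"
 shows "(\<Sum>(x,K)\<in>p. f (Sup K) - f (Inf K)) = f b - f a"
 using additive_tagged_division_1[OF assms] .

lemma tagged_division_interval:
 assumes "p tagged_division_of {a..b::real}" "(x,K) \<in> p"
 obtains u v where "K = {u..v}" "u \<le> x" "x \<le> v" "a \<le> u" "v \<le> b" "Inf K = u" "Sup K = v"
  "measure lborel K = v - u"
proof -
 obtain u v where K: "K = cbox u v" "x \<in> K" "K \<subseteq> {a..b}"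
  using assms by (metis tagged_division_ofD(2-4))
 then have "u \<le> v" by auto
 then show thesis using K by (intro that[of u v]) auto
qed

lemma tagged_division_split_sum:
 fixes f :: "real => real set => 'b::comm_monoid_add"
 assumes "finite p"
 shows "(\<Sum>(x,K)\<in>p. f x K) = (\<Sum>(x,K)\<in>{z\<in>p. fst z \<in> N}. f x K) + (\<Sum>(x,K)\<in>{z\<in>p. fst z \<notin> N}. f x K)"
proof -
 have "p = {z\<in>p. fst z \<in> N} \<union> {z\<in>p. fst z \<notin> N}" by auto
 then have "(\<Sum>(x,K)\<in>p. f x K) = (\<Sum>(x,K)\<in>{z\<in>p. fst z \<in> N} \<union> {z\<in>p. fst z \<notin> N}. f x K)"
  by simp
 also have "\<dots> = (\<Sum>(x,K)\<in>{z\<in>p. fst z \<in> N}. f x K) + (\<Sum>(x,K)\<in>{z\<in>p. fst z \<notin> N}. f x K)"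
  using assms by (intro sum.union_disjoint) auto
 finally show ?thesis .
qed

text \<open>The two-sided form of the bound is the one that fits the Henstock-Kurzweil integral: every interval of a
  fine tagged division has its tag inside, so that its increment is compared directly with the
  corresponding term of the Riemann sum. No derivative of \<open>\<Theta>\<close> is involved.\<close>
lemma abs_continuous_increment_le_integral:
 fixes \<Theta> g :: "real => real"
 assumes "a \<le> b" and ac: "abs_continuous_on {a..b} \<Theta>" and g: "g integrable_on {a..b}"
  and N: "negligible N"
  and dini: "\<And>s e. s \<in> {a..b} - N ==> e > 0 ==> \<exists>d>0. \<forall>u v. a \<le> u \<and> u \<le> s \<and> s \<le> v \<and> v \<le> b \<and>
    s - d < u \<and> v < s + d --> \<Theta> v - \<Theta> u \<le> (g s + e) * (v - u)"
 shows "\<Theta> b - \<Theta> a \<le> integral {a..b} g"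
proof (rule field_le_epsilon)
 fix \<epsilon> :: real assume "\<epsilon> > 0"
 define e where "e = \<epsilon> / (b - a + 2)"
 have "b - a + 2 > 0" using \<open>a \<le> b\<close> by simp
  then have "e > 0" "e * (b - a + 2) = \<epsilon>" using \<open>\<epsilon> > 0\<close> by (auto simp: e_def)
  then have e: "e > 0" "e * (b - a) + e + e = \<epsilon>" by (auto simp: algebra_simps)
 define g' where "g' s = (if s \<in> N then 0 else g s)" for s
 have "(g' has_integral integral {a..b} g) {a..b}"
  using has_integral_spike[OF N _ integrable_integral[OF g], of g'] by (auto simp: g'_def)
 from has_integral_real[THEN iffD1, rule_format, OF this \<open>e > 0\<close>]
 obtain \<gamma>1 where \<gamma>1: "gauge \<gamma>1" "\<forall>p. p tagged_division_of {a..b} \<and> \<gamma>1 fine p -->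
   norm ((\<Sum>(x,K)\<in>p. measure lborel K *\<^sub>R g' x) - integral {a..b} g) < e"
  by (elim exE conjE)
 obtain \<gamma>2 where \<gamma>2: "gauge \<gamma>2" "\<forall>p. p tagged_partial_division_of {a..b} \<and> \<gamma>2 fine p \<and> (\<forall>z\<in>p. fst z \<in> N) -->
    (\<Sum>(x,K)\<in>p. norm (\<Theta> (Sup K) - \<Theta> (Inf K))) < e"
  using abs_continuous_null_tags[OF ac N \<open>e > 0\<close>] by (elim exE conjE)
 have "\<forall>s\<in>{a..b} - N. \<exists>d>0. \<forall>u v. a \<le> u \<and> u \<le> s \<and> s \<le> v \<and> v \<le> b \<and>
    s - d < u \<and> v < s + d --> \<Theta> v - \<Theta> u \<le> (g s + e) * (v - u)"
  using dini[OF _ \<open>e > 0\<close>] by (intro ballI)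
 from bchoice[OF this] obtain d where d: "\<forall>s\<in>{a..b} - N. d s > 0 \<and> (\<forall>u v. a \<le> u \<and> u \<le> s \<and> s \<le> v \<and> v \<le> b \<and>
    s - d s < u \<and> v < s + d s --> \<Theta> v - \<Theta> u \<le> (g s + e) * (v - u))"
  by (elim exE)
 define \<gamma>3 where "\<gamma>3 s = (if s \<in> {a..b} - N then ball s (d s) else UNIV)" for s
 have "gauge \<gamma>3" unfolding gauge_def \<gamma>3_def using d by auto
 then have "gauge (\<lambda>x. \<gamma>1 x \<inter> \<gamma>2 x \<inter> \<gamma>3 x)" using \<gamma>1 \<gamma>2 by (intro gauge_Int)
 then obtain p where p: "p tagged_division_of {a..b}" "(\<lambda>x. \<gamma>1 x \<inter> \<gamma>2 x \<inter> \<gamma>3 x) fine p"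
  using fine_division_exists_real by blast
 have fine: "\<gamma>1 fine p" "\<gamma>2 fine p" "\<gamma>3 fine p" using p(2) by (auto simp: fine_def)
 have "finite p" using p(1) by blast
 let ?B = "{z\<in>p. fst z \<in> N}" and ?G = "{z\<in>p. fst z \<notin> N}"
 have "(\<Sum>(x,K)\<in>?B. norm (\<Theta> (Sup K) - \<Theta> (Inf K))) < e"
 proof (rule \<gamma>2(2)[rule_format], intro conjI)
  have "p tagged_partial_division_of {a..b}" using p(1) by (simp add: tagged_division_of_def)
  then show "?B tagged_partial_division_of {a..b}"
   by (rule tagged_partial_division_subset) auto
  show "\<gamma>2 fine ?B" using fine(2) by (auto simp: fine_def)
 qed auto
 moreover have "(\<Sum>(x,K)\<in>?B. \<Theta> (Sup K) - \<Theta> (Inf K)) \<le> (\<Sum>(x,K)\<in>?B. norm (\<Theta> (Sup K) - \<Theta> (Inf K)))"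
  by (intro sum_mono) auto
 ultimately have bad: "(\<Sum>(x,K)\<in>?B. \<Theta> (Sup K) - \<Theta> (Inf K)) \<le> e" by linarith
 have "(\<Sum>(x,K)\<in>?G. \<Theta> (Sup K) - \<Theta> (Inf K)) \<le> (\<Sum>(x,K)\<in>?G. measure lborel K *\<^sub>R g' x + e * measure lborel K)"
 proof (rule sum_mono, clarify)
  fix x K assume xK: "(x,K) \<in> p" "fst (x,K) \<notin> N"
  obtain u v where uv: "K = {u..v}" "u \<le> x" "x \<le> v" "a \<le> u" "v \<le> b" "Inf K = u" "Sup K = v"
   "measure lborel K = v - u" using tagged_division_interval[OF p(1) xK(1)] .
  have x: "x \<in> {a..b} - N" using uv xK by auto
  have "K \<subseteq> ball x (d x)" using fine(3) xK(1) x unfolding fine_def \<gamma>3_def by fastforce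
  moreover have "u \<in> K" "v \<in> K" using uv by auto
  ultimately have "u \<in> ball x (d x)" "v \<in> ball x (d x)" by blast+
  then have "x - d x < u" "v < x + d x" by (auto simp: dist_real_def)
  then have "\<Theta> v - \<Theta> u \<le> (g x + e) * (v - u)" using d[rule_format, OF x] uv by blast
  then show "\<Theta> (Sup K) - \<Theta> (Inf K) \<le> measure lborel K *\<^sub>R g' x + e * measure lborel K"
   using uv xK by (simp add: g'_def algebra_simps)
 qed
 also have "\<dots> \<le> (\<Sum>(x,K)\<in>p. measure lborel K *\<^sub>R g' x + e * measure lborel K)"
  unfolding tagged_division_split_sum[OF \<open>finite p\<close>, of _ N]
  using \<open>e > 0\<close> by (auto intro!: sum_nonneg simp: g'_def)
 also have "\<dots> = (\<Sum>(x,K)\<in>p. measure lborel K *\<^sub>R g' x) + e * (\<Sum>(x,K)\<in>p. measure lborel K)"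
  by (simp add: sum.distrib sum_distrib_left case_prod_beta)
 also have "(\<Sum>(x,K)\<in>p. measure lborel K) = b - a"
  using additive_content_tagged_division[of p a b] p(1) \<open>a \<le> b\<close> by (simp add: cbox_interval)
 also have "(\<Sum>(x,K)\<in>p. measure lborel K *\<^sub>R g' x) \<le> integral {a..b} g + e"
  using \<gamma>1(2)[rule_format, OF conjI[OF p(1) fine(1)]] by auto
 finally have "(\<Sum>(x,K)\<in>p. \<Theta> (Sup K) - \<Theta> (Inf K)) \<le> integral {a..b} g + e + e * (b - a) + e"
  using bad unfolding tagged_division_split_sum[OF \<open>finite p\<close>, of _ N] by simp
 then show "\<Theta> b - \<Theta> a \<le> integral {a..b} g + \<epsilon>"
  using additive_tagged_division_increments[OF \<open>a \<le> b\<close> p(1), of \<Theta>] e by simp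
qed

lemma abs_continuous_ftc:
 fixes f :: "real => 'b::euclidean_space"
 assumes "a \<le> b" and ac: "abs_continuous_on {a..b} f" and N: "negligible N"
  and der: "\<And>s. s \<in> {a..b} - N ==> (f has_vector_derivative f' s) (at s within {a..b})"
 shows "(f' has_integral (f b - f a)) {a..b}"
proof -
 define g' where "g' s = (if s \<in> N then 0 else f' s)" for s
 have "(g' has_integral (f b - f a)) {a..b}"
  unfolding has_integral_real
 proof (intro allI impI)
  fix \<epsilon> :: real assume "\<epsilon> > 0"
  define e where "e = \<epsilon> / (b - a + 2)"
  have "b - a + 2 > 0" using \<open>a \<le> b\<close> by simp
  then have "e > 0" "e * (b - a + 2) = \<epsilon>" using \<open>\<epsilon> > 0\<close> by (auto simp: e_def)
  then have e: "e > 0" "e * (b - a) + e + e = \<epsilon>" by (auto simp: algebra_simps)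
  obtain \<gamma>2 where \<gamma>2: "gauge \<gamma>2" "\<forall>p. p tagged_partial_division_of {a..b} \<and> \<gamma>2 fine p \<and> (\<forall>z\<in>p. fst z \<in> N) -->
    (\<Sum>(x,K)\<in>p. norm (f (Sup K) - f (Inf K))) < e"
   using abs_continuous_null_tags[OF ac N \<open>e > 0\<close>] by (elim exE conjE)
  have "\<forall>s\<in>{a..b} - N. \<exists>d>0. \<forall>y\<in>{a..b}. norm (y - s) < d -->
    norm (f y - f s - (y - s) *\<^sub>R f' s) \<le> e * norm (y - s)"
  proof
   fix s assume "s \<in> {a..b} - N"
   from der[OF this] have "\<forall>e>0. \<exists>d>0. \<forall>y\<in>{a..b}. norm (y - s) < d -->
     norm (f y - f s - (y - s) *\<^sub>R f' s) \<le> e * norm (y - s)"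
    unfolding has_vector_derivative_def has_derivative_within_alt by (rule conjunct2)
   then show "\<exists>d>0. \<forall>y\<in>{a..b}. norm (y - s) < d -->
     norm (f y - f s - (y - s) *\<^sub>R f' s) \<le> e * norm (y - s)"
    using \<open>e > 0\<close> by (elim allE[of _ e] impE)
  qed
  from bchoice[OF this] obtain d where d: "\<forall>s\<in>{a..b} - N. d s > 0 \<and> (\<forall>y\<in>{a..b}. norm (y - s) < d s -->
    norm (f y - f s - (y - s) *\<^sub>R f' s) \<le> e * norm (y - s))"
   by (elim exE)
  define \<gamma>3 where "\<gamma>3 s = (if s \<in> {a..b} - N then ball s (d s) else UNIV)" for s
  have "gauge \<gamma>3" unfolding gauge_def \<gamma>3_def using d by auto
  then have "gauge (\<lambda>x. \<gamma>2 x \<inter> \<gamma>3 x)" using \<gamma>2 by (intro gauge_Int)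
  moreover have "norm ((\<Sum>(x,K)\<in>p. measure lborel K *\<^sub>R g' x) - (f b - f a)) < \<epsilon>"
   if p: "p tagged_division_of {a..b}" "(\<lambda>x. \<gamma>2 x \<inter> \<gamma>3 x) fine p" for p
  proof -
   have fine: "\<gamma>2 fine p" "\<gamma>3 fine p" using p(2) by (auto simp: fine_def)
   have "finite p" using p(1) by blast
   let ?B = "{z\<in>p. fst z \<in> N}" and ?G = "{z\<in>p. fst z \<notin> N}"
   let ?E = "\<lambda>x K. measure lborel K *\<^sub>R g' x - (f (Sup K) - f (Inf K))"
   have "(\<Sum>(x,K)\<in>?B. norm (f (Sup K) - f (Inf K))) < e"
   proof (rule \<gamma>2(2)[rule_format], intro conjI)
    have "p tagged_partial_division_of {a..b}" using p(1) by (simp add: tagged_division_of_def)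
    then show "?B tagged_partial_division_of {a..b}"
     by (rule tagged_partial_division_subset) auto
    show "\<gamma>2 fine ?B" using fine(1) by (auto simp: fine_def)
   qed auto
   moreover have "(\<Sum>(x,K)\<in>?B. norm (?E x K)) = (\<Sum>(x,K)\<in>?B. norm (f (Sup K) - f (Inf K)))"
    by (intro sum.cong) (auto simp: g'_def norm_minus_commute)
   ultimately have bad: "(\<Sum>(x,K)\<in>?B. norm (?E x K)) < e" by linarith
   have "(\<Sum>(x,K)\<in>?G. norm (?E x K)) \<le> (\<Sum>(x,K)\<in>?G. e * measure lborel K)"
   proof (rule sum_mono, clarify)
    fix x K assume xK: "(x,K) \<in> p" "fst (x,K) \<notin> N"
    obtain u v where uv: "K = {u..v}" "u \<le> x" "x \<le> v" "a \<le> u" "v \<le> b" "Inf K = u" "Sup K = v"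
     "measure lborel K = v - u" using tagged_division_interval[OF p(1) xK(1)] .
    have x: "x \<in> {a..b} - N" using uv xK by auto
    have "K \<subseteq> ball x (d x)" using fine(2) xK(1) x unfolding fine_def \<gamma>3_def by fastforce
    moreover have "u \<in> K" "v \<in> K" using uv by auto
  ultimately have "u \<in> ball x (d x)" "v \<in> ball x (d x)" by blast+
    then have near: "norm (u - x) < d x" "norm (v - x) < d x" by (auto simp: dist_norm norm_minus_commute)
    have "norm (f v - f x - (v - x) *\<^sub>R f' x) \<le> e * norm (v - x)"
     "norm (f u - f x - (u - x) *\<^sub>R f' x) \<le> e * norm (u - x)"
     using d[rule_format, OF x, THEN conjunct2, rule_format, of v] d[rule_format, OF x, THEN conjunct2, rule_format, of u] uv near by auto
    then have "norm (f v - f x - (v - x) *\<^sub>R f' x) \<le> e * (v - x)"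
     "norm (f u - f x - (u - x) *\<^sub>R f' x) \<le> e * (x - u)" using uv by auto
    then have "norm ((f u - f x - (u - x) *\<^sub>R f' x) - (f v - f x - (v - x) *\<^sub>R f' x)) \<le> e * (x - u) + e * (v - x)"
     by (intro order_trans[OF norm_triangle_ineq4]) auto
    moreover have "(f u - f x - (u - x) *\<^sub>R f' x) - (f v - f x - (v - x) *\<^sub>R f' x) = (v - u) *\<^sub>R f' x - (f v - f u)"
     by (simp add: algebra_simps)
    ultimately show "norm (?E x K) \<le> e * measure lborel K"
     using uv xK by (simp add: g'_def algebra_simps)
   qed
   also have "\<dots> \<le> (\<Sum>(x,K)\<in>p. e * measure lborel K)"
    unfolding tagged_division_split_sum[OF \<open>finite p\<close>, of _ N]
    using \<open>e > 0\<close> by (auto intro!: sum_nonneg)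
   also have "\<dots> = e * (\<Sum>(x,K)\<in>p. measure lborel K)"
    by (simp add: sum_distrib_left case_prod_beta)
   also have "(\<Sum>(x,K)\<in>p. measure lborel K) = b - a"
    using additive_content_tagged_division[of p a b] p(1) \<open>a \<le> b\<close> by (simp add: cbox_interval)
   finally have lt: "(\<Sum>(x,K)\<in>p. norm (?E x K)) < e * (b - a) + e"
    using bad unfolding tagged_division_split_sum[OF \<open>finite p\<close>, of _ N] by simp
   have eq: "(\<Sum>(x,K)\<in>p. measure lborel K *\<^sub>R g' x) - (f b - f a) = (\<Sum>(x,K)\<in>p. ?E x K)"
    using additive_tagged_division_increments[OF \<open>a \<le> b\<close> p(1), of f]
    by (simp add: sum_subtractf case_prod_beta)
   have "norm (\<Sum>(x,K)\<in>p. ?E x K) \<le> (\<Sum>(x,K)\<in>p. norm (?E x K))"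
    by (rule order_trans[OF norm_sum]) (simp add: case_prod_beta)
   then show ?thesis unfolding eq using e lt by linarith
  qed
  ultimately show "\<exists>\<gamma>. gauge \<gamma> \<and> (\<forall>\<D>. \<D> tagged_division_of {a..b} \<and> \<gamma> fine \<D> -->
    norm ((\<Sum>(x, k)\<in>\<D>. measure lborel k *\<^sub>R g' x) - (f b - f a)) < \<epsilon>)"
   by (intro exI[of _ "\<lambda>x. \<gamma>2 x \<inter> \<gamma>3 x"] conjI allI impI) simp_all
 qed
 from has_integral_spike[OF N _ this, of f'] show ?thesis by (auto simp: g'_def)
qed

section \<open>Lipschitz functions, measurability and forward differences on an interval\<close>

lemma lipschitz_on_interval_pointwise:
 fixes \<phi> :: "real => real"
 assumes "a \<le> b" and ptl: "\<And>r e. r \<in> {a..b} ==> e > 0 ==>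
   \<exists>d>0. \<forall>r'\<in>{a..b}. \<bar>r' - r\<bar> < d --> \<bar>\<phi> r' - \<phi> r\<bar> \<le> (C + e) * \<bar>r' - r\<bar>"
 shows "\<bar>\<phi> b - \<phi> a\<bar> \<le> C * (b - a)"
proof -
 have cont: "continuous_on {a..b} \<phi>"
  unfolding continuous_on_iff
 proof (intro ballI allI impI)
  fix r e :: real assume r: "r \<in> {a..b}" and "e > 0"
  obtain d where d: "d > 0" "\<forall>r'\<in>{a..b}. \<bar>r' - r\<bar> < d --> \<bar>\<phi> r' - \<phi> r\<bar> \<le> (C + 1) * \<bar>r' - r\<bar>"
   using ptl[OF r, of 1] by auto
  define d' where "d' = min d (e / (\<bar>C\<bar> + 2))"
  have "dist (\<phi> r') (\<phi> r) < e" if "r' \<in> {a..b}" "dist r' r < d'" for r'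
  proof -
   have "\<bar>\<phi> r' - \<phi> r\<bar> \<le> (C + 1) * \<bar>r' - r\<bar>" using d that by (auto simp: d'_def dist_real_def)
   also have "\<dots> \<le> (\<bar>C\<bar> + 2) * \<bar>r' - r\<bar>" by (intro mult_right_mono) auto
   also have "\<dots> < e" using that by (auto simp: d'_def dist_real_def field_simps)
   finally show ?thesis by (simp add: dist_real_def)
  qed
  moreover have "d' > 0" using d \<open>e > 0\<close> by (auto simp: d'_def)
  ultimately show "\<exists>d>0. \<forall>r'\<in>{a..b}. dist r' r < d --> dist (\<phi> r') (\<phi> r) < e" by blast
 qed
 have *: "\<psi> b - \<psi> a \<le> C * (b - a)"
  if \<psi>: "continuous_on {a..b} \<psi>" "\<And>r r'. \<bar>\<psi> r' - \<psi> r\<bar> = \<bar>\<phi> r' - \<phi> r\<bar>" for \<psi>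
 proof (rule dini_bound_imp_increment_bound[OF \<open>a \<le> b\<close> \<psi>(1), where N = "{}"])
  show "\<exists>B d. d > 0 \<and> (\<forall>r'\<in>{a..b}. \<bar>r' - r\<bar> < d --> \<bar>\<psi> r' - \<psi> r\<bar> \<le> B * \<bar>r' - r\<bar>)"
   if "r \<in> {a..b}" for r
   using ptl[OF that zero_less_one] unfolding \<psi>(2) by blast
  fix r e :: real assume r: "r \<in> {a..<b} - {}" and e: "e > 0"
  obtain d where d: "d > 0" "\<forall>r'\<in>{a..b}. \<bar>r' - r\<bar> < d --> \<bar>\<phi> r' - \<phi> r\<bar> \<le> (C + e) * \<bar>r' - r\<bar>"
   using ptl[OF _ e, of r] r by auto
  define r' where "r' = min b (r + d / 2)"
  have r': "r < r'" "r' \<in> {a..b}" "\<bar>r' - r\<bar> < d" using r d by (auto simp: r'_def min_def)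
  then have "\<psi> r' - \<psi> r \<le> (C + e) * (r' - r)" using d(2) \<psi>(2)[of r' r] by fastforce
  then show "\<exists>r'\<in>{r<..b}. \<psi> r' - \<psi> r \<le> (C + e) * (r' - r)" using r' by auto
 qed auto
 have "\<phi> b - \<phi> a \<le> C * (b - a)" using *[of \<phi>] cont by simp
 moreover have "- \<phi> b - - \<phi> a \<le> C * (b - a)"
  using *[of "\<lambda>r. - \<phi> r"] cont by (simp add: continuous_on_minus abs_minus_commute)
 ultimately show ?thesis by linarith
qed

lemma lipschitz_imp_abs_continuous:
 fixes f :: "real => 'b::real_normed_vector"
 assumes lip: "\<And>u v. u \<in> S ==> v \<in> S ==> norm (f u - f v) \<le> K * \<bar>u - v\<bar>"
 shows "abs_continuous_on S f"
 unfolding abs_continuous_on_def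
proof (intro allI impI)
 fix \<epsilon> :: real assume "\<epsilon> > 0"
 define \<delta> where "\<delta> = \<epsilon> / (\<bar>K\<bar> + 1)"
 have \<delta>: "\<delta> > 0" "(\<bar>K\<bar> + 1) * \<delta> = \<epsilon>" using \<open>\<epsilon> > 0\<close> by (auto simp: \<delta>_def)
 show "\<exists>\<delta>>0. \<forall>(n::nat) a b.
    (\<forall>i<n. a i \<le> b i \<and> {a i..b i} \<subseteq> S) \<and>
    (\<forall>i<n. \<forall>j<n. i \<noteq> j --> {a i<..<b i} \<inter> {a j<..<b j} = {}) \<and>
    (\<Sum>i<n. b i - a i) < \<delta>
    --> (\<Sum>i<n. norm (f (b i) - f (a i))) < \<epsilon>"
 proof (intro exI[of _ \<delta>] conjI \<open>\<delta> > 0\<close> allI impI, elim conjE)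
  fix n :: nat and a b :: "nat => real"
  assume ab: "\<forall>i<n. a i \<le> b i \<and> {a i..b i} \<subseteq> S" "(\<Sum>i<n. b i - a i) < \<delta>"
  have "(\<Sum>i<n. norm (f (b i) - f (a i))) \<le> (\<Sum>i<n. (\<bar>K\<bar> + 1) * (b i - a i))"
  proof (rule sum_mono)
   fix i assume "i \<in> {..<n}"
   then have "a i \<le> b i" "{a i..b i} \<subseteq> S" using ab by auto
   then have i: "a i \<le> b i" "a i \<in> S" "b i \<in> S" by (auto simp: subset_iff)
   have "norm (f (b i) - f (a i)) \<le> K * \<bar>b i - a i\<bar>" using lip i by blast
   also have "\<dots> \<le> (\<bar>K\<bar> + 1) * \<bar>b i - a i\<bar>" by (intro mult_right_mono) auto
   finally show "norm (f (b i) - f (a i)) \<le> (\<bar>K\<bar> + 1) * (b i - a i)" using i by simp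
  qed
  also have "\<dots> = (\<bar>K\<bar> + 1) * (\<Sum>i<n. b i - a i)" by (simp add: sum_distrib_left)
  also have "\<dots> < (\<bar>K\<bar> + 1) * \<delta>" using ab(2) by (intro mult_strict_left_mono) auto
  finally show "(\<Sum>i<n. norm (f (b i) - f (a i))) < \<epsilon>" using \<delta> by simp
 qed
qed

lemma borel_measurable_lebesgue_on_cong_AE:
 fixes f g :: "'a::euclidean_space => 'b::euclidean_space"
 assumes "S \<in> sets lebesgue" "f \<in> borel_measurable (lebesgue_on S)" "AE x in lebesgue_on S. f x = g x"
 shows "g \<in> borel_measurable (lebesgue_on S)"
proof -
 have "(\<lambda>x. if x \<in> S then f x else 0) \<in> borel_measurable lebesgue"
  using assms borel_measurable_if by blast
 moreover have "AE x in lebesgue. (if x \<in> S then f x else 0) = (if x \<in> S then g x else 0)"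
  using assms(1,3) by (auto simp: AE_restrict_space_iff elim!: eventually_mono)
 ultimately have "(\<lambda>x. if x \<in> S then g x else 0) \<in> borel_measurable lebesgue"
  by (rule borel_measurable_AE)
 then show ?thesis using assms borel_measurable_if by blast
qed

lemma measurable_ident_lebesgue_on [measurable]: "(\<lambda>x. x) \<in> borel_measurable (lebesgue_on S)"
 by (rule measurable_restrict_space1) (simp add: measurable_completion)

text \<open>A function that is measurable in the first and continuous in the second variable is the limit of
  the functions that evaluate it at grid points of the second variable.\<close>
lemma borel_measurable_caratheodory:
 fixes f :: "'a => real => 'b::euclidean_space"
 assumes meas: "\<And>r. r \<in> {0..1} ==> (\<lambda>\<tau>. f \<tau> r) \<in> borel_measurable A"
  and cont: "\<And>\<tau>. \<tau> \<in> space A ==> continuous_on {0..1} (f \<tau>)"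
 shows "(\<lambda>z. f (fst z) (snd z)) \<in> borel_measurable (A \<Otimes>\<^sub>M lebesgue_on {0..1})"
proof (rule borel_measurable_LIMSEQ_metric)
 let ?k = "\<lambda>n (z :: 'a \<times> real). nat \<lfloor>real (Suc n) * snd z\<rfloor>"
 let ?r = "\<lambda>n k. min 1 (real k / real (Suc n))"
 fix n
 have snd': "(\<lambda>z. snd z) \<in> borel_measurable (A \<Otimes>\<^sub>M lebesgue_on {0..1::real})"
  using measurable_compose[OF measurable_snd measurable_ident_lebesgue_on] by simp
 show "(\<lambda>z. f (fst z) (?r n (?k n z))) \<in> borel_measurable (A \<Otimes>\<^sub>M lebesgue_on {0..1})"
 proof (rule measurable_compose_countable[where f = "\<lambda>k z. f (fst z) (?r n k)"])
  show "(\<lambda>z. f (fst z) (?r n k)) \<in> borel_measurable (A \<Otimes>\<^sub>M lebesgue_on {0..1})" for k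
   using measurable_compose[OF measurable_fst meas[of "?r n k"]] by auto
  show "?k n \<in> (A \<Otimes>\<^sub>M lebesgue_on {0..1}) \<rightarrow>\<^sub>M count_space UNIV"
   using snd' by measurable
 qed
next
 fix z assume "z \<in> space (A \<Otimes>\<^sub>M lebesgue_on {0..1::real})"
 then obtain \<tau> r where z: "z = (\<tau>, r)" "\<tau> \<in> space A" "r \<in> {0..1}"
  by (auto simp: space_pair_measure)
 let ?q = "\<lambda>n. min 1 (real (nat \<lfloor>real (Suc n) * r\<rfloor>) / real (Suc n))"
 have bound: "r - 1 / real (Suc n) \<le> ?q n \<and> ?q n \<le> r" for n
 proof -
  have "real (nat \<lfloor>real (Suc n) * r\<rfloor>) = real_of_int \<lfloor>real (Suc n) * r\<rfloor>" using z by simp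
  then have "real (Suc n) * r - 1 \<le> real (nat \<lfloor>real (Suc n) * r\<rfloor>)"
   "real (nat \<lfloor>real (Suc n) * r\<rfloor>) \<le> real (Suc n) * r" by linarith+
  then have "(real (Suc n) * r - 1) / real (Suc n) \<le> real (nat \<lfloor>real (Suc n) * r\<rfloor>) / real (Suc n)"
   "real (nat \<lfloor>real (Suc n) * r\<rfloor>) / real (Suc n) \<le> (real (Suc n) * r) / real (Suc n)"
   by (intro divide_right_mono; simp)+
  then have "r - 1 / real (Suc n) \<le> real (nat \<lfloor>real (Suc n) * r\<rfloor>) / real (Suc n)"
   "real (nat \<lfloor>real (Suc n) * r\<rfloor>) / real (Suc n) \<le> r"
   by (simp_all add: diff_divide_distrib del: of_nat_Suc)
  moreover have "r - 1 / real (Suc n) \<le> 1"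
   using z by (smt (verit) atLeastAtMost_iff divide_nonneg_nonneg of_nat_0_le_iff)
  ultimately show ?thesis using z by auto
 qed
 have "?q \<longlonglongrightarrow> r"
 proof (rule tendsto_sandwich[of "\<lambda>n. r - 1 / real (Suc n)" _ _ "\<lambda>n. r"])
  have "(\<lambda>n. r - 1 / real (Suc n)) \<longlonglongrightarrow> r - 0"
   using LIMSEQ_inverse_real_of_nat by (intro tendsto_intros) (simp add: inverse_eq_divide)
  then show "(\<lambda>n. r - 1 / real (Suc n)) \<longlonglongrightarrow> r" by simp
 qed (use bound in auto)
 moreover have "?q n \<in> {0..1}" for n using z by auto
 ultimately have "(\<lambda>n. f \<tau> (?q n)) \<longlonglongrightarrow> f \<tau> r"
  by (intro continuous_on_tendsto_compose[OF cont[OF z(2)]] z(3) always_eventually allI)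
 then show "(\<lambda>n. f (fst z) (min 1 (real (nat \<lfloor>real (Suc n) * snd z\<rfloor>) / real (Suc n)))) \<longlonglongrightarrow> f (fst z) (snd z)"
  using z by simp
qed

lemma tendsto_forward_point:
 assumes "r \<in> {0..1::real}"
 shows "(\<lambda>n. min 1 (r + 1 / real (Suc n))) \<longlonglongrightarrow> r"
proof -
 have "(\<lambda>n. min 1 (r + 1 / real (Suc n))) \<longlonglongrightarrow> min 1 (r + 0)"
  using LIMSEQ_inverse_real_of_nat by (intro tendsto_intros) (simp add: inverse_eq_divide)
 then show ?thesis using assms by simp
qed

text \<open>The truncation of the shifted argument at the end point \<open>1\<close> contributes the boundary term \<open>e * f 1\<close>.\<close>
lemma has_integral_forward_shift:
 fixes f :: "real => real"
 assumes f: "f integrable_on {0..1}" and e: "0 < e" "e \<le> 1"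
 shows "((\<lambda>r. f (min 1 (r + e))) has_integral (integral {0..1} f - integral {0..e} f) + e * f 1) {0..1}"
proof -
 let ?c = "1 - e"
 have "f integrable_on {e..1}"
  using f by (rule integrable_subinterval_real) (use e in auto)
 moreover have "integral {0..e} f + integral {e..1} f = integral {0..1} f"
  using Henstock_Kurzweil_Integration.integral_combine[of 0 e 1 f] e f by simp
 ultimately have "(f has_integral integral {0..1} f - integral {0..e} f) {e..1}"
  by (simp add: has_integral_integrable_integral)
 then have "((f \<circ> (+) e) has_integral integral {0..1} f - integral {0..e} f) {0..?c}"
  by (simp add: has_integral_shift_Icc_real)
 then have 1: "((\<lambda>r. f (min 1 (r + e))) has_integral integral {0..1} f - integral {0..e} f) {0..?c}"
  by (rule has_integral_eq[rotated]) (simp add: add.commute)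
 have 2: "((\<lambda>r. f (min 1 (r + e))) has_integral (1 - ?c) * f 1) {?c..1}"
  using has_integral_const_real[of "f 1" ?c 1] e
  by (subst has_integral_cong[of _ _ "\<lambda>_. f 1"]) (auto simp: min_def)
 show ?thesis using has_integral_combine[OF _ _ 1 2] e by auto
qed

text \<open>The difference quotients telescope to averages of \<open>f\<close> near the two ends of the interval, so no
  differentiability is needed.\<close>
lemma integral_forward_difference:
 fixes f :: "real => real"
 assumes cont: "continuous_on {0..1} f"
 shows "(\<lambda>n. integral {0..1} (\<lambda>r. real (Suc n) * (f (min 1 (r + 1 / real (Suc n))) - f r))) \<longlonglongrightarrow> f 1 - f 0"
proof -
 define e where "e n = 1 / real (Suc n)" for n
 have e: "0 < e n" "e n \<le> 1" for n by (auto simp: e_def)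
 have e0: "e \<longlonglongrightarrow> 0" using LIMSEQ_inverse_real_of_nat unfolding e_def inverse_eq_divide .
 define F where "F u = integral {0..u} f" for u
 have f: "f integrable_on {0..1}" by (rule integrable_continuous_real[OF cont])
 have eq: "integral {0..1} (\<lambda>r. real (Suc n) * (f (min 1 (r + e n)) - f r)) = f 1 - F (e n) / e n" for n
 proof -
  have "((\<lambda>r. f (min 1 (r + e n)) - f r) has_integral (F 1 - F (e n)) + e n * f 1 - F 1) {0..1}"
   unfolding F_def using has_integral_forward_shift[OF f e(1)[of n] e(2)[of n]] integrable_integral[OF f]
   by (rule has_integral_diff)
  from has_integral_mult_right[OF this, of "real (Suc n)"]
  have "((\<lambda>r. real (Suc n) * (f (min 1 (r + e n)) - f r)) has_integral real (Suc n) * (e n * f 1 - F (e n))) {0..1}"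
   by simp
  moreover have "real (Suc n) * (e n * f 1 - F (e n)) = f 1 - F (e n) / e n"
   by (simp add: e_def field_simps)
  ultimately show ?thesis by (metis integral_unique)
 qed
 have "(F has_vector_derivative f 0) (at 0 within {0..1})"
  unfolding F_def by (rule integral_has_vector_derivative[OF cont]) simp
 then have "((\<lambda>u. (F u - F 0) / (u - 0)) \<longlongrightarrow> f 0) (at 0 within {0..1})"
  by (simp add: has_real_derivative_iff_has_vector_derivative[symmetric] has_field_derivative_iff)
 moreover have "filterlim e (at 0 within {0..1}) sequentially"
  unfolding filterlim_at using e0 e by (auto simp: less_imp_le less_imp_neq[symmetric] intro!: always_eventually)
 ultimately have "(\<lambda>n. (F (e n) - F 0) / (e n - 0)) \<longlonglongrightarrow> f 0" by (rule filterlim_compose)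
 then have "(\<lambda>n. f 1 - F (e n) / e n) \<longlonglongrightarrow> f 1 - f 0"
  by (intro tendsto_intros) (simp add: F_def)
 then show ?thesis using eq by (simp add: e_def)
qed

lemma borel_measurable_pair_compose:
 fixes f :: "real => real => 'b::topological_space"
 assumes f: "(\<lambda>z. f (fst z) (snd z)) \<in> borel_measurable borel"
  and "g1 \<in> borel_measurable M" "g2 \<in> borel_measurable M"
 shows "(\<lambda>z. f (g1 z) (g2 z)) \<in> borel_measurable M"
proof -
 have "(\<lambda>z. (g1 z, g2 z)) \<in> borel_measurable M" using assms(2,3) by (rule borel_measurable_Pair)
 from measurable_compose[OF this f] show ?thesis by simp
qed

text \<open>A bounded measurable function is an \<open>L\<^sup>1\<close>-limit of equally bounded continuous functions, and for these
  dominated convergence applies.\<close>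
lemma L1_translation_continuous:
 fixes f :: "real => 'b::euclidean_space"
 assumes meas: "f \<in> borel_measurable borel" and bnd: "\<And>r. norm (f r) \<le> K"
 shows "(\<lambda>n. \<integral>r. norm (f (min 1 (r + 1 / real (Suc n))) - f r) \<partial>lebesgue_on {0..1}) \<longlonglongrightarrow> 0"
proof (rule LIMSEQ_I)
 fix \<epsilon> :: real assume "\<epsilon> > 0"
 interpret Q: finite_measure "lebesgue_on {0..1::real}"
  by (rule finite_measure_lebesgue_on) simp
 note meas [measurable]
 have K: "K \<ge> 0" using bnd[of 0] norm_ge_zero order_trans by blast
 obtain N g where N: "negligible N" "\<And>k::nat. continuous_on UNIV (g k)" "\<And>r. r \<notin> N ==> (\<lambda>k. g k r) \<longlonglongrightarrow> f r"
 proof -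
  have "f measurable_on UNIV"
   by (rule lebesgue_measurable_imp_measurable_on) (use meas in \<open>auto intro: measurable_completion\<close>)
  then show thesis using that unfolding measurable_on_def by auto
 qed
 define G where "G k r = closest_point (cball 0 K) (g k r)" for k r
 have ne: "cball (0::'b) K \<noteq> {}" using K by auto
 have contG: "continuous_on UNIV (G k)" for k
  unfolding G_def using continuous_on_compose2[OF continuous_on_closest_point[OF convex_cball closed_cball ne] N(2)] by auto
 have Gm [measurable]: "G k \<in> borel_measurable borel" for k
  using contG by (rule borel_measurable_continuous_onI)
 have Gb: "norm (G k r) \<le> K" for k r
  using closest_point_in_set[OF closed_cball ne] by (simp add: G_def)
 have Glim: "(\<lambda>k. G k r) \<longlonglongrightarrow> f r" if "r \<notin> N" for r
 proof -
  have "(\<lambda>k. G k r) \<longlonglongrightarrow> closest_point (cball 0 K) (f r)"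
   unfolding G_def
   by (rule continuous_on_tendsto_compose[OF continuous_on_closest_point[OF convex_cball closed_cball ne, of UNIV] N(3)[OF that]]) auto
  then show ?thesis using bnd closest_point_self[of "f r" "cball 0 K"] by simp
 qed
 have diff: "norm (f r - G k r') \<le> 2 * K" "norm (G k r - G k r') \<le> 2 * K" "norm (G k r' - f r) \<le> 2 * K" for k r r'
  using norm_triangle_ineq4[of "f r" "G k r'"] norm_triangle_ineq4[of "G k r" "G k r'"] norm_triangle_ineq4[of "G k r'" "f r"]
   bnd[of r] Gb[of k r] Gb[of k r'] by linarith+
 have AE_N: "AE r in lebesgue_on {0..1}. r \<notin> N"
 proof -
  have "AE r in lebesgue. r \<notin> N" using N(1) by (simp add: AE_not_in negligible_iff_null_sets)
  then show ?thesis by (auto simp: AE_restrict_space_iff elim: eventually_mono)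
 qed
 have "(\<lambda>k. \<integral>r. norm (G k r - f r) \<partial>lebesgue_on {0..1}) \<longlonglongrightarrow> (\<integral>r. 0 \<partial>lebesgue_on {0..1::real})"
 proof (rule integral_dominated_convergence[where w = "\<lambda>_. 2 * K"])
  show "AE r in lebesgue_on {0..1}. (\<lambda>k. norm (G k r - f r)) \<longlonglongrightarrow> 0"
   using AE_N
  proof eventually_elim
   case (elim r)
   from tendsto_norm_zero[OF tendsto_diff[OF Glim[OF elim] tendsto_const[of "f r"], simplified diff_self]] show ?case by simp
  qed
 qed (use diff in \<open>auto intro!: Q.integrable_const measurable_compose[OF measurable_ident_lebesgue_on]\<close>)
 then obtain k where k: "(\<integral>r. norm (G k r - f r) \<partial>lebesgue_on {0..1}) < \<epsilon> / 4"
  using LIMSEQ_D[of _ 0 "\<epsilon>/4"] \<open>\<epsilon> > 0\<close> by (force simp: abs_less_iff)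
 let ?q = "\<lambda>n r. min 1 (r + 1 / real (Suc n))"
 let ?\<phi> = "\<lambda>r. norm (f r - G k r)"
 have int: "integrable (lebesgue_on {0..1}) u"
  if "u \<in> borel_measurable borel" "\<And>r. norm (u r) \<le> 2 * K" for u :: "real => real"
  using that by (intro Q.integrable_const_bound[of _ "2 * K"] measurable_compose[OF measurable_ident_lebesgue_on]) auto
 have shift: "(\<integral>r. ?\<phi> (?q n r) \<partial>lebesgue_on {0..1}) \<le> (\<integral>r. ?\<phi> r \<partial>lebesgue_on {0..1}) + 2 * K / real (Suc n)" for n
 proof -
  define e where "e = 1 / real (Suc n)"
  have e: "0 < e" "e \<le> 1" by (auto simp: e_def)
  have hk: "integral\<^sup>L (lebesgue_on {0..1}) u = integral {0..1} u \<and> u integrable_on {0..1}"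
   if "u \<in> borel_measurable borel" "\<And>r. norm (u r) \<le> 2 * K" for u :: "real => real"
   using lebesgue_integral_eq_integral[OF int[OF that]] integrable_on_lebesgue_on[OF int[OF that]] by auto
  have \<phi>: "?\<phi> integrable_on {0..1}" using hk[of ?\<phi>] diff by auto
  from has_integral_forward_shift[OF \<phi> e]
  have "integral {0..1} (\<lambda>r. ?\<phi> (min 1 (r + e))) = (integral {0..1} ?\<phi> - integral {0..e} ?\<phi>) + e * ?\<phi> 1"
   by (rule integral_unique)
  also have "\<dots> \<le> integral {0..1} ?\<phi> + e * (2 * K)"
  proof -
   have "integral {0..e} ?\<phi> \<ge> 0"
    by (intro Henstock_Kurzweil_Integration.integral_nonneg integrable_subinterval_real[OF \<phi>]) (use e in auto)
   moreover have "e * ?\<phi> 1 \<le> e * (2 * K)" using e diff by (intro mult_left_mono) auto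
   ultimately show ?thesis by linarith
  qed
  finally show ?thesis using hk[of ?\<phi>] hk[of "\<lambda>r. ?\<phi> (?q n r)"] diff by (simp add: e_def)
 qed
 have mid: "(\<lambda>n. \<integral>r. norm (G k (?q n r) - G k r) \<partial>lebesgue_on {0..1}) \<longlonglongrightarrow> (\<integral>r. 0 \<partial>lebesgue_on {0..1::real})"
 proof (rule integral_dominated_convergence[where w = "\<lambda>_. 2 * K"])
  show "AE r in lebesgue_on {0..1}. (\<lambda>n. norm (G k (?q n r) - G k r)) \<longlonglongrightarrow> 0"
  proof (rule AE_I2)
   fix r assume "r \<in> space (lebesgue_on {0..1::real})"
   then have r: "r \<in> {0..1}" by auto
   have "(\<lambda>n. G k (?q n r)) \<longlonglongrightarrow> G k r"
    by (rule continuous_on_tendsto_compose[OF contG tendsto_forward_point[OF r]]) auto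
   from tendsto_norm_zero[OF tendsto_diff[OF this tendsto_const[of "G k r"], simplified diff_self]]
   show "(\<lambda>n. norm (G k (?q n r) - G k r)) \<longlonglongrightarrow> 0" by simp
  qed
 qed (use diff in \<open>auto intro!: Q.integrable_const measurable_compose[OF measurable_ident_lebesgue_on]\<close>)
 have "(\<lambda>n. (\<integral>r. norm (G k (?q n r) - G k r) \<partial>lebesgue_on {0..1}) + 2 * K * (1 / real (Suc n))) \<longlonglongrightarrow> 0 + 2 * K * 0"
  using mid LIMSEQ_inverse_real_of_nat unfolding inverse_eq_divide by (intro tendsto_intros) auto
 then have "\<forall>\<^sub>F n in sequentially.
   (\<integral>r. norm (G k (?q n r) - G k r) \<partial>lebesgue_on {0..1}) + 2 * K * (1 / real (Suc n)) < \<epsilon> / 4"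
  by (rule order_tendstoD(2)) (use \<open>\<epsilon> > 0\<close> in simp)
 then obtain n0 where n0: "\<And>n. n \<ge> n0 ==>
   (\<integral>r. norm (G k (?q n r) - G k r) \<partial>lebesgue_on {0..1}) + 2 * K * (1 / real (Suc n)) < \<epsilon> / 4"
  unfolding eventually_sequentially by blast
 show "\<exists>n0. \<forall>n\<ge>n0. norm ((\<integral>r. norm (f (?q n r) - f r) \<partial>lebesgue_on {0..1}) - 0) < \<epsilon>"
 proof (intro exI[of _ n0] allI impI)
  fix n assume n: "n \<ge> n0"
  have "(\<integral>r. norm (f (?q n r) - f r) \<partial>lebesgue_on {0..1}) \<le>
   (\<integral>r. ?\<phi> (?q n r) + norm (G k (?q n r) - G k r) + norm (G k r - f r) \<partial>lebesgue_on {0..1})"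
  proof (rule integral_mono')
   show "integrable (lebesgue_on {0..1}) (\<lambda>r. ?\<phi> (?q n r) + norm (G k (?q n r) - G k r) + norm (G k r - f r))"
    using diff by (intro Bochner_Integration.integrable_add int) auto
   fix r
   have "f (?q n r) - f r = (f (?q n r) - G k (?q n r)) + (G k (?q n r) - G k r) + (G k r - f r)" by simp
   then show "norm (f (?q n r) - f r) \<le> ?\<phi> (?q n r) + norm (G k (?q n r) - G k r) + norm (G k r - f r)"
    by (metis norm_triangle_le norm_triangle_ineq add_mono order_refl)
  qed auto
  also have "\<dots> = (\<integral>r. ?\<phi> (?q n r) \<partial>lebesgue_on {0..1}) + (\<integral>r. norm (G k (?q n r) - G k r) \<partial>lebesgue_on {0..1})
    + (\<integral>r. norm (G k r - f r) \<partial>lebesgue_on {0..1})"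
  proof -
   have i: "integrable (lebesgue_on {0..1}) (\<lambda>r. ?\<phi> (?q n r))"
    "integrable (lebesgue_on {0..1}) (\<lambda>r. norm (G k (?q n r) - G k r))"
    "integrable (lebesgue_on {0..1}) (\<lambda>r. norm (G k r - f r))"
    using diff by (intro int; auto)+
   show ?thesis
    unfolding Bochner_Integration.integral_add[OF Bochner_Integration.integrable_add[OF i(1,2)] i(3)]
     Bochner_Integration.integral_add[OF i(1,2)] ..
  qed
  also have "\<dots> < \<epsilon>"
  proof -
   have "(\<integral>r. ?\<phi> r \<partial>lebesgue_on {0..1}) = (\<integral>r. norm (G k r - f r) \<partial>lebesgue_on {0..1})"
    by (simp add: norm_minus_commute)
   moreover have "2 * K / real (Suc n) = 2 * K * (1 / real (Suc n))" by simp
   ultimately show ?thesis using shift[of n] n0[OF n] k \<open>\<epsilon> > 0\<close> by linarith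
  qed
  finally show "norm ((\<integral>r. norm (f (?q n r) - f r) \<partial>lebesgue_on {0..1}) - 0) < \<epsilon>"
   by (simp add: integral_nonneg_AE)
 qed
qed

text \<open>A representative of the time derivative that is jointly measurable: a limit of difference quotients
  with a fixed default where the limit misbehaves. The bound \<open>K\<close> is the Lipschitz constant, so the
  truncation is invisible at points of differentiability.\<close>
definition forward_tderiv :: "real => real => (real => real => 'b::euclidean_space) => real => real => 'b" where
 "forward_tderiv t K f \<tau> r =
   (let v = lim (\<lambda>n. real (Suc n) *\<^sub>R (f (min t (\<tau> + 1 / real (Suc n))) r - f \<tau> r))
   in if norm v \<le> K then v else 0)"

lemma norm_forward_tderiv: "K \<ge> 0 ==> norm (forward_tderiv t K f \<tau> r) \<le> K"
 by (simp add: forward_tderiv_def Let_def)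

lemma borel_measurable_forward_tderiv:
 assumes f: "(\<lambda>z. f (fst z) (snd z)) \<in> borel_measurable borel"
 shows "(\<lambda>z. forward_tderiv t K f (fst z) (snd z)) \<in> borel_measurable borel"
proof -
 have [measurable]: "(\<lambda>z. f (fst z) (snd z)) \<in> borel_measurable borel" by (rule f)
 have [measurable]: "(\<lambda>z. f (min t (fst z + 1 / real (Suc n))) (snd z)) \<in> borel_measurable borel" for n
  by (rule borel_measurable_pair_compose[OF f]) (auto simp: borel_prod[symmetric])
 have [measurable]: "(\<lambda>z. lim (\<lambda>n. real (Suc n) *\<^sub>R (f (min t (fst z + 1 / real (Suc n))) (snd z) - f (fst z) (snd z)))) \<in> borel_measurable borel"
  by (rule borel_measurable_lim_metric) measurable
 show ?thesis unfolding forward_tderiv_def Let_def by measurable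
qed

lemma forward_tderiv_eqI:
 assumes der: "((\<lambda>\<tau>. f \<tau> r) has_vector_derivative d) (at \<tau> within {s..t})" and \<tau>: "\<tau> \<in> {s..<t}"
  and lip: "\<And>\<tau> \<tau>'. norm (f \<tau> r - f \<tau>' r) \<le> K * \<bar>\<tau> - \<tau>'\<bar>"
 shows "forward_tderiv t K f \<tau> r = d"
proof -
 let ?v = "\<lambda>n. real (Suc n) *\<^sub>R (f (min t (\<tau> + 1 / real (Suc n))) r - f \<tau> r)"
 have "?v \<longlonglongrightarrow> d"
 proof (rule LIMSEQ_I)
  fix e :: real assume "e > 0"
  have "\<forall>e>0. \<exists>\<delta>>0. \<forall>y\<in>{s..t}. norm (y - \<tau>) < \<delta> --> norm (f y r - f \<tau> r - (y - \<tau>) *\<^sub>R d) \<le> e * norm (y - \<tau>)"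
   using der unfolding has_vector_derivative_def has_derivative_within_alt by (rule conjunct2)
  then obtain \<delta> where \<delta>: "\<delta> > 0" "\<And>y. y \<in> {s..t} ==> norm (y - \<tau>) < \<delta> ==> norm (f y r - f \<tau> r - (y - \<tau>) *\<^sub>R d) \<le> e/2 * norm (y - \<tau>)"
   using \<open>e > 0\<close> by (metis half_gt_zero)
  obtain n0 where n0: "inverse (real (Suc n0)) < min \<delta> (t - \<tau>)"
   using reals_Archimedean[of "min \<delta> (t - \<tau>)"] \<delta> \<tau> by auto
  have "norm (?v n - d) < e" if n: "n \<ge> n0" for n
  proof -
   define h where "h = 1 / real (Suc n)"
   have "h \<le> inverse (real (Suc n0))" using n by (simp add: h_def field_simps)
   then have h: "h > 0" "h < \<delta>" "\<tau> + h < t" using n0 by (auto simp: h_def)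
   have "norm (f (\<tau> + h) r - f \<tau> r - h *\<^sub>R d) \<le> e/2 * h"
    using \<delta>(2)[of "\<tau> + h"] h \<tau> by auto
   moreover have "?v n - d = real (Suc n) *\<^sub>R (f (\<tau> + h) r - f \<tau> r - h *\<^sub>R d)"
    using h(3) by (simp add: h_def[symmetric] scaleR_diff_right) (simp add: h_def)
   ultimately have "norm (?v n - d) \<le> real (Suc n) * (e/2 * h)" by simp
   also have "\<dots> = e / 2 * (real (Suc n) * h)" by (simp only: ac_simps)
   also have "real (Suc n) * h = 1" by (simp add: h_def del: of_nat_Suc)
   finally show ?thesis using \<open>e > 0\<close> by linarith
  qed
  then show "\<exists>n0. \<forall>n\<ge>n0. norm (?v n - d) < e" by blast
 qed
 moreover have "norm (?v n) \<le> K" for n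
 proof -
  have "norm (?v n) = real (Suc n) * norm (f (min t (\<tau> + 1 / real (Suc n))) r - f \<tau> r)" by simp
  also have "\<dots> \<le> real (Suc n) * (K * \<bar>min t (\<tau> + 1 / real (Suc n)) - \<tau>\<bar>)"
   by (intro mult_left_mono lip) auto
  also have "\<dots> \<le> real (Suc n) * (K * (1 / real (Suc n)))"
  proof -
   have "K * 1 \<ge> 0" using order_trans[OF norm_ge_zero lip[of 1 0]] by simp
   then show ?thesis using \<tau> by (intro mult_left_mono) (auto simp: min_def)
  qed
  finally show ?thesis by simp
 qed
 ultimately have "lim ?v = d" "norm d \<le> K"
  by (auto intro: limI Lim_norm_ubound[of sequentially ?v])
 then show ?thesis by (simp add: forward_tderiv_def Let_def)
qed

section \<open>Transport of exactness along a one-parameter family of extremals\<close>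

text \<open>For a family of extremals with parameter \<open>r\<close>: \<open>x\<close> and \<open>p\<close> are the canonical coordinates, \<open>X\<^sub>q\<close> and \<open>X\<^sub>p\<close> the components
  of the Hamiltonian field along the family, \<open>h\<close> the Hamiltonian, \<open>L\<close> the Lagrangian and \<open>\<Theta>\<close> the action.
  The exceptional times in \<open>der_x\<close> and \<open>der_p\<close> depend on \<open>r\<close>, those of the remaining hypotheses do not. The
  hypothesis \<open>start\<close> says that \<open>d\<Theta> = p dx\<close> holds at time \<open>s\<close>.\<close>
locale hamiltonian_strip =
 fixes s t K B m :: real
  and x p :: "real => real => 'e::euclidean_space"
  and X\<^sub>q X\<^sub>p :: "real => real => 'e"
  and h L \<Theta> :: "real => real => real"
 assumes st: "s < t" and K: "K \<ge> 0" and B: "B \<ge> 0"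
  and lip_x: "\<And>\<tau> \<tau>' r r'. norm (x \<tau> r - x \<tau>' r') \<le> K * \<bar>\<tau> - \<tau>'\<bar> + B * \<bar>r - r'\<bar>"
  and lip_p: "\<And>\<tau> \<tau>' r r'. norm (p \<tau> r - p \<tau>' r') \<le> K * \<bar>\<tau> - \<tau>'\<bar> + B * \<bar>r - r'\<bar>"
  and der_x: "\<And>r. r \<in> {0..1} ==> AE \<tau> in lebesgue_on {s..t}.
   ((\<lambda>\<tau>. x \<tau> r) has_vector_derivative X\<^sub>q \<tau> r) (at \<tau> within {s..t})"
  and der_p: "\<And>r. r \<in> {0..1} ==> AE \<tau> in lebesgue_on {s..t}.
   ((\<lambda>\<tau>. p \<tau> r) has_vector_derivative X\<^sub>p \<tau> r) (at \<tau> within {s..t})"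
  and L_eq: "AE \<tau> in lebesgue_on {s..t}. \<forall>r\<in>{0..1}. L \<tau> r = p \<tau> r \<bullet> X\<^sub>q \<tau> r - h \<tau> r"
  and h_diff: "AE \<tau> in lebesgue_on {s..t}. \<forall>r\<in>{0..1}. \<forall>e>0. \<exists>d>0. \<forall>r'\<in>{0..1}. \<bar>r' - r\<bar> < d -->
   \<bar>h \<tau> r' - h \<tau> r - ((p \<tau> r' - p \<tau> r) \<bullet> X\<^sub>q \<tau> r - (x \<tau> r' - x \<tau> r) \<bullet> X\<^sub>p \<tau> r)\<bar> \<le> e * \<bar>r' - r\<bar>"
  and L_meas: "\<And>r. r \<in> {0..1} ==> (\<lambda>\<tau>. L \<tau> r) \<in> borel_measurable (lebesgue_on {s..t})"
  and L_bdd: "\<And>r. r \<in> {0..1} ==> \<exists>C. \<forall>\<tau>\<in>{s..t}. \<bar>L \<tau> r\<bar> \<le> C"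
  and L_lip: "AE \<tau> in lebesgue_on {s..t}. \<forall>r\<in>{0..1}. \<forall>r'\<in>{0..1}. \<bar>L \<tau> r' - L \<tau> r\<bar> \<le> m * \<bar>r' - r\<bar>"
  and \<Theta>_eq: "\<And>r. r \<in> {0..1} ==> \<Theta> t r = \<Theta> s r + integral {s..t} (\<lambda>\<tau>. L \<tau> r)"
  and start: "\<And>r e. r \<in> {0..1} ==> e > 0 ==> \<exists>d>0. \<forall>r'\<in>{0..1}. \<bar>r' - r\<bar> < d -->
   \<bar>\<Theta> s r' - \<Theta> s r - p s r \<bullet> (x s r' - x s r)\<bar> \<le> e * \<bar>r' - r\<bar>"
begin

abbreviation "A \<equiv> lebesgue_on {s..t}"
abbreviation "Q \<equiv> lebesgue_on {0..1::real}"

sublocale A: finite_measure A by (rule finite_measure_lebesgue_on) simp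
sublocale Q: finite_measure Q by (rule finite_measure_lebesgue_on) simp
sublocale P: pair_sigma_finite A Q ..
sublocale PP: finite_measure "A \<Otimes>\<^sub>M Q"
 by (rule finite_measure_pair_measure) (unfold_locales)

definition nxt :: "nat => real => real" where "nxt n r = min 1 (r + 1 / real (Suc n))"
definition dif :: "nat => (real => real => 'c::real_vector) => real => real => 'c" where
 "dif n f \<tau> r = real (Suc n) *\<^sub>R (f \<tau> (nxt n r) - f \<tau> r)"
abbreviation "a \<equiv> forward_tderiv t K x"
abbreviation "b \<equiv> forward_tderiv t K p"

lemma nxt: "r \<in> {0..1} ==> nxt n r \<in> {0..1}" "r \<in> {0..1} ==> r \<le> nxt n r"
 "r \<in> {0..1} ==> \<bar>nxt n r - r\<bar> \<le> 1 / real (Suc n)"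
 by (auto simp: nxt_def min_def)

lemma nxt_meas [measurable]: "nxt n \<in> borel_measurable borel"
 unfolding nxt_def by measurable

lemma lip_imp_cont:
 fixes f :: "real => real => 'e"
 assumes "\<And>\<tau> \<tau>' r r'. norm (f \<tau> r - f \<tau>' r') \<le> K * \<bar>\<tau> - \<tau>'\<bar> + B * \<bar>r - r'\<bar>"
 shows "continuous_on UNIV (\<lambda>z. f (fst z) (snd z))"
proof (rule lipschitz_on_continuous_on[OF lipschitz_onI])
 fix z z' :: "real \<times> real"
 have "norm (f (fst z) (snd z) - f (fst z') (snd z')) \<le> K * \<bar>fst z - fst z'\<bar> + B * \<bar>snd z - snd z'\<bar>"
  by (rule assms)
 also have "\<dots> \<le> K * dist z z' + B * dist z z'"
  using dist_fst_le[of z z'] dist_snd_le[of z z'] K B by (intro add_mono mult_left_mono) (auto simp: dist_real_def)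
 finally show "dist (f (fst z) (snd z)) (f (fst z') (snd z')) \<le> (K + B) * dist z z'"
  by (simp add: dist_norm algebra_simps)
qed (use K B in simp)

lemma xp_meas: "(\<lambda>z. x (fst z) (snd z)) \<in> borel_measurable borel" "(\<lambda>z. p (fst z) (snd z)) \<in> borel_measurable borel"
 by (intro borel_measurable_continuous_onI lip_imp_cont lip_x lip_p)+

lemmas ab_meas = borel_measurable_forward_tderiv[OF xp_meas(1)] borel_measurable_forward_tderiv[OF xp_meas(2)]

lemma fst_snd_meas [measurable]: "fst \<in> borel_measurable (A \<Otimes>\<^sub>M Q)" "snd \<in> borel_measurable (A \<Otimes>\<^sub>M Q)"
 using measurable_compose[OF measurable_fst measurable_ident_lebesgue_on]
  measurable_compose[OF measurable_snd measurable_ident_lebesgue_on] by simp_all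

lemma ab_bound: "norm (a \<tau> r) \<le> K" "norm (b \<tau> r) \<le> K"
 using norm_forward_tderiv[OF K] by blast+

lemma AE_not_endpoint: "AE \<tau> in A. \<tau> \<noteq> t"
 by (auto simp: AE_restrict_space_iff intro!: eventually_mono[OF AE_not_in[of "{t}" lebesgue]])

lemma a_eq: assumes "r \<in> {0..1}" shows "AE \<tau> in A. a \<tau> r = X\<^sub>q \<tau> r"
 using der_x[OF assms] AE_not_endpoint AE_space[of A]
proof eventually_elim
 case (elim \<tau>)
 show ?case by (rule forward_tderiv_eqI[where f = x and r = r, OF elim(1)]) (use elim lip_x[of _ r _ r] in auto)
qed

lemma b_eq: assumes "r \<in> {0..1}" shows "AE \<tau> in A. b \<tau> r = X\<^sub>p \<tau> r"
 using der_p[OF assms] AE_not_endpoint AE_space[of A]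
proof eventually_elim
 case (elim \<tau>)
 show ?case by (rule forward_tderiv_eqI[where f = p and r = r, OF elim(1)]) (use elim lip_p[of _ r _ r] in auto)
qed

definition regular :: "real => bool" where
 "regular \<tau> \<longleftrightarrow> (\<forall>r\<in>{0..1}. \<forall>e>0. \<exists>d>0. \<forall>r'\<in>{0..1}. \<bar>r' - r\<bar> < d -->
   \<bar>h \<tau> r' - h \<tau> r - ((p \<tau> r' - p \<tau> r) \<bullet> X\<^sub>q \<tau> r - (x \<tau> r' - x \<tau> r) \<bullet> X\<^sub>p \<tau> r)\<bar> \<le> e * \<bar>r' - r\<bar>)"

text \<open>Where \<open>h\<close> is not differentiable along the family nothing is known about it; it is reset to \<open>0\<close> at such
  times, so that it becomes continuous in \<open>r\<close> at every time.\<close>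
definition hr :: "real => real => real" where "hr \<tau> r = (if regular \<tau> then h \<tau> r else 0)"

lemma AE_regular: "AE \<tau> in A. regular \<tau>" using h_diff by (simp add: regular_def)

lemma increment_bounds: "norm (x \<tau> r' - x \<tau> r) \<le> B * \<bar>r' - r\<bar>" "norm (p \<tau> r' - p \<tau> r) \<le> B * \<bar>r' - r\<bar>"
 using lip_x[of \<tau> r' \<tau> r] lip_p[of \<tau> r' \<tau> r] by simp_all

lemma hr_pointwise_lipschitz:
 assumes "r \<in> {0..1}"
 shows "\<exists>C d. d > 0 \<and> C \<ge> 0 \<and> (\<forall>r'\<in>{0..1}. \<bar>r' - r\<bar> < d --> \<bar>hr \<tau> r' - hr \<tau> r\<bar> \<le> C * \<bar>r' - r\<bar>)"
proof (cases "regular \<tau>")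
 case True
 from True[unfolded regular_def, rule_format, OF assms zero_less_one] obtain d where d: "d > 0"
  "\<And>r'. r' \<in> {0..1} ==> \<bar>r' - r\<bar> < d ==>
   \<bar>h \<tau> r' - h \<tau> r - ((p \<tau> r' - p \<tau> r) \<bullet> X\<^sub>q \<tau> r - (x \<tau> r' - x \<tau> r) \<bullet> X\<^sub>p \<tau> r)\<bar> \<le> 1 * \<bar>r' - r\<bar>"
  by blast
 let ?C = "1 + B * norm (X\<^sub>q \<tau> r) + B * norm (X\<^sub>p \<tau> r)"
 have "\<bar>hr \<tau> r' - hr \<tau> r\<bar> \<le> ?C * \<bar>r' - r\<bar>" if "r' \<in> {0..1}" "\<bar>r' - r\<bar> < d" for r'
 proof -
  have "\<bar>(p \<tau> r' - p \<tau> r) \<bullet> X\<^sub>q \<tau> r\<bar> \<le> (B * \<bar>r' - r\<bar>) * norm (X\<^sub>q \<tau> r)"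
   "\<bar>(x \<tau> r' - x \<tau> r) \<bullet> X\<^sub>p \<tau> r\<bar> \<le> (B * \<bar>r' - r\<bar>) * norm (X\<^sub>p \<tau> r)"
   using Cauchy_Schwarz_ineq2 mult_right_mono[OF increment_bounds(2) norm_ge_zero]
    mult_right_mono[OF increment_bounds(1) norm_ge_zero] order_trans by blast+
  moreover have "?C * \<bar>r' - r\<bar> = 1 * \<bar>r' - r\<bar> + (B * \<bar>r' - r\<bar>) * norm (X\<^sub>q \<tau> r) + (B * \<bar>r' - r\<bar>) * norm (X\<^sub>p \<tau> r)"
   by (simp add: algebra_simps)
  moreover have "hr \<tau> r' - hr \<tau> r = h \<tau> r' - h \<tau> r" using True by (simp add: hr_def)
  ultimately show ?thesis using d(2)[OF that] by linarith
 qed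
 moreover have "?C \<ge> 0" using B by simp
 ultimately show ?thesis using d(1) by blast
qed (auto simp: hr_def intro!: exI[of _ "1::real"])

lemma hr_cont: "continuous_on {0..1} (hr \<tau>)"
 unfolding continuous_on_iff
proof (intro ballI allI impI)
 fix r e :: real assume r: "r \<in> {0..1}" and "e > 0"
 obtain C d where d: "d > 0" "C \<ge> 0" "\<And>r'. r' \<in> {0..1} ==> \<bar>r' - r\<bar> < d ==> \<bar>hr \<tau> r' - hr \<tau> r\<bar> \<le> C * \<bar>r' - r\<bar>"
  using hr_pointwise_lipschitz[OF r] by blast
 define d' where "d' = min d (e / (C + 1))"
 have "dist (hr \<tau> r') (hr \<tau> r) < e" if "r' \<in> {0..1}" "dist r' r < d'" for r'
 proof -
  have "\<bar>hr \<tau> r' - hr \<tau> r\<bar> \<le> C * \<bar>r' - r\<bar>" using d that by (auto simp: d'_def dist_real_def)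
  also have "\<dots> \<le> (C + 1) * \<bar>r' - r\<bar>" by (intro mult_right_mono) auto
  also have "\<dots> < e" using that \<open>C \<ge> 0\<close> by (auto simp: d'_def dist_real_def field_simps)
  finally show ?thesis by (simp add: dist_real_def)
 qed
 moreover have "d' > 0" using d \<open>e > 0\<close> by (auto simp: d'_def)
 ultimately show "\<exists>d>0. \<forall>r'\<in>{0..1}. dist r' r < d --> dist (hr \<tau> r') (hr \<tau> r) < e" by blast
qed

lemma hr_eq: "r \<in> {0..1} ==> AE \<tau> in A. hr \<tau> r = p \<tau> r \<bullet> a \<tau> r - L \<tau> r"
proof -
 assume r: "r \<in> {0..1}"
 show ?thesis using AE_regular L_eq a_eq[OF r] by eventually_elim (use r in \<open>auto simp: hr_def\<close>)
qed

lemma pair_meas: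
 assumes "(\<lambda>z. f (fst z) (snd z)) \<in> borel_measurable borel"
 shows "(\<lambda>z. f (fst z) (snd z)) \<in> borel_measurable (A \<Otimes>\<^sub>M Q)"
  "(\<lambda>z. f (fst z) (nxt n (snd z))) \<in> borel_measurable (A \<Otimes>\<^sub>M Q)"
  "(\<lambda>\<tau>. f \<tau> r) \<in> borel_measurable A"
  "(\<lambda>r. f \<tau> r) \<in> borel_measurable Q"
  "(\<lambda>r. f \<tau> (nxt n r)) \<in> borel_measurable Q"
 by (rule borel_measurable_pair_compose[OF assms]; measurable)+

text \<open>The Hamiltonian is not assumed measurable in time; it inherits measurability from \<open>L = p X\<^sub>q - h\<close>.\<close>
lemma hr_meas_time: assumes r: "r \<in> {0..1}" shows "(\<lambda>\<tau>. hr \<tau> r) \<in> borel_measurable A"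
proof (rule borel_measurable_lebesgue_on_cong_AE)
 show "(\<lambda>\<tau>. p \<tau> r \<bullet> a \<tau> r - L \<tau> r) \<in> borel_measurable A"
  by (intro borel_measurable_diff borel_measurable_inner pair_meas xp_meas ab_meas L_meas r)
 show "AE \<tau> in A. p \<tau> r \<bullet> a \<tau> r - L \<tau> r = hr \<tau> r" using hr_eq[OF r] by (auto elim: eventually_mono)
qed simp

lemma hr_meas: "(\<lambda>z. hr (fst z) (snd z)) \<in> borel_measurable (A \<Otimes>\<^sub>M Q)"
  "(\<lambda>z. hr (fst z) (nxt n (snd z))) \<in> borel_measurable (A \<Otimes>\<^sub>M Q)"
proof -
 show "(\<lambda>z. hr (fst z) (snd z)) \<in> borel_measurable (A \<Otimes>\<^sub>M Q)"
  by (rule borel_measurable_caratheodory) (use hr_meas_time hr_cont in auto)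
 show "(\<lambda>z. hr (fst z) (nxt n (snd z))) \<in> borel_measurable (A \<Otimes>\<^sub>M Q)"
 proof (rule borel_measurable_caratheodory)
  show "(\<lambda>\<tau>. hr \<tau> (nxt n r)) \<in> borel_measurable A" if "r \<in> {0..1}" for r using hr_meas_time nxt that by blast
  show "continuous_on {0..1} (\<lambda>r. hr \<tau> (nxt n r))" for \<tau>
   by (rule continuous_on_compose2[OF hr_cont])
    (auto simp: nxt_def intro!: continuous_intros)
 qed
qed

definition W :: "nat => real => real => real" where
 "W n \<tau> r = dif n p \<tau> r \<bullet> a \<tau> r - dif n x \<tau> r \<bullet> b \<tau> r - dif n hr \<tau> r"

lemma dif_meas: "(\<lambda>z. dif n x (fst z) (snd z)) \<in> borel_measurable (A \<Otimes>\<^sub>M Q)"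
 "(\<lambda>z. dif n p (fst z) (snd z)) \<in> borel_measurable (A \<Otimes>\<^sub>M Q)"
 "(\<lambda>z. dif n hr (fst z) (snd z)) \<in> borel_measurable (A \<Otimes>\<^sub>M Q)"
 unfolding dif_def
 by (intro borel_measurable_scaleR borel_measurable_const borel_measurable_diff pair_meas xp_meas hr_meas)+

lemma W_meas [measurable]: "(\<lambda>z. W n (fst z) (snd z)) \<in> borel_measurable (A \<Otimes>\<^sub>M Q)"
 unfolding W_def by (intro borel_measurable_diff borel_measurable_inner dif_meas pair_meas ab_meas)

lemma dif_bound: "r \<in> {0..1} ==> norm (dif n x \<tau> r) \<le> B" "r \<in> {0..1} ==> norm (dif n p \<tau> r) \<le> B"
proof -
 assume r: "r \<in> {0..1}"
 have *: "real (Suc n) * v \<le> B" if "v \<le> B * \<bar>nxt n r - r\<bar>" for v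
 proof -
  have "real (Suc n) * v \<le> real (Suc n) * (B * (1 / real (Suc n)))"
   using that nxt(3)[OF r, of n] B by (meson mult_left_mono of_nat_0_le_iff order_trans)
  then show ?thesis by simp
 qed
 show "norm (dif n x \<tau> r) \<le> B" "norm (dif n p \<tau> r) \<le> B"
  unfolding dif_def norm_scaleR using *[OF increment_bounds(1)[of \<tau> "nxt n r" r]] *[OF increment_bounds(2)[of \<tau> "nxt n r" r]] by simp_all
qed

lemma W_limit:
 assumes r: "r \<in> {0..1}" and \<tau>: "regular \<tau>" "a \<tau> r = X\<^sub>q \<tau> r" "b \<tau> r = X\<^sub>p \<tau> r"
 shows "(\<lambda>n. W n \<tau> r) \<longlonglongrightarrow> 0"
proof (rule LIMSEQ_I)
 fix e :: real assume "e > 0"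
 from \<tau>(1)[unfolded regular_def, rule_format, OF r, of "e/2"] \<open>e > 0\<close> obtain d where d: "d > 0"
  "\<And>r'. r' \<in> {0..1} ==> \<bar>r' - r\<bar> < d ==>
   \<bar>h \<tau> r' - h \<tau> r - ((p \<tau> r' - p \<tau> r) \<bullet> X\<^sub>q \<tau> r - (x \<tau> r' - x \<tau> r) \<bullet> X\<^sub>p \<tau> r)\<bar> \<le> e/2 * \<bar>r' - r\<bar>"
  by auto
 obtain n0 where n0: "inverse (real (Suc n0)) < d" using reals_Archimedean[OF d(1)] by blast
 have "norm (W n \<tau> r - 0) < e" if n: "n \<ge> n0" for n
 proof -
  have "1 / real (Suc n) \<le> inverse (real (Suc n0))" using n by (simp add: field_simps)
  then have "\<bar>nxt n r - r\<bar> < d" using nxt(3)[OF r, of n] n0 by linarith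
  note dd = d(2)[OF nxt(1)[OF r] this]
  have "W n \<tau> r = - real (Suc n) * (h \<tau> (nxt n r) - h \<tau> r - ((p \<tau> (nxt n r) - p \<tau> r) \<bullet> X\<^sub>q \<tau> r - (x \<tau> (nxt n r) - x \<tau> r) \<bullet> X\<^sub>p \<tau> r))"
   unfolding W_def dif_def hr_def using \<tau> by (simp only: if_True inner_scaleR_left real_scaleR_def) (simp only: ring_distribs minus_mult_left diff_conv_add_uminus minus_add_distrib minus_minus ac_simps)
  then have "\<bar>W n \<tau> r\<bar> = real (Suc n) * \<bar>h \<tau> (nxt n r) - h \<tau> r - ((p \<tau> (nxt n r) - p \<tau> r) \<bullet> X\<^sub>q \<tau> r - (x \<tau> (nxt n r) - x \<tau> r) \<bullet> X\<^sub>p \<tau> r)\<bar>"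
   by (simp only: abs_mult abs_minus_cancel abs_of_nat)
  also have "\<dots> \<le> real (Suc n) * (e/2 * \<bar>nxt n r - r\<bar>)" by (intro mult_left_mono dd) auto
  also have "\<dots> \<le> real (Suc n) * (e/2 * (1 / real (Suc n)))"
   using nxt(3)[OF r, of n] \<open>e > 0\<close> by (intro mult_left_mono) auto
  also have "\<dots> = e/2" by (simp del: of_nat_Suc)
  finally show ?thesis using \<open>e > 0\<close> by simp
 qed
 then show "\<exists>n0. \<forall>n\<ge>n0. norm (W n \<tau> r - 0) < e" by blast
qed

lemma W_limit_set: "{z \<in> space (A \<Otimes>\<^sub>M Q). (\<lambda>n. W n (fst z) (snd z)) \<longlonglongrightarrow> 0} \<in> sets (A \<Otimes>\<^sub>M Q)"
proof -
 have "(\<lambda>n. W n (fst z) (snd z)) \<longlonglongrightarrow> 0 \<longleftrightarrow>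
   (\<forall>k::nat. \<exists>n0. \<forall>n\<in>{n0..}. \<bar>W n (fst z) (snd z)\<bar> < inverse (real (Suc k)))" for z
 proof
  assume lim: "(\<lambda>n. W n (fst z) (snd z)) \<longlonglongrightarrow> 0"
  show "\<forall>k::nat. \<exists>n0. \<forall>n\<in>{n0..}. \<bar>W n (fst z) (snd z)\<bar> < inverse (real (Suc k))"
  proof
   fix k show "\<exists>n0. \<forall>n\<in>{n0..}. \<bar>W n (fst z) (snd z)\<bar> < inverse (real (Suc k))"
    using LIMSEQ_D[OF lim, of "inverse (real (Suc k))"] by (auto simp del: of_nat_Suc)
  qed
 next
  assume R: "\<forall>k::nat. \<exists>n0. \<forall>n\<in>{n0..}. \<bar>W n (fst z) (snd z)\<bar> < inverse (real (Suc k))"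
  show "(\<lambda>n. W n (fst z) (snd z)) \<longlonglongrightarrow> 0"
  proof (rule LIMSEQ_I)
   fix e :: real assume "e > 0"
   obtain k where k: "inverse (real (Suc k)) < e" using reals_Archimedean[OF \<open>e > 0\<close>] by blast
   obtain n0 where "\<forall>n\<in>{n0..}. \<bar>W n (fst z) (snd z)\<bar> < inverse (real (Suc k))" using R by blast
   then show "\<exists>n0. \<forall>n\<ge>n0. norm (W n (fst z) (snd z) - 0) < e"
    using k by (intro exI[of _ n0]) (auto intro: less_trans)
  qed
 qed
 then have "{z \<in> space (A \<Otimes>\<^sub>M Q). (\<lambda>n. W n (fst z) (snd z)) \<longlonglongrightarrow> 0} =
   {z \<in> space (A \<Otimes>\<^sub>M Q). \<forall>k::nat. \<exists>n0. \<forall>n\<in>{n0..}. \<bar>W n (fst z) (snd z)\<bar> < inverse (real (Suc k))}" by simp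
 also have "\<dots> \<in> sets (A \<Otimes>\<^sub>M Q)" by measurable
 finally show ?thesis .
qed

lemma AE_AE_W_limit: "AE \<tau> in A. AE r in Q. (\<lambda>n. W n \<tau> r) \<longlonglongrightarrow> 0"
proof -
 have "AE r in Q. AE \<tau> in A. (\<lambda>n. W n \<tau> r) \<longlonglongrightarrow> 0"
 proof (rule AE_I2)
  fix r assume "r \<in> space Q"
  then have r: "r \<in> {0..1}" by auto
  show "AE \<tau> in A. (\<lambda>n. W n \<tau> r) \<longlonglongrightarrow> 0"
   using AE_regular a_eq[OF r] b_eq[OF r] by eventually_elim (rule W_limit[OF r])
 qed
 then show ?thesis using P.AE_commute[of "\<lambda>\<tau> r. (\<lambda>n. W n \<tau> r) \<longlonglongrightarrow> 0"] W_limit_set by blast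
qed

text \<open>Differentiability of \<open>h\<close> along the family gives a Lipschitz bound near each parameter whose size may vary
  with the parameter. At almost every time the canonical expression bounds the difference quotients of
  \<open>h\<close> at almost every parameter by \<open>2 K B\<close>, and the Dini criterion makes this bound uniform.\<close>
lemma hr_lipschitz: "AE \<tau> in A. \<forall>r\<in>{0..1}. \<forall>r'\<in>{0..1}. \<bar>hr \<tau> r' - hr \<tau> r\<bar> \<le> 2 * K * B * \<bar>r' - r\<bar>"
 using AE_AE_W_limit
proof eventually_elim
 case (elim \<tau>)
 then have "AE r in lebesgue. r \<in> {0..1} --> (\<lambda>n. W n \<tau> r) \<longlonglongrightarrow> 0" by (simp add: AE_restrict_space_iff)
 then have N: "negligible {r. \<not> (r \<in> {0..1} --> (\<lambda>n. W n \<tau> r) \<longlonglongrightarrow> 0)}"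
  by (simp add: negligible_iff_null_sets completion.AE_iff_null_sets)
 have *: "\<psi> r' - \<psi> r \<le> 2 * K * B * (r' - r)"
  if \<psi>: "continuous_on {0..1} \<psi>" "\<And>r r'. \<bar>\<psi> r' - \<psi> r\<bar> = \<bar>hr \<tau> r' - hr \<tau> r\<bar>" and rr: "r \<in> {0..1}" "r' \<in> {0..1}" "r \<le> r'" for \<psi> r r'
 proof (rule dini_bound_imp_increment_bound[OF rr(3) _ _ N])
  show "continuous_on {r..r'} \<psi>" using \<psi>(1) by (rule continuous_on_subset) (use rr in auto)
  show "\<exists>C d. d > 0 \<and> (\<forall>r2\<in>{r..r'}. \<bar>r2 - r1\<bar> < d --> \<bar>\<psi> r2 - \<psi> r1\<bar> \<le> C * \<bar>r2 - r1\<bar>)" if "r1 \<in> {r..r'}" for r1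
  proof -
   have "r1 \<in> {0..1}" "{r..r'} \<subseteq> {0..1}" using that rr by auto
   then show ?thesis using hr_pointwise_lipschitz[of r1 \<tau>] unfolding \<psi>(2) by blast
  qed
  fix r1 e :: real assume r1: "r1 \<in> {r..<r'} - {r. \<not> (r \<in> {0..1} --> (\<lambda>n. W n \<tau> r) \<longlonglongrightarrow> 0)}" and e: "e > 0"
  then have r01: "r1 \<in> {0..1}" "r1 < r'" and lim: "(\<lambda>n. W n \<tau> r1) \<longlonglongrightarrow> 0" using rr by auto
  from LIMSEQ_D[OF lim e] obtain n0 where n0: "\<And>n. n \<ge> n0 ==> \<bar>W n \<tau> r1\<bar> < e" by auto
  obtain n1 where n1: "inverse (real (Suc n1)) < r' - r1" using reals_Archimedean[of "r' - r1"] r01 by auto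
  define n where "n = max n0 n1"
  have "1 / real (Suc n) \<le> inverse (real (Suc n1))" by (simp add: n_def field_simps)
  then have n: "1 / real (Suc n) < r' - r1" using n1 by linarith
  let ?r = "r1 + 1 / real (Suc n)"
  have nx: "nxt n r1 = ?r" using n rr by (simp add: nxt_def)
  have "\<bar>dif n p \<tau> r1 \<bullet> a \<tau> r1\<bar> \<le> B * K" "\<bar>dif n x \<tau> r1 \<bullet> b \<tau> r1\<bar> \<le> B * K"
   by (rule order_trans[OF Cauchy_Schwarz_ineq2], rule mult_mono, (rule dif_bound[OF r01(1)] ab_bound B norm_ge_zero)+)+
  moreover have "dif n hr \<tau> r1 = dif n p \<tau> r1 \<bullet> a \<tau> r1 - dif n x \<tau> r1 \<bullet> b \<tau> r1 - W n \<tau> r1"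
   by (simp add: W_def)
  moreover have "\<bar>W n \<tau> r1\<bar> < e" using n0[of n] by (simp add: n_def)
  ultimately have "\<bar>dif n hr \<tau> r1\<bar> \<le> B * K + B * K + e" by linarith
  then have "\<bar>dif n hr \<tau> r1\<bar> \<le> 2 * K * B + e" by (simp add: algebra_simps)
  moreover have "\<bar>dif n hr \<tau> r1\<bar> = real (Suc n) * \<bar>\<psi> ?r - \<psi> r1\<bar>"
   unfolding dif_def nx \<psi>(2) by (simp add: abs_mult)
  ultimately have "\<bar>\<psi> ?r - \<psi> r1\<bar> \<le> (2 * K * B + e) * (1 / real (Suc n))" by (simp add: field_simps)
  then have "\<psi> ?r - \<psi> r1 \<le> (2 * K * B + e) * (?r - r1)" by simp
  then show "\<exists>r2\<in>{r1<..r'}. \<psi> r2 - \<psi> r1 \<le> (2 * K * B + e) * (r2 - r1)"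
   using n by (intro bexI[of _ ?r]) auto
 qed
 have "\<bar>hr \<tau> r' - hr \<tau> r\<bar> \<le> 2 * K * B * (r' - r)" if "r \<in> {0..1}" "r' \<in> {0..1}" "r \<le> r'" for r r'
 proof -
  have "hr \<tau> r' - hr \<tau> r \<le> 2 * K * B * (r' - r)" using *[of "hr \<tau>"] hr_cont that by simp
  moreover have "- hr \<tau> r' - - hr \<tau> r \<le> 2 * K * B * (r' - r)"
   using *[of "\<lambda>r. - hr \<tau> r"] hr_cont that by (simp add: continuous_on_minus abs_minus_commute)
  ultimately show ?thesis by linarith
 qed
 then show ?case by (metis abs_minus_commute abs_of_nonneg diff_ge_0_iff_ge linear)
qed

end

lemma AE_lebesgue_on_imp_negligible:
 assumes "S \<in> sets lebesgue" "AE x in lebesgue_on S. P x"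
 shows "negligible {x\<in>S. \<not> P x}"
proof -
 have "AE x in lebesgue. \<not> (x \<in> S \<and> \<not> P x)" using assms by (simp add: AE_restrict_space_iff)
 then show ?thesis by (simp add: negligible_iff_null_sets completion.AE_iff_null_sets)
qed

context hamiltonian_strip
begin

definition E :: "nat => real => real => real" where
 "E n \<tau> r = dif n \<Theta> \<tau> r - p \<tau> r \<bullet> dif n x \<tau> r"

lemma time_meas:
 "(\<lambda>\<tau>. x \<tau> r) \<in> borel_measurable A" "(\<lambda>\<tau>. p \<tau> r) \<in> borel_measurable A"
 "(\<lambda>\<tau>. a \<tau> r) \<in> borel_measurable A" "(\<lambda>\<tau>. b \<tau> r) \<in> borel_measurable A"
 by (rule pair_meas(3)[OF xp_meas(1)] pair_meas(3)[OF xp_meas(2)] pair_meas(3)[OF ab_meas(1)] pair_meas(3)[OF ab_meas(2)])+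

definition R :: "nat => real => real => real" where
 "R n \<tau> r = W n \<tau> r + dif n p \<tau> r \<bullet> (a \<tau> (nxt n r) - a \<tau> r)"

lemma L_integrable: "r \<in> {0..1} ==> integrable A (\<lambda>\<tau>. L \<tau> r)"
proof -
 assume r: "r \<in> {0..1}"
 obtain C where C: "\<forall>\<tau>\<in>{s..t}. \<bar>L \<tau> r\<bar> \<le> C" using L_bdd[OF r] by blast
 show ?thesis by (rule A.integrable_const_bound[of _ C]) (use C L_meas[OF r] in \<open>auto intro!: AE_I2\<close>)
qed

lemma \<Theta>_eq': "r \<in> {0..1} ==> \<Theta> t r = \<Theta> s r + (\<integral>\<tau>. L \<tau> r \<partial>A)"
 using \<Theta>_eq lebesgue_integral_eq_integral[OF L_integrable] by simp

text \<open>\<open>E\<close> is the defect of \<open>d\<Theta> = p dx\<close> in difference quotient form. Its time derivative is the symplectic cancellation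
  \<open>dp X\<^sub>q - dx X\<^sub>p - dh\<close>, up to the term in which \<open>X\<^sub>q\<close> is taken at the neighbouring parameter.\<close>
lemma E_increment:
 assumes r: "r \<in> {0..1}"
 shows "E n t r - E n s r = (\<integral>\<tau>. R n \<tau> r \<partial>A)"
proof -
 define r' where "r' = nxt n r"
 have r': "r' \<in> {0..1}" using nxt r by (simp add: r'_def)
 define C where "C = norm (p s r) + K * (t - s)"
 define D where "D = B * \<bar>r' - r\<bar>"
 have D: "D \<ge> 0" using B by (simp add: D_def)
 have pC: "norm (p \<tau> r) \<le> C" if "\<tau> \<in> {s..t}" for \<tau>
 proof -
  have "norm (p \<tau> r) \<le> norm (p s r) + norm (p \<tau> r - p s r)" by (metis norm_triangle_sub)
  also have "norm (p \<tau> r - p s r) \<le> K * \<bar>\<tau> - s\<bar>" using lip_p[of \<tau> r s r] by simp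
  also have "\<dots> \<le> K * (t - s)" using that K by (intro mult_left_mono) auto
  finally show ?thesis by (simp add: C_def)
 qed
 then have C: "C \<ge> 0" using norm_ge_zero order_trans st by (metis atLeastAtMost_iff less_imp_le order_refl)
 define u where "u \<tau> = p \<tau> r \<bullet> (x \<tau> r' - x \<tau> r)" for \<tau>
 define u' where "u' \<tau> = b \<tau> r \<bullet> (x \<tau> r' - x \<tau> r) + p \<tau> r \<bullet> (a \<tau> r' - a \<tau> r)" for \<tau>
 have "(u' has_integral u t - u s) {s..t}"
 proof (rule abs_continuous_ftc)
  let ?P = "\<lambda>\<tau>. ((\<lambda>\<tau>. x \<tau> r) has_vector_derivative a \<tau> r) (at \<tau> within {s..t}) \<and>
   ((\<lambda>\<tau>. x \<tau> r') has_vector_derivative a \<tau> r') (at \<tau> within {s..t}) \<and>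
   ((\<lambda>\<tau>. p \<tau> r) has_vector_derivative b \<tau> r) (at \<tau> within {s..t})"
  have "AE \<tau> in A. ?P \<tau>"
   using der_x[OF r] der_x[OF r'] der_p[OF r] a_eq[OF r] a_eq[OF r'] b_eq[OF r]
   by eventually_elim auto
  from AE_lebesgue_on_imp_negligible[OF _ this] show "negligible {\<tau>\<in>{s..t}. \<not> ?P \<tau>}" by simp
  fix \<tau> assume "\<tau> \<in> {s..t} - {\<tau>\<in>{s..t}. \<not> ?P \<tau>}"
  then have d: "((\<lambda>\<tau>. x \<tau> r) has_vector_derivative a \<tau> r) (at \<tau> within {s..t})"
   "((\<lambda>\<tau>. x \<tau> r') has_vector_derivative a \<tau> r') (at \<tau> within {s..t})"
   "((\<lambda>\<tau>. p \<tau> r) has_vector_derivative b \<tau> r) (at \<tau> within {s..t})" by auto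
  show "(u has_vector_derivative u' \<tau>) (at \<tau> within {s..t})"
   unfolding u_def
   by (rule has_vector_derivative_eq_rhs[OF bounded_bilinear.has_vector_derivative[OF bounded_bilinear_inner d(3) has_vector_derivative_diff[OF d(2,1)]]])
    (simp add: u'_def)
 next
  show "abs_continuous_on {s..t} u"
  proof (rule lipschitz_imp_abs_continuous)
   fix \<tau> \<tau>' assume \<tau>: "\<tau> \<in> {s..t}" "\<tau>' \<in> {s..t}"
   have "u \<tau> - u \<tau>' = (p \<tau> r - p \<tau>' r) \<bullet> (x \<tau> r' - x \<tau> r) + p \<tau>' r \<bullet> ((x \<tau> r' - x \<tau>' r') - (x \<tau> r - x \<tau>' r))"
    by (simp add: u_def inner_diff_left inner_diff_right)
   also have "norm \<dots> \<le> (K * \<bar>\<tau> - \<tau>'\<bar>) * D + C * (K * \<bar>\<tau> - \<tau>'\<bar> + K * \<bar>\<tau> - \<tau>'\<bar>)"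
   proof (rule norm_triangle_le[OF add_mono])
    show "norm ((p \<tau> r - p \<tau>' r) \<bullet> (x \<tau> r' - x \<tau> r)) \<le> (K * \<bar>\<tau> - \<tau>'\<bar>) * D"
     unfolding real_norm_def
    proof (rule order_trans[OF Cauchy_Schwarz_ineq2 mult_mono])
     show "norm (p \<tau> r - p \<tau>' r) \<le> K * \<bar>\<tau> - \<tau>'\<bar>" using lip_p[of \<tau> r \<tau>' r] by simp
     show "norm (x \<tau> r' - x \<tau> r) \<le> D" using increment_bounds by (simp add: D_def)
    qed (use K in auto)
    show "norm (p \<tau>' r \<bullet> ((x \<tau> r' - x \<tau>' r') - (x \<tau> r - x \<tau>' r))) \<le> C * (K * \<bar>\<tau> - \<tau>'\<bar> + K * \<bar>\<tau> - \<tau>'\<bar>)"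
     unfolding real_norm_def
    proof (rule order_trans[OF Cauchy_Schwarz_ineq2 mult_mono])
     show "norm (p \<tau>' r) \<le> C" using pC \<tau> by blast
     show "norm ((x \<tau> r' - x \<tau>' r') - (x \<tau> r - x \<tau>' r)) \<le> K * \<bar>\<tau> - \<tau>'\<bar> + K * \<bar>\<tau> - \<tau>'\<bar>"
      using lip_x[of \<tau> r \<tau>' r] lip_x[of \<tau> r' \<tau>' r'] norm_triangle_ineq4[of "x \<tau> r' - x \<tau>' r'" "x \<tau> r - x \<tau>' r"] by simp
    qed (use C in auto)
   qed
   also have "\<dots> = (K * D + 2 * C * K) * \<bar>\<tau> - \<tau>'\<bar>" by (simp add: algebra_simps)
   finally show "norm (u \<tau> - u \<tau>') \<le> (K * D + 2 * C * K) * \<bar>\<tau> - \<tau>'\<bar>" .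
  qed
 qed (use st in simp)
 moreover have "integrable A u'"
 proof (rule A.integrable_const_bound[of _ "K * D + C * (K + K)"])
  show "u' \<in> borel_measurable A"
   unfolding u'_def by (intro borel_measurable_add borel_measurable_inner borel_measurable_diff time_meas)
  show "AE \<tau> in A. norm (u' \<tau>) \<le> K * D + C * (K + K)"
  proof (rule AE_I2)
   fix \<tau> assume "\<tau> \<in> space A"
   then have \<tau>: "\<tau> \<in> {s..t}" by simp
   show "norm (u' \<tau>) \<le> K * D + C * (K + K)"
    unfolding u'_def
   proof (rule norm_triangle_le[OF add_mono])
    show "norm (b \<tau> r \<bullet> (x \<tau> r' - x \<tau> r)) \<le> K * D"
     unfolding real_norm_def
    proof (rule order_trans[OF Cauchy_Schwarz_ineq2 mult_mono])
     show "norm (x \<tau> r' - x \<tau> r) \<le> D" using increment_bounds by (simp add: D_def)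
    qed (use K ab_bound in auto)
    show "norm (p \<tau> r \<bullet> (a \<tau> r' - a \<tau> r)) \<le> C * (K + K)"
     unfolding real_norm_def
    proof (rule order_trans[OF Cauchy_Schwarz_ineq2 mult_mono])
     show "norm (p \<tau> r) \<le> C" using pC \<tau> by blast
     show "norm (a \<tau> r' - a \<tau> r) \<le> K + K"
      by (rule order_trans[OF norm_triangle_ineq4 add_mono[OF ab_bound(1) ab_bound(1)]])
    qed (use C in auto)
   qed
  qed
 qed
 ultimately have u': "integrable A u'" "(\<integral>\<tau>. u' \<tau> \<partial>A) = u t - u s"
  using lebesgue_integral_eq_integral[of "{s..t}" u'] by (auto dest: integral_unique)
 have eq: "(\<Theta> t r' - \<Theta> t r - u t) - (\<Theta> s r' - \<Theta> s r - u s) = (\<integral>\<tau>. L \<tau> r' - L \<tau> r - u' \<tau> \<partial>A)"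
  unfolding \<Theta>_eq'[OF r] \<Theta>_eq'[OF r'] using L_integrable[OF r] L_integrable[OF r'] u' by simp
 have "E n t r - E n s r = real (Suc n) * ((\<Theta> t r' - \<Theta> t r - u t) - (\<Theta> s r' - \<Theta> s r - u s))"
  unfolding E_def dif_def r'_def[symmetric] u_def inner_scaleR_right real_scaleR_def by (simp only: right_diff_distrib)
 also have "\<dots> = (\<integral>\<tau>. real (Suc n) * (L \<tau> r' - L \<tau> r - u' \<tau>) \<partial>A)"
  unfolding eq by (rule integral_mult_right_zero[symmetric])
 also have "\<dots> = (\<integral>\<tau>. R n \<tau> r \<partial>A)"
 proof (rule integral_cong_AE)
  show "(\<lambda>\<tau>. real (Suc n) * (L \<tau> r' - L \<tau> r - u' \<tau>)) \<in> borel_measurable A"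
   using L_integrable[OF r] L_integrable[OF r'] u' by (intro borel_measurable_times borel_measurable_const borel_measurable_diff) auto
  show "(\<lambda>\<tau>. R n \<tau> r) \<in> borel_measurable A"
   unfolding R_def W_def dif_def
   by (intro borel_measurable_add borel_measurable_diff borel_measurable_inner borel_measurable_scaleR borel_measurable_const
     time_meas hr_meas_time[OF r] hr_meas_time[OF r'[unfolded r'_def]])
  show "AE \<tau> in A. real (Suc n) * (L \<tau> r' - L \<tau> r - u' \<tau>) = R n \<tau> r"
   using hr_eq[OF r] hr_eq[OF r']
  proof eventually_elim
   case (elim \<tau>)
   have "L \<tau> r = p \<tau> r \<bullet> a \<tau> r - hr \<tau> r" "L \<tau> r' = p \<tau> r' \<bullet> a \<tau> r' - hr \<tau> r'" using elim by auto
   then have "L \<tau> r' - L \<tau> r - u' \<tau> = (p \<tau> r' - p \<tau> r) \<bullet> a \<tau> r - (x \<tau> r' - x \<tau> r) \<bullet> b \<tau> r - (hr \<tau> r' - hr \<tau> r)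
     + (p \<tau> r' - p \<tau> r) \<bullet> (a \<tau> r' - a \<tau> r)"
    unfolding u'_def inner_diff_left inner_diff_right by (simp add: inner_commute)
   then show ?case
    unfolding R_def W_def dif_def r'_def[symmetric]
    by (simp only: inner_scaleR_left real_scaleR_def right_diff_distrib distrib_left)
  qed
 qed
 finally show ?thesis .
qed

lemma \<Theta>s_lipschitz: "r \<in> {0..1} ==> r' \<in> {0..1} ==> \<bar>\<Theta> s r' - \<Theta> s r\<bar> \<le> (norm (p s 0) + B) * B * \<bar>r' - r\<bar>"
proof (induction r r' rule: linorder_wlog)
 case (le r r')
 have "\<bar>\<Theta> s r' - \<Theta> s r\<bar> \<le> (norm (p s 0) + B) * B * (r' - r)"
 proof (rule lipschitz_on_interval_pointwise)
  fix r1 e :: real assume r1: "r1 \<in> {r..r'}" and e: "e > 0"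
  then have r01: "r1 \<in> {0..1}" using le by auto
  obtain d where d: "d > 0" "\<And>r2. r2 \<in> {0..1} ==> \<bar>r2 - r1\<bar> < d ==>
   \<bar>\<Theta> s r2 - \<Theta> s r1 - p s r1 \<bullet> (x s r2 - x s r1)\<bar> \<le> e * \<bar>r2 - r1\<bar>" using start[OF r01 e] by blast
  have "\<bar>\<Theta> s r2 - \<Theta> s r1\<bar> \<le> ((norm (p s 0) + B) * B + e) * \<bar>r2 - r1\<bar>" if "r2 \<in> {r..r'}" "\<bar>r2 - r1\<bar> < d" for r2
  proof -
   have "norm (p s r1) \<le> norm (p s 0) + norm (p s r1 - p s 0)" by (metis norm_triangle_sub)
   also have "norm (p s r1 - p s 0) \<le> B * \<bar>r1 - 0\<bar>" by (rule increment_bounds)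
   also have "\<dots> \<le> B * 1" using r01 B by (intro mult_left_mono) auto
   finally have "norm (p s r1) \<le> norm (p s 0) + B" by simp
   then have "\<bar>p s r1 \<bullet> (x s r2 - x s r1)\<bar> \<le> (norm (p s 0) + B) * (B * \<bar>r2 - r1\<bar>)"
    by (intro order_trans[OF Cauchy_Schwarz_ineq2] mult_mono increment_bounds) (use B in auto)
   moreover have "\<bar>\<Theta> s r2 - \<Theta> s r1 - p s r1 \<bullet> (x s r2 - x s r1)\<bar> \<le> e * \<bar>r2 - r1\<bar>" using d(2) that le by auto
   moreover have "((norm (p s 0) + B) * B + e) * \<bar>r2 - r1\<bar> = (norm (p s 0) + B) * (B * \<bar>r2 - r1\<bar>) + e * \<bar>r2 - r1\<bar>"
    by (simp add: algebra_simps)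
   ultimately show ?thesis by linarith
  qed
  then show "\<exists>d>0. \<forall>r2\<in>{r..r'}. \<bar>r2 - r1\<bar> < d --> \<bar>\<Theta> s r2 - \<Theta> s r1\<bar> \<le> ((norm (p s 0) + B) * B + e) * \<bar>r2 - r1\<bar>"
   using d(1) by blast
 qed (use le in simp)
 then show ?case using le by simp
next
 case (sym r r') then show ?case by (simp add: abs_minus_commute)
qed

lemma \<Theta>t_lipschitz:
 assumes r: "r \<in> {0..1}" "r' \<in> {0..1}"
 shows "\<bar>\<Theta> t r' - \<Theta> t r\<bar> \<le> ((norm (p s 0) + B) * B + m * (t - s)) * \<bar>r' - r\<bar>"
proof -
 have "\<bar>(\<integral>\<tau>. L \<tau> r' \<partial>A) - (\<integral>\<tau>. L \<tau> r \<partial>A)\<bar> = \<bar>\<integral>\<tau>. L \<tau> r' - L \<tau> r \<partial>A\<bar>"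
  using L_integrable r by simp
 also have "\<dots> \<le> (\<integral>\<tau>. \<bar>L \<tau> r' - L \<tau> r\<bar> \<partial>A)" by (rule integral_abs_bound)
 also have "\<dots> \<le> (\<integral>\<tau>. m * \<bar>r' - r\<bar> \<partial>A)"
  using L_lip L_integrable r by (intro integral_mono_AE) (auto elim: eventually_mono)
 also have "\<dots> = m * \<bar>r' - r\<bar> * (t - s)" using st by (simp add: measure_restrict_space)
 finally have "\<bar>(\<integral>\<tau>. L \<tau> r' \<partial>A) - (\<integral>\<tau>. L \<tau> r \<partial>A)\<bar> \<le> m * \<bar>r' - r\<bar> * (t - s)" .
 with \<Theta>s_lipschitz[OF r]
 have "\<bar>\<Theta> s r' - \<Theta> s r\<bar> + \<bar>(\<integral>\<tau>. L \<tau> r' \<partial>A) - (\<integral>\<tau>. L \<tau> r \<partial>A)\<bar>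
   \<le> (norm (p s 0) + B) * B * \<bar>r' - r\<bar> + m * \<bar>r' - r\<bar> * (t - s)" by (rule add_mono)
 also have "\<dots> = ((norm (p s 0) + B) * B + m * (t - s)) * \<bar>r' - r\<bar>"
  by (simp only: distrib_right[of "(norm (p s 0) + B) * B"] mult.assoc mult.commute[of "t - s"])
 finally show ?thesis
  unfolding \<Theta>_eq'[OF r(1)] \<Theta>_eq'[OF r(2)] by simp
qed

lemma lip_cont_real:
 assumes "\<And>r r'. r \<in> {0..1} ==> r' \<in> {0..1} ==> \<bar>f r' - f r\<bar> \<le> C * \<bar>r' - r\<bar>"
 shows "continuous_on {0..1::real} (f :: real => real)"
proof (rule lipschitz_on_continuous_on[OF lipschitz_onI])
 fix r r' :: real assume r: "r \<in> {0..1}" "r' \<in> {0..1}"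
 have "\<bar>f r - f r'\<bar> \<le> C * \<bar>r - r'\<bar>" by (rule assms[OF r(2,1)])
 also have "\<dots> \<le> \<bar>C\<bar> * \<bar>r - r'\<bar>" by (intro mult_right_mono) auto
 finally show "dist (f r) (f r') \<le> \<bar>C\<bar> * dist r r'" by (simp add: dist_real_def)
qed simp

lemma \<Theta>_cont: "continuous_on {0..1} (\<Theta> s)" "continuous_on {0..1} (\<Theta> t)"
 by (rule lip_cont_real, rule \<Theta>s_lipschitz \<Theta>t_lipschitz, assumption+)+

lemma xp_cont: "continuous_on T (x \<tau>)" "continuous_on T (p \<tau>)"
proof -
 show "continuous_on T (x \<tau>)"
  by (rule lipschitz_on_continuous_on[of B], rule lipschitz_onI) (use increment_bounds B in \<open>auto simp: dist_norm\<close>)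
 show "continuous_on T (p \<tau>)"
  by (rule lipschitz_on_continuous_on[of B], rule lipschitz_onI) (use increment_bounds B in \<open>auto simp: dist_norm\<close>)
qed

lemma nxt_cont: "continuous_on T (nxt n)"
 unfolding nxt_def by (intro continuous_intros)

lemma dif_cont:
 fixes f :: "real => real => 'c::real_normed_vector"
 assumes "continuous_on {0..1} (f \<tau>)" shows "continuous_on {0..1} (dif n f \<tau>)"
 unfolding dif_def
 by (intro continuous_intros assms continuous_on_compose2[OF assms nxt_cont]) (use nxt in auto)

lemma E_cont: "continuous_on {0..1} (E n s)" "continuous_on {0..1} (E n t)"
 unfolding E_def by (intro continuous_intros dif_cont xp_cont \<Theta>_cont)+

lemma cont_integrable: "continuous_on {0..1} f ==> integrable Q (f :: real => real)"
 by (rule continuous_imp_integrable_real)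

lemma R_meas: "(\<lambda>z. R n (fst z) (snd z)) \<in> borel_measurable (A \<Otimes>\<^sub>M Q)"
 unfolding R_def by (intro borel_measurable_add borel_measurable_diff borel_measurable_inner W_meas dif_meas pair_meas ab_meas)

lemma AE_W_bound: "AE \<tau> in A. \<forall>n. \<forall>r\<in>{0..1}. \<bar>W n \<tau> r\<bar> \<le> 4 * K * B"
 using hr_lipschitz
proof eventually_elim
 case (elim \<tau>)
 show ?case
 proof (intro allI ballI)
  fix n and r :: real assume r: "r \<in> {0..1}"
  have "\<bar>dif n hr \<tau> r\<bar> = real (Suc n) * \<bar>hr \<tau> (nxt n r) - hr \<tau> r\<bar>" by (simp add: dif_def abs_mult)
  also have "\<dots> \<le> real (Suc n) * (2 * K * B * (1 / real (Suc n)))"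
  proof (rule mult_left_mono)
   have "\<bar>hr \<tau> (nxt n r) - hr \<tau> r\<bar> \<le> 2 * K * B * \<bar>nxt n r - r\<bar>"
    using elim r nxt(1)[OF r, of n] by blast
   also have "\<dots> \<le> 2 * K * B * (1 / real (Suc n))"
    by (rule mult_left_mono[OF nxt(3)[OF r]]) (use K B in simp)
   finally show "\<bar>hr \<tau> (nxt n r) - hr \<tau> r\<bar> \<le> 2 * K * B * (1 / real (Suc n))" .
  qed simp
  also have "\<dots> = 2 * (K * B)" by simp
  finally have "\<bar>dif n hr \<tau> r\<bar> \<le> 2 * (K * B)" .
  moreover have "\<bar>dif n p \<tau> r \<bullet> a \<tau> r\<bar> \<le> B * K" "\<bar>dif n x \<tau> r \<bullet> b \<tau> r\<bar> \<le> B * K"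
   by (rule order_trans[OF Cauchy_Schwarz_ineq2], rule mult_mono, (rule dif_bound[OF r] ab_bound B norm_ge_zero)+)+
  moreover have "B * K = K * B" "4 * K * B = 4 * (K * B)" by simp_all
  ultimately show "\<bar>W n \<tau> r\<bar> \<le> 4 * K * B" unfolding W_def by linarith
 qed
qed

lemma AE_pair_I:
 assumes "{z \<in> space (A \<Otimes>\<^sub>M Q). \<phi> z} \<in> sets (A \<Otimes>\<^sub>M Q)" "AE \<tau> in A. AE r in Q. \<phi> (\<tau>, r)"
 shows "AE z in A \<Otimes>\<^sub>M Q. \<phi> z"
 using assms by (rule P.AE_pair_measure)

lemma AE_pair_W_bound: "AE z in A \<Otimes>\<^sub>M Q. \<bar>W n (fst z) (snd z)\<bar> \<le> 4 * K * B"
proof (rule AE_pair_I)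
 show "AE \<tau> in A. AE r in Q. \<bar>W n (fst (\<tau>, r)) (snd (\<tau>, r))\<bar> \<le> 4 * K * B"
  using AE_W_bound by eventually_elim (auto intro!: AE_I2)
qed measurable

lemma W_L1: "(\<lambda>n. \<integral>z. \<bar>W n (fst z) (snd z)\<bar> \<partial>(A \<Otimes>\<^sub>M Q)) \<longlonglongrightarrow> 0"
proof -
 have "(\<lambda>n. \<integral>z. \<bar>W n (fst z) (snd z)\<bar> \<partial>(A \<Otimes>\<^sub>M Q)) \<longlonglongrightarrow> (\<integral>z. 0 \<partial>(A \<Otimes>\<^sub>M Q))"
 proof (rule integral_dominated_convergence[where w = "\<lambda>_. 4 * K * B"])
  have "AE z in A \<Otimes>\<^sub>M Q. (\<lambda>n. W n (fst z) (snd z)) \<longlonglongrightarrow> 0"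
   by (rule AE_pair_I) (use W_limit_set AE_AE_W_limit in auto)
  then show "AE z in A \<Otimes>\<^sub>M Q. (\<lambda>n. \<bar>W n (fst z) (snd z)\<bar>) \<longlonglongrightarrow> 0"
   by eventually_elim (rule tendsto_rabs_zero)
  show "AE z in A \<Otimes>\<^sub>M Q. norm \<bar>W n (fst z) (snd z)\<bar> \<le> 4 * K * B" for n
   using AE_pair_W_bound[of n] by simp
 qed (auto intro!: PP.integrable_const)
 then show ?thesis by simp
qed

lemma a_shift_meas: "(\<lambda>z. norm (a (fst z) (nxt n (snd z)) - a (fst z) (snd z))) \<in> borel_measurable (A \<Otimes>\<^sub>M Q)"
 by (rule measurable_compose[OF borel_measurable_diff[OF pair_meas(2)[OF ab_meas(1)] pair_meas(1)[OF ab_meas(1)]] borel_measurable_norm])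

lemma a_translation_L1: "(\<lambda>n. \<integral>z. norm (a (fst z) (nxt n (snd z)) - a (fst z) (snd z)) \<partial>(A \<Otimes>\<^sub>M Q)) \<longlonglongrightarrow> 0"
proof -
 have bnd: "norm (a \<tau> r - a \<tau>' r') \<le> 2 * K" for \<tau> r \<tau>' r'
  using norm_triangle_ineq4[of "a \<tau> r" "a \<tau>' r'"] ab_bound(1)[of \<tau> r] ab_bound(1)[of \<tau>' r'] by linarith
 have i1: "integrable (A \<Otimes>\<^sub>M Q) (\<lambda>z. norm (a (fst z) (nxt n (snd z)) - a (fst z) (snd z)))" for n
  by (rule PP.integrable_const_bound[of _ "2 * K"]) (use bnd a_shift_meas in auto)
 have eq: "(\<integral>z. norm (a (fst z) (nxt n (snd z)) - a (fst z) (snd z)) \<partial>(A \<Otimes>\<^sub>M Q)) =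
   (\<integral>\<tau>. (\<integral>r. norm (a \<tau> (nxt n r) - a \<tau> r) \<partial>Q) \<partial>A)" for n
  using P.integral_fst'[OF i1[of n]] by simp
 have "(\<lambda>n. \<integral>\<tau>. (\<integral>r. norm (a \<tau> (nxt n r) - a \<tau> r) \<partial>Q) \<partial>A) \<longlonglongrightarrow> (\<integral>\<tau>. 0 \<partial>A)"
 proof (rule integral_dominated_convergence[where w = "\<lambda>_. 2 * K"])
  show "AE \<tau> in A. (\<lambda>n. \<integral>r. norm (a \<tau> (nxt n r) - a \<tau> r) \<partial>Q) \<longlonglongrightarrow> 0"
  proof (rule AE_I2)
   fix \<tau>
   have "a \<tau> \<in> borel_measurable borel"
    by (rule borel_measurable_pair_compose[where f = a and ?g1.0 = "\<lambda>_. \<tau>" and ?g2.0 = "\<lambda>r. r", OF ab_meas(1)]) simp_all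
   from L1_translation_continuous[where f = "a \<tau>", OF this ab_bound(1)]
   show "(\<lambda>n. \<integral>r. norm (a \<tau> (nxt n r) - a \<tau> r) \<partial>Q) \<longlonglongrightarrow> 0" by (simp add: nxt_def)
  qed
  show "(\<lambda>\<tau>. \<integral>r. norm (a \<tau> (nxt n r) - a \<tau> r) \<partial>Q) \<in> borel_measurable A" for n
   using borel_measurable_integrable[OF P.integrable_fst'[OF i1[of n]]] by simp
  show "AE \<tau> in A. norm (\<integral>r. norm (a \<tau> (nxt n r) - a \<tau> r) \<partial>Q) \<le> 2 * K" for n
  proof (rule AE_I2)
   fix \<tau>
   have "(\<integral>r. norm (a \<tau> (nxt n r) - a \<tau> r) \<partial>Q) \<le> (\<integral>r. 2 * K \<partial>Q)"
    by (rule integral_mono'[OF Q.integrable_const bnd]) (use K in simp)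
   also have "\<dots> = 2 * K" by (simp add: measure_restrict_space)
   finally show "norm (\<integral>r. norm (a \<tau> (nxt n r) - a \<tau> r) \<partial>Q) \<le> 2 * K"
    by (simp add: integral_nonneg_AE)
  qed
 qed (auto intro!: A.integrable_const)
 then show ?thesis by (simp add: eq)
qed

text \<open>Averaging over \<open>r\<close> is essential: the velocity \<open>a\<close> is merely measurable in \<open>r\<close>, so that \<open>a \<tau> (nxt n r) - a \<tau> r\<close>
 tends to \<open>0\<close> only in the mean.\<close>
lemma E_difference_limit: "(\<lambda>n. (\<integral>r. E n t r \<partial>Q) - (\<integral>r. E n s r \<partial>Q)) \<longlonglongrightarrow> 0"
proof -
 have bnd: "norm (a \<tau> r - a \<tau>' r') \<le> 2 * K" for \<tau> r \<tau>' r'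
  using norm_triangle_ineq4[of "a \<tau> r" "a \<tau>' r'"] ab_bound(1)[of \<tau> r] ab_bound(1)[of \<tau>' r'] by linarith
 let ?T = "\<lambda>n z. norm (a (fst z) (nxt n (snd z)) - a (fst z) (snd z))"
 have iT: "integrable (A \<Otimes>\<^sub>M Q) (?T n)" for n
  by (rule PP.integrable_const_bound[of _ "2 * K"])
   (use bnd a_shift_meas in auto)
 have iW: "integrable (A \<Otimes>\<^sub>M Q) (\<lambda>z. \<bar>W n (fst z) (snd z)\<bar>)" for n
  by (rule PP.integrable_const_bound[of _ "4 * K * B"]) (use AE_pair_W_bound in auto)
 have RW: "\<bar>R n (fst z) (snd z)\<bar> \<le> \<bar>W n (fst z) (snd z)\<bar> + B * ?T n z" if "z \<in> space (A \<Otimes>\<^sub>M Q)" for n z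
 proof -
  have r: "snd z \<in> {0..1}" using that by (auto simp: space_pair_measure)
  have "\<bar>dif n p (fst z) (snd z) \<bullet> (a (fst z) (nxt n (snd z)) - a (fst z) (snd z))\<bar> \<le> B * ?T n z"
   by (rule order_trans[OF Cauchy_Schwarz_ineq2], rule mult_right_mono[OF dif_bound(2)[OF r] norm_ge_zero])
  then show ?thesis unfolding R_def by linarith
 qed
 have iR: "integrable (A \<Otimes>\<^sub>M Q) (\<lambda>z. R n (fst z) (snd z))" for n
  by (rule Bochner_Integration.integrable_bound[OF Bochner_Integration.integrable_add[OF iW[of n] integrable_mult_right[OF iT[of n], of B]] R_meas])
   (rule AE_I2, unfold real_norm_def, rule order_trans[OF RW abs_ge_self])
 have eq: "(\<integral>r. E n t r \<partial>Q) - (\<integral>r. E n s r \<partial>Q) = (\<integral>z. R n (fst z) (snd z) \<partial>(A \<Otimes>\<^sub>M Q))" for n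
 proof -
  have "(\<integral>r. E n t r \<partial>Q) - (\<integral>r. E n s r \<partial>Q) = (\<integral>r. E n t r - E n s r \<partial>Q)"
   using cont_integrable E_cont by simp
  also have "\<dots> = (\<integral>r. (\<integral>\<tau>. R n \<tau> r \<partial>A) \<partial>Q)"
   by (rule Bochner_Integration.integral_cong) (use E_increment in auto)
  also have "\<dots> = (\<integral>z. R n (fst z) (snd z) \<partial>(A \<Otimes>\<^sub>M Q))"
   using P.integral_snd[of "\<lambda>\<tau> r. R n \<tau> r"] iR[of n] by (simp add: case_prod_beta')
  finally show ?thesis .
 qed
 have bound: "norm (\<integral>z. R n (fst z) (snd z) \<partial>(A \<Otimes>\<^sub>M Q)) \<le>
   (\<integral>z. \<bar>W n (fst z) (snd z)\<bar> \<partial>(A \<Otimes>\<^sub>M Q)) + B * (\<integral>z. ?T n z \<partial>(A \<Otimes>\<^sub>M Q))" for n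
 proof -
  have "norm (\<integral>z. R n (fst z) (snd z) \<partial>(A \<Otimes>\<^sub>M Q)) \<le> (\<integral>z. \<bar>R n (fst z) (snd z)\<bar> \<partial>(A \<Otimes>\<^sub>M Q))"
   unfolding real_norm_def by (rule integral_abs_bound)
  also have "\<dots> \<le> (\<integral>z. \<bar>W n (fst z) (snd z)\<bar> + B * ?T n z \<partial>(A \<Otimes>\<^sub>M Q))"
   by (rule Bochner_Integration.integral_mono) (use iR iW iT RW in auto)
  also have "\<dots> = (\<integral>z. \<bar>W n (fst z) (snd z)\<bar> \<partial>(A \<Otimes>\<^sub>M Q)) + B * (\<integral>z. ?T n z \<partial>(A \<Otimes>\<^sub>M Q))"
   using iW iT by simp
  finally show ?thesis .
 qed
 have "(\<lambda>n. (\<integral>z. \<bar>W n (fst z) (snd z)\<bar> \<partial>(A \<Otimes>\<^sub>M Q)) + B * (\<integral>z. ?T n z \<partial>(A \<Otimes>\<^sub>M Q))) \<longlonglongrightarrow> 0 + B * 0"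
  by (rule tendsto_add[OF W_L1 tendsto_mult[OF tendsto_const a_translation_L1]])
 then have lim: "(\<lambda>n. (\<integral>z. \<bar>W n (fst z) (snd z)\<bar> \<partial>(A \<Otimes>\<^sub>M Q)) + B * (\<integral>z. ?T n z \<partial>(A \<Otimes>\<^sub>M Q))) \<longlonglongrightarrow> 0" by simp
 show ?thesis unfolding eq
  by (rule Lim_null_comparison[OF _ lim]) (rule always_eventually, rule allI, rule bound)
qed

lemma E_start_limit: "(\<lambda>n. \<integral>r. E n s r \<partial>Q) \<longlonglongrightarrow> 0"
proof -
 define C where "C = (norm (p s 0) + B) * B"
 have C: "C \<ge> 0" using B by (simp add: C_def)
 have p: "norm (p s r) \<le> norm (p s 0) + B" if "r \<in> {0..1}" for r
 proof -
  have "norm (p s r) \<le> norm (p s 0) + norm (p s r - p s 0)" by (metis norm_triangle_sub)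
  also have "norm (p s r - p s 0) \<le> B * \<bar>r - 0\<bar>" by (rule increment_bounds)
  also have "\<dots> \<le> B * 1" using that B by (intro mult_left_mono) auto
  finally show ?thesis by simp
 qed
 have "(\<lambda>n. \<integral>r. E n s r \<partial>Q) \<longlonglongrightarrow> (\<integral>r. 0 \<partial>Q)"
 proof (rule integral_dominated_convergence[where w = "\<lambda>_. 2 * C"])
  show "E n s \<in> borel_measurable Q" for n using cont_integrable[OF E_cont(1)] by auto
  show "AE r in Q. (\<lambda>n. E n s r) \<longlonglongrightarrow> 0"
  proof (rule AE_I2, rule LIMSEQ_I)
   fix r e :: real assume "r \<in> space Q" and "e > 0"
   then have r: "r \<in> {0..1}" by simp
   obtain d where d: "d > 0" "\<And>r'. r' \<in> {0..1} ==> \<bar>r' - r\<bar> < d ==>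
    \<bar>\<Theta> s r' - \<Theta> s r - p s r \<bullet> (x s r' - x s r)\<bar> \<le> e/2 * \<bar>r' - r\<bar>"
    using start[OF r, of "e/2"] \<open>e > 0\<close> by auto
   obtain n0 where n0: "inverse (real (Suc n0)) < d" using reals_Archimedean[OF d(1)] by blast
   have "norm (E n s r - 0) < e" if n: "n \<ge> n0" for n
   proof -
    have "1 / real (Suc n) \<le> inverse (real (Suc n0))" using n by (simp add: field_simps)
    then have "\<bar>nxt n r - r\<bar> < d" using nxt(3)[OF r, of n] n0 by linarith
    note dd = d(2)[OF nxt(1)[OF r] this]
    have "E n s r = real (Suc n) * (\<Theta> s (nxt n r) - \<Theta> s r - p s r \<bullet> (x s (nxt n r) - x s r))"
     unfolding E_def dif_def by (simp add: right_diff_distrib)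
    then have "\<bar>E n s r\<bar> = real (Suc n) * \<bar>\<Theta> s (nxt n r) - \<Theta> s r - p s r \<bullet> (x s (nxt n r) - x s r)\<bar>"
     by (simp only: abs_mult abs_of_nat)
    also have "\<dots> \<le> real (Suc n) * (e/2 * (1 / real (Suc n)))"
     using nxt(3)[OF r, of n] \<open>e > 0\<close> by (intro mult_left_mono order_trans[OF dd] mult_left_mono) auto
    also have "\<dots> = e/2" by (simp del: of_nat_Suc)
    finally show ?thesis using \<open>e > 0\<close> by simp
   qed
   then show "\<exists>n0. \<forall>n\<ge>n0. norm (E n s r - 0) < e" by blast
  qed
  show "AE r in Q. norm (E n s r) \<le> 2 * C" for n
  proof (rule AE_I2)
   fix r assume "r \<in> space Q"
   then have r: "r \<in> {0..1}" by simp
   have "\<bar>dif n \<Theta> s r\<bar> = real (Suc n) * \<bar>\<Theta> s (nxt n r) - \<Theta> s r\<bar>" by (simp add: dif_def abs_mult)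
   also have "\<dots> \<le> real (Suc n) * (C * (1 / real (Suc n)))"
    using \<Theta>s_lipschitz[OF r nxt(1)[OF r], of n] nxt(3)[OF r, of n] C
    by (intro mult_left_mono order_trans[of _ "C * \<bar>nxt n r - r\<bar>" "C * (1 / real (Suc n))"]) (auto simp: C_def)
   also have "\<dots> = C" by simp
   finally have "\<bar>dif n \<Theta> s r\<bar> \<le> C" .
   moreover have "\<bar>p s r \<bullet> dif n x s r\<bar> \<le> C"
    unfolding C_def by (rule order_trans[OF Cauchy_Schwarz_ineq2], rule mult_mono[OF p[OF r] dif_bound(1)[OF r]]) (use B in auto)
   ultimately show "norm (E n s r) \<le> 2 * C" unfolding E_def real_norm_def by linarith
  qed
 qed (auto intro!: Q.integrable_const)
 then show ?thesis by simp
qed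

text \<open>Along the family the averaged difference quotients of \<open>\<Theta> - p dx\<close> vanish in the limit both at time \<open>s\<close> and at
  time \<open>t\<close>. Replacing \<open>p t r\<close> by \<open>p t 0\<close> in the latter costs at most \<open>B\<close> for \<open>p\<close> times \<open>B\<close> for \<open>dx\<close>, hence a bound that is
  quadratic in the length of the family.\<close>
theorem generating_function_estimate:
 "\<bar>\<Theta> t 1 - \<Theta> t 0 - p t 0 \<bullet> (x t 1 - x t 0)\<bar> \<le> B * B"
proof -
 define F where "F r = \<Theta> t r - p t 0 \<bullet> x t r" for r
 have F: "continuous_on {0..1} F" unfolding F_def by (intro continuous_intros \<Theta>_cont xp_cont)
 let ?F = "\<lambda>n r. real (Suc n) * (F (nxt n r) - F r)"
 have Fc: "continuous_on {0..1} (?F n)" for n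
  by (intro continuous_intros F continuous_on_compose2[OF F nxt_cont]) (use nxt in auto)
 have "(\<lambda>n. integral {0..1} (?F n)) \<longlonglongrightarrow> F 1 - F 0"
  using integral_forward_difference[OF F] by (simp add: nxt_def)
 then have l1: "(\<lambda>n. \<integral>r. ?F n r \<partial>Q) \<longlonglongrightarrow> F 1 - F 0"
  using lebesgue_integral_eq_integral[OF cont_integrable[OF Fc]] by simp
 have l2: "(\<lambda>n. \<integral>r. E n t r \<partial>Q) \<longlonglongrightarrow> 0"
  using tendsto_add[OF E_difference_limit E_start_limit] by simp
 have "(\<lambda>n. (\<integral>r. ?F n r \<partial>Q) - (\<integral>r. E n t r \<partial>Q)) \<longlonglongrightarrow> F 1 - F 0 - 0"
  by (rule tendsto_diff[OF l1 l2])
 moreover have "norm ((\<integral>r. ?F n r \<partial>Q) - (\<integral>r. E n t r \<partial>Q)) \<le> B * B" for n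
 proof -
  have eq: "(\<integral>r. ?F n r \<partial>Q) - (\<integral>r. E n t r \<partial>Q) = (\<integral>r. ?F n r - E n t r \<partial>Q)"
   by (rule Bochner_Integration.integral_diff[OF cont_integrable[OF Fc] cont_integrable[OF E_cont(2)], symmetric])
  have int: "integrable Q (\<lambda>r. norm (?F n r - E n t r))"
   by (rule integrable_norm[OF Bochner_Integration.integrable_diff[OF cont_integrable[OF Fc] cont_integrable[OF E_cont(2)]]])
  have pt: "norm (?F n r - E n t r) \<le> B * B" if r: "r \<in> {0..1}" for r
  proof -
   have eq': "?F n r - E n t r = (p t r - p t 0) \<bullet> dif n x t r"
    unfolding F_def E_def dif_def inner_diff_left inner_diff_right inner_scaleR_right real_scaleR_def
    by (simp only: right_diff_distrib)
   have "norm (p t r - p t 0) \<le> B * \<bar>r - 0\<bar>" by (rule increment_bounds)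
   also have "\<dots> \<le> B * 1" using r B by (intro mult_left_mono) auto
   finally have "norm (p t r - p t 0) \<le> B" by simp
   then show ?thesis unfolding eq' real_norm_def
    by (rule order_trans[OF Cauchy_Schwarz_ineq2 mult_mono[OF _ dif_bound(1)[OF r] B norm_ge_zero]])
  qed
  have "norm (\<integral>r. ?F n r - E n t r \<partial>Q) \<le> (\<integral>r. norm (?F n r - E n t r) \<partial>Q)" by (rule integral_norm_bound)
  also have "\<dots> \<le> (\<integral>r. B * B \<partial>Q)"
   by (rule Bochner_Integration.integral_mono[OF int Q.integrable_const]) (use pt in auto)
  also have "\<dots> = B * B" by (simp add: measure_restrict_space)
  finally show ?thesis unfolding eq .
 qed
 ultimately have "norm (F 1 - F 0 - 0) \<le> B * B"
  by (rule Lim_norm_ubound[OF trivial_limit_sequentially _ always_eventually[OF allI]])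
 then show ?thesis by (simp add: F_def inner_diff_right algebra_simps)
qed

end

section \<open>Manifolds with an atlas of class C1\<close>

text \<open>The cotangent bundle is needed only as a manifold of class C1, where its transition maps have
  derivatives that involve the second derivatives of the base; hence a class of atlases that covers both.\<close>
locale C1_atlas =
 fixes A :: "('p, 'e::euclidean_space) chart set"
 assumes inj: "c \<in> A ==> inj_on (crd c) (dom_of c)"
  and open_range: "c \<in> A ==> open (crd c ` dom_of c)"
  and open_overlap: "c \<in> A ==> c' \<in> A ==> open (crd c ` (dom_of c \<inter> dom_of c'))"
  and C1: "c \<in> A ==> c' \<in> A ==> \<exists>D. \<forall>z\<in>crd c ` (dom_of c \<inter> dom_of c').
   (transition c c' has_derivative D z) (at z) \<and>
   (\<forall>v. continuous_on (crd c ` (dom_of c \<inter> dom_of c')) (\<lambda>z. D z v))"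
begin

definition Dtr :: "('p, 'e) chart => ('p, 'e) chart => 'e => 'e => 'e" where
 "Dtr c c' z = frechet_derivative (transition c c') (at z)"

lemma crd_inv_crd [simp]: "c \<in> A ==> x \<in> dom_of c ==> crd_inv c (crd c x) = x"
 unfolding crd_inv_def by (rule inv_into_f_f[OF inj])

lemma crd_inv_in [simp]: "z \<in> crd c ` dom_of c ==> crd_inv c z \<in> dom_of c"
 unfolding crd_inv_def by (rule inv_into_into)

lemma crd_crd_inv [simp]: "z \<in> crd c ` dom_of c ==> crd c (crd_inv c z) = z"
 unfolding crd_inv_def by (rule f_inv_into_f)

lemma transition_crd [simp]: "c \<in> A ==> x \<in> dom_of c ==> transition c c' (crd c x) = crd c' x"
 by (simp add: transition_def)

lemma transition_has_derivative:
 assumes "c \<in> A" "c' \<in> A" "x \<in> dom_of c" "x \<in> dom_of c'"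
 shows "(transition c c' has_derivative Dtr c c' (crd c x)) (at (crd c x))"
 using C1[OF assms(1,2)] assms(3,4) unfolding Dtr_def by (metis IntI frechet_derivative_at imageI)

lemma Dtr_continuous:
 assumes "c \<in> A" "c' \<in> A"
 shows "continuous_on (crd c ` (dom_of c \<inter> dom_of c')) (\<lambda>z. Dtr c c' z v)"
proof (cases "dom_of c \<inter> dom_of c' = {}")
 case False
 obtain D where D: "\<forall>z\<in>crd c ` (dom_of c \<inter> dom_of c'). (transition c c' has_derivative D z) (at z) \<and>
   (\<forall>v. continuous_on (crd c ` (dom_of c \<inter> dom_of c')) (\<lambda>z. D z v))"
  using C1[OF assms] by blast
 then have "continuous_on (crd c ` (dom_of c \<inter> dom_of c')) (\<lambda>z. D z v)" using False by blast
 moreover have "D z v = Dtr c c' z v" if "z \<in> crd c ` (dom_of c \<inter> dom_of c')" for z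
 proof -
  have "D z = frechet_derivative (transition c c') (at z)"
   using D that by (intro frechet_derivative_at) blast
  then show ?thesis by (simp add: Dtr_def)
 qed
 ultimately show ?thesis by (metis (no_types, lifting) continuous_on_cong)
qed simp

lemma transition_continuous:
 assumes "c \<in> A" "c' \<in> A"
 shows "continuous_on (crd c ` (dom_of c \<inter> dom_of c')) (transition c c')"
 using transition_has_derivative[OF assms]
 by (auto intro!: continuous_at_imp_continuous_on has_derivative_continuous)

lemma Dtr_linear: "c \<in> A ==> c' \<in> A ==> x \<in> dom_of c ==> x \<in> dom_of c' ==> bounded_linear (Dtr c c' (crd c x))"
 using transition_has_derivative has_derivative_bounded_linear by blast

lemma Dtr_refl:
 assumes "c \<in> A" "x \<in> dom_of c" shows "Dtr c c (crd c x) a = a"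
proof -
 have "(transition c c has_derivative (\<lambda>a. a)) (at (crd c x))"
 proof (rule has_derivative_transform_within_open[OF has_derivative_ident open_range[OF assms(1)]])
  show "crd c x \<in> crd c ` dom_of c" using assms by simp
  show "z = transition c c z" if "z \<in> crd c ` dom_of c" for z using that assms by auto
 qed
 then show ?thesis using frechet_derivative_at unfolding Dtr_def by metis
qed

lemma Dtr_chain:
 assumes "c \<in> A" "c' \<in> A" "c'' \<in> A" "x \<in> dom_of c" "x \<in> dom_of c'" "x \<in> dom_of c''"
 shows "Dtr c' c'' (crd c' x) (Dtr c c' (crd c x) a) = Dtr c c'' (crd c x) a"
proof -
 have "(transition c' c'' has_derivative Dtr c' c'' (crd c' x)) (at (transition c c' (crd c x)))"
  using transition_has_derivative[of c' c'' x] assms by simp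
 from diff_chain_at[OF transition_has_derivative[of c c' x] this]
 have "(transition c' c'' \<circ> transition c c' has_derivative Dtr c' c'' (crd c' x) \<circ> Dtr c c' (crd c x)) (at (crd c x))"
  using assms by simp
 then have "(transition c c'' has_derivative Dtr c' c'' (crd c' x) \<circ> Dtr c c' (crd c x)) (at (crd c x))"
 proof (rule has_derivative_transform_within_open[OF _ open_overlap[of c c']])
  show "(transition c' c'' \<circ> transition c c') z = transition c c'' z" if "z \<in> crd c ` (dom_of c \<inter> dom_of c')" for z
   using that assms by auto
 qed (use assms in auto)
 then have "Dtr c' c'' (crd c' x) \<circ> Dtr c c' (crd c x) = Dtr c c'' (crd c x)"
  unfolding Dtr_def[of c c''] by (rule frechet_derivative_at)
 then show ?thesis by (metis comp_apply)
qed

lemma openin_mtop_C1: "openin (mtop A) W \<longleftrightarrow> W \<subseteq> carrier_of A \<and> (\<forall>c\<in>A. open (crd c ` (W \<inter> dom_of c)))"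
proof -
 let ?P = "\<lambda>W. W \<subseteq> carrier_of A \<and> (\<forall>c\<in>A. open (crd c ` (W \<inter> dom_of c)))"
 have int: "?P (S \<inter> T)" if "?P S" "?P T" for S T
 proof -
  have "crd c ` (S \<inter> T \<inter> dom_of c) = crd c ` (S \<inter> dom_of c) \<inter> crd c ` (T \<inter> dom_of c)" if "c \<in> A" for c
   using inj_on_image_Int[OF inj[OF that], of "S \<inter> dom_of c" "T \<inter> dom_of c"]
   by (simp add: Int_ac)
  then show ?thesis using that by auto
 qed
 have un: "?P (\<Union>\<K>)" if "\<forall>S\<in>\<K>. ?P S" for \<K>
 proof -
  have "crd c ` (\<Union>\<K> \<inter> dom_of c) = (\<Union>S\<in>\<K>. crd c ` (S \<inter> dom_of c))" for c :: "('p,'e) chart" by auto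
  then show ?thesis using that by (auto intro!: open_UN)
 qed
 have "istopology ?P" unfolding istopology_def using int un by blast
 then show ?thesis by (simp add: mtop_def)
qed

lemma carrierI: "c \<in> A ==> x \<in> dom_of c ==> x \<in> carrier_of A"
 by (auto simp: carrier_of_def)

lemma openin_chart_preimage:
 assumes c: "c \<in> A" and V: "open V"
 shows "openin (mtop A) {x \<in> dom_of c. crd c x \<in> V}"
 unfolding openin_mtop_C1
proof (intro conjI ballI)
 show "{x \<in> dom_of c. crd c x \<in> V} \<subseteq> carrier_of A" using c carrierI by blast
 fix c' assume c': "c' \<in> A"
 let ?O = "crd c' ` (dom_of c' \<inter> dom_of c)"
 have "crd c' ` ({x \<in> dom_of c. crd c x \<in> V} \<inter> dom_of c') = ?O \<inter> transition c' c -` V"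
  using c' by force
 also have "open \<dots>"
  by (rule continuous_open_preimage[OF transition_continuous[OF c' c] open_overlap[OF c' c] V])
 finally show "open (crd c' ` ({x \<in> dom_of c. crd c x \<in> V} \<inter> dom_of c'))" .
qed

lemma openin_dom: "c \<in> A ==> openin (mtop A) (dom_of c)"
 using openin_chart_preimage[of c UNIV] by simp

lemma topspace_mtop: "topspace (mtop A) = carrier_of A"
proof
 show "topspace (mtop A) \<subseteq> carrier_of A"
  using openin_topspace[of "mtop A"] unfolding openin_mtop_C1 by blast
 show "carrier_of A \<subseteq> topspace (mtop A)"
  unfolding carrier_of_def using openin_dom openin_subset by blast
qed

lemma open_image_chart: "openin (mtop A) W ==> c \<in> A ==> open (crd c ` (W \<inter> dom_of c))"
 by (simp add: openin_mtop_C1)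

lemma curve_in_carrier: "mcontinuous_curve A S \<gamma> ==> t \<in> S ==> \<gamma> t \<in> carrier_of A"
 unfolding mcontinuous_curve_def continuous_map_def topspace_mtop by auto

lemma curve_preimage_open:
 assumes "mcontinuous_curve A S \<gamma>" "openin (mtop A) W"
 shows "openin (top_of_set S) {t \<in> S. \<gamma> t \<in> W}"
 using openin_continuous_map_preimage[OF assms(1)[unfolded mcontinuous_curve_def] assms(2)] by simp

lemma curve_near:
 assumes "mcontinuous_curve A S \<gamma>" "openin (mtop A) W" "t \<in> S" "\<gamma> t \<in> W"
 obtains d where "d > 0" "\<And>s. s \<in> S ==> \<bar>s - t\<bar> < d ==> \<gamma> s \<in> W"
proof -
 from curve_preimage_open[OF assms(1,2)] obtain d where "d > 0" "\<forall>s\<in>S. dist s t < d --> s \<in> {t \<in> S. \<gamma> t \<in> W}"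
  unfolding openin_euclidean_subtopology_iff using assms(3,4) by blast
 then show thesis using that by (auto simp: dist_real_def)
qed

lemma curve_chart_continuous:
 assumes \<gamma>: "mcontinuous_curve A S \<gamma>" and c: "c \<in> A" and T: "T \<subseteq> S" "\<gamma> ` T \<subseteq> dom_of c"
 shows "continuous_on T (crd c \<circ> \<gamma>)"
 unfolding continuous_on_iff
proof (intro ballI allI impI)
 fix t e :: real assume t: "t \<in> T" and "e > 0"
 obtain d where d: "d > 0" "\<And>s. s \<in> S ==> \<bar>s - t\<bar> < d ==> \<gamma> s \<in> {x \<in> dom_of c. crd c x \<in> ball (crd c (\<gamma> t)) e}"
 proof (rule curve_near[OF \<gamma> openin_chart_preimage[OF c open_ball]])
  show "\<gamma> t \<in> {x \<in> dom_of c. crd c x \<in> ball (crd c (\<gamma> t)) e}" using t T \<open>e > 0\<close> by auto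
 qed (use t T in auto)
 then show "\<exists>d>0. \<forall>s\<in>T. dist s t < d --> dist ((crd c \<circ> \<gamma>) s) ((crd c \<circ> \<gamma>) t) < e"
  using T by (intro exI[of _ d]) (auto simp: dist_real_def dist_commute subset_iff)
qed

lemma mcontinuous_curve_chartI:
 assumes c: "c \<in> A" and \<gamma>: "\<gamma> ` S \<subseteq> dom_of c" "continuous_on S (crd c \<circ> \<gamma>)"
 shows "mcontinuous_curve A S \<gamma>"
 unfolding mcontinuous_curve_def continuous_map_def topspace_mtop
proof (intro conjI allI impI)
 show "\<gamma> \<in> topspace (top_of_set S) \<rightarrow> carrier_of A"
  by (rule Pi_I) (use \<gamma>(1) carrierI[OF c] in auto)
 fix W assume W: "openin (mtop A) W"
 have "{t \<in> topspace (top_of_set S). \<gamma> t \<in> W} = S \<inter> (crd c \<circ> \<gamma>) -` (crd c ` (W \<inter> dom_of c))"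
 proof -
  have "crd c (\<gamma> t) \<in> crd c ` (W \<inter> dom_of c) \<longleftrightarrow> \<gamma> t \<in> W \<inter> dom_of c" if "t \<in> S" for t
   by (rule inj_on_image_mem_iff[OF inj[OF c]]) (use \<gamma>(1) that in auto)
  then have "{t \<in> S. \<gamma> t \<in> W} = {t \<in> S. crd c (\<gamma> t) \<in> crd c ` (W \<inter> dom_of c)}"
   using \<gamma>(1) by blast
  then show ?thesis by auto
 qed
 then show "openin (top_of_set S) {t \<in> topspace (top_of_set S). \<gamma> t \<in> W}"
  using continuous_openin_preimage_gen[OF \<gamma>(2) open_image_chart[OF W c]] by simp
qed

lemma mcontinuous_curve_subset: "mcontinuous_curve A S \<gamma> ==> T \<subseteq> S ==> mcontinuous_curve A T \<gamma>"
 unfolding mcontinuous_curve_def by (metis continuous_map_from_subtopology subtopology_subtopology inf.absorb2)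

lemma tvec_of_apply: "c' \<in> A ==> x \<in> dom_of c' ==> tvec_of A c x a c' = Dtr c c' (crd c x) a"
 by (simp add: tvec_of_def Dtr_def)

lemma tvec_of_self [simp]: "c \<in> A ==> x \<in> dom_of c ==> tvec_of A c x a c = a"
 by (simp add: tvec_of_apply Dtr_refl)

lemma tvec_of_in [simp]:
 assumes "c \<in> A" "x \<in> dom_of c" shows "tvec_of A c x a \<in> tangent_space A x"
 unfolding tangent_space_def
proof (intro CollectI conjI ballI impI allI)
 fix c' c'' assume c: "c' \<in> A" "c'' \<in> A" and "x \<in> dom_of c' \<and> x \<in> dom_of c''"
 then have x: "x \<in> dom_of c'" "x \<in> dom_of c''" by auto
 show "tvec_of A c x a c'' = frechet_derivative (transition c' c'') (at (crd c' x)) (tvec_of A c x a c')"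
  unfolding tvec_of_apply[OF c(1) x(1)] tvec_of_apply[OF c(2) x(2)] Dtr_def[of c' c'', symmetric]
  by (rule Dtr_chain[OF assms(1) c assms(2) x, symmetric])
next
 fix c' assume "\<not> (c' \<in> A \<and> x \<in> dom_of c')"
 then show "tvec_of A c x a c' = 0" unfolding tvec_of_def by (rule if_not_P)
qed

lemma tangent_change:
 assumes "v \<in> tangent_space A x" "c \<in> A" "c' \<in> A" "x \<in> dom_of c" "x \<in> dom_of c'"
 shows "v c' = Dtr c c' (crd c x) (v c)"
 using assms unfolding tangent_space_def Dtr_def by blast

lemma tangent_eq_tvec_of:
 assumes "v \<in> tangent_space A x" "c \<in> A" "x \<in> dom_of c"
 shows "v = tvec_of A c x (v c)"
proof
 fix c'
 show "v c' = tvec_of A c x (v c) c'"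
 proof (cases "c' \<in> A \<and> x \<in> dom_of c'")
  case True
  then show ?thesis using tangent_change[OF assms(1,2) _ assms(3)] by (simp add: tvec_of_apply)
 next
  case False
  have "v c' = 0" using assms(1) False unfolding tangent_space_def by blast
  then show ?thesis by (simp only: tvec_of_def if_not_P[OF False])
 qed
qed

lemma tvec_of_change:
 assumes "c \<in> A" "c' \<in> A" "x \<in> dom_of c" "x \<in> dom_of c'"
 shows "tvec_of A c x a = tvec_of A c' x (Dtr c c' (crd c x) a)"
 using tangent_eq_tvec_of[of "tvec_of A c x a" x c'] assms by (simp add: tvec_of_apply)

lemma tvec_of_linear:
 assumes "c \<in> A" "x \<in> dom_of c"
 shows "tvec_of A c x (r *\<^sub>R a + s *\<^sub>R b) = (\<lambda>c'. r *\<^sub>R tvec_of A c x a c' + s *\<^sub>R tvec_of A c x b c')"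
proof
 fix c'
 show "tvec_of A c x (r *\<^sub>R a + s *\<^sub>R b) c' = r *\<^sub>R tvec_of A c x a c' + s *\<^sub>R tvec_of A c x b c'"
 proof (cases "c' \<in> A \<and> x \<in> dom_of c'")
  case True
  interpret bounded_linear "Dtr c c' (crd c x)" using Dtr_linear assms True by blast
  show ?thesis using True by (simp add: tvec_of_apply add scaleR)
 next
  case False
  then show ?thesis by (simp only: tvec_of_def if_not_P[OF False]) simp
 qed
qed

lemma curve_chart_derivative:
 assumes \<gamma>: "mcontinuous_curve A S \<gamma>" and t: "t \<in> interior S"
  and c: "c \<in> A" "\<gamma> t \<in> dom_of c" and c': "c' \<in> A" "\<gamma> t \<in> dom_of c'"
  and der: "((crd c \<circ> \<gamma>) has_vector_derivative a) (at t)"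
 shows "((crd c' \<circ> \<gamma>) has_vector_derivative Dtr c c' (crd c (\<gamma> t)) a) (at t)"
proof -
 have "(transition c c' has_derivative Dtr c c' (crd c (\<gamma> t))) (at ((crd c \<circ> \<gamma>) t))"
  using transition_has_derivative[OF c(1) c'(1) c(2) c'(2)] by simp
 from diff_chain_at[OF der[unfolded has_vector_derivative_def] this]
 have 1: "(transition c c' \<circ> (crd c \<circ> \<gamma>) has_derivative (\<lambda>h. Dtr c c' (crd c (\<gamma> t)) (h *\<^sub>R a))) (at t)"
  by (simp add: o_def)
 interpret D: bounded_linear "Dtr c c' (crd c (\<gamma> t))" using Dtr_linear c c' by blast
 have tS: "t \<in> S" using t interior_subset by blast
 obtain d where d: "d > 0" "\<And>s. s \<in> S ==> \<bar>s - t\<bar> < d ==> \<gamma> s \<in> dom_of c"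
  using curve_near[OF \<gamma> openin_dom[OF c(1)] tS c(2)] by blast
 obtain e where e: "e > 0" "ball t e \<subseteq> S" using t by (meson mem_interior)
 have "(crd c' \<circ> \<gamma> has_derivative (\<lambda>h. Dtr c c' (crd c (\<gamma> t)) (h *\<^sub>R a))) (at t)"
 proof (rule has_derivative_transform_within_open[OF 1 open_ball[of t "min d e"]])
  show "(transition c c' \<circ> (crd c \<circ> \<gamma>)) s = (crd c' \<circ> \<gamma>) s" if "s \<in> ball t (min d e)" for s
  proof -
   have "s \<in> S" "\<bar>s - t\<bar> < d" using that e by (auto simp: dist_real_def)
   then show ?thesis using d(2) c by simp
  qed
 qed (use d e in auto)
 then show ?thesis unfolding has_vector_derivative_def by (simp add: D.scaleR)
qed

lemma velocity_eq:
 assumes "mcontinuous_curve A S \<gamma>" "t \<in> interior S" "c \<in> A" "\<gamma> t \<in> dom_of c"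
  and "((crd c \<circ> \<gamma>) has_vector_derivative a) (at t)"
 shows "velocity A \<gamma> t = tvec_of A c (\<gamma> t) a"
 using curve_chart_derivative[OF assms(1-4) _ _ assms(5)]
 by (auto simp: velocity_def tvec_of_def Dtr_def vector_derivative_at)

lemma some_chart_in:
 assumes "c \<in> A" "x \<in> dom_of c" shows "some_chart A x \<in> A" "x \<in> dom_of (some_chart A x)"
proof -
 have "\<exists>c. c \<in> A \<and> x \<in> dom_of c" using assms by blast
 from someI_ex[OF this] show "some_chart A x \<in> A" "x \<in> dom_of (some_chart A x)"
  unfolding some_chart_def by blast+
qed

text \<open>The definition evaluates the differential in an arbitrarily selected chart; the chain rule shows
  that the selection is immaterial.\<close>
lemma differential_chart:
 assumes h: "mdifferentiable_at A h x" and c: "c \<in> A" "x \<in> dom_of c" and v: "v \<in> tangent_space A x"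
 shows "differential A h x v = frechet_derivative (h \<circ> crd_inv c) (at (crd c x)) (v c)"
proof -
 define d where "d = some_chart A x"
 have d: "d \<in> A" "x \<in> dom_of d" using some_chart_in[OF c] by (simp_all add: d_def)
 have "(h \<circ> crd_inv c has_derivative frechet_derivative (h \<circ> crd_inv c) (at (crd c x))) (at (transition d c (crd d x)))"
  using h c d unfolding mdifferentiable_at_def by (simp add: frechet_derivative_works[symmetric])
 from diff_chain_at[OF transition_has_derivative[OF d(1) c(1) d(2) c(2)] this]
 have "((h \<circ> crd_inv c) \<circ> transition d c has_derivative
   frechet_derivative (h \<circ> crd_inv c) (at (crd c x)) \<circ> Dtr d c (crd d x)) (at (crd d x))" .
 then have "(h \<circ> crd_inv d has_derivative
   frechet_derivative (h \<circ> crd_inv c) (at (crd c x)) \<circ> Dtr d c (crd d x)) (at (crd d x))"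
 proof (rule has_derivative_transform_within_open[OF _ open_overlap[OF d(1) c(1)]])
  show "crd d x \<in> crd d ` (dom_of d \<inter> dom_of c)" using c d by blast
  show "((h \<circ> crd_inv c) \<circ> transition d c) z = (h \<circ> crd_inv d) z" if "z \<in> crd d ` (dom_of d \<inter> dom_of c)" for z
   using that c d by auto
 qed
 from frechet_derivative_at[OF this, symmetric] show ?thesis
  unfolding differential_def Let_def d_def[symmetric] using v tangent_change[OF v d(1) c(1) d(2) c(2)] by simp
qed

end

section \<open>Riemannian distance and coordinates\<close>

lemma piecewise_C1_transform_within_open:
 fixes f h :: "real => 'b::real_normed_vector"
 assumes f: "f piecewise_C1_differentiable_on S" and U: "open U" "S \<subseteq> U" and eq: "\<And>u. u \<in> U ==> f u = h u"
 shows "h piecewise_C1_differentiable_on S"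
proof -
 obtain F D where F: "finite F" "\<forall>x\<in>S - F. (f has_vector_derivative D x) (at x)" "continuous_on (S - F) D" "continuous_on S f"
  using f unfolding piecewise_C1_differentiable_on_def C1_differentiable_on_def by blast
 have "continuous_on S h" by (rule continuous_on_cong[THEN iffD1, OF refl _ F(4)]) (use U eq in auto)
 moreover have "(h has_vector_derivative D x) (at x)" if "x \<in> S - F" for x
  by (rule has_vector_derivative_transform_within_open[OF F(2)[rule_format, OF that] U(1)]) (use that U eq in auto)
 ultimately show ?thesis
  unfolding piecewise_C1_differentiable_on_def C1_differentiable_on_def using F(1,3) by blast
qed

locale C1_riemannian = C1_atlas A for A :: "('p, 'e::euclidean_space) chart set" +
 fixes g :: "('p, 'e) metric_tensor"
 assumes metric: "riemannian_metric A g"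
begin

definition G :: "('p, 'e) chart => 'e => 'e => 'e => real" where
 "G c z a b = g (crd_inv c z) (tvec_of A c (crd_inv c z) a) (tvec_of A c (crd_inv c z) b)"

lemma G_sym: "c \<in> A ==> z \<in> crd c ` dom_of c ==> G c z a b = G c z b a"
 using metric carrierI[of c "crd_inv c z"] tvec_of_in[of c "crd_inv c z"] crd_inv_in[of z c]
 unfolding G_def riemannian_metric_def by blast

lemma G_linear:
 assumes c: "c \<in> A" "z \<in> crd c ` dom_of c"
 shows "G c z (r *\<^sub>R a + s *\<^sub>R a') b = r * G c z a b + s * G c z a' b"
proof -
 let ?x = "crd_inv c z"
 have x: "?x \<in> dom_of c" "?x \<in> carrier_of A" using c carrierI by auto
 have T: "tvec_of A c ?x v \<in> tangent_space A ?x" for v using c x by simp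
 have "\<forall>u\<in>tangent_space A ?x. \<forall>v\<in>tangent_space A ?x. \<forall>w\<in>tangent_space A ?x. \<forall>r s.
      g ?x (\<lambda>c. r *\<^sub>R u c + s *\<^sub>R v c) w = r * g ?x u w + s * g ?x v w"
  using metric x(2) unfolding riemannian_metric_def by blast
 then show ?thesis unfolding G_def tvec_of_linear[OF c(1) x(1)] using T by blast
qed

lemma G_pos:
 assumes c: "c \<in> A" "z \<in> crd c ` dom_of c" and "a \<noteq> 0"
 shows "G c z a a > 0"
proof -
 let ?x = "crd_inv c z"
 have x: "?x \<in> dom_of c" "?x \<in> carrier_of A" using c carrierI by auto
 have T: "tvec_of A c ?x a \<in> tangent_space A ?x" using c x by simp
 have "tvec_of A c ?x a c \<noteq> 0" using assms x by simp
 then have "tvec_of A c ?x a \<noteq> (\<lambda>_. 0)" by auto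
 then show ?thesis using metric x T unfolding riemannian_metric_def G_def by blast
qed

lemma G_expand:
 assumes c: "c \<in> A" "z \<in> crd c ` dom_of c"
 shows "G c z a b = (\<Sum>i\<in>Basis. \<Sum>j\<in>Basis. (a \<bullet> i) * (b \<bullet> j) * G c z i j)"
proof -
 have lin: "linear (\<lambda>a. G c z a b)" for b
  using G_linear[OF c, of 1 _ 1 _ b] G_linear[OF c, of _ _ 0 0 b] by (intro linearI) auto
 have 1: "G c z a b = (\<Sum>i\<in>Basis. (a \<bullet> i) * G c z i b)" for a b
 proof -
  have "G c z a b = G c z (\<Sum>i\<in>Basis. (a \<bullet> i) *\<^sub>R i) b" by (simp add: euclidean_representation)
  also have "\<dots> = (\<Sum>i\<in>Basis. (a \<bullet> i) * G c z i b)"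
   by (simp add: linear_sum[OF lin] linear_scale[OF lin])
  finally show ?thesis .
 qed
 have 2: "G c z i b = (\<Sum>j\<in>Basis. (b \<bullet> j) * G c z i j)" for i
 proof -
  have "G c z i b = (\<Sum>j\<in>Basis. (b \<bullet> j) * G c z j i)" by (rule trans[OF G_sym[OF c] 1])
  also have "\<dots> = (\<Sum>j\<in>Basis. (b \<bullet> j) * G c z i j)"
   by (rule sum.cong[OF refl], rule arg_cong[where f = "(*) _"], rule G_sym[OF c])
  finally show ?thesis .
 qed
 show ?thesis
  unfolding 1[of a b] by (rule sum.cong[OF refl]) (subst 2, simp add: sum_distrib_left mult.assoc)
qed

lemma G_scale: "c \<in> A ==> z \<in> crd c ` dom_of c ==> G c z (k *\<^sub>R a) (k *\<^sub>R a) = k\<^sup>2 * G c z a a"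
 unfolding G_expand[of c z "k *\<^sub>R a"] G_expand[of c z a]
 by (simp add: sum_distrib_left power2_eq_square mult_ac)

lemma G_nonneg: "c \<in> A ==> z \<in> crd c ` dom_of c ==> G c z a a \<ge> 0"
 using G_pos[of c z a] G_scale[of c z 0 a] by (cases "a = 0") auto

lemma G_continuous:
 assumes c: "c \<in> A"
 shows "continuous_on ((crd c ` dom_of c) \<times> UNIV) (\<lambda>(z, a). G c z a a)"
proof -
 have "continuous_on (crd c ` dom_of c) (\<lambda>z. G c z i j)" for i j
  using metric c unfolding riemannian_metric_def smooth_on_def G_def
  by (metis (no_types, lifting) Ck_on.simps(1))
 then have "continuous_on ((crd c ` dom_of c) \<times> UNIV) (\<lambda>w. G c (fst w) i j)" for i j
  by (rule continuous_on_compose2[OF _ continuous_on_fst[OF continuous_on_id]]) auto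
 then have "continuous_on ((crd c ` dom_of c) \<times> UNIV)
   (\<lambda>w. \<Sum>i\<in>Basis. \<Sum>j\<in>Basis. (snd w \<bullet> i) * (snd w \<bullet> j) * G c (fst w) i j)"
  by (intro continuous_intros) auto
 then show ?thesis
  by (rule continuous_on_cong[THEN iffD1, rotated 2]) (auto simp: G_expand[OF c, symmetric])
qed

text \<open>By homogeneity it suffices to bound the metric on the product of \<open>K\<close> with the unit sphere, which is compact.\<close>
lemma G_bounds:
 assumes c: "c \<in> A" and K: "compact K" "K \<subseteq> crd c ` dom_of c"
 obtains m M where "0 < m" "0 < M" "\<And>z a. z \<in> K ==> m * norm a \<le> sqrt (G c z a a)"
  "\<And>z a. z \<in> K ==> sqrt (G c z a a) \<le> M * norm a"
proof (cases "K = {}")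
 case True then show thesis using that[of 1 1] by auto
next
 case False
 let ?S = "K \<times> sphere (0::'e) 1"
 let ?f = "\<lambda>w. sqrt (case w of (z, a) => G c z a a)"
 obtain b :: 'e where "b \<in> Basis" using nonempty_Basis by blast
 then have ne: "?S \<noteq> {}" using False by auto
 have comp: "compact ?S" by (intro compact_Times K compact_sphere)
 have cont: "continuous_on ?S ?f"
  by (intro continuous_on_real_sqrt continuous_on_subset[OF G_continuous[OF c]]) (use K in auto)
 obtain w0 where w0: "w0 \<in> ?S" "\<And>w. w \<in> ?S ==> ?f w0 \<le> ?f w"
  using continuous_attains_inf[OF comp ne cont] by blast
 obtain w1 where w1: "w1 \<in> ?S" "\<And>w. w \<in> ?S ==> ?f w \<le> ?f w1"
  using continuous_attains_sup[OF comp ne cont] by blast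
 have pos: "?f w > 0" if wS: "w \<in> ?S" for w
 proof -
  obtain z a where w: "w = (z, a)" "z \<in> K" "norm a = 1" using wS by (cases w) auto
  then have "a \<noteq> 0" "z \<in> crd c ` dom_of c" using K by auto
  then show ?thesis using G_pos[OF c] w by simp
 qed
 have hom: "sqrt (G c z a a) = norm a * ?f (z, a /\<^sub>R norm a)" if "z \<in> K" "a \<noteq> 0" for z a
 proof -
  have "G c z a a = (norm a)\<^sup>2 * G c z (a /\<^sub>R norm a) (a /\<^sub>R norm a)"
   using G_scale[OF c, of z "norm a" "a /\<^sub>R norm a"] that K by (auto simp: subset_iff)
  then show ?thesis by (simp add: real_sqrt_mult)
 qed
 have zero: "G c z 0 0 = 0" if "z \<in> K" for z using G_scale[OF c, of z 0 0] that K by auto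
 have b: "?f w0 * norm a \<le> sqrt (G c z a a) \<and> sqrt (G c z a a) \<le> ?f w1 * norm a" if z: "z \<in> K" for z a
 proof (cases "a = 0")
  case False
  then have "(z, a /\<^sub>R norm a) \<in> ?S" using z by simp
  from w0(2)[OF this] w1(2)[OF this] show ?thesis unfolding hom[OF z False]
   by (simp only: mult.commute[of _ "norm a"] mult_left_mono[OF _ norm_ge_zero] simp_thms)
 qed (use zero z in simp)
 show thesis by (rule that[of "?f w0" "?f w1"]) (use pos w0(1) w1(1) b in blast)+
qed

definition speed :: "(real => 'p) => real => real" where
 "speed \<gamma> t = sqrt (g (\<gamma> t) (velocity A \<gamma> t) (velocity A \<gamma> t))"

definition lengths :: "'p => 'p => real set" where
 "lengths x y = {l. \<exists>\<gamma>. piecewise_C1_curve A \<gamma> \<and> \<gamma> 0 = x \<and> \<gamma> 1 = y \<and> (speed \<gamma> has_integral l) {0..1}}"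

abbreviation "rdist \<equiv> riemannian_dist A g"

lemma rdist_eq: "rdist x y = Inf (lengths x y)"
 unfolding riemannian_dist_def lengths_def speed_def ..

definition regular_at :: "(real => 'p) => real => bool" where
 "regular_at \<gamma> t \<longleftrightarrow> t \<in> {0<..<1} \<and> (\<exists>c\<in>A. \<gamma> t \<in> dom_of c \<and> (crd c \<circ> \<gamma>) differentiable (at t))"

lemma speed_chart:
 assumes \<gamma>: "mcontinuous_curve A S \<gamma>" "t \<in> interior S" and c: "c \<in> A" "\<gamma> t \<in> dom_of c"
  and der: "((crd c \<circ> \<gamma>) has_vector_derivative a) (at t)"
 shows "speed \<gamma> t = sqrt (G c (crd c (\<gamma> t)) a a)"
 unfolding speed_def velocity_eq[OF assms] G_def using c by simp

lemma regular_at_chart: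
 assumes \<gamma>: "mcontinuous_curve A {0..1} \<gamma>" and reg: "regular_at \<gamma> t" and c: "c \<in> A" "\<gamma> t \<in> dom_of c"
 obtains a where "((crd c \<circ> \<gamma>) has_vector_derivative a) (at t)"
proof -
 obtain c' where c': "c' \<in> A" "\<gamma> t \<in> dom_of c'" "(crd c' \<circ> \<gamma>) differentiable (at t)" "t \<in> {0<..<1}"
  using reg unfolding regular_at_def by blast
 then obtain a' where "((crd c' \<circ> \<gamma>) has_vector_derivative a') (at t)"
  using vector_derivative_works by blast
 from curve_chart_derivative[OF \<gamma> _ c'(1,2) c this] c'(4) show thesis using that by simp
qed

lemma regular_speed_nonneg:
 assumes \<gamma>: "mcontinuous_curve A {0..1} \<gamma>" and reg: "regular_at \<gamma> t"
 shows "speed \<gamma> t \<ge> 0"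
proof -
 obtain c where c: "c \<in> A" "\<gamma> t \<in> dom_of c" and t: "t \<in> {0<..<1}" using reg unfolding regular_at_def by blast
 obtain a where a: "((crd c \<circ> \<gamma>) has_vector_derivative a) (at t)" using regular_at_chart[OF \<gamma> reg c] by blast
 show ?thesis using speed_chart[OF \<gamma> _ c a] G_nonneg[OF c(1)] c t by simp
qed

text \<open>Every time has a neighbourhood in which the curve stays in one chart and has finitely many break points;
  finitely many such neighbourhoods cover the unit interval.\<close>
lemma finite_irregular:
 assumes "piecewise_C1_curve A \<gamma>"
 shows "finite {t\<in>{0..1}. \<not> regular_at \<gamma> t}"
proof -
 have \<gamma>: "mcontinuous_curve A {0..1} \<gamma>"
  and pc: "\<And>c a b. c \<in> A ==> {a..b} \<subseteq> {0..1} ==> \<gamma> ` {a..b} \<subseteq> dom_of c ==> (crd c \<circ> \<gamma>) piecewise_C1_differentiable_on {a..b}"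
  using assms unfolding piecewise_C1_curve_def by blast+
 let ?B = "{t\<in>{0..1}. \<not> regular_at \<gamma> t}"
 have "finite (?B \<inter> {0..1})"
 proof (rule Bolzano[where P = "\<lambda>u v. finite (?B \<inter> {u..v})"])
  fix u v w :: real assume "finite (?B \<inter> {u..v})" "finite (?B \<inter> {v..w})" "u \<le> v" "v \<le> w"
  moreover have "?B \<inter> {u..w} \<subseteq> (?B \<inter> {u..v}) \<union> (?B \<inter> {v..w})" by auto
  ultimately show "finite (?B \<inter> {u..w})" using finite_subset finite_UnI by blast
 next
  fix t :: real assume "0 \<le> t" "t \<le> 1"
  then have t: "t \<in> {0..1}" by simp
  obtain c where c: "c \<in> A" "\<gamma> t \<in> dom_of c" using curve_in_carrier[OF \<gamma> t] unfolding carrier_of_def by blast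
  obtain d where d: "d > 0" "\<And>s. s \<in> {0..1} ==> \<bar>s - t\<bar> < d ==> \<gamma> s \<in> dom_of c"
   using curve_near[OF \<gamma> openin_dom[OF c(1)] t c(2)] by blast
  have "finite (?B \<inter> {u..v})" if uv: "u \<le> t" "t \<le> v" "v - u < d" for u v
  proof -
   let ?a = "max 0 u" and ?b = "min 1 v"
   have "(crd c \<circ> \<gamma>) piecewise_C1_differentiable_on {?a..?b}"
    by (rule pc[OF c(1)]) (use uv d(2) in \<open>auto intro!: d(2)\<close>)
   then obtain F where F: "finite F" "(crd c \<circ> \<gamma>) C1_differentiable_on ({?a..?b} - F)"
    unfolding piecewise_C1_differentiable_on_def by blast
   have "?B \<inter> {u..v} \<subseteq> F \<union> {0, 1}"
   proof
    fix s assume s: "s \<in> ?B \<inter> {u..v}"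
    show "s \<in> F \<union> {0, 1}"
    proof (rule ccontr)
     assume n: "s \<notin> F \<union> {0, 1}"
     then have "(crd c \<circ> \<gamma>) differentiable (at s)"
      using F(2) s unfolding C1_differentiable_on_eq by auto
     moreover have "\<gamma> s \<in> dom_of c" using s uv by (intro d(2)) auto
     ultimately have "regular_at \<gamma> s" unfolding regular_at_def using s n c by (auto simp: less_le)
     then show False using s by simp
    qed
   qed
   then show ?thesis using F(1) finite_subset by blast
  qed
  then show "\<exists>d>0. \<forall>u v. u \<le> t \<and> t \<le> v \<and> v - u < d --> finite (?B \<inter> {u..v})" using d(1) by blast
 qed simp
 moreover have "?B \<inter> {0..1} = ?B" by auto
 ultimately show ?thesis by simp
qed

text \<open>At break points the components of the velocity need not form a tangent vector, so that the sign of the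
  speed is unknown there; changing it at finitely many points leaves the integral unchanged.\<close>
lemma speed_repaired:
 assumes pc: "piecewise_C1_curve A \<gamma>" and int: "(speed \<gamma> has_integral l) {0..1}"
 defines "sp \<equiv> \<lambda>t. if regular_at \<gamma> t then speed \<gamma> t else 0"
 shows "(sp has_integral l) {0..1}" "\<And>t. sp t \<ge> 0"
proof -
 have \<gamma>: "mcontinuous_curve A {0..1} \<gamma>" using pc unfolding piecewise_C1_curve_def by blast
 show "(sp has_integral l) {0..1}"
  by (rule has_integral_spike_finite[OF finite_irregular[OF pc] _ int]) (auto simp: sp_def)
 show "sp t \<ge> 0" for t using regular_speed_nonneg[OF \<gamma>] by (simp add: sp_def)
qed

lemma lengths_nonneg: "l \<in> lengths x y ==> l \<ge> 0"
 unfolding lengths_def using speed_repaired has_integral_nonneg by blast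

lemma rdist_nonneg: "lengths x y \<noteq> {} ==> rdist x y \<ge> 0"
 unfolding rdist_eq using lengths_nonneg by (intro cInf_greatest)

lemma rdist_le: "l \<in> lengths x y ==> rdist x y \<le> l"
 unfolding rdist_eq using lengths_nonneg by (intro cInf_lower bdd_belowI[of _ 0])

text \<open>The straight segment in coordinates is an admissible curve.\<close>
lemma lengths_segment:
 assumes c: "c \<in> A" and V: "open V" "convex V" "V \<subseteq> crd c ` dom_of c"
  and M: "\<And>z a. z \<in> V ==> sqrt (G c z a a) \<le> M * norm a" and z: "z \<in> V" "z' \<in> V"
 shows "\<exists>l\<in>lengths (crd_inv c z) (crd_inv c z'). l \<le> M * norm (z' - z)"
proof -
 define lin where "lin t = z + t *\<^sub>R (z' - z)" for t :: real
 define \<gamma> where "\<gamma> t = crd_inv c (lin t)" for t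
 define S where "S = {t. lin t \<in> V}"
 have lincont: "continuous_on T lin" for T unfolding lin_def by (intro continuous_intros)
 have S: "open S" unfolding S_def using open_vimage[OF V(1) lincont] by (simp add: vimage_def)
 have sub: "{0..1} \<subseteq> S"
 proof
  fix t :: real assume "t \<in> {0..1}"
  moreover have "lin t = (1 - t) *\<^sub>R z + t *\<^sub>R z'" by (simp add: lin_def algebra_simps)
  ultimately show "t \<in> S" using convexD_alt[OF V(2) z, of t] by (simp add: S_def)
 qed
 have dom: "\<gamma> t \<in> dom_of c" and crd: "crd c (\<gamma> t) = lin t" if "t \<in> S" for t
  using that V(3) unfolding \<gamma>_def S_def by (auto simp: subset_iff)
 have contS: "mcontinuous_curve A S \<gamma>"
 proof (rule mcontinuous_curve_chartI[OF c])
  show "continuous_on S (crd c \<circ> \<gamma>)" using lincont[of S] by (rule continuous_on_cong[THEN iffD1, rotated 2]) (use crd in auto)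
 qed (use dom in auto)
 have der: "((crd c \<circ> \<gamma>) has_vector_derivative (z' - z)) (at t)" if t: "t \<in> S" for t
 proof -
  have "(lin has_vector_derivative (z' - z)) (at t)"
   unfolding lin_def by (auto intro!: derivative_eq_intros)
  then show ?thesis
   by (rule has_vector_derivative_transform_within_open[OF _ S t]) (use crd in auto)
 qed
 have "piecewise_C1_curve A \<gamma>"
  unfolding piecewise_C1_curve_def
 proof (intro conjI ballI allI impI)
  show "mcontinuous_curve A {0..1} \<gamma>" using contS sub by (rule mcontinuous_curve_subset)
  fix c' a b assume c': "c' \<in> A" and ab: "{a..b} \<subseteq> {0..1::real} \<and> \<gamma> ` {a..b} \<subseteq> dom_of c'"
  have "(crd c' \<circ> \<gamma>) C1_differentiable_on {a..b}"
   unfolding C1_differentiable_on_def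
  proof (intro exI[of _ "\<lambda>t. Dtr c c' (lin t) (z' - z)"] conjI ballI)
   fix t assume t: "t \<in> {a..b}"
   then have tS: "t \<in> S" "\<gamma> t \<in> dom_of c'" using ab sub by auto
   show "((crd c' \<circ> \<gamma>) has_vector_derivative Dtr c c' (lin t) (z' - z)) (at t)"
    using curve_chart_derivative[OF contS _ c dom[OF tS(1)] c' tS(2) der[OF tS(1)]] tS S
    by (simp add: crd interior_open)
  next
   show "continuous_on {a..b} (\<lambda>t. Dtr c c' (lin t) (z' - z))"
   proof (rule continuous_on_compose2[OF Dtr_continuous[OF c c'] lincont])
    show "lin ` {a..b} \<subseteq> crd c ` (dom_of c \<inter> dom_of c')"
    proof
     fix w assume "w \<in> lin ` {a..b}"
     then obtain t where t: "t \<in> {a..b}" "w = lin t" by blast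
     then have "t \<in> S" "\<gamma> t \<in> dom_of c'" using ab sub by auto
     then show "w \<in> crd c ` (dom_of c \<inter> dom_of c')" using t dom crd by (metis IntI imageI)
    qed
   qed
  qed
  then show "(crd c' \<circ> \<gamma>) piecewise_C1_differentiable_on {a..b}" by (rule C1_differentiable_imp_piecewise)
 qed
 moreover have sp: "speed \<gamma> t = sqrt (G c (lin t) (z' - z) (z' - z))" if t: "t \<in> S" for t
  using speed_chart[OF contS _ c dom[OF t] der[OF t]] S t crd[OF t] by (simp add: interior_open)
 have "continuous_on {0..1} (\<lambda>t. sqrt (case (lin t, z' - z) of (z, a) => G c z a a))"
  by (intro continuous_on_real_sqrt continuous_on_compose2[OF G_continuous[OF c]] continuous_intros lincont)
   (use sub V(3) in \<open>auto simp: S_def\<close>)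
 then have "continuous_on {0..1} (speed \<gamma>)"
  by (rule continuous_on_cong[THEN iffD1, rotated 2]) (use sp sub in auto)
 then have int: "(speed \<gamma> has_integral integral {0..1} (speed \<gamma>)) {0..1}"
  using integrable_continuous_real by blast
 moreover have "integral {0..1} (speed \<gamma>) \<le> M * norm (z' - z)"
 proof (rule has_integral_le[OF int])
  show "((\<lambda>_. M * norm (z' - z)) has_integral M * norm (z' - z)) {0..1::real}"
   using has_integral_const_real[of "M * norm (z' - z)" 0 1] by simp
  show "speed \<gamma> t \<le> M * norm (z' - z)" if "t \<in> {0..1}" for t
   using sp[of t] M[of "lin t"] sub that by (auto simp: S_def)
 qed
 moreover have "\<gamma> 0 = crd_inv c z" "\<gamma> 1 = crd_inv c z'" by (simp_all add: \<gamma>_def lin_def)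
 ultimately show ?thesis unfolding lengths_def by blast
qed

lemma has_integral_affine_half:
 assumes "((f :: real => real) has_integral l) {0..1}"
 shows "((\<lambda>t. 2 * f (2 * t - k)) has_integral l) {k/2..(k+1)/2}"
proof -
 have "((\<lambda>t. f (2 *\<^sub>R t + - k)) has_integral (l /\<^sub>R 2 ^ DIM(real))) (cbox ((0 - - k) /\<^sub>R 2) ((1 - - k) /\<^sub>R 2))"
  using assms by (intro has_integral_affinity') auto
 then have "((\<lambda>t. f (2 * t - k)) has_integral l / 2) {k/2..(k+1)/2}" by (simp add: add.commute)
 from has_integral_mult_right[OF this, of 2] show ?thesis by simp
qed

text \<open>Both curves are run at double speed.\<close>
lemma lengths_concat:
 assumes "l1 \<in> lengths x y" "l2 \<in> lengths y w"
 shows "l1 + l2 \<in> lengths x w"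
proof -
 obtain \<gamma>1 where g1: "piecewise_C1_curve A \<gamma>1" "\<gamma>1 0 = x" "\<gamma>1 1 = y" "(speed \<gamma>1 has_integral l1) {0..1}"
  using assms(1) unfolding lengths_def by blast
 obtain \<gamma>2 where g2: "piecewise_C1_curve A \<gamma>2" "\<gamma>2 0 = y" "\<gamma>2 1 = w" "(speed \<gamma>2 has_integral l2) {0..1}"
  using assms(2) unfolding lengths_def by blast
 have m1: "mcontinuous_curve A {0..1} \<gamma>1" and m2: "mcontinuous_curve A {0..1} \<gamma>2"
  using g1 g2 unfolding piecewise_C1_curve_def by blast+
 define \<gamma> where "\<gamma> t = (if t \<le> 1/2 then \<gamma>1 (2 * t) else \<gamma>2 (2 * t - 1))" for t :: real
 have m: "mcontinuous_curve A {0..1} \<gamma>"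
  unfolding mcontinuous_curve_def \<gamma>_def
 proof (rule continuous_map_cases_le)
  have eq1: "subtopology (top_of_set {0..1::real}) {x \<in> topspace (top_of_set {0..1}). x \<le> 1 / 2} = top_of_set {0..1/2}"
   by (simp add: subtopology_subtopology) (rule arg_cong[of _ _ top_of_set], auto)
  have eq2: "subtopology (top_of_set {0..1::real}) {x \<in> topspace (top_of_set {0..1}). 1 / 2 \<le> x} = top_of_set {1/2..1}"
   by (simp add: subtopology_subtopology) (rule arg_cong[of _ _ top_of_set], auto)
  show "continuous_map (subtopology (top_of_set {0..1::real}) {x \<in> topspace (top_of_set {0..1}). x \<le> 1 / 2}) (mtop A) (\<lambda>t. \<gamma>1 (2 * t))"
   unfolding eq1 using m1[unfolded mcontinuous_curve_def]
   by (rule continuous_map_compose[of "top_of_set {0..1/2}" "top_of_set {0..1}" "(*) 2", unfolded o_def, rotated])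
    (auto intro!: continuous_intros)
  show "continuous_map (subtopology (top_of_set {0..1::real}) {x \<in> topspace (top_of_set {0..1}). 1 / 2 \<le> x}) (mtop A) (\<lambda>t. \<gamma>2 (2 * t - 1))"
   unfolding eq2 using m2[unfolded mcontinuous_curve_def]
   by (rule continuous_map_compose[of "top_of_set {1/2..1}" "top_of_set {0..1}" "\<lambda>t. 2 * t - 1", unfolded o_def, rotated])
    (auto intro!: continuous_intros)
  show "\<gamma>1 (2 * t) = \<gamma>2 (2 * t - 1)" if "t = 1/2" for t by (simp add: that g1 g2)
 qed (auto intro!: continuous_intros)
 have pcg: "piecewise_C1_curve A \<gamma>"
  unfolding piecewise_C1_curve_def
 proof (intro conjI ballI allI impI m)
  fix c a b assume c: "c \<in> A" and ab: "{a..b} \<subseteq> {0..1::real} \<and> \<gamma> ` {a..b} \<subseteq> dom_of c"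
  have p1: "(\<lambda>t. crd c (\<gamma>1 (2 * t))) piecewise_C1_differentiable_on {a'..b'}" if "a \<le> a'" "b' \<le> b" "b' \<le> 1/2" for a' b'
  proof -
   have "(crd c \<circ> \<gamma>1) piecewise_C1_differentiable_on {2 * a'..2 * b'}"
   proof -
    have "\<gamma>1 s \<in> dom_of c \<and> s \<in> {0..1}" if s: "s \<in> {2 * a'..2 * b'}" for s
    proof -
     have "s/2 \<in> {a..b}" "s/2 \<le> 1/2" using s \<open>a \<le> a'\<close> \<open>b' \<le> b\<close> \<open>b' \<le> 1/2\<close> by auto
     then have "\<gamma> (s/2) \<in> dom_of c" "s/2 \<in> {0..1}" using ab by blast+
     then show ?thesis using \<open>s/2 \<le> 1/2\<close> by (simp add: \<gamma>_def)
    qed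
    then show ?thesis using g1(1) c unfolding piecewise_C1_curve_def by blast
   qed
   moreover have "(\<lambda>t. 2 * t + 0) ` {a'..b'} = {2 * a'..2 * b'}" by (simp add: image_affinity_atLeastAtMost)
   ultimately show ?thesis using piecewise_C1_differentiable_affine[of "crd c \<circ> \<gamma>1" 2 0 "{a'..b'}"] by (simp add: o_def)
  qed
  have p2: "(\<lambda>t. crd c (\<gamma>2 (2 * t - 1))) piecewise_C1_differentiable_on {a'..b'}" if "a \<le> a'" "b' \<le> b" "1/2 \<le> a'" for a' b'
  proof -
   have "(crd c \<circ> \<gamma>2) piecewise_C1_differentiable_on {2 * a' - 1..2 * b' - 1}"
   proof -
    have "\<gamma>2 s \<in> dom_of c \<and> s \<in> {0..1}" if s: "s \<in> {2 * a' - 1..2 * b' - 1}" for s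
    proof -
     have "(s+1)/2 \<in> {a..b}" "(s+1)/2 \<ge> 1/2" using s \<open>a \<le> a'\<close> \<open>b' \<le> b\<close> \<open>1/2 \<le> a'\<close> by auto
     then have "\<gamma> ((s+1)/2) \<in> dom_of c" "(s+1)/2 \<in> {0..1}" using ab by blast+
     moreover have "\<gamma> ((s+1)/2) = \<gamma>2 s"
     proof (cases "s = 0")
      case False
      have "2 * ((s+1)/2) - 1 = s" by (simp add: field_simps)
      then have "\<gamma>2 (2 * ((s+1)/2) - 1) = \<gamma>2 s" by (rule arg_cong)
      moreover have "\<not> (s+1)/2 \<le> 1/2" using \<open>(s+1)/2 \<ge> 1/2\<close> False by auto
      ultimately show ?thesis by (simp only: \<gamma>_def if_False)
     qed (simp add: \<gamma>_def g1 g2)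
     ultimately show ?thesis using \<open>(s+1)/2 \<ge> 1/2\<close> by auto
    qed
    then show ?thesis using g2(1) c unfolding piecewise_C1_curve_def by blast
   qed
   moreover have "(\<lambda>t. 2 * t + - 1) ` {a'..b'} = {2 * a' - 1..2 * b' - 1}"
    by (simp only: image_affinity_atLeastAtMost) auto
   ultimately show ?thesis using piecewise_C1_differentiable_affine[of "crd c \<circ> \<gamma>2" 2 "-1" "{a'..b'}"] by (simp add: o_def)
  qed
  have eq: "crd c \<circ> \<gamma> = (\<lambda>t. if t \<le> 1/2 then crd c (\<gamma>1 (2 * t)) else crd c (\<gamma>2 (2 * t - 1)))"
   by (auto simp: \<gamma>_def)
  consider "a \<le> 1/2" "1/2 \<le> b" | "b < 1/2" | "1/2 < a" by linarith
  then show "(crd c \<circ> \<gamma>) piecewise_C1_differentiable_on {a..b}"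
  proof cases
   case 1
   then show ?thesis unfolding eq
    by (intro piecewise_C1_differentiable_cases p1 p2) (use g1 g2 in auto)
  next
   case 2
   show ?thesis unfolding eq
    by (rule piecewise_C1_transform_within_open[OF p1[of a b] open_lessThan[of "1/2"]]) (use 2 in auto)
  next
   case 3
   show ?thesis unfolding eq
    by (rule piecewise_C1_transform_within_open[OF p2[of a b] open_greaterThan[of "1/2"]]) (use 3 in auto)
  qed
 qed
 have half: "speed \<gamma> t = 2 * speed \<gamma>' (2 * t - k)"
  if mm: "mcontinuous_curve A {0..1} \<gamma>'" and eq: "\<And>s. s \<in> {k/2<..<(k+1)/2} ==> \<gamma> s = \<gamma>' (2 * s - k)"
   and k: "k \<in> {0, 1}" and t: "t \<in> {k/2<..<(k+1)/2}" and reg: "regular_at \<gamma>' (2 * t - k)" for t k \<gamma>'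
 proof -
  have t01: "t \<in> {0<..<1}" using k t by auto
  obtain c where c: "c \<in> A" "\<gamma>' (2 * t - k) \<in> dom_of c" using reg unfolding regular_at_def by blast
  obtain a where a: "((crd c \<circ> \<gamma>') has_vector_derivative a) (at (2 * t - k))" using regular_at_chart[OF mm reg c] by blast
  have "((\<lambda>t. 2 * t - k) has_vector_derivative 2) (at t)" by (auto intro!: derivative_eq_intros)
  from vector_diff_chain_at[OF this a] have "((crd c \<circ> \<gamma>') \<circ> (\<lambda>t. 2 * t - k) has_vector_derivative 2 *\<^sub>R a) (at t)" .
  then have der: "((crd c \<circ> \<gamma>) has_vector_derivative 2 *\<^sub>R a) (at t)"
   by (rule has_vector_derivative_transform_within_open[OF _ open_greaterThanLessThan t]) (use eq in auto)
  have ct: "\<gamma> t \<in> dom_of c" using c eq[OF t] by simp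
  have "speed \<gamma> t = sqrt (G c (crd c (\<gamma> t)) (2 *\<^sub>R a) (2 *\<^sub>R a))"
   by (rule speed_chart[OF m _ c(1) ct der]) (use t01 in simp)
  also have "\<dots> = 2 * sqrt (G c (crd c (\<gamma> t)) a a)"
   using G_scale[OF c(1), of "crd c (\<gamma> t)" 2 a] ct by (simp add: real_sqrt_mult)
  also have "sqrt (G c (crd c (\<gamma> t)) a a) = speed \<gamma>' (2 * t - k)"
   unfolding eq[OF t] by (rule speed_chart[OF mm _ c a, symmetric]) (use t k in auto)
  finally show ?thesis .
 qed
 have int: "(speed \<gamma> has_integral l) {k/2..(k+1)/2}"
  if pc: "piecewise_C1_curve A \<gamma>'" and eq: "\<And>s. s \<in> {k/2<..<(k+1)/2} ==> \<gamma> s = \<gamma>' (2 * s - k)"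
   and k: "k \<in> {0, 1}" and l: "(speed \<gamma>' has_integral l) {0..1}" for k \<gamma>' l
 proof (rule has_integral_spike_finite[OF _ _ has_integral_affine_half[OF l]])
  let ?B = "{t\<in>{0..1}. \<not> regular_at \<gamma>' t}"
  show "finite ({k/2, (k+1)/2} \<union> (\<lambda>s. (s + k) / 2) ` ?B)" using finite_irregular[OF pc] by simp
  fix t assume t: "t \<in> {k/2..(k+1)/2} - ({k/2, (k+1)/2} \<union> (\<lambda>s. (s + k) / 2) ` ?B)"
  then have t': "t \<in> {k/2<..<(k+1)/2}" by auto
  moreover have "regular_at \<gamma>' (2 * t - k)"
  proof (rule ccontr)
   assume "\<not> ?thesis"
   then have "2 * t - k \<in> ?B" using t' by auto
   then have "t \<in> (\<lambda>s. (s + k) / 2) ` ?B" by (intro image_eqI[of _ _ "2 * t - k"]) auto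
   then show False using t by blast
  qed
  ultimately show "speed \<gamma> t = 2 * speed \<gamma>' (2 * t - k)"
   using half[of \<gamma>' k t] pc eq k unfolding piecewise_C1_curve_def by blast
 qed
 have "(speed \<gamma> has_integral l1) {0..1/2}" using int[OF g1(1) _ _ g1(4), of 0] by (simp add: \<gamma>_def)
 moreover have "(speed \<gamma> has_integral l2) {1/2..1}" using int[OF g2(1) _ _ g2(4), of 1] by (simp add: \<gamma>_def)
 ultimately have "(speed \<gamma> has_integral l1 + l2) {0..1}" by (intro has_integral_combine[of 0 "1/2" 1]) auto
 moreover have "\<gamma> 0 = x" "\<gamma> 1 = w" using g1 g2 by (simp_all add: \<gamma>_def)
 ultimately show ?thesis using pcg unfolding lengths_def by blast
qed

end

context C1_riemannian begin

lemma local_lengths: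
 assumes c: "c \<in> A" "x \<in> dom_of c"
 obtains r m M where "r > 0" "m > 0" "M > 0" "cball (crd c x) r \<subseteq> crd c ` dom_of c"
  "\<And>z a. z \<in> cball (crd c x) r ==> m * norm a \<le> sqrt (G c z a a)"
  "\<And>z z'. z \<in> ball (crd c x) r ==> z' \<in> ball (crd c x) r ==>
   \<exists>l\<in>lengths (crd_inv c z) (crd_inv c z'). l \<le> M * norm (z' - z)"
proof -
 obtain r where r: "r > 0" "cball (crd c x) r \<subseteq> crd c ` dom_of c"
  using open_contains_cball[of "crd c ` dom_of c"] open_range[OF c(1)] c(2) by blast
 obtain m M where mM: "0 < m" "0 < M" "\<And>z a. z \<in> cball (crd c x) r ==> m * norm a \<le> sqrt (G c z a a)"
  "\<And>z a. z \<in> cball (crd c x) r ==> sqrt (G c z a a) \<le> M * norm a"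
  using G_bounds[OF c(1) compact_cball r(2)] by blast
 have sub: "ball (crd c x) r \<subseteq> crd c ` dom_of c" using r(2) by auto
 have "\<exists>l\<in>lengths (crd_inv c z) (crd_inv c z'). l \<le> M * norm (z' - z)"
  if "z \<in> ball (crd c x) r" "z' \<in> ball (crd c x) r" for z z'
  by (rule lengths_segment[OF c(1) open_ball convex_ball sub _ that]) (use mM(4) in auto)
 then show thesis using that[OF r(1) mM(1,2) r(2) mM(3)] by blast
qed

lemma lengths_refl: "x \<in> carrier_of A ==> lengths x x \<noteq> {}"
proof -
 assume "x \<in> carrier_of A"
 then obtain c where c: "c \<in> A" "x \<in> dom_of c" unfolding carrier_of_def by blast
 obtain r M where "r > 0" "\<And>z z'. z \<in> ball (crd c x) r ==> z' \<in> ball (crd c x) r ==>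
   \<exists>l\<in>lengths (crd_inv c z) (crd_inv c z'). l \<le> M * norm (z' - z)"
  using local_lengths[OF c] by metis
 from this(2)[of "crd c x" "crd c x"] this(1) show ?thesis using c by auto
qed

text \<open>The points that can be reached from \<open>x\<close> by rectifiable curves form an open and closed set. This
  matters because the infimum of the empty set is unspecified.\<close>
lemma lengths_nonempty:
 assumes conn: "connected_space (mtop A)" and x: "x \<in> carrier_of A" and y: "y \<in> carrier_of A"
 shows "lengths x y \<noteq> {}"
proof -
 define C where "C = {y\<in>carrier_of A. lengths x y \<noteq> {}}"
 have nbhd: "\<exists>N. openin (mtop A) N \<and> y \<in> N \<and> (\<forall>w\<in>N. lengths y w \<noteq> {} \<and> lengths w y \<noteq> {})"
  if "y \<in> carrier_of A" for y
 proof -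
  obtain c where c: "c \<in> A" "y \<in> dom_of c" using \<open>y \<in> carrier_of A\<close> unfolding carrier_of_def by blast
  obtain r M where r: "r > 0" "\<And>z z'. z \<in> ball (crd c y) r ==> z' \<in> ball (crd c y) r ==>
    \<exists>l\<in>lengths (crd_inv c z) (crd_inv c z'). l \<le> M * norm (z' - z)"
   using local_lengths[OF c] by metis
  let ?N = "{w \<in> dom_of c. crd c w \<in> ball (crd c y) r}"
  have "lengths y w \<noteq> {} \<and> lengths w y \<noteq> {}" if "w \<in> ?N" for w
   using r(2)[of "crd c y" "crd c w"] r(2)[of "crd c w" "crd c y"] r(1) c that by auto
  then show ?thesis using openin_chart_preimage[OF c(1) open_ball] r(1) c
   by (intro exI[of _ ?N]) auto
 qed
 have "openin (mtop A) C"
 proof (subst openin_subopen, intro ballI)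
  fix y assume y: "y \<in> C"
  then obtain N where N: "openin (mtop A) N" "y \<in> N" "\<forall>w\<in>N. lengths y w \<noteq> {} \<and> lengths w y \<noteq> {}"
   using nbhd unfolding C_def by blast
  have "N \<subseteq> C"
   using N(3) y openin_subset[OF N(1)] lengths_concat unfolding C_def topspace_mtop by blast
  then show "\<exists>T. openin (mtop A) T \<and> y \<in> T \<and> T \<subseteq> C" using N by blast
 qed
 moreover have "openin (mtop A) (carrier_of A - C)"
 proof (subst openin_subopen, intro ballI)
  fix y assume y: "y \<in> carrier_of A - C"
  then obtain N where N: "openin (mtop A) N" "y \<in> N" "\<forall>w\<in>N. lengths y w \<noteq> {} \<and> lengths w y \<noteq> {}"
   using nbhd by blast
  have "N \<subseteq> carrier_of A - C"
   using N(3) y openin_subset[OF N(1)] lengths_concat unfolding C_def topspace_mtop by blast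
  then show "\<exists>T. openin (mtop A) T \<and> y \<in> T \<and> T \<subseteq> carrier_of A - C" using N by blast
 qed
 then have "closedin (mtop A) C" unfolding closedin_def topspace_mtop C_def by auto
 ultimately have "C = {} \<or> C = carrier_of A"
  using conn unfolding connected_space_clopen_in topspace_mtop by blast
 moreover have "x \<in> C" using x lengths_refl unfolding C_def by blast
 ultimately show ?thesis using y unfolding C_def by blast
qed

text \<open>The upper half of the comparison of distances: coordinate segments have length at most a constant times their
  Euclidean length.\<close>
lemma rdist_upper:
 assumes c: "c \<in> A" "x \<in> dom_of c"
 obtains r M where "r > 0" "M > 0"
  "\<And>y y'. y \<in> dom_of c ==> y' \<in> dom_of c ==> crd c y \<in> ball (crd c x) r ==> crd c y' \<in> ball (crd c x) r ==>
   0 \<le> rdist y y' \<and> rdist y y' \<le> M * norm (crd c y' - crd c y)"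
proof -
 obtain r M where r: "r > 0" "M > 0" "\<And>z z'. z \<in> ball (crd c x) r ==> z' \<in> ball (crd c x) r ==>
   \<exists>l\<in>lengths (crd_inv c z) (crd_inv c z'). l \<le> M * norm (z' - z)"
  using local_lengths[OF c] by metis
 have "0 \<le> rdist y y' \<and> rdist y y' \<le> M * norm (crd c y' - crd c y)"
  if y: "y \<in> dom_of c" "y' \<in> dom_of c" "crd c y \<in> ball (crd c x) r" "crd c y' \<in> ball (crd c x) r" for y y'
 proof -
  obtain l where l: "l \<in> lengths y y'" "l \<le> M * norm (crd c y' - crd c y)" using r(3)[OF y(3,4)] y c by auto
  then show ?thesis using rdist_le[OF l(1)] rdist_nonneg[of y y'] by auto
 qed
 then show thesis using that r by blast
qed

text \<open>The Euclidean length of the coordinate curve is at most its Riemannian length divided by \<open>m\<close>.\<close>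
lemma displacement_le_length:
 assumes pc: "piecewise_C1_curve A \<gamma>" and int: "(speed \<gamma> has_integral l) {0..1}"
  and \<tau>: "\<tau> \<in> {0..1}" and c: "c \<in> A" and m: "m > 0"
  and dom: "\<gamma> ` {0..\<tau>} \<subseteq> dom_of c"
  and low: "\<And>t a. t \<in> {0..\<tau>} ==> m * norm a \<le> sqrt (G c (crd c (\<gamma> t)) a a)"
 shows "m * norm (crd c (\<gamma> \<tau>) - crd c (\<gamma> 0)) \<le> l"
proof -
 have \<gamma>: "mcontinuous_curve A {0..1} \<gamma>" using pc unfolding piecewise_C1_curve_def by blast
 define sp where "sp t = (if regular_at \<gamma> t then speed \<gamma> t else 0)" for t
 have sp: "(sp has_integral l) {0..1}" "\<And>t. sp t \<ge> 0" using speed_repaired[OF pc int] unfolding sp_def by blast+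
 define f where "f = crd c \<circ> \<gamma>"
 define f' where "f' t = (if regular_at \<gamma> t \<and> t \<in> {0<..<\<tau>} then vector_derivative f (at t) else 0)" for t
 have der: "(f has_vector_derivative f' t) (at t) \<and> m * norm (f' t) \<le> sp t" if t: "t \<in> {0<..<\<tau>}" "regular_at \<gamma> t" for t
 proof -
  have ct: "\<gamma> t \<in> dom_of c" using dom t by auto
  obtain a where a: "((crd c \<circ> \<gamma>) has_vector_derivative a) (at t)" using regular_at_chart[OF \<gamma> t(2) c ct] by blast
  have "speed \<gamma> t = sqrt (G c (crd c (\<gamma> t)) a a)"
   by (rule speed_chart[OF \<gamma> _ c ct a]) (use t \<tau> in auto)
  then have "m * norm a \<le> sp t" using low[of t a] t by (simp add: sp_def)
  moreover have "f' t = a" using t a unfolding f'_def f_def by (simp add: vector_derivative_at)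
  ultimately show ?thesis using a by (simp add: f_def)
 qed
 have ftc: "(f' has_integral (f \<tau> - f 0)) {0..\<tau>}"
 proof (rule fundamental_theorem_of_calculus_interior_strong[OF finite_irregular[OF pc]])
  show "(f has_vector_derivative f' t) (at t)" if "t \<in> {0<..<\<tau>} - {t\<in>{0..1}. \<not> regular_at \<gamma> t}" for t
   using der[of t] that \<tau> by auto
  show "continuous_on {0..\<tau>} f" unfolding f_def
   by (rule curve_chart_continuous[OF \<gamma> c _ dom]) (use \<tau> in auto)
 qed (use \<tau> in auto)
 have int1: "sp integrable_on {0..1}" using sp(1) by blast
 then have int\<tau>: "sp integrable_on {0..\<tau>}" by (rule integrable_subinterval_real) (use \<tau> in auto)
 have "norm (integral {0..\<tau>} f') \<le> integral {0..\<tau>} (\<lambda>t. sp t / m)"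
 proof (rule integral_norm_bound_integral)
  show "f' integrable_on {0..\<tau>}" using ftc by blast
  show "(\<lambda>t. sp t / m) integrable_on {0..\<tau>}" using int\<tau> by (rule integrable_on_divide)
  show "norm (f' t) \<le> sp t / m" for t
   using der[of t] sp(2)[of t] m by (cases "regular_at \<gamma> t \<and> t \<in> {0<..<\<tau>}") (auto simp: f'_def field_simps)
 qed
 also have "\<dots> = integral {0..\<tau>} sp / m" by simp
 also have "\<dots> \<le> l / m"
 proof -
  have "integral {0..\<tau>} sp \<le> integral {0..1} sp"
   by (rule integral_subset_le[OF _ int\<tau> int1]) (use \<tau> sp(2) in auto)
  then show ?thesis using sp(1) m by (simp add: integral_unique divide_right_mono)
 qed
 finally have "norm (f \<tau> - f 0) \<le> l / m" using ftc by (simp add: integral_unique)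
 then show ?thesis using m by (simp add: f_def field_simps)
qed

lemma compact_chart_image:
 assumes c: "c \<in> A" and K: "compact K" "K \<subseteq> crd c ` dom_of c"
 shows "compactin (mtop A) {v \<in> dom_of c. crd c v \<in> K}"
proof -
 have "continuous_map (top_of_set K) (mtop A) (crd_inv c)"
  unfolding continuous_map_def topspace_mtop
 proof (intro conjI allI impI)
  show "crd_inv c \<in> topspace (top_of_set K) \<rightarrow> carrier_of A" using K(2) carrierI[OF c] by (auto simp: subset_iff)
  fix W assume W: "openin (mtop A) W"
  have "z \<in> crd c ` (W \<inter> dom_of c) \<longleftrightarrow> crd_inv c z \<in> W" if "z \<in> K" for z
  proof
   assume "z \<in> crd c ` (W \<inter> dom_of c)" then show "crd_inv c z \<in> W" using c by auto
  next
   assume w: "crd_inv c z \<in> W"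
   have "z = crd c (crd_inv c z)" "crd_inv c z \<in> dom_of c" using that K(2) by auto
   then show "z \<in> crd c ` (W \<inter> dom_of c)" using w by blast
  qed
  then have "{z \<in> topspace (top_of_set K). crd_inv c z \<in> W} = K \<inter> crd c ` (W \<inter> dom_of c)" by auto
  then show "openin (top_of_set K) {z \<in> topspace (top_of_set K). crd_inv c z \<in> W}"
   using open_image_chart[OF W c] by (simp add: openin_open_Int)
 qed
 then have "compactin (mtop A) (crd_inv c ` K)"
  using image_compactin[of "top_of_set K" K "mtop A" "crd_inv c"] K(1)
  by (simp add: compactin_subtopology)
 moreover have "crd_inv c ` K = {v \<in> dom_of c. crd c v \<in> K}"
  using K(2) c by (auto simp: subset_iff image_iff) (metis crd_inv_crd)
 ultimately show ?thesis by simp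
qed

text \<open>A curve that leaves a compact coordinate ball has a first exit time, and up to this time its length
  is bounded below by the radius. Short curves therefore stay in the chart. The Hausdorff property makes
  the compact coordinate ball closed, which is what excludes that the curve leaves the chart without
  crossing the boundary sphere.\<close>
lemma rdist_lower:
 assumes haus: "Hausdorff_space (mtop A)" and c: "c \<in> A" "x \<in> dom_of c"
 obtains r e C where "r > 0" "e > 0" "C > 0"
  "\<And>y w. y \<in> dom_of c ==> crd c y \<in> ball (crd c x) r ==> lengths y w \<noteq> {} ==> rdist y w < e ==>
   w \<in> dom_of c \<and> norm (crd c w - crd c y) \<le> C * rdist y w"
proof -
 let ?p = "crd c x"
 obtain R m where R: "R > 0" "m > 0" "cball ?p R \<subseteq> crd c ` dom_of c"
  "\<And>z a. z \<in> cball ?p R ==> m * norm a \<le> sqrt (G c z a a)"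
  using local_lengths[OF c] by metis
 define r where "r = R / 2"
 have r: "r > 0" "R = 2 * r" using R by (auto simp: r_def)
 define W where "W = {v \<in> dom_of c. crd c v \<in> ball ?p R}"
 define Ks where "Ks = {v \<in> dom_of c. crd c v \<in> cball ?p R}"
 have W: "openin (mtop A) W" unfolding W_def by (rule openin_chart_preimage[OF c(1) open_ball])
 have Ks: "closedin (mtop A) Ks"
  unfolding Ks_def by (rule compactin_imp_closedin[OF haus compact_chart_image[OF c(1) compact_cball R(3)]])
 have core: "w \<in> dom_of c \<and> m * norm (crd c w - crd c y) \<le> l"
  if y: "y \<in> dom_of c" "crd c y \<in> ball ?p r" and l: "l \<in> lengths y w" "l < m * r" for y w l
 proof -
  obtain \<gamma> where pc: "piecewise_C1_curve A \<gamma>" "\<gamma> 0 = y" "\<gamma> 1 = w" and int: "(speed \<gamma> has_integral l) {0..1}"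
   using l(1) unfolding lengths_def by blast
  have \<gamma>: "mcontinuous_curve A {0..1} \<gamma>" using pc unfolding piecewise_C1_curve_def by blast
  have disp: "m * norm (crd c (\<gamma> \<tau>) - crd c y) \<le> l" if "\<tau> \<in> {0..1}" "\<gamma> ` {0..\<tau>} \<subseteq> Ks" for \<tau>
   unfolding pc(2)[symmetric]
  proof (rule displacement_le_length[OF pc(1) int that(1) c(1) R(2)])
   have in_Ks: "\<gamma> t \<in> Ks" if "t \<in> {0..\<tau>}" for t using \<open>\<gamma> ` {0..\<tau>} \<subseteq> Ks\<close> that by blast
   show "\<gamma> ` {0..\<tau>} \<subseteq> dom_of c" using in_Ks by (auto simp: Ks_def)
   show "m * norm a \<le> sqrt (G c (crd c (\<gamma> t)) a a)" if "t \<in> {0..\<tau>}" for t a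
    using in_Ks[OF that] R(4) by (simp add: Ks_def)
  qed
  define T where "T = {t\<in>{0..1}. \<gamma> t \<notin> W}"
  have "T = {}"
  proof (rule ccontr)
   assume "T \<noteq> {}"
   have "closedin (top_of_set {0..1}) T"
   proof -
    have "{0..1} - T = {t\<in>{0..1}. \<gamma> t \<in> W}" by (auto simp: T_def)
    then have "openin (top_of_set {0..1}) ({0..1} - T)" using curve_preimage_open[OF \<gamma> W] by (simp only:)
    moreover have "T \<subseteq> {0..1}" by (auto simp: T_def)
    ultimately show ?thesis unfolding closedin_def topspace_euclidean_subtopology by (rule conjI[rotated])
   qed
   then have "closed T" using closedin_closed_trans closed_atLeastAtMost by blast
   have bdd: "bdd_below T" by (rule bdd_belowI[of _ 0]) (auto simp: T_def)
   define t where "t = Inf T"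
   have t: "t \<in> T" unfolding t_def by (rule closed_contains_Inf[OF \<open>T \<noteq> {}\<close> bdd \<open>closed T\<close>])
   have before: "\<gamma> s \<in> W" if "0 \<le> s" "s < t" for s
   proof (rule ccontr)
    assume "\<gamma> s \<notin> W"
    then have "s \<in> T" using that t by (auto simp: T_def)
    then have "t \<le> s" unfolding t_def using bdd by (rule cInf_lower)
    then show False using that by simp
   qed
   have "\<gamma> 0 \<in> W" using y pc(2) r by (auto simp: W_def)
   then have t0: "t > 0" using t by (cases "t = 0") (auto simp: T_def)
   have "openin (mtop A) (carrier_of A - Ks)" using Ks unfolding closedin_def topspace_mtop by blast
   have "\<gamma> t \<in> Ks"
   proof (rule ccontr)
    assume n: "\<gamma> t \<notin> Ks"
    have t01: "t \<in> {0..1}" using t by (simp add: T_def)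
    then have "\<gamma> t \<in> carrier_of A - Ks" using curve_in_carrier[OF \<gamma>] n by blast
    from curve_near[OF \<gamma> \<open>openin (mtop A) (carrier_of A - Ks)\<close> t01 this]
    obtain d where d: "d > 0" "\<And>s. s \<in> {0..1} ==> \<bar>s - t\<bar> < d ==> \<gamma> s \<in> carrier_of A - Ks" by blast
    define s where "s = max 0 (t - d/2)"
    have "s \<in> {0..1}" "\<bar>s - t\<bar> < d" "0 \<le> s" "s < t" using t01 t0 d(1) by (auto simp: s_def)
    then have "\<gamma> s \<notin> Ks" "\<gamma> s \<in> W" using d(2) before by auto
    then show False by (auto simp: W_def Ks_def)
   qed
   then have "\<gamma> s \<in> Ks" if "s \<in> {0..t}" for s
    using before[of s] that by (cases "s = t") (auto simp: W_def Ks_def)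
   then have "\<gamma> ` {0..t} \<subseteq> Ks" by blast
   then have "m * norm (crd c (\<gamma> t) - crd c y) \<le> l" using disp[of t] t by (simp add: T_def)
   then have "m * norm (crd c (\<gamma> t) - crd c y) < m * r" using l(2) by linarith
   then have "norm (crd c (\<gamma> t) - crd c y) < r" using R(2) by simp
   then have "dist ?p (crd c (\<gamma> t)) < R"
    using y(2) dist_triangle[of ?p "crd c (\<gamma> t)" "crd c y"] r(2) by (simp add: dist_norm norm_minus_commute)
   then show False using t \<open>\<gamma> t \<in> Ks\<close> by (auto simp: T_def W_def Ks_def)
  qed
  then have all: "\<gamma> t \<in> W" if "t \<in> {0..1}" for t using that by (auto simp: T_def)
  then have "\<gamma> ` {0..1} \<subseteq> Ks" by (fastforce simp: W_def Ks_def)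
  then show ?thesis using disp[of 1] all[of 1] pc(3) by (auto simp: W_def)
 qed
 have "w \<in> dom_of c \<and> norm (crd c w - crd c y) \<le> (1 / m) * rdist y w"
  if y: "y \<in> dom_of c" "crd c y \<in> ball ?p r" and ne: "lengths y w \<noteq> {}" and near: "rdist y w < m * r" for y w
 proof -
  have bdd: "bdd_below (lengths y w)" using lengths_nonneg by (rule bdd_belowI)
  obtain l0 where l0: "l0 \<in> lengths y w" "l0 < m * r"
   using near cInf_less_iff[OF ne bdd] unfolding rdist_eq by blast
  have "m * norm (crd c w - crd c y) \<le> rdist y w"
   unfolding rdist_eq
  proof (rule cInf_greatest[OF ne])
   fix l assume l: "l \<in> lengths y w"
   show "m * norm (crd c w - crd c y) \<le> l"
    using core[OF y l] core[OF y l0] l0(2) by (cases "l < m * r") auto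
  qed
  then show ?thesis using core[OF y l0] R(2) by (simp add: field_simps)
 qed
 then show thesis using that[of r "m * r" "1/m"] r R(2) by simp
qed

end

section \<open>The cotangent bundle as a C1 manifold\<close>

lemma second_difference_mean_value:
 fixes f :: "'a::real_normed_vector => real"
 assumes r: "0 < h" and dom: "\<And>s t. s \<in> {0..h} ==> t \<in> {0..h} ==> z + s *\<^sub>R v + t *\<^sub>R w \<in> S"
  and d1: "\<And>y. y \<in> S ==> (f has_derivative D y) (at y)"
  and d2: "\<And>y. y \<in> S ==> ((\<lambda>y. D y v) has_derivative D2 y) (at y)"
 obtains s t where "s \<in> {0..h}" "t \<in> {0..h}"
  "f (z + h *\<^sub>R v + h *\<^sub>R w) - f (z + h *\<^sub>R v) - f (z + h *\<^sub>R w) + f z = h\<^sup>2 * D2 (z + s *\<^sub>R v + t *\<^sub>R w) w"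
proof -
 define k where "k s = f (z + s *\<^sub>R v + h *\<^sub>R w) - f (z + s *\<^sub>R v)" for s
 define k' where "k' s = D (z + s *\<^sub>R v + h *\<^sub>R w) v - D (z + s *\<^sub>R v) v" for s
 have line: "((\<lambda>s. z + s *\<^sub>R v + t *\<^sub>R w) has_derivative (\<lambda>d. d *\<^sub>R v)) (at s within X)" for s t X
  by (auto intro!: derivative_eq_intros)
 have kd: "(k has_derivative (\<lambda>d. d * k' s)) (at s)" if s: "s \<in> {0..h}" for s
 proof -
  have "(f has_derivative D (z + s *\<^sub>R v + h *\<^sub>R w)) (at (z + s *\<^sub>R v + h *\<^sub>R w))"
   "(f has_derivative D (z + s *\<^sub>R v + 0 *\<^sub>R w)) (at (z + s *\<^sub>R v + 0 *\<^sub>R w))"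
   by (rule d1[OF dom[OF s]], use r in simp)+
  note this[THEN has_derivative_compose[OF line, rotated]]
  moreover have "bounded_linear (D (z + s *\<^sub>R v + h *\<^sub>R w))" "bounded_linear (D (z + s *\<^sub>R v))"
   using d1[THEN has_derivative_bounded_linear] dom[of s h] dom[of s 0] s r by auto
  ultimately show ?thesis
   unfolding k_def k'_def by (auto intro!: derivative_eq_intros simp: linear_simps algebra_simps)
 qed
 obtain s where s: "s \<in> {0<..<h}" "k h - k 0 = h * k' s"
  using mvt_simple[of 0 h k "\<lambda>s d. d * k' s"] r kd by (force intro: has_derivative_at_withinI)
 define l where "l t = D (z + s *\<^sub>R v + t *\<^sub>R w) v" for t
 have line': "((\<lambda>t. z + s *\<^sub>R v + t *\<^sub>R w) has_derivative (\<lambda>d. d *\<^sub>R w)) (at t within X)" for t X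
  by (auto intro!: derivative_eq_intros)
 have ld: "(l has_derivative (\<lambda>d. d * D2 (z + s *\<^sub>R v + t *\<^sub>R w) w)) (at t)" if t: "t \<in> {0..h}" for t
 proof -
  have y: "z + s *\<^sub>R v + t *\<^sub>R w \<in> S" using dom s t by auto
  have "bounded_linear (D2 (z + s *\<^sub>R v + t *\<^sub>R w))" using d2[OF y] has_derivative_bounded_linear by blast
  then show ?thesis
   unfolding l_def using has_derivative_compose[OF line' d2[OF y]] by (simp add: linear_simps)
 qed
 obtain t where t: "t \<in> {0<..<h}" "l h - l 0 = h * D2 (z + s *\<^sub>R v + t *\<^sub>R w) w"
  using mvt_simple[of 0 h l "\<lambda>t d. d * D2 (z + s *\<^sub>R v + t *\<^sub>R w) w"] r ld by (force intro: has_derivative_at_withinI)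
 have "k' s = l h - l 0" by (simp add: k'_def l_def)
 then have "k h - k 0 = h\<^sup>2 * D2 (z + s *\<^sub>R v + t *\<^sub>R w) w" using s(2) t(2) by (simp add: power2_eq_square)
 then show thesis using that[of s t] s(1) t(1) by (auto simp: k_def algebra_simps)
qed

text \<open>Schwarz's theorem, for a second derivative given by iterated directional derivatives: the second difference
  quotient is symmetric in the two directions. It is behind the invariance of the symplectic form.\<close>
lemma symmetric_second_derivative:
 fixes f :: "'a::real_normed_vector => real"
 assumes S: "open S" "z \<in> S"
  and d1: "\<And>y. y \<in> S ==> (f has_derivative D y) (at y)"
  and d2: "\<And>y v. y \<in> S ==> ((\<lambda>y. D y v) has_derivative D2 v y) (at y)"
  and cont: "\<And>v w. continuous_on S (\<lambda>y. D2 v y w)"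
 shows "D2 v z w = D2 w z v"
proof (rule ccontr)
 assume ne: "D2 v z w \<noteq> D2 w z v"
 define e where "e = \<bar>D2 v z w - D2 w z v\<bar> / 2"
 have e: "e > 0" using ne by (simp add: e_def)
 have "continuous (at z) (\<lambda>y. D2 v y w)" "continuous (at z) (\<lambda>y. D2 w y v)"
  using cont S continuous_on_eq_continuous_at by blast+
 then obtain d1' d2' where dd: "d1' > 0" "d2' > 0"
  "\<And>y. dist y z < d1' ==> \<bar>D2 v y w - D2 v z w\<bar> < e" "\<And>y. dist y z < d2' ==> \<bar>D2 w y v - D2 w z v\<bar> < e"
  using e unfolding continuous_at_eps_delta dist_real_def by metis
 obtain R where R: "R > 0" "ball z R \<subseteq> S" using S open_contains_ball by blast
 define \<rho> where "\<rho> = min R (min d1' d2')"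
 have \<rho>: "\<rho> > 0" using R dd by (simp add: \<rho>_def)
 define h where "h = \<rho> / (norm v + norm w + 1)"
 have pos: "norm v + norm w + 1 > 0" by (smt (verit) norm_ge_zero)
 have h: "h > 0" using \<rho> pos by (simp add: h_def)
 have near: "dist (z + s *\<^sub>R v + t *\<^sub>R w) z < \<rho>" if "s \<in> {0..h}" "t \<in> {0..h}" for s t
 proof -
  have "dist (z + s *\<^sub>R v + t *\<^sub>R w) z \<le> \<bar>s\<bar> * norm v + \<bar>t\<bar> * norm w"
   using norm_triangle_ineq[of "s *\<^sub>R v" "t *\<^sub>R w"] by (simp add: dist_norm add.assoc)
  also have "\<dots> \<le> h * norm v + h * norm w" using that by (intro add_mono mult_right_mono) auto
  also have "\<dots> < h * (norm v + norm w + 1)" using h by (simp add: algebra_simps)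
  also have "\<dots> = \<rho>" using pos by (simp add: h_def)
  finally show ?thesis .
 qed
 have dom: "z + s *\<^sub>R v + t *\<^sub>R w \<in> S" if "s \<in> {0..h}" "t \<in> {0..h}" for s t
  using near[OF that] R(2) by (auto simp: \<rho>_def dist_commute subset_iff)
 have dom': "z + s *\<^sub>R w + t *\<^sub>R v \<in> S" if "s \<in> {0..h}" "t \<in> {0..h}" for s t
  using dom[OF that(2,1)] by (simp add: add_ac)
 obtain s t where st: "s \<in> {0..h}" "t \<in> {0..h}"
  "f (z + h *\<^sub>R v + h *\<^sub>R w) - f (z + h *\<^sub>R v) - f (z + h *\<^sub>R w) + f z = h\<^sup>2 * D2 v (z + s *\<^sub>R v + t *\<^sub>R w) w"
  by (rule second_difference_mean_value[OF h dom d1 d2]) auto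
 obtain s' t' where st': "s' \<in> {0..h}" "t' \<in> {0..h}"
  "f (z + h *\<^sub>R w + h *\<^sub>R v) - f (z + h *\<^sub>R w) - f (z + h *\<^sub>R v) + f z = h\<^sup>2 * D2 w (z + s' *\<^sub>R w + t' *\<^sub>R v) v"
  by (rule second_difference_mean_value[OF h dom' d1 d2]) auto
 have "h\<^sup>2 * D2 v (z + s *\<^sub>R v + t *\<^sub>R w) w = h\<^sup>2 * D2 w (z + s' *\<^sub>R w + t' *\<^sub>R v) v"
 proof -
  have perm: "z + h *\<^sub>R w + h *\<^sub>R v = z + h *\<^sub>R v + h *\<^sub>R w" by (simp add: add_ac)
  show ?thesis using st(3) st'(3)[unfolded perm] by linarith
 qed
 then have eq: "D2 v (z + s *\<^sub>R v + t *\<^sub>R w) w = D2 w (z + s' *\<^sub>R w + t' *\<^sub>R v) v" using h by simp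
 have "\<bar>D2 v (z + s *\<^sub>R v + t *\<^sub>R w) w - D2 v z w\<bar> < e"
  using near[OF st(1,2)] by (intro dd(3)) (simp add: \<rho>_def)
 moreover have "\<bar>D2 w (z + s' *\<^sub>R w + t' *\<^sub>R v) v - D2 w z v\<bar> < e"
  using near[OF st'(2,1)] by (intro dd(4)) (simp add: \<rho>_def add_ac)
 moreover have "\<bar>D2 v z w - D2 w z v\<bar> \<le> \<bar>u - D2 w z v\<bar> + \<bar>u - D2 v z w\<bar>" for u
  using abs_triangle_ineq4[of "u - D2 w z v" "u - D2 v z w"] by simp
 ultimately show False using eq unfolding e_def by (smt (verit) field_sum_of_halves)
qed

locale smooth_manifold =
 fixes A :: "('p, 'e::euclidean_space) chart set"
 assumes smooth: "smooth_atlas A"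
begin

sublocale C1_atlas A
proof
 fix c c' assume c: "c \<in> A" and c': "c' \<in> A"
 show "inj_on (crd c) (dom_of c)" "open (crd c ` dom_of c)" using smooth c unfolding smooth_atlas_def by blast+
 show "open (crd c ` (dom_of c \<inter> dom_of c'))" using smooth c c' unfolding smooth_atlas_def by blast
 have "Ck_on (Suc 0) (crd c ` (dom_of c \<inter> dom_of c')) (transition c c')"
  using smooth c c' unfolding smooth_atlas_def smooth_on_def by blast
 then show "\<exists>D. \<forall>z\<in>crd c ` (dom_of c \<inter> dom_of c').
   (transition c c' has_derivative D z) (at z) \<and>
   (\<forall>v. continuous_on (crd c ` (dom_of c \<inter> dom_of c')) (\<lambda>z. D z v))"
  by (intro exI[of _ "\<lambda>z. frechet_derivative (transition c c') (at z)"])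
   (auto simp: frechet_derivative_works[symmetric])
qed

definition D2tr :: "('p, 'e) chart => ('p, 'e) chart => 'e => 'e => 'e => 'e" where
 "D2tr c c' v z = frechet_derivative (\<lambda>z. Dtr c c' z v) (at z)"

lemma Dtr_has_derivative:
 assumes "c \<in> A" "c' \<in> A" "z \<in> crd c ` (dom_of c \<inter> dom_of c')"
 shows "((\<lambda>z. Dtr c c' z v) has_derivative D2tr c c' v z) (at z)"
proof -
 have "Ck_on (Suc (Suc 0)) (crd c ` (dom_of c \<inter> dom_of c')) (transition c c')"
  using smooth assms unfolding smooth_atlas_def smooth_on_def by blast
 then have "(\<lambda>z. Dtr c c' z v) differentiable (at z)" using assms(3) unfolding Dtr_def by auto
 then show ?thesis unfolding D2tr_def frechet_derivative_works .
qed

lemma D2tr_continuous: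
 assumes "c \<in> A" "c' \<in> A"
 shows "continuous_on (crd c ` (dom_of c \<inter> dom_of c')) (\<lambda>z. D2tr c c' v z w)"
proof -
 have "Ck_on (Suc (Suc 0)) (crd c ` (dom_of c \<inter> dom_of c')) (transition c c')"
  using smooth assms unfolding smooth_atlas_def smooth_on_def by blast
 then show ?thesis unfolding D2tr_def Dtr_def by simp
qed

lemma D2tr_symmetric:
 assumes c: "c \<in> A" "c' \<in> A" and x: "x \<in> dom_of c" "x \<in> dom_of c'"
 shows "D2tr c c' v (crd c x) w = D2tr c c' w (crd c x) v"
proof (rule euclidean_eqI)
 fix i :: 'e assume "i \<in> Basis"
 let ?S = "crd c ` (dom_of c \<inter> dom_of c')"
 show "D2tr c c' v (crd c x) w \<bullet> i = D2tr c c' w (crd c x) v \<bullet> i"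
 proof (rule symmetric_second_derivative[where S = ?S and f = "\<lambda>z. transition c c' z \<bullet> i" and D = "\<lambda>z v. Dtr c c' z v \<bullet> i"
    and ?D2.0 = "\<lambda>v z w. D2tr c c' v z w \<bullet> i"])
  show "open ?S" by (rule open_overlap[OF c])
  show "crd c x \<in> ?S" using x by blast
  show "((\<lambda>z. transition c c' z \<bullet> i) has_derivative (\<lambda>v. Dtr c c' y v \<bullet> i)) (at y)" if "y \<in> ?S" for y
   using that transition_has_derivative[OF c] by (auto intro!: has_derivative_inner_left)
  show "((\<lambda>y. Dtr c c' y v \<bullet> i) has_derivative (\<lambda>w. D2tr c c' v y w \<bullet> i)) (at y)" if "y \<in> ?S" for y v
   by (intro has_derivative_inner_left Dtr_has_derivative c that)
  show "continuous_on ?S (\<lambda>y. D2tr c c' v y w \<bullet> i)" for v w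
   by (intro continuous_intros D2tr_continuous c)
 qed
qed

definition mom :: "('p, 'e) chart => ('p, 'e) cot => 'e" where
 "mom c l = (\<Sum>b\<in>Basis. snd l (tvec_of A c (fst l) b) *\<^sub>R b)"

definition covec :: "('p, 'e) chart => 'p => 'e => ('p, 'e) tvec => real" where
 "covec c x p v = (if v \<in> tangent_space A x then p \<bullet> v c else 0)"

lemma dom_cot_chart: "l \<in> dom_of (cot_chart A c) \<longleftrightarrow> fst l \<in> dom_of c \<and> snd l \<in> cotangent_space A (fst l)"
 by (cases l) (simp add: cot_chart_def)

lemma crd_cot_chart: "crd (cot_chart A c) l = (crd c (fst l), mom c l)"
 by (cases l) (simp add: cot_chart_def mom_def)

lemma pairing:
 assumes c: "c \<in> A" and l: "l \<in> dom_of (cot_chart A c)" and v: "v \<in> tangent_space A (fst l)"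
 shows "snd l v = mom c l \<bullet> v c"
proof -
 have x: "fst l \<in> dom_of c" and cot: "snd l \<in> cotangent_space A (fst l)" using l dom_cot_chart by auto
 let ?t = "tvec_of A c (fst l)"
 have L: "snd l (?t (r *\<^sub>R a + s *\<^sub>R b)) = r * snd l (?t a) + s * snd l (?t b)" for r s a b
  using cot tvec_of_in[OF c x] unfolding tvec_of_linear[OF c x] cotangent_space_def by blast
 have lin: "linear (\<lambda>a. snd l (?t a))"
  using L[of 1 _ 1] L[of _ _ 0 0] by (intro linearI) auto
 have "snd l v = snd l (?t (\<Sum>i\<in>Basis. (v c \<bullet> i) *\<^sub>R i))"
  using tangent_eq_tvec_of[OF v c x] by (simp add: euclidean_representation)
 also have "\<dots> = (\<Sum>i\<in>Basis. (v c \<bullet> i) * snd l (?t i))" by (simp add: linear_sum[OF lin] linear_scale[OF lin])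
 also have "\<dots> = mom c l \<bullet> v c" unfolding mom_def inner_sum_left inner_scaleR_left
  by (intro sum.cong refl) (simp add: inner_commute)
 finally show ?thesis .
qed

lemma covec_cot:
 assumes c: "c \<in> A" and x: "x \<in> dom_of c"
 shows "covec c x p \<in> cotangent_space A x"
proof -
 have "(\<lambda>c'. r *\<^sub>R u c' + s *\<^sub>R v c') \<in> tangent_space A x" if "u \<in> tangent_space A x" "v \<in> tangent_space A x" for u v r s
 proof -
  have "tvec_of A c x (r *\<^sub>R u c + s *\<^sub>R v c) = (\<lambda>c'. r *\<^sub>R u c' + s *\<^sub>R v c')"
   unfolding tvec_of_linear[OF c x] using tangent_eq_tvec_of[OF that(1) c x] tangent_eq_tvec_of[OF that(2) c x] by simp
  then show ?thesis using tvec_of_in[OF c x] by metis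
 qed
 then show ?thesis unfolding cotangent_space_def covec_def by (auto simp: inner_add_right)
qed

lemma mom_covec: "c \<in> A ==> x \<in> dom_of c ==> mom c (x, covec c x p) = p"
 unfolding mom_def covec_def by (simp add: euclidean_representation)

lemma cot_eqI:
 assumes c: "c \<in> A" and l: "l \<in> dom_of (cot_chart A c)" "l' \<in> dom_of (cot_chart A c)" "fst l = fst l'" "mom c l = mom c l'"
 shows "l = l'"
proof (rule prod_eqI)
 show "snd l = snd l'"
 proof
  fix v show "snd l v = snd l' v"
  proof (cases "v \<in> tangent_space A (fst l)")
   case True
   then show ?thesis using pairing[OF c l(1) True] pairing[OF c l(2)] l(3,4) by simp
  next
   case False
   then show ?thesis using l unfolding dom_cot_chart cotangent_space_def by auto
  qed
 qed
qed (fact l(3))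

lemma cot_chart_image: "c \<in> A ==> crd (cot_chart A c) ` dom_of (cot_chart A c) = (crd c ` dom_of c) \<times> UNIV"
proof -
 assume c: "c \<in> A"
 have "(crd c x, p) \<in> crd (cot_chart A c) ` dom_of (cot_chart A c)" if "x \<in> dom_of c" for x p
  using that c covec_cot[OF c that, of p]
  by (intro image_eqI[of _ _ "(x, covec c x p)"]) (auto simp: crd_cot_chart dom_cot_chart mom_covec)
 then show ?thesis by (auto simp: crd_cot_chart dom_cot_chart)
qed

lemma inj_cot_chart: "c \<in> A ==> inj_on (crd (cot_chart A c)) (dom_of (cot_chart A c))"
proof (rule inj_onI)
 fix l l' assume c: "c \<in> A" and l: "l \<in> dom_of (cot_chart A c)" "l' \<in> dom_of (cot_chart A c)"
  and eq: "crd (cot_chart A c) l = crd (cot_chart A c) l'"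
 have "fst l = fst l'"
  using eq l inj[OF c] by (auto simp: crd_cot_chart dom_cot_chart inj_on_def)
 then show "l = l'" using cot_eqI[OF c l] eq by (simp add: crd_cot_chart)
qed

lemma crd_inv_cot_chart:
 assumes c: "c \<in> A" and q: "q \<in> crd c ` dom_of c"
 shows "crd_inv (cot_chart A c) (q, p) = (crd_inv c q, covec c (crd_inv c q) p)"
proof -
 have x: "crd_inv c q \<in> dom_of c" using q by simp
 have "crd_inv (cot_chart A c) (crd (cot_chart A c) (crd_inv c q, covec c (crd_inv c q) p)) = (crd_inv c q, covec c (crd_inv c q) p)"
  unfolding crd_inv_def[of "cot_chart A c"]
  by (rule inv_into_f_f[OF inj_cot_chart[OF c]]) (use x covec_cot[OF c x] in \<open>simp add: dom_cot_chart\<close>)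
 then show ?thesis using q x c by (simp add: crd_cot_chart mom_covec)
qed

text \<open>Momenta transform with the adjoint of the inverse transition.\<close>
lemma mom_change:
 assumes c: "c \<in> A" "c' \<in> A" and l: "l \<in> dom_of (cot_chart A c)" "fst l \<in> dom_of c'"
 shows "mom c' l = (\<Sum>b\<in>Basis. (mom c l \<bullet> Dtr c' c (crd c' (fst l)) b) *\<^sub>R b)"
proof -
 have x: "fst l \<in> dom_of c" using l dom_cot_chart by auto
 have "snd l (tvec_of A c' (fst l) b) = mom c l \<bullet> Dtr c' c (crd c' (fst l)) b" for b
  using pairing[OF c(1) l(1) tvec_of_in[OF c(2) l(2)]] c x by (simp add: tvec_of_apply)
 then show ?thesis unfolding mom_def[of c'] by simp
qed

lemma cot_overlap_image:
 assumes "c \<in> A" "c' \<in> A"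
 shows "crd (cot_chart A c) ` (dom_of (cot_chart A c) \<inter> dom_of (cot_chart A c')) = crd c ` (dom_of c \<inter> dom_of c') \<times> UNIV"
proof -
 have "(crd c x, p) \<in> crd (cot_chart A c) ` (dom_of (cot_chart A c) \<inter> dom_of (cot_chart A c'))" if "x \<in> dom_of c" "x \<in> dom_of c'" for x p
  using that assms covec_cot[OF assms(1) that(1), of p]
  by (intro image_eqI[of _ _ "(x, covec c x p)"]) (auto simp: crd_cot_chart dom_cot_chart mom_covec)
 then show ?thesis by (auto simp: crd_cot_chart dom_cot_chart)
qed

lemma transition_cot:
 assumes c: "c \<in> A" "c' \<in> A" and q: "q \<in> crd c ` (dom_of c \<inter> dom_of c')"
 shows "transition (cot_chart A c) (cot_chart A c') (q, p) =
  (transition c c' q, \<Sum>b\<in>Basis. (p \<bullet> Dtr c' c (transition c c' q) b) *\<^sub>R b)"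
proof -
 obtain x where x: "q = crd c x" "x \<in> dom_of c" "x \<in> dom_of c'" using q by blast
 let ?l = "(x, covec c x p)"
 have l: "?l \<in> dom_of (cot_chart A c)" using x covec_cot[OF c(1)] by (simp add: dom_cot_chart)
 have "transition (cot_chart A c) (cot_chart A c') (q, p) = crd (cot_chart A c') ?l"
  unfolding transition_def using crd_inv_cot_chart[OF c(1), of q p] x c by simp
 then show ?thesis using mom_change[OF c l] x c by (simp add: crd_cot_chart mom_covec)
qed

text \<open>The derivative of the transition map between canonical charts.\<close>
definition Dcot :: "('p, 'e) chart => ('p, 'e) chart => 'e \<times> 'e => 'e \<times> 'e => 'e \<times> 'e" where
 "Dcot c c' z d = (Dtr c c' (fst z) (fst d), \<Sum>b\<in>Basis. (snd d \<bullet> Dtr c' c (transition c c' (fst z)) b +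
   snd z \<bullet> D2tr c' c b (transition c c' (fst z)) (Dtr c c' (fst z) (fst d))) *\<^sub>R b)"

lemma transition_in: "c \<in> A ==> q \<in> crd c ` (dom_of c \<inter> dom_of c') ==> transition c c' q \<in> crd c' ` (dom_of c' \<inter> dom_of c)"
 by auto

lemma transition_cot_has_derivative:
 assumes c: "c \<in> A" "c' \<in> A" and z: "fst z \<in> crd c ` (dom_of c \<inter> dom_of c')"
 shows "(transition (cot_chart A c) (cot_chart A c') has_derivative Dcot c c' z) (at z)"
proof -
 let ?S = "crd c ` (dom_of c \<inter> dom_of c')"
 have d1: "((\<lambda>z. transition c c' (fst z)) has_derivative (\<lambda>d. Dtr c c' (fst z) (fst d))) (at z)"
  using has_derivative_compose[OF has_derivative_fst[OF has_derivative_ident], of "transition c c'" "Dtr c c' (fst z)" z UNIV]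
   transition_has_derivative[OF c] z by auto
 have d2: "((\<lambda>z. Dtr c' c (transition c c' (fst z)) b) has_derivative
   (\<lambda>d. D2tr c' c b (transition c c' (fst z)) (Dtr c c' (fst z) (fst d)))) (at z)" for b
  using has_derivative_compose[OF d1, of "\<lambda>w. Dtr c' c w b"] Dtr_has_derivative[OF c(2,1) transition_in[OF c(1) z]] by blast
 have "((\<lambda>z. (transition c c' (fst z), \<Sum>b\<in>Basis. (snd z \<bullet> Dtr c' c (transition c c' (fst z)) b) *\<^sub>R b)) has_derivative Dcot c c' z) (at z)"
  unfolding Dcot_def
  by (rule derivative_eq_intros d1 d2 refl | simp)+ (auto intro!: sum.cong simp: fun_eq_iff add.commute)
 then show ?thesis
 proof (rule has_derivative_transform_within_open)
  show "open (?S \<times> (UNIV :: 'e set))" using open_overlap[OF c] by (intro open_Times) auto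
  show "z \<in> ?S \<times> UNIV" using z by (cases z) auto
  show "(transition c c' (fst w), \<Sum>b\<in>Basis. (snd w \<bullet> Dtr c' c (transition c c' (fst w)) b) *\<^sub>R b) =
    transition (cot_chart A c) (cot_chart A c') w" if "w \<in> ?S \<times> UNIV" for w
   using transition_cot[OF c, of "fst w" "snd w"] that by auto
 qed
qed

lemma Dcot_continuous:
 assumes c: "c \<in> A" "c' \<in> A"
 shows "continuous_on (crd c ` (dom_of c \<inter> dom_of c') \<times> UNIV) (\<lambda>z. Dcot c c' z d)"
proof -
 let ?S = "crd c ` (dom_of c \<inter> dom_of c') \<times> (UNIV :: 'e set)"
 have f: "continuous_on ?S (\<lambda>z. h (fst z))" if "continuous_on (crd c ` (dom_of c \<inter> dom_of c')) h" for h :: "'e => 'e"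
  by (rule continuous_on_compose2[OF that continuous_on_fst[OF continuous_on_id]]) auto
 have t: "continuous_on (crd c ` (dom_of c \<inter> dom_of c')) (\<lambda>q. h (transition c c' q))"
  if "continuous_on (crd c' ` (dom_of c' \<inter> dom_of c)) h" for h :: "'e => 'e"
  by (rule continuous_on_compose2[OF that transition_continuous[OF c]]) (use transition_in[OF c(1)] in blast)
 have exp: "D2tr c' c b (transition c c' (fst z)) (Dtr c c' (fst z) (fst d)) =
   (\<Sum>i\<in>Basis. (Dtr c c' (fst z) (fst d) \<bullet> i) *\<^sub>R D2tr c' c b (transition c c' (fst z)) i)" if "z \<in> ?S" for z b
 proof -
  have "transition c c' (fst z) \<in> crd c' ` (dom_of c' \<inter> dom_of c)" using that c by auto
  then have lin: "linear (D2tr c' c b (transition c c' (fst z)))"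
   using Dtr_has_derivative[OF c(2,1)] has_derivative_linear by blast
  have "D2tr c' c b (transition c c' (fst z)) (Dtr c c' (fst z) (fst d)) =
    D2tr c' c b (transition c c' (fst z)) (\<Sum>i\<in>Basis. (Dtr c c' (fst z) (fst d) \<bullet> i) *\<^sub>R i)"
   by (simp add: euclidean_representation)
  then show ?thesis by (simp add: linear_sum[OF lin] linear_scale[OF lin])
 qed
 have "continuous_on ?S (\<lambda>z. (Dtr c c' (fst z) (fst d), \<Sum>b\<in>Basis. (snd d \<bullet> Dtr c' c (transition c c' (fst z)) b +
   snd z \<bullet> (\<Sum>i\<in>Basis. (Dtr c c' (fst z) (fst d) \<bullet> i) *\<^sub>R D2tr c' c b (transition c c' (fst z)) i)) *\<^sub>R b))"
  by (intro continuous_intros f[OF Dtr_continuous[OF c]] f[OF t[OF Dtr_continuous[OF c(2,1)]]] f[OF t[OF D2tr_continuous[OF c(2,1)]]])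
 then show ?thesis unfolding Dcot_def by (rule continuous_on_cong[THEN iffD1, rotated 2]) (use exp in auto)
qed

sublocale TM: C1_atlas "cot_atlas A"
proof
 fix C C' assume "C \<in> cot_atlas A" "C' \<in> cot_atlas A"
 then obtain c c' where c: "c \<in> A" "c' \<in> A" and C: "C = cot_chart A c" "C' = cot_chart A c'"
  unfolding cot_atlas_def by blast
 show "inj_on (crd C) (dom_of C)" unfolding C by (rule inj_cot_chart[OF c(1)])
 show "open (crd C ` dom_of C)" unfolding C cot_chart_image[OF c(1)] by (intro open_Times open_range c) auto
 show "open (crd C ` (dom_of C \<inter> dom_of C'))" unfolding C cot_overlap_image[OF c] by (intro open_Times open_overlap c) auto
 show "\<exists>D. \<forall>z\<in>crd C ` (dom_of C \<inter> dom_of C'). (transition C C' has_derivative D z) (at z) \<and>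
   (\<forall>v. continuous_on (crd C ` (dom_of C \<inter> dom_of C')) (\<lambda>z. D z v))"
  unfolding C cot_overlap_image[OF c]
  using transition_cot_has_derivative[OF c] Dcot_continuous[OF c] by (intro exI[of _ "Dcot c c'"]) auto
qed

end

section \<open>Hamiltonian vector fields in canonical coordinates\<close>

lemma linear_expand:
 fixes f :: "'a::euclidean_space => real"
 assumes "linear f" shows "f a = (\<Sum>b\<in>Basis. (a \<bullet> b) * f b)"
proof -
 have "f a = f (\<Sum>b\<in>Basis. (a \<bullet> b) *\<^sub>R b)" by (simp add: euclidean_representation)
 then show ?thesis by (simp add: linear_sum[OF assms] linear_scale[OF assms])
qed

context smooth_manifold begin

lemma cot_chart_in: "c \<in> A ==> cot_chart A c \<in> cot_atlas A"
 by (simp add: cot_atlas_def)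

lemma carrier_cot: "carrier_of (cot_atlas A) = {l. fst l \<in> carrier_of A \<and> snd l \<in> cotangent_space A (fst l)}"
 unfolding carrier_of_def cot_atlas_def by (simp add: set_eq_iff dom_cot_chart)

lemma TM_Dtr_eq:
 assumes c: "c \<in> A" "c' \<in> A" and l: "l \<in> dom_of (cot_chart A c)" "fst l \<in> dom_of c'"
 shows "TM.Dtr (cot_chart A c) (cot_chart A c') (crd (cot_chart A c) l) = Dcot c c' (crd (cot_chart A c) l)"
 unfolding TM.Dtr_def
 by (rule frechet_derivative_at[symmetric], rule transition_cot_has_derivative[OF c])
  (use l in \<open>auto simp: crd_cot_chart dom_cot_chart\<close>)

lemma dom_cot_chart_change: "l \<in> dom_of (cot_chart A c) ==> fst l \<in> dom_of c' ==> l \<in> dom_of (cot_chart A c')"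
 by (simp add: dom_cot_chart)

lemma some_cot_chart:
 assumes "l \<in> carrier_of (cot_atlas A)"
 obtains c where "c \<in> A" "some_chart (cot_atlas A) l = cot_chart A c" "l \<in> dom_of (cot_chart A c)"
proof -
 have "\<exists>C. C \<in> cot_atlas A \<and> l \<in> dom_of C" using assms unfolding carrier_of_def by blast
 then have "some_chart (cot_atlas A) l \<in> cot_atlas A \<and> l \<in> dom_of (some_chart (cot_atlas A) l)"
  unfolding some_chart_def by (rule someI_ex)
 then show thesis using that unfolding cot_atlas_def by auto
qed

lemma proj_push_eq:
 assumes c: "c \<in> A" and l: "l \<in> dom_of (cot_chart A c)" and w: "w \<in> tangent_space (cot_atlas A) l"
 shows "proj_push A l w = tvec_of A c (fst l) (fst (w (cot_chart A c)))"
proof -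
 obtain c0 where c0: "c0 \<in> A" "some_chart (cot_atlas A) l = cot_chart A c0" "l \<in> dom_of (cot_chart A c0)"
  using some_cot_chart TM.carrierI[OF cot_chart_in[OF c] l] by blast
 let ?K = "cot_chart A c0"
 have x: "fst l \<in> dom_of c0" "fst l \<in> dom_of c" using c0 l dom_cot_chart by auto
 have fd: "frechet_derivative (crd c' \<circ> fst \<circ> crd_inv ?K) (at (crd ?K l)) (w ?K) = Dtr c0 c' (crd c0 (fst l)) (fst (w ?K))"
  if c': "c' \<in> A" "fst l \<in> dom_of c'" for c'
 proof -
  have "((\<lambda>z. transition c0 c' (fst z)) has_derivative (\<lambda>d. Dtr c0 c' (crd c0 (fst l)) (fst d))) (at (crd ?K l))"
   using has_derivative_compose[OF has_derivative_fst[OF has_derivative_ident], of "transition c0 c'" "Dtr c0 c' (crd c0 (fst l))" "crd ?K l" UNIV]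
    transition_has_derivative[OF c0(1) c'(1) x(1) c'(2)] by (simp add: crd_cot_chart)
  then have "(crd c' \<circ> fst \<circ> crd_inv ?K has_derivative (\<lambda>d. Dtr c0 c' (crd c0 (fst l)) (fst d))) (at (crd ?K l))"
  proof (rule has_derivative_transform_within_open)
   show "open (crd ?K ` dom_of ?K)" using TM.open_range cot_chart_in[OF c0(1)] by blast
   show "transition c0 c' (fst z) = (crd c' \<circ> fst \<circ> crd_inv ?K) z" if "z \<in> crd ?K ` dom_of ?K" for z
    using that unfolding cot_chart_image[OF c0(1)]
    by (cases z) (auto simp: crd_inv_cot_chart[OF c0(1)] c0(1))
  qed (use c0 in auto)
  from frechet_derivative_at[OF this, symmetric] show ?thesis by simp
 qed
 have 1: "proj_push A l w = tvec_of A c0 (fst l) (fst (w ?K))"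
  unfolding proj_push_def pushforward_def Let_def c0(2)
  by (rule ext) (use fd in \<open>auto simp: tvec_of_def Dtr_def\<close>)
 have "w (cot_chart A c) = TM.Dtr ?K (cot_chart A c) (crd ?K l) (w ?K)"
  by (rule TM.tangent_change[OF w cot_chart_in[OF c0(1)] cot_chart_in[OF c] c0(3) l])
 then have "fst (w (cot_chart A c)) = Dtr c0 c (crd c0 (fst l)) (fst (w ?K))"
  unfolding TM_Dtr_eq[OF c0(1) c c0(3) x(2)] by (simp add: Dcot_def crd_cot_chart)
 then show ?thesis unfolding 1 using tvec_of_change[OF c0(1) c x] by simp
qed

lemma liouville_chart:
 assumes c: "c \<in> A" and l: "l \<in> dom_of (cot_chart A c)" and w: "w \<in> tangent_space (cot_atlas A) l"
 shows "liouville_form A l w = mom c l \<bullet> fst (w (cot_chart A c))"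
proof -
 have x: "fst l \<in> dom_of c" using l dom_cot_chart by auto
 show ?thesis unfolding liouville_form_def proj_push_eq[OF c l w]
  using pairing[OF c l tvec_of_in[OF c x]] c x by simp
qed

lemma has_velocity_projection:
 assumes vel: "has_velocity (cot_atlas A) \<gamma> t w" and near: "mcontinuous_curve (cot_atlas A) S \<gamma>" "t \<in> interior S"
 shows "has_velocity A (\<lambda>s. fst (\<gamma> s)) t (proj_push A (\<gamma> t) w)"
proof -
 have w: "w \<in> tangent_space (cot_atlas A) (\<gamma> t)" using vel unfolding has_velocity_def by blast
 have "\<gamma> t \<in> carrier_of (cot_atlas A)" using TM.curve_in_carrier near interior_subset by blast
 then obtain c0 where c0: "c0 \<in> A" "\<gamma> t \<in> dom_of (cot_chart A c0)" using some_cot_chart by metis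
 have push: "proj_push A (\<gamma> t) w = tvec_of A c (fst (\<gamma> t)) (fst (w (cot_chart A c)))"
  if "c \<in> A" "fst (\<gamma> t) \<in> dom_of c" for c
  using proj_push_eq[OF that(1) _ w] dom_cot_chart_change[OF c0(2) that(2)] by simp
 show ?thesis
  unfolding has_velocity_def
 proof (intro conjI ballI impI)
  have x0: "fst (\<gamma> t) \<in> dom_of c0" using c0 dom_cot_chart by auto
  show "proj_push A (\<gamma> t) w \<in> tangent_space A (fst (\<gamma> t))"
   using push[OF c0(1) x0] tvec_of_in[OF c0(1) x0] by simp
  fix c assume c: "c \<in> A" "fst (\<gamma> t) \<in> dom_of c"
  have l: "\<gamma> t \<in> dom_of (cot_chart A c)" using dom_cot_chart_change[OF c0(2) c(2)] .
  have "((crd (cot_chart A c) \<circ> \<gamma>) has_vector_derivative w (cot_chart A c)) (at t)"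
   using vel l cot_chart_in[OF c(1)] unfolding has_velocity_def by blast
  then have "((\<lambda>s. fst ((crd (cot_chart A c) \<circ> \<gamma>) s)) has_vector_derivative fst (w (cot_chart A c))) (at t)"
   by (rule bounded_linear.has_vector_derivative[OF bounded_linear_fst])
  moreover have "(\<lambda>s. fst ((crd (cot_chart A c) \<circ> \<gamma>) s)) = crd c \<circ> (\<lambda>s. fst (\<gamma> s))"
   by (auto simp: crd_cot_chart)
  ultimately show "((crd c \<circ> (\<lambda>s. fst (\<gamma> s))) has_vector_derivative proj_push A (\<gamma> t) w c) (at t)"
   using push[OF c] c by simp
 qed
qed

definition \<omega> :: "'e \<times> 'e => 'e \<times> 'e => real" where
 "\<omega> v w = snd v \<bullet> fst w - snd w \<bullet> fst v"

text \<open>The terms with second derivatives of the transition cancel by their symmetry; the remaining ones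
  reproduce \<open>\<omega>\<close> because momenta transform contragrediently.\<close>
lemma \<omega>_invariant:
 assumes c: "c \<in> A" "c' \<in> A" and l: "l \<in> dom_of (cot_chart A c)" "fst l \<in> dom_of c'"
 shows "\<omega> (Dcot c c' (crd (cot_chart A c) l) v) (Dcot c c' (crd (cot_chart A c) l) w) = \<omega> v w"
proof -
 let ?z = "crd (cot_chart A c) l" and ?q = "crd c (fst l)"
 let ?P = "\<lambda>z. snd (transition (cot_chart A c) (cot_chart A c') z)"
 have x: "fst l \<in> dom_of c" "fst l \<in> dom_of c'" using l dom_cot_chart by auto
 have z: "fst ?z = ?q" "snd ?z = mom c l" by (simp_all add: crd_cot_chart)
 let ?S = "crd c ` (dom_of c \<inter> dom_of c')"
 have qS: "fst ?z \<in> ?S" using x z by auto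
 have ident: "?P y \<bullet> Dtr c c' (fst y) a = snd y \<bullet> a" if yS: "y \<in> ?S \<times> UNIV" for y a
 proof -
  obtain x' p where y: "y = (crd c x', p)" "x' \<in> dom_of c" "x' \<in> dom_of c'" using yS by auto
  have "bounded_linear (Dtr c' c (crd c' x'))" by (rule Dtr_linear[OF c(2,1) y(3,2)])
  then have lin: "linear (Dtr c' c (crd c' x'))" by (rule bounded_linear.linear)
  have "?P y \<bullet> Dtr c c' (fst y) a = (\<Sum>b\<in>Basis. (Dtr c c' (crd c x') a \<bullet> b) * (p \<bullet> Dtr c' c (crd c' x') b))"
   using transition_cot[OF c, of "crd c x'" p] y c by (simp add: inner_sum_left) (intro sum.cong refl, simp add: inner_commute)
  also have "\<dots> = p \<bullet> Dtr c' c (crd c' x') (\<Sum>b\<in>Basis. (Dtr c c' (crd c x') a \<bullet> b) *\<^sub>R b)"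
   by (simp add: linear_sum[OF lin] linear_scale[OF lin] inner_sum_right)
  also have "\<dots> = p \<bullet> Dtr c' c (crd c' x') (Dtr c c' (crd c x') a)" by (simp add: euclidean_representation)
  also have "\<dots> = p \<bullet> a"
   using Dtr_chain[OF c c(1) y(2,3,2)] Dtr_refl[OF c(1) y(2)] by simp
  finally show ?thesis using y by simp
 qed
 have key: "snd (Dcot c c' ?z v) \<bullet> Dtr c c' ?q a + ?P ?z \<bullet> D2tr c c' a ?q (fst v) = snd v \<bullet> a" for v a
 proof -
  have P: "(?P has_derivative (\<lambda>v. snd (Dcot c c' ?z v))) (at ?z)"
   by (rule has_derivative_snd[OF transition_cot_has_derivative[OF c qS]])
  have D: "((\<lambda>y. Dtr c c' (fst y) a) has_derivative (\<lambda>v. D2tr c c' a ?q (fst v))) (at ?z)"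
   using has_derivative_compose[OF has_derivative_fst[OF has_derivative_ident], of "\<lambda>q. Dtr c c' q a" "D2tr c c' a ?q" ?z UNIV]
    Dtr_has_derivative[OF c, of ?q] qS z by auto
  have "((\<lambda>y. snd y \<bullet> a) has_derivative (\<lambda>v. snd (Dcot c c' ?z v) \<bullet> Dtr c c' (fst ?z) a + ?P ?z \<bullet> D2tr c c' a ?q (fst v))) (at ?z)"
  proof (rule has_derivative_transform_within_open)
   show "((\<lambda>y. ?P y \<bullet> Dtr c c' (fst y) a) has_derivative (\<lambda>v. snd (Dcot c c' ?z v) \<bullet> Dtr c c' (fst ?z) a + ?P ?z \<bullet> D2tr c c' a ?q (fst v))) (at ?z)"
    using has_derivative_inner[OF P D] by (simp add: add.commute)
   show "open (?S \<times> (UNIV :: 'e set))" using open_overlap[OF c] by (intro open_Times) auto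
   show "?z \<in> ?S \<times> UNIV" using qS by (cases ?z) auto
  qed (rule ident)
  moreover have "((\<lambda>y. snd y \<bullet> a) has_derivative (\<lambda>v. snd v \<bullet> a)) (at ?z)"
   by (auto intro!: derivative_eq_intros)
  ultimately have "(\<lambda>v. snd (Dcot c c' ?z v) \<bullet> Dtr c c' (fst ?z) a + ?P ?z \<bullet> D2tr c c' a ?q (fst v)) = (\<lambda>v. snd v \<bullet> a)"
   by (rule has_derivative_unique)
  from fun_cong[OF this, of v] show ?thesis by (simp add: z)
 qed
 have f: "fst (Dcot c c' ?z v) = Dtr c c' ?q (fst v)" for v by (simp add: Dcot_def z)
 show ?thesis
  unfolding \<omega>_def f using key[of v "fst w"] key[of w "fst v"] D2tr_symmetric[OF c x, of "fst w" "fst v"]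
  by simp
qed

text \<open>The exterior derivative is defined in a selected chart, where it is computed to be \<open>\<omega>\<close>; invariance of \<open>\<omega>\<close>
 transfers the result to all canonical charts.\<close>
lemma symplectic_chart:
 assumes c: "c \<in> A" and l: "l \<in> dom_of (cot_chart A c)"
  and v: "v \<in> tangent_space (cot_atlas A) l" and w: "w \<in> tangent_space (cot_atlas A) l"
 shows "symplectic_form A l v w = \<omega> (v (cot_chart A c)) (w (cot_chart A c))"
proof -
 obtain c0 where c0: "c0 \<in> A" "some_chart (cot_atlas A) l = cot_chart A c0" "l \<in> dom_of (cot_chart A c0)"
  using some_cot_chart TM.carrierI[OF cot_chart_in[OF c] l] by blast
 let ?K = "cot_chart A c0"
 have x: "fst l \<in> dom_of c0" "fst l \<in> dom_of c" using c0 l dom_cot_chart by auto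
 define comp where "comp a z = liouville_form A (crd_inv ?K z) (tvec_of (cot_atlas A) ?K (crd_inv ?K z) a)" for a z
 have fd: "frechet_derivative (comp a) (at (crd ?K l)) d = snd d \<bullet> fst a" for a d
 proof -
  have "(comp a has_derivative (\<lambda>d. snd d \<bullet> fst a)) (at (crd ?K l))"
  proof (rule has_derivative_transform_within_open)
   show "((\<lambda>z. snd z \<bullet> fst a) has_derivative (\<lambda>d. snd d \<bullet> fst a)) (at (crd ?K l))"
    by (auto intro!: derivative_eq_intros)
   show "open (crd ?K ` dom_of ?K)" using TM.open_range cot_chart_in[OF c0(1)] by blast
   show "crd ?K l \<in> crd ?K ` dom_of ?K" using c0 by blast
   fix z assume z: "z \<in> crd ?K ` dom_of ?K"
   have m: "mom c0 (crd_inv ?K z) = snd z" using TM.crd_crd_inv[OF z] by (metis crd_cot_chart snd_conv)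
   show "snd z \<bullet> fst a = comp a z"
    unfolding comp_def liouville_chart[OF c0(1) TM.crd_inv_in[OF z] TM.tvec_of_in[OF cot_chart_in[OF c0(1)] TM.crd_inv_in[OF z]]] m
    using TM.tvec_of_self[OF cot_chart_in[OF c0(1)] TM.crd_inv_in[OF z]] by simp
  qed
  from frechet_derivative_at[OF this, symmetric] show ?thesis by simp
 qed
 have 1: "symplectic_form A l v w = \<omega> (v ?K) (w ?K)"
  unfolding symplectic_form_def ext_deriv_def Let_def c0(2) comp_def[symmetric] fd \<omega>_def ..
 have ch: "u (cot_chart A c) = Dcot c0 c (crd ?K l) (u ?K)" if "u \<in> tangent_space (cot_atlas A) l" for u
  using TM.tangent_change[OF that cot_chart_in[OF c0(1)] cot_chart_in[OF c] c0(3) l]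
  unfolding TM_Dtr_eq[OF c0(1) c c0(3) x(2)] .
 show ?thesis unfolding 1 ch[OF v] ch[OF w] by (rule \<omega>_invariant[OF c0(1) c c0(3) x(2), symmetric])
qed

text \<open>Non-degeneracy of \<open>\<omega>\<close> makes the defining description unique and solvable, and the solution is the
  canonical Hamiltonian field in every chart, at each point of differentiability.\<close>
lemma hamiltonian_vector_chart:
 assumes h: "mdifferentiable_at (cot_atlas A) h l" and c: "c \<in> A" and l: "l \<in> dom_of (cot_chart A c)"
 defines "X \<equiv> hamiltonian_vector A h l"
 shows "X \<in> tangent_space (cot_atlas A) l"
  and "(h \<circ> crd_inv (cot_chart A c) has_derivative
   (\<lambda>d. snd d \<bullet> fst (X (cot_chart A c)) - fst d \<bullet> snd (X (cot_chart A c)))) (at (crd (cot_chart A c) l))"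
proof -
 let ?C = "cot_chart A c" and ?T = "tangent_space (cot_atlas A) l"
 note C = cot_chart_in[OF c]
 define D where "D = frechet_derivative (h \<circ> crd_inv ?C) (at (crd ?C l))"
 have D: "(h \<circ> crd_inv ?C has_derivative D) (at (crd ?C l))"
  using h C l unfolding mdifferentiable_at_def D_def by (simp add: frechet_derivative_works[symmetric])
 have lin: "linear D" using D by (rule has_derivative_linear)
 define X0 where "X0 = tvec_of (cot_atlas A) ?C l (\<Sum>b\<in>Basis. D (0, b) *\<^sub>R b, - (\<Sum>b\<in>Basis. D (b, 0) *\<^sub>R b))"
 have X0: "X0 \<in> ?T" "X0 ?C = (\<Sum>b\<in>Basis. D (0, b) *\<^sub>R b, - (\<Sum>b\<in>Basis. D (b, 0) *\<^sub>R b))"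
  unfolding X0_def using TM.tvec_of_in[OF C l] TM.tvec_of_self[OF C l] by blast+
 have D\<omega>: "D d = \<omega> d (X0 ?C)" for d
 proof -
  have "linear (\<lambda>a. D (a, 0))"
  proof (rule linearI)
   show "D (a + a', 0) = D (a, 0) + D (a', 0)" for a a' using linear_add[OF lin, of "(a, 0)" "(a', 0)"] by simp
   show "D (r *\<^sub>R a, 0) = r *\<^sub>R D (a, 0)" for r a using linear_scale[OF lin, of r "(a, 0)"] by simp
  qed
  moreover have "linear (\<lambda>b. D (0, b))"
  proof (rule linearI)
   show "D (0, a + a') = D (0, a) + D (0, a')" for a a' using linear_add[OF lin, of "(0, a)" "(0, a')"] by simp
   show "D (0, r *\<^sub>R a) = r *\<^sub>R D (0, a)" for r a using linear_scale[OF lin, of r "(0, a)"] by simp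
  qed
  ultimately have lins: "linear (\<lambda>a. D (a, 0))" "linear (\<lambda>b. D (0, b))" .
  from linear_expand[OF lins(1)] linear_expand[OF lins(2)]
  have "D (a, 0) = (\<Sum>b\<in>Basis. (a \<bullet> b) * D (b, 0))" "D (0, a) = (\<Sum>b\<in>Basis. (a \<bullet> b) * D (0, b))" for a
   by blast+
  note parts = this
  have "D d = D (fst d, 0) + D (0, snd d)"
   using linear_add[OF lin, of "(fst d, 0)" "(0, snd d)"] by simp
  moreover have "(\<Sum>b\<in>Basis. D (b, 0) *\<^sub>R b) \<bullet> fst d = D (fst d, 0)"
   unfolding parts(1)[of "fst d"] inner_sum_left by (intro sum.cong refl) (simp add: inner_commute)
  moreover have "snd d \<bullet> (\<Sum>b\<in>Basis. D (0, b) *\<^sub>R b) = D (0, snd d)"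
   unfolding parts(2)[of "snd d"] inner_sum_right by (intro sum.cong refl) simp
  ultimately show ?thesis unfolding \<omega>_def X0(2) by simp
 qed
 have char: "(\<forall>v\<in>?T. differential (cot_atlas A) h l v = symplectic_form A l v Y) \<longleftrightarrow> (\<forall>d. D d = \<omega> d (Y ?C))" if Y: "Y \<in> ?T" for Y
 proof
  assume L: "\<forall>v\<in>?T. differential (cot_atlas A) h l v = symplectic_form A l v Y"
  show "\<forall>d. D d = \<omega> d (Y ?C)"
  proof
   fix d
   let ?v = "tvec_of (cot_atlas A) ?C l d"
   have v: "?v \<in> ?T" "?v ?C = d" using TM.tvec_of_in[OF C l] TM.tvec_of_self[OF C l] by blast+
   show "D d = \<omega> d (Y ?C)"
    using L[rule_format, OF v(1)] unfolding TM.differential_chart[OF h C l v(1)] symplectic_chart[OF c l v(1) Y] v(2) D_def .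
  qed
 next
  assume R: "\<forall>d. D d = \<omega> d (Y ?C)"
  show "\<forall>v\<in>?T. differential (cot_atlas A) h l v = symplectic_form A l v Y"
  proof
   fix v assume v: "v \<in> ?T"
   show "differential (cot_atlas A) h l v = symplectic_form A l v Y"
    unfolding TM.differential_chart[OF h C l v] symplectic_chart[OF c l v Y] D_def[symmetric] using R by blast
  qed
 qed
 have "\<exists>!X. X \<in> ?T \<and> (\<forall>v\<in>?T. differential (cot_atlas A) h l v = symplectic_form A l v X)"
 proof (rule ex1I[of _ X0])
  show "X0 \<in> ?T \<and> (\<forall>v\<in>?T. differential (cot_atlas A) h l v = symplectic_form A l v X0)"
   using X0(1) char[OF X0(1)] D\<omega> by blast
  fix Y assume Y: "Y \<in> ?T \<and> (\<forall>v\<in>?T. differential (cot_atlas A) h l v = symplectic_form A l v Y)"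
  then have "\<omega> d (Y ?C) = \<omega> d (X0 ?C)" for d using char[of Y] D\<omega> by metis
  from this[of "(0, fst (Y ?C) - fst (X0 ?C))"] this[of "(snd (Y ?C) - snd (X0 ?C), 0)"]
  have "(fst (Y ?C) - fst (X0 ?C)) \<bullet> (fst (Y ?C) - fst (X0 ?C)) = 0" "(snd (Y ?C) - snd (X0 ?C)) \<bullet> (snd (Y ?C) - snd (X0 ?C)) = 0"
   unfolding \<omega>_def by (simp_all add: inner_diff_left inner_diff_right inner_commute)
  then have "Y ?C = X0 ?C" by (simp add: prod_eq_iff)
  then show "Y = X0" using TM.tangent_eq_tvec_of[OF _ C l, of Y] TM.tangent_eq_tvec_of[OF X0(1) C l] Y by simp
 qed
 from theI'[OF this] have X: "X \<in> ?T \<and> (\<forall>v\<in>?T. differential (cot_atlas A) h l v = symplectic_form A l v X)"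
  unfolding X_def hamiltonian_vector_def .
 then show "X \<in> ?T" by blast
 have "D = (\<lambda>d. snd d \<bullet> fst (X ?C) - fst d \<bullet> snd (X ?C))"
  using X char[of X] by (auto simp: \<omega>_def inner_commute)
 then show "(h \<circ> crd_inv ?C has_derivative (\<lambda>d. snd d \<bullet> fst (X ?C) - fst d \<bullet> snd (X ?C))) (at (crd ?C l))" using D by simp
qed

lemma openin_cot_preimage:
 assumes "openin (mtop A) U"
 shows "openin (mtop (cot_atlas A)) {l \<in> carrier_of (cot_atlas A). fst l \<in> U}"
 unfolding TM.openin_mtop_C1
proof (intro conjI ballI)
 fix C assume "C \<in> cot_atlas A"
 then obtain c where c: "c \<in> A" and C: "C = cot_chart A c" unfolding cot_atlas_def by blast
 have "(crd c x, p) \<in> crd C ` ({l \<in> carrier_of (cot_atlas A). fst l \<in> U} \<inter> dom_of C)" if "x \<in> U" "x \<in> dom_of c" for x p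
  using that c covec_cot[OF c that(2), of p] carrierI[OF c that(2)]
  by (intro image_eqI[of _ _ "(x, covec c x p)"]) (auto simp: C crd_cot_chart dom_cot_chart mom_covec carrier_cot)
 then have "crd C ` ({l \<in> carrier_of (cot_atlas A). fst l \<in> U} \<inter> dom_of C) = crd c ` (U \<inter> dom_of c) \<times> UNIV"
  by (auto simp: C crd_cot_chart dom_cot_chart)
 then show "open (crd C ` ({l \<in> carrier_of (cot_atlas A). fst l \<in> U} \<inter> dom_of C))"
  using open_image_chart[OF assms c] by (simp add: open_Times)
qed auto

lemma Hausdorff_cot:
 assumes "Hausdorff_space (mtop A)" shows "Hausdorff_space (mtop (cot_atlas A))"
 unfolding Hausdorff_space_def TM.topspace_mtop
proof (intro allI impI)
 fix l k assume lk: "l \<in> carrier_of (cot_atlas A) \<and> k \<in> carrier_of (cot_atlas A) \<and> l \<noteq> k"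
 show "\<exists>U V. openin (mtop (cot_atlas A)) U \<and> openin (mtop (cot_atlas A)) V \<and> l \<in> U \<and> k \<in> V \<and> disjnt U V"
 proof (cases "fst l = fst k")
  case False
  have "fst l \<in> topspace (mtop A)" "fst k \<in> topspace (mtop A)" using lk by (auto simp: carrier_cot topspace_mtop)
  then have "\<exists>U V. openin (mtop A) U \<and> openin (mtop A) V \<and> fst l \<in> U \<and> fst k \<in> V \<and> disjnt U V"
   using assms[unfolded Hausdorff_space_def, rule_format, of "fst l" "fst k"] False by simp
  then obtain U V where UV: "openin (mtop A) U" "openin (mtop A) V" "fst l \<in> U" "fst k \<in> V" "disjnt U V"
   by (elim exE conjE)
  define PU where "PU U = {l \<in> carrier_of (cot_atlas A). fst l \<in> U}" for U
  have "openin (mtop (cot_atlas A)) (PU U)" "openin (mtop (cot_atlas A)) (PU V)"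
   unfolding PU_def using openin_cot_preimage UV by blast+
  moreover have "l \<in> PU U" "k \<in> PU V" using lk UV by (simp_all add: PU_def)
  moreover have "disjnt (PU U) (PU V)" using UV(5) by (auto simp: PU_def disjnt_def)
  ultimately show ?thesis by blast
 next
  case True
  obtain c where c: "c \<in> A" "l \<in> dom_of (cot_chart A c)" using lk some_cot_chart by metis
  have k: "k \<in> dom_of (cot_chart A c)" using c lk True by (simp add: dom_cot_chart carrier_cot)
  have ne: "crd (cot_chart A c) l \<noteq> crd (cot_chart A c) k"
   using inj_cot_chart[OF c(1)] c(2) k lk unfolding inj_on_def by blast
  obtain U V where UV: "open U" "open V" "crd (cot_chart A c) l \<in> U" "crd (cot_chart A c) k \<in> V" "U \<inter> V = {}"
   using hausdorff[OF ne] by (elim exE conjE)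
  define PU where "PU U = {x \<in> dom_of (cot_chart A c). crd (cot_chart A c) x \<in> U}" for U
  have "openin (mtop (cot_atlas A)) (PU U)" "openin (mtop (cot_atlas A)) (PU V)"
   unfolding PU_def using TM.openin_chart_preimage[OF cot_chart_in[OF c(1)]] UV by blast+
  moreover have "l \<in> PU U" "k \<in> PU V" using c(2) k UV by (simp_all add: PU_def)
  moreover have "disjnt (PU U) (PU V)" using UV(5) by (auto simp: PU_def disjnt_def)
  ultimately show ?thesis by blast
 qed
qed

lemma covec_zero: "covec c x 0 = (\<lambda>_. 0)"
 by (auto simp: covec_def)

lemma cot_point_mem:
 assumes c: "c \<in> A" "x \<in> dom_of c"
 shows "(x, covec c x p) \<in> V \<longleftrightarrow> (crd c x, p) \<in> crd (cot_chart A c) ` (V \<inter> dom_of (cot_chart A c))"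
proof -
 have d: "(x, covec c x p) \<in> dom_of (cot_chart A c)" using c covec_cot[OF c] by (simp add: dom_cot_chart)
 have "crd (cot_chart A c) (x, covec c x p) = (crd c x, p)" using mom_covec[OF c] by (simp add: crd_cot_chart)
 then show ?thesis
  using inj_on_image_mem_iff[OF inj_cot_chart[OF c(1)] d, of "V \<inter> dom_of (cot_chart A c)"] d by auto
qed

text \<open>The fibres are connected, and the zero section is a copy of the base that meets all of them.\<close>
lemma connected_cot:
 assumes conn: "connected_space (mtop A)" shows "connected_space (mtop (cot_atlas A))"
 unfolding connected_space_clopen_in TM.topspace_mtop
proof (intro allI impI)
 fix W assume W: "openin (mtop (cot_atlas A)) W \<and> closedin (mtop (cot_atlas A)) W"
 let ?W' = "carrier_of (cot_atlas A) - W"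
 have WC: "W \<subseteq> carrier_of (cot_atlas A)" using W openin_subset TM.topspace_mtop by blast
 have W': "openin (mtop (cot_atlas A)) ?W'" using W unfolding closedin_def TM.topspace_mtop by blast
 have in_carrier: "(x, covec c x p) \<in> carrier_of (cot_atlas A)" if "c \<in> A" "x \<in> dom_of c" for c x p
  using that covec_cot[OF that] carrierI[OF that] by (simp add: carrier_cot)
 have fopen: "open {p. (x, covec c x p) \<in> V}" if c: "c \<in> A" "x \<in> dom_of c" and V: "openin (mtop (cot_atlas A)) V" for c x V
  unfolding cot_point_mem[OF c]
  using open_vimage[OF TM.open_image_chart[OF V cot_chart_in[OF c(1)]], of "\<lambda>p. (crd c x, p)"]
  by (simp add: vimage_def continuous_intros)
 have fibre: "(x, covec c x p) \<in> W \<longleftrightarrow> (x, covec c x 0) \<in> W" if c: "c \<in> A" "x \<in> dom_of c" for c x p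
 proof -
  have "- {p. (x, covec c x p) \<in> W} = {p. (x, covec c x p) \<in> ?W'}" using in_carrier[OF c] by auto
  then have cl: "closed {p. (x, covec c x p) \<in> W}" using fopen[OF c W'] by (simp add: closed_open)
  have op: "open {p. (x, covec c x p) \<in> W}" by (rule fopen[OF c]) (use W in blast)
  have "{p. (x, covec c x p) \<in> W} = {} \<or> {p. (x, covec c x p) \<in> W} = UNIV"
   using cl op by (rule clopen[THEN iffD1, OF conjI])
  then show ?thesis by blast
 qed
 have zopen: "openin (mtop A) {x \<in> carrier_of A. (x, \<lambda>_. 0) \<in> V}" if V: "openin (mtop (cot_atlas A)) V" for V
  unfolding openin_mtop_C1
 proof (intro conjI ballI)
  fix c assume c: "c \<in> A"
  let ?C = "cot_chart A c"
  have "(x, \<lambda>_. 0) \<in> V \<longleftrightarrow> (crd c x, 0) \<in> crd ?C ` (V \<inter> dom_of ?C)" if "x \<in> dom_of c" for x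
   using cot_point_mem[OF c that, of 0 V] by (simp add: covec_zero)
  moreover have "q \<in> crd c ` dom_of c" if "(q, 0) \<in> crd ?C ` (V \<inter> dom_of ?C)" for q
   using that by (auto simp: crd_cot_chart dom_cot_chart)
  ultimately have "crd c ` ({x \<in> carrier_of A. (x, \<lambda>_. 0) \<in> V} \<inter> dom_of c) = {q. (q, 0) \<in> crd ?C ` (V \<inter> dom_of ?C)}"
   using carrierI[OF c] by blast
  moreover have "open ((\<lambda>q. (q, 0)) -` (crd ?C ` (V \<inter> dom_of ?C)))"
   by (rule open_vimage[OF TM.open_image_chart[OF V cot_chart_in[OF c]]]) (intro continuous_intros)
  ultimately show "open (crd c ` ({x \<in> carrier_of A. (x, \<lambda>_. 0) \<in> V} \<inter> dom_of c))"
   by (simp add: vimage_def)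
 qed auto
 define S where "S = {x \<in> carrier_of A. (x, \<lambda>_. 0) \<in> W}"
 have zc: "(x, \<lambda>_. 0) \<in> carrier_of (cot_atlas A)" if x: "x \<in> carrier_of A" for x
 proof -
  obtain c where "c \<in> A" "x \<in> dom_of c" using x unfolding carrier_of_def by blast
  from in_carrier[OF this, of 0] show ?thesis by (simp add: covec_zero)
 qed
 have "carrier_of A - S = {x \<in> carrier_of A. (x, \<lambda>_. 0) \<in> ?W'}" using zc by (auto simp: S_def)
 then have "closedin (mtop A) S" unfolding closedin_def topspace_mtop using zopen[OF W'] by (auto simp: S_def)
 moreover have "openin (mtop A) S" unfolding S_def using zopen W by blast
 ultimately have S: "S = {} \<or> S = carrier_of A"
  using conn unfolding connected_space_clopen_in topspace_mtop by blast
 have iff: "l \<in> W \<longleftrightarrow> fst l \<in> S" if l: "l \<in> carrier_of (cot_atlas A)" for l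
 proof -
  obtain c where c: "c \<in> A" "l \<in> dom_of (cot_chart A c)" using l some_cot_chart by metis
  then have x: "fst l \<in> dom_of c" using dom_cot_chart by blast
  have "l = (fst l, covec c (fst l) (mom c l))"
   by (rule cot_eqI[OF c]) (use x covec_cot[OF c(1) x] mom_covec[OF c(1) x] in \<open>auto simp: dom_cot_chart\<close>)
  then have "l \<in> W \<longleftrightarrow> (fst l, \<lambda>_. 0) \<in> W" using fibre[OF c(1) x, of "mom c l"] by (simp add: covec_zero)
  then show ?thesis using carrierI[OF c(1) x] by (simp add: S_def)
 qed
 show "W = {} \<or> W = carrier_of (cot_atlas A)"
  using S
 proof
  assume "S = {}" then have "W = {}" using iff WC by blast then show ?thesis ..
 next
  assume "S = carrier_of A" then have "W = carrier_of (cot_atlas A)" using iff WC by (auto simp: carrier_cot) then show ?thesis ..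
 qed
qed

end

section \<open>Coordinate boxes of extremals\<close>

lemma has_derivative_zero_bound:
 fixes f :: "'a::real_normed_vector => real"
 assumes "(f has_derivative (\<lambda>_. 0)) (at y)" "e > 0"
 obtains d where "d > 0" "\<And>y'. norm (y' - y) < d ==> \<bar>f y' - f y\<bar> \<le> e * norm (y' - y)"
proof -
 have "\<forall>e>0. \<exists>d>0. \<forall>y'. norm (y' - y) < d --> norm (f y' - f y - 0) \<le> e * norm (y' - y)"
  using assms(1) unfolding has_derivative_at_alt by blast
 then obtain d where "d > 0" "\<forall>y'. norm (y' - y) < d --> norm (f y' - f y - 0) \<le> e * norm (y' - y)"
  using assms(2) by blast
 then show thesis using that by auto
qed

lemma has_derivative_zeroI:
 fixes f :: "'a::real_normed_vector => real"
 assumes "\<And>e. e > 0 ==> \<exists>d>0. \<forall>y'. norm (y' - y) < d --> \<bar>f y' - f y\<bar> \<le> e * norm (y' - y)"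
 shows "(f has_derivative (\<lambda>_. 0)) (at y)"
 unfolding has_derivative_at_alt using assms by auto

lemma AE_lebesgue_onI:
 assumes "AE t in lebesgue. t \<in> I --> P t" "S \<subseteq> I" "S \<in> sets lebesgue"
 shows "AE t in lebesgue_on S. P t"
 using assms by (auto simp: AE_restrict_space_iff elim: eventually_mono)

text \<open>The coordinate picture of a field of extremals near one of them, with \<open>y\<close> the coordinate of the starting
  point. Only \<open>L\<close>, not \<open>h\<close>, is known to be measurable in time and Lipschitz in \<open>y\<close>.\<close>
locale flow_box =
 fixes I :: "real set" and U :: "'e::euclidean_space set" and K :: real
  and x p X\<^sub>q X\<^sub>p :: "real => 'e => 'e" and h L \<theta> :: "real => 'e => real"
 assumes I: "is_interval I" and U: "open U" "convex U" and K: "K \<ge> 0"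
  and lip_x: "\<And>t t' y y'. t \<in> I ==> t' \<in> I ==> y \<in> U ==> y' \<in> U ==>
   norm (x t y - x t' y') \<le> K * (\<bar>t - t'\<bar> + norm (y - y'))"
  and lip_p: "\<And>t t' y y'. t \<in> I ==> t' \<in> I ==> y \<in> U ==> y' \<in> U ==>
   norm (p t y - p t' y') \<le> K * (\<bar>t - t'\<bar> + norm (y - y'))"
  and der: "\<And>y. y \<in> U ==> AE t in lebesgue. t \<in> I -->
   ((\<lambda>t. x t y) has_vector_derivative X\<^sub>q t y) (at t) \<and> ((\<lambda>t. p t y) has_vector_derivative X\<^sub>p t y) (at t)"
  and L_eq: "AE t in lebesgue. t \<in> I --> (\<forall>y\<in>U. L t y = p t y \<bullet> X\<^sub>q t y - h t y)"
  and h_diff: "AE t in lebesgue. t \<in> I --> (\<forall>y\<in>U. \<forall>e>0. \<exists>d>0. \<forall>y'\<in>U. norm (y' - y) < d -->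
   \<bar>h t y' - h t y - ((p t y' - p t y) \<bullet> X\<^sub>q t y - (x t y' - x t y) \<bullet> X\<^sub>p t y)\<bar> \<le> e * norm (y' - y))"
  and L_meas: "\<And>y S. y \<in> U ==> S \<subseteq> I ==> S \<in> sets lebesgue ==> (\<lambda>t. L t y) \<in> borel_measurable (lebesgue_on S)"
  and L_bdd: "\<And>y. y \<in> U ==> \<exists>C. \<forall>t\<in>I. \<bar>L t y\<bar> \<le> C"
  and L_lip: "AE t in lebesgue. t \<in> I --> (\<forall>y\<in>U. \<forall>y'\<in>U. \<bar>L t y' - L t y\<bar> \<le> K * norm (y' - y))"
  and \<theta>_eq: "\<And>s t y. s \<in> I ==> t \<in> I ==> s \<le> t ==> y \<in> U ==> \<theta> t y = \<theta> s y + integral {s..t} (\<lambda>\<tau>. L \<tau> y)"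
begin

definition exact_at :: "real => 'e => bool" where
 "exact_at t y \<longleftrightarrow> ((\<lambda>y'. \<theta> t y' - p t y \<bullet> x t y') has_derivative (\<lambda>_. 0)) (at y)"

lemma Icc_sub: "s \<in> I ==> t \<in> I ==> {s..t} \<subseteq> I"
 using mem_is_interval_1_I[OF I] by (meson atLeastAtMost_iff subsetI)

text \<open>The extremals that start on the segment from \<open>y\<close> to \<open>y1\<close> form a strip whose Lipschitz constant in the
  parameter is proportional to the length of the segment.\<close>
lemma exactness_estimate:
 assumes st: "s \<in> I" "t \<in> I" "s < t" and y: "y \<in> U" "y1 \<in> U" and ex: "\<And>y. y \<in> U ==> exact_at s y"
 shows "\<bar>\<theta> t y1 - \<theta> t y - p t y \<bullet> (x t y1 - x t y)\<bar> \<le> (K * norm (y1 - y)) * (K * norm (y1 - y))"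
proof -
 \<comment> \<open>The strip is defined for all times and parameters, so both are clamped to their ranges.\<close>
 define cl where "cl \<tau> = max s (min t \<tau>)" for \<tau>
 define cr where "cr r = max 0 (min 1 r)" for r :: real
 define seg where "seg r = y + cr r *\<^sub>R (y1 - y)" for r
 have cl: "cl \<tau> \<in> I" "\<bar>cl \<tau> - cl \<tau>'\<bar> \<le> \<bar>\<tau> - \<tau>'\<bar>" "\<tau> \<in> {s..t} ==> cl \<tau> = \<tau>" for \<tau> \<tau>'
  using Icc_sub[OF st(1,2)] st by (auto simp: cl_def subset_iff)
 have seg: "seg r \<in> U" for r
 proof -
  have "cr r \<in> {0..1}" by (auto simp: cr_def)
  moreover have "seg r = (1 - cr r) *\<^sub>R y + cr r *\<^sub>R y1" by (simp add: seg_def algebra_simps)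
  ultimately show ?thesis using convexD_alt[OF U(2) y] by simp
 qed
 have seg_diff: "norm (seg r - seg r') = \<bar>cr r - cr r'\<bar> * norm (y1 - y)" for r r'
  by (simp add: seg_def scaleR_diff_left[symmetric])
 have seg_lip: "norm (seg r - seg r') \<le> \<bar>r - r'\<bar> * norm (y1 - y)" for r r'
  unfolding seg_diff by (rule mult_right_mono) (auto simp: cr_def)
 have sub: "{s..t} \<subseteq> I" by (rule Icc_sub[OF st(1,2)])
 have lip: "norm (f (cl \<tau>) (seg r) - f (cl \<tau>') (seg r')) \<le> K * \<bar>\<tau> - \<tau>'\<bar> + (K * norm (y1 - y)) * \<bar>r - r'\<bar>"
  if f: "\<And>t t' y y'. t \<in> I ==> t' \<in> I ==> y \<in> U ==> y' \<in> U ==> norm (f t y - f t' y') \<le> K * (\<bar>t - t'\<bar> + norm (y - y'))"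
  for f :: "real => 'e => 'e" and \<tau> \<tau>' r r'
 proof -
  have "norm (f (cl \<tau>) (seg r) - f (cl \<tau>') (seg r')) \<le> K * (\<bar>cl \<tau> - cl \<tau>'\<bar> + norm (seg r - seg r'))"
   by (rule f[OF cl(1) cl(1) seg seg])
  also have "\<dots> \<le> K * (\<bar>\<tau> - \<tau>'\<bar> + \<bar>r - r'\<bar> * norm (y1 - y))"
   by (intro mult_left_mono add_mono cl(2) seg_lip K)
  finally show ?thesis by (simp add: algebra_simps)
 qed
 interpret strip: hamiltonian_strip s t K "K * norm (y1 - y)" "K * norm (y1 - y)" "\<lambda>\<tau> r. x (cl \<tau>) (seg r)" "\<lambda>\<tau> r. p (cl \<tau>) (seg r)"
  "\<lambda>\<tau> r. X\<^sub>q \<tau> (seg r)" "\<lambda>\<tau> r. X\<^sub>p \<tau> (seg r)" "\<lambda>\<tau> r. h \<tau> (seg r)" "\<lambda>\<tau> r. L \<tau> (seg r)" "\<lambda>\<tau> r. \<theta> \<tau> (seg r)"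
 proof
  show "s < t" "0 \<le> K" "0 \<le> K * norm (y1 - y)" using st K by auto
  show "norm (x (cl \<tau>) (seg r) - x (cl \<tau>') (seg r')) \<le> K * \<bar>\<tau> - \<tau>'\<bar> + K * norm (y1 - y) * \<bar>r - r'\<bar>" for \<tau> \<tau>' r r'
   by (rule lip[OF lip_x])
  show "norm (p (cl \<tau>) (seg r) - p (cl \<tau>') (seg r')) \<le> K * \<bar>\<tau> - \<tau>'\<bar> + K * norm (y1 - y) * \<bar>r - r'\<bar>" for \<tau> \<tau>' r r'
   by (rule lip[OF lip_p])
  fix r :: real
  have D: "AE \<tau> in lebesgue_on {s..t}. ((\<lambda>t. x t (seg r)) has_vector_derivative X\<^sub>q \<tau> (seg r)) (at \<tau>) \<and>
    ((\<lambda>t. p t (seg r)) has_vector_derivative X\<^sub>p \<tau> (seg r)) (at \<tau>)"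
   by (rule AE_lebesgue_onI[OF der[OF seg] sub]) simp
  have tr: "((\<lambda>\<tau>. f (cl \<tau>) (seg r)) has_vector_derivative v) (at \<tau> within {s..t})"
   if "((\<lambda>\<tau>. f \<tau> (seg r)) has_vector_derivative v) (at \<tau>)" "\<tau> \<in> {s..t}" for f :: "real => 'e => 'e" and v \<tau>
   by (rule has_vector_derivative_transform[OF that(2) _ has_vector_derivative_at_within[OF that(1)]]) (simp add: cl(3))
  show "AE \<tau> in lebesgue_on {s..t}. ((\<lambda>\<tau>. x (cl \<tau>) (seg r)) has_vector_derivative X\<^sub>q \<tau> (seg r)) (at \<tau> within {s..t})"
   using D AE_space[of "lebesgue_on {s..t}"] by eventually_elim (rule tr, auto)
  show "AE \<tau> in lebesgue_on {s..t}. ((\<lambda>\<tau>. p (cl \<tau>) (seg r)) has_vector_derivative X\<^sub>p \<tau> (seg r)) (at \<tau> within {s..t})"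
   using D AE_space[of "lebesgue_on {s..t}"] by eventually_elim (rule tr, auto)
  show "(\<lambda>\<tau>. L \<tau> (seg r)) \<in> borel_measurable (lebesgue_on {s..t})" by (rule L_meas[OF seg sub]) simp
  show "\<exists>C. \<forall>\<tau>\<in>{s..t}. \<bar>L \<tau> (seg r)\<bar> \<le> C" using L_bdd[OF seg] sub by blast
  show "\<theta> t (seg r) = \<theta> s (seg r) + integral {s..t} (\<lambda>\<tau>. L \<tau> (seg r))"
   by (rule \<theta>_eq[OF st(1,2) _ seg]) (use st in simp)
 next
  have "AE \<tau> in lebesgue_on {s..t}. \<forall>y\<in>U. L \<tau> y = p \<tau> y \<bullet> X\<^sub>q \<tau> y - h \<tau> y"
   by (rule AE_lebesgue_onI[OF L_eq sub]) simp
  then show "AE \<tau> in lebesgue_on {s..t}. \<forall>r\<in>{0..1}. L \<tau> (seg r) = p (cl \<tau>) (seg r) \<bullet> X\<^sub>q \<tau> (seg r) - h \<tau> (seg r)"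
   using AE_space[of "lebesgue_on {s..t}"] by eventually_elim (use seg cl(3) in auto)
  have "AE \<tau> in lebesgue_on {s..t}. \<forall>y\<in>U. \<forall>y'\<in>U. \<bar>L \<tau> y' - L \<tau> y\<bar> \<le> K * norm (y' - y)"
   by (rule AE_lebesgue_onI[OF L_lip sub]) simp
  then show "AE \<tau> in lebesgue_on {s..t}. \<forall>r\<in>{0..1}. \<forall>r'\<in>{0..1}. \<bar>L \<tau> (seg r') - L \<tau> (seg r)\<bar> \<le> K * norm (y1 - y) * \<bar>r' - r\<bar>"
  proof eventually_elim
   case (elim \<tau>)
   show ?case
   proof (intro ballI)
    fix r r' :: real
    have "\<bar>L \<tau> (seg r') - L \<tau> (seg r)\<bar> \<le> K * norm (seg r' - seg r)" using elim seg by blast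
    also have "\<dots> \<le> K * (\<bar>r' - r\<bar> * norm (y1 - y))" by (intro mult_left_mono seg_lip K)
    finally show "\<bar>L \<tau> (seg r') - L \<tau> (seg r)\<bar> \<le> K * norm (y1 - y) * \<bar>r' - r\<bar>" by (simp add: mult_ac)
   qed
  qed
  have scale: "\<exists>d>0. \<forall>r'\<in>{0..1}. \<bar>r' - r\<bar> < d --> Q (seg r') \<le> e * \<bar>r' - r\<bar>"
   if e: "e > 0" and Q: "\<And>e. e > 0 ==> \<exists>d>0. \<forall>y'\<in>U. norm (y' - seg r) < d --> Q y' \<le> e * norm (y' - seg r)" for e r and Q :: "'e => real"
  proof -
   let ?n = "norm (y1 - y) + 1"
   have n: "?n > 0" by (smt (verit) norm_ge_zero)
   obtain d where d: "d > 0" "\<forall>y'\<in>U. norm (y' - seg r) < d --> Q y' \<le> (e / ?n) * norm (y' - seg r)"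
    using Q[of "e / ?n"] e n by auto
   have "Q (seg r') \<le> e * \<bar>r' - r\<bar>" if "\<bar>r' - r\<bar> < d / ?n" for r'
   proof -
    have b: "norm (seg r' - seg r) \<le> \<bar>r' - r\<bar> * ?n"
     using seg_lip[of r' r] by (rule order_trans) (intro mult_left_mono, auto)
    also have "\<dots> < d" using that n by (simp add: field_simps)
    finally have "Q (seg r') \<le> (e / ?n) * norm (seg r' - seg r)" using d(2) seg by blast
    also have "\<dots> \<le> (e / ?n) * (\<bar>r' - r\<bar> * ?n)" using b e n by (intro mult_left_mono) auto
    also have "\<dots> = e * \<bar>r' - r\<bar>" using n by simp
    finally show ?thesis .
   qed
   moreover have "d / ?n > 0" using d(1) n by simp
   ultimately show ?thesis by blast
  qed
  have "AE \<tau> in lebesgue_on {s..t}. \<forall>y\<in>U. \<forall>e>0. \<exists>d>0. \<forall>y'\<in>U. norm (y' - y) < d -->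
   \<bar>h \<tau> y' - h \<tau> y - ((p \<tau> y' - p \<tau> y) \<bullet> X\<^sub>q \<tau> y - (x \<tau> y' - x \<tau> y) \<bullet> X\<^sub>p \<tau> y)\<bar> \<le> e * norm (y' - y)"
   by (rule AE_lebesgue_onI[OF h_diff sub]) simp
  then show "AE \<tau> in lebesgue_on {s..t}. \<forall>r\<in>{0..1}. \<forall>e>0. \<exists>d>0. \<forall>r'\<in>{0..1}. \<bar>r' - r\<bar> < d -->
   \<bar>h \<tau> (seg r') - h \<tau> (seg r) - ((p (cl \<tau>) (seg r') - p (cl \<tau>) (seg r)) \<bullet> X\<^sub>q \<tau> (seg r) -
    (x (cl \<tau>) (seg r') - x (cl \<tau>) (seg r)) \<bullet> X\<^sub>p \<tau> (seg r))\<bar> \<le> e * \<bar>r' - r\<bar>"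
   using AE_space[of "lebesgue_on {s..t}"]
  proof eventually_elim
   case (elim \<tau>)
   have cl\<tau>: "cl \<tau> = \<tau>" using elim(2) cl(3) by simp
   show ?case unfolding cl\<tau> by (intro ballI allI impI scale) (use elim(1) seg in blast)+
  qed
  fix r e :: real assume "e > 0"
  have cls: "cl s = s" using cl(3) st by simp
  show "\<exists>d>0. \<forall>r'\<in>{0..1}. \<bar>r' - r\<bar> < d -->
   \<bar>\<theta> s (seg r') - \<theta> s (seg r) - p (cl s) (seg r) \<bullet> (x (cl s) (seg r') - x (cl s) (seg r))\<bar> \<le> e * \<bar>r' - r\<bar>"
   unfolding cls
  proof (rule scale[OF \<open>e > 0\<close>])
   fix e :: real assume "e > 0"
   from has_derivative_zero_bound[OF ex[OF seg, of r, unfolded exact_at_def] this]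
   obtain d where "d > 0" "\<And>y'. norm (y' - seg r) < d ==>
    \<bar>(\<theta> s y' - p s (seg r) \<bullet> x s y') - (\<theta> s (seg r) - p s (seg r) \<bullet> x s (seg r))\<bar> \<le> e * norm (y' - seg r)" by blast
   then show "\<exists>d>0. \<forall>y'\<in>U. norm (y' - seg r) < d -->
    \<bar>\<theta> s y' - \<theta> s (seg r) - p s (seg r) \<bullet> (x s y' - x s (seg r))\<bar> \<le> e * norm (y' - seg r)"
    by (intro exI[of _ d]) (simp add: inner_diff_right algebra_simps)
  qed
 qed
 have "cl t = t" "seg 1 = y1" "seg 0 = y" using cl(3) st by (auto simp: seg_def cr_def)
 then show ?thesis using strip.generating_function_estimate by simp
qed

text \<open>The defect is quadratic in the distance, so its derivative vanishes.\<close>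
lemma exactness_propagates:
 assumes st: "s \<in> I" "t \<in> I" "s \<le> t" and y: "y \<in> U" and ex: "\<And>y. y \<in> U ==> exact_at s y"
 shows "exact_at t y"
proof (cases "s = t")
 case False
 obtain r where r: "r > 0" "ball y r \<subseteq> U" using U(1) y open_contains_ball by blast
 show ?thesis unfolding exact_at_def
 proof (rule has_derivative_zeroI)
  fix e :: real assume "e > 0"
  define d where "d = min r (e / (K * K + 1))"
  have KK: "K * K + 1 > 0" using K by (smt (verit) mult_nonneg_nonneg)
  have "\<bar>(\<theta> t y' - p t y \<bullet> x t y') - (\<theta> t y - p t y \<bullet> x t y)\<bar> \<le> e * norm (y' - y)" if "norm (y' - y) < d" for y'
  proof -
   have y': "y' \<in> U" using that r(2) by (auto simp: d_def dist_norm norm_minus_commute subset_iff)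
   have "\<bar>\<theta> t y' - \<theta> t y - p t y \<bullet> (x t y' - x t y)\<bar> \<le> (K * norm (y' - y)) * (K * norm (y' - y))"
    by (rule exactness_estimate[OF st(1,2) _ y y' ex]) (use False st in auto)
   also have "\<dots> = (K * K * norm (y' - y)) * norm (y' - y)" by simp
   also have "\<dots> \<le> e * norm (y' - y)"
   proof (rule mult_right_mono)
    have "K * K * norm (y' - y) \<le> (K * K + 1) * norm (y' - y)" by (intro mult_right_mono) auto
    also have "\<dots> \<le> (K * K + 1) * (e / (K * K + 1))" using that KK by (intro mult_left_mono) (auto simp: d_def)
    finally show "K * K * norm (y' - y) \<le> e" using KK by simp
   qed simp
   finally show ?thesis by (simp add: inner_diff_right algebra_simps)
  qed
  moreover have "d > 0" using r \<open>e > 0\<close> KK by (simp add: d_def)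
  ultimately show "\<exists>d>0. \<forall>y'. norm (y' - y) < d -->
    \<bar>(\<theta> t y' - p t y \<bullet> x t y') - (\<theta> t y - p t y \<bullet> x t y)\<bar> \<le> e * norm (y' - y)" by blast
 qed
qed (use ex y in simp)

text \<open>A mean value inequality with a frozen momentum \<open>pbar\<close>. Since \<open>\<theta>\<^sub>t\<close> is only differentiable relative to the
  Lipschitz map \<open>x\<^sub>t\<close>, it is derived from pointwise Lipschitz bounds along the segment.\<close>
lemma exact_mean_value:
 assumes t: "t \<in> I" and y: "y \<in> U" "y1 \<in> U" and ex: "\<And>y. y \<in> U ==> exact_at t y"
  and osc: "\<And>z. z \<in> closed_segment y y1 ==> norm (p t z - pbar) \<le> \<epsilon>"
 shows "\<bar>\<theta> t y1 - \<theta> t y - pbar \<bullet> (x t y1 - x t y)\<bar> \<le> \<epsilon> * K * norm (y1 - y)"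
proof -
 define seg where "seg r = y + r *\<^sub>R (y1 - y)" for r
 have segc: "seg r \<in> closed_segment y y1" if "r \<in> {0..1}" for r
  using that by (auto simp: closed_segment_def seg_def intro!: exI[of _ r]) (simp add: algebra_simps)
 have segU: "seg r \<in> U" if "r \<in> {0..1}" for r
  using segc[OF that] closed_segment_subset[OF y U(2)] by blast
 have \<epsilon>: "\<epsilon> \<ge> 0" using osc[of y] norm_ge_zero order_trans by (metis ends_in_segment(1))
 define f where "f r = \<theta> t (seg r) - pbar \<bullet> x t (seg r)" for r
 have sd: "norm (seg r' - seg r) = \<bar>r' - r\<bar> * norm (y1 - y)" for r r'
  by (simp add: seg_def scaleR_diff_left[symmetric])
 have "\<bar>f 1 - f 0\<bar> \<le> (\<epsilon> * K * norm (y1 - y)) * (1 - 0)"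
 proof (rule lipschitz_on_interval_pointwise)
  fix r e :: real assume r: "r \<in> {0..1}" and e: "e > 0"
  let ?n = "norm (y1 - y) + 1"
  have n: "?n > 0" by (smt (verit) norm_ge_zero)
  obtain d where d: "d > 0" "\<And>y'. norm (y' - seg r) < d ==>
    \<bar>(\<theta> t y' - p t (seg r) \<bullet> x t y') - (\<theta> t (seg r) - p t (seg r) \<bullet> x t (seg r))\<bar> \<le> (e / ?n) * norm (y' - seg r)"
   using has_derivative_zero_bound[OF ex[OF segU[OF r], unfolded exact_at_def], of "e / ?n"] e n by (metis divide_pos_pos)
  have "\<bar>f r' - f r\<bar> \<le> (\<epsilon> * K * norm (y1 - y) + e) * \<bar>r' - r\<bar>" if r': "r' \<in> {0..1}" "\<bar>r' - r\<bar> < d / ?n" for r'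
  proof -
   have b: "norm (seg r' - seg r) \<le> \<bar>r' - r\<bar> * ?n" unfolding sd by (intro mult_left_mono) auto
   also have "\<dots> < d" using r'(2) n by (simp add: field_simps)
   finally have 1: "\<bar>(\<theta> t (seg r') - p t (seg r) \<bullet> x t (seg r')) - (\<theta> t (seg r) - p t (seg r) \<bullet> x t (seg r))\<bar> \<le> (e / ?n) * norm (seg r' - seg r)"
    by (rule d(2))
   also have "\<dots> \<le> (e / ?n) * (\<bar>r' - r\<bar> * ?n)" using b e n by (intro mult_left_mono) auto
   also have "\<dots> = e * \<bar>r' - r\<bar>" using n by simp
   finally have 1: "\<bar>(\<theta> t (seg r') - p t (seg r) \<bullet> x t (seg r')) - (\<theta> t (seg r) - p t (seg r) \<bullet> x t (seg r))\<bar> \<le> e * \<bar>r' - r\<bar>" .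
   have "norm (x t (seg r') - x t (seg r)) \<le> K * (\<bar>t - t\<bar> + norm (seg r' - seg r))"
    by (rule lip_x[OF t t segU[OF r'(1)] segU[OF r]])
   then have "norm (x t (seg r') - x t (seg r)) \<le> K * (\<bar>r' - r\<bar> * norm (y1 - y))" by (simp add: sd)
   then have 2: "\<bar>(p t (seg r) - pbar) \<bullet> (x t (seg r') - x t (seg r))\<bar> \<le> \<epsilon> * (K * (\<bar>r' - r\<bar> * norm (y1 - y)))"
    using osc[OF segc[OF r]] \<epsilon> by (intro order_trans[OF Cauchy_Schwarz_ineq2] mult_mono) auto
   have "f r' - f r = ((\<theta> t (seg r') - p t (seg r) \<bullet> x t (seg r')) - (\<theta> t (seg r) - p t (seg r) \<bullet> x t (seg r)))
     + (p t (seg r) - pbar) \<bullet> (x t (seg r') - x t (seg r))"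
    by (simp add: f_def inner_diff_left inner_diff_right)
   then have "\<bar>f r' - f r\<bar> \<le> e * \<bar>r' - r\<bar> + \<epsilon> * (K * (\<bar>r' - r\<bar> * norm (y1 - y)))"
    using 1 2 by linarith
   also have "\<dots> = (\<epsilon> * K * norm (y1 - y) + e) * \<bar>r' - r\<bar>" by (simp add: algebra_simps)
   finally show ?thesis .
  qed
  moreover have "d / ?n > 0" using d(1) n by simp
  ultimately show "\<exists>d>0. \<forall>r'\<in>{0..1}. \<bar>r' - r\<bar> < d --> \<bar>f r' - f r\<bar> \<le> (\<epsilon> * K * norm (y1 - y) + e) * \<bar>r' - r\<bar>" by blast
 qed simp
 then show ?thesis by (simp add: f_def seg_def inner_diff_right algebra_simps)
qed

end

lemma has_vector_derivative_increment:
 fixes f :: "real => 'b::real_normed_vector"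
 assumes "(f has_vector_derivative D) (at s within S)" "e > 0"
 obtains d where "d > 0" "\<And>t. t \<in> S ==> \<bar>t - s\<bar> < d ==> norm (f t - f s - (t - s) *\<^sub>R D) \<le> e * \<bar>t - s\<bar>"
proof -
 have "\<forall>e>0. \<exists>d>0. \<forall>t\<in>S. norm (t - s) < d --> norm (f t - f s - (t - s) *\<^sub>R D) \<le> e * norm (t - s)"
  using assms(1) unfolding has_vector_derivative_def has_derivative_within_alt by blast
 then have "\<exists>d>0. \<forall>t\<in>S. norm (t - s) < d --> norm (f t - f s - (t - s) *\<^sub>R D) \<le> e * norm (t - s)"
  using assms(2) by blast
 then show thesis using that by (elim exE conjE) (simp add: real_norm_def)
qed

lemma lipschitz_imp_vector_derivative_bound:
 fixes f :: "real => 'b::real_normed_vector"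
 assumes D: "(f has_vector_derivative D) (at s within {u..v})" and s: "s \<in> {u..v}" "u < v"
  and lip: "\<And>t. t \<in> {u..v} ==> norm (f t - f s) \<le> K * \<bar>t - s\<bar>"
 shows "norm D \<le> K"
proof (rule field_le_epsilon)
 fix e :: real assume "e > 0"
 obtain d where d: "d > 0" "\<And>t. t \<in> {u..v} ==> \<bar>t - s\<bar> < d ==> norm (f t - f s - (t - s) *\<^sub>R D) \<le> e * \<bar>t - s\<bar>"
  using has_vector_derivative_increment[OF D \<open>e > 0\<close>] by blast
 obtain t where t: "t \<in> {u..v}" "\<bar>t - s\<bar> < d" "t \<noteq> s"
 proof (cases "s < v")
  case True
  show ?thesis by (rule that[of "min v (s + d / 2)"]) (use True s d(1) in auto)
 next
  case False
  show ?thesis by (rule that[of "max u (s - d / 2)"]) (use False s d(1) in auto)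
 qed
 have "\<bar>t - s\<bar> * norm D = norm ((f t - f s) - (f t - f s - (t - s) *\<^sub>R D))" by simp
 also have "\<dots> \<le> norm (f t - f s) + norm (f t - f s - (t - s) *\<^sub>R D)" by (rule norm_triangle_ineq4)
 also have "\<dots> \<le> K * \<bar>t - s\<bar> + e * \<bar>t - s\<bar>" by (rule add_mono[OF lip[OF t(1)] d(2)[OF t(1,2)]])
 finally have "\<bar>t - s\<bar> * norm D \<le> \<bar>t - s\<bar> * (K + e)" by (simp add: algebra_simps)
 then show "norm D \<le> K + e" using t(3) by simp
qed

lemma abs_continuous_lipschitz_bound:
 fixes f :: "real => 'a::real_normed_vector" and F :: "real => 'b::real_normed_vector"
 assumes ac: "abs_continuous_on S f" and C: "C \<ge> 0"
  and le: "\<And>s t. s \<in> S ==> t \<in> S ==> s \<le> t ==> norm (F t - F s) \<le> C * (\<bar>t - s\<bar> + norm (f t - f s))"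
 shows "abs_continuous_on S F"
 unfolding abs_continuous_on_def
proof (intro allI impI)
 fix \<epsilon> :: real assume "\<epsilon> > 0"
 define e where "e = \<epsilon> / (2 * (C + 1))"
 have e: "e > 0" "C * e \<le> (C + 1) * e" "(C + 1) * e = \<epsilon> / 2" using \<open>\<epsilon> > 0\<close> C by (auto simp: e_def field_simps)
 from ac[unfolded abs_continuous_on_def, rule_format, OF e(1)]
 obtain \<delta> where \<delta>: "\<delta> > 0" "\<And>(n::nat) a b.
    (\<forall>i<n. a i \<le> b i \<and> {a i..b i} \<subseteq> S) \<and>
    (\<forall>i<n. \<forall>j<n. i \<noteq> j --> {a i<..<b i} \<inter> {a j<..<b j} = {}) \<and>
    (\<Sum>i<n. b i - a i) < \<delta> ==> (\<Sum>i<n. norm (f (b i) - f (a i))) < e"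
  by (elim exE conjE) (use that in blast)
 show "\<exists>\<delta>>0. \<forall>(n::nat) a b.
    (\<forall>i<n. a i \<le> b i \<and> {a i..b i} \<subseteq> S) \<and>
    (\<forall>i<n. \<forall>j<n. i \<noteq> j --> {a i<..<b i} \<inter> {a j<..<b j} = {}) \<and>
    (\<Sum>i<n. b i - a i) < \<delta>
    --> (\<Sum>i<n. norm (F (b i) - F (a i))) < \<epsilon>"
 proof (intro exI[of _ "min \<delta> e"] conjI allI impI)
  fix n :: nat and a b :: "nat => real"
  assume H: "(\<forall>i<n. a i \<le> b i \<and> {a i..b i} \<subseteq> S) \<and>
    (\<forall>i<n. \<forall>j<n. i \<noteq> j --> {a i<..<b i} \<inter> {a j<..<b j} = {}) \<and> (\<Sum>i<n. b i - a i) < min \<delta> e"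
  have f: "(\<Sum>i<n. norm (f (b i) - f (a i))) < e" by (rule \<delta>(2)) (use H in auto)
  have "(\<Sum>i<n. norm (F (b i) - F (a i))) \<le> (\<Sum>i<n. C * ((b i - a i) + norm (f (b i) - f (a i))))"
  proof (rule sum_mono)
   fix i assume "i \<in> {..<n}"
   then have i: "a i \<le> b i" "{a i..b i} \<subseteq> S" using H by auto
   then have "a i \<in> S" "b i \<in> S" by auto
   from le[OF this i(1)] show "norm (F (b i) - F (a i)) \<le> C * ((b i - a i) + norm (f (b i) - f (a i)))"
    using i(1) by simp
  qed
  also have "\<dots> = C * ((\<Sum>i<n. b i - a i) + (\<Sum>i<n. norm (f (b i) - f (a i))))"
   by (simp add: sum_distrib_left[symmetric] sum.distrib)
  also have "\<dots> \<le> C * (e + e)" using H f by (intro mult_left_mono C add_mono) auto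
  also have "\<dots> < \<epsilon>" using e by (simp add: algebra_simps)
  finally show "(\<Sum>i<n. norm (F (b i) - F (a i))) < \<epsilon>" .
 qed (use \<delta> e in auto)
qed

lemma has_integral_le_negligible:
 fixes f g :: "'a::euclidean_space => real"
 assumes f: "(f has_integral i) S" and g: "(g has_integral j) S" and N: "negligible N"
  and le: "\<And>x. x \<in> S - N ==> f x \<le> g x"
 shows "i \<le> j"
proof -
 have "((\<lambda>x. if x \<in> N then g x else f x) has_integral i) S"
  by (rule has_integral_spike[OF N _ f]) auto
 then show ?thesis by (rule has_integral_le[OF _ g]) (use le in auto)
qed

context flow_box begin

lemma L_integrable:
 assumes st: "s \<in> I" "t \<in> I" and y: "y \<in> U"
 shows "(\<lambda>\<tau>. L \<tau> y) integrable_on {s..t}"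
proof -
 obtain C where C: "\<forall>t\<in>I. \<bar>L t y\<bar> \<le> C" using L_bdd[OF y] by blast
 have sub: "{s..t} \<subseteq> I" by (rule Icc_sub[OF st])
 show ?thesis
  by (rule measurable_bounded_by_integrable_imp_integrable[OF L_meas[OF y sub], where g = "\<lambda>_. C"])
   (use C sub in \<open>auto simp: subset_iff\<close>)
qed

lemma velocity_integral:
 assumes st: "s \<in> I" "t \<in> I" "s \<le> t" and y: "y \<in> U"
 shows "((\<lambda>\<tau>. X\<^sub>q \<tau> y) has_integral (x t y - x s y)) {s..t}"
proof -
 have sub: "{s..t} \<subseteq> I" by (rule Icc_sub[OF st(1,2)])
 have "AE \<tau> in lebesgue_on {s..t}. ((\<lambda>t. x t y) has_vector_derivative X\<^sub>q \<tau> y) (at \<tau>) \<and>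
    ((\<lambda>t. p t y) has_vector_derivative X\<^sub>p \<tau> y) (at \<tau>)"
  by (rule AE_lebesgue_onI[OF der[OF y] sub]) simp
 from AE_lebesgue_on_imp_negligible[OF _ this]
 have N: "negligible {\<tau>\<in>{s..t}. \<not> (((\<lambda>t. x t y) has_vector_derivative X\<^sub>q \<tau> y) (at \<tau>) \<and>
    ((\<lambda>t. p t y) has_vector_derivative X\<^sub>p \<tau> y) (at \<tau>))}" by simp
 show ?thesis
 proof (rule abs_continuous_ftc[OF st(3) _ N])
  show "abs_continuous_on {s..t} (\<lambda>t. x t y)"
   by (rule lipschitz_imp_abs_continuous[where K=K]) (use lip_x[OF _ _ y y] sub in \<open>force simp: subset_iff\<close>)
 qed (use has_vector_derivative_at_within in blast)
qed

text \<open>For a fixed starting point the action is the integral of \<open>p X\<^sub>q - h\<close>, and \<open>X\<^sub>q\<close> is the velocity of \<open>x\<close>. Freezing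
  the momentum costs the oscillation of \<open>p\<close> times the bound \<open>K\<close> of the velocity.\<close>
lemma value_increment_at_fixed_base:
 assumes uv: "u \<in> I" "v \<in> I" "u \<le> v" and y: "y \<in> U" and \<epsilon>: "\<epsilon> \<ge> 0"
  and p: "\<And>\<tau>. \<tau> \<in> {u..v} ==> norm (p \<tau> y - pbar) \<le> \<epsilon>"
  and h: "\<And>\<tau>. \<tau> \<in> {u..v} ==> c \<le> h \<tau> y"
 shows "\<theta> v y - \<theta> u y \<le> pbar \<bullet> (x v y - x u y) + (\<epsilon> * K - c) * (v - u)"
proof -
 have sub: "{u..v} \<subseteq> I" by (rule Icc_sub[OF uv(1,2)])
 have "AE \<tau> in lebesgue_on {u..v}. \<forall>y\<in>U. L \<tau> y = p \<tau> y \<bullet> X\<^sub>q \<tau> y - h \<tau> y"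
  by (rule AE_lebesgue_onI[OF L_eq sub]) simp
 moreover have "AE \<tau> in lebesgue_on {u..v}. ((\<lambda>t. x t y) has_vector_derivative X\<^sub>q \<tau> y) (at \<tau>) \<and>
    ((\<lambda>t. p t y) has_vector_derivative X\<^sub>p \<tau> y) (at \<tau>)"
  by (rule AE_lebesgue_onI[OF der[OF y] sub]) simp
 ultimately have "AE \<tau> in lebesgue_on {u..v}. L \<tau> y = p \<tau> y \<bullet> X\<^sub>q \<tau> y - h \<tau> y \<and>
   ((\<lambda>t. x t y) has_vector_derivative X\<^sub>q \<tau> y) (at \<tau>)"
  by eventually_elim (use y in blast)
 from AE_lebesgue_on_imp_negligible[OF _ this]
 have N: "negligible {\<tau>\<in>{u..v}. \<not> (L \<tau> y = p \<tau> y \<bullet> X\<^sub>q \<tau> y - h \<tau> y \<and>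
   ((\<lambda>t. x t y) has_vector_derivative X\<^sub>q \<tau> y) (at \<tau>))}" (is "negligible ?N") by simp
 have \<theta>: "((\<lambda>\<tau>. L \<tau> y) has_integral (\<theta> v y - \<theta> u y)) {u..v}"
  using integrable_integral[OF L_integrable[OF uv(1,2) y]] \<theta>_eq[OF uv y] by simp
 have R: "((\<lambda>\<tau>. pbar \<bullet> X\<^sub>q \<tau> y + (\<epsilon> * K - c)) has_integral (pbar \<bullet> (x v y - x u y) + (\<epsilon> * K - c) * (v - u))) {u..v}"
 proof (rule has_integral_add)
  show "((\<lambda>\<tau>. pbar \<bullet> X\<^sub>q \<tau> y) has_integral (pbar \<bullet> (x v y - x u y))) {u..v}"
   using has_integral_linear[OF velocity_integral[OF uv y] bounded_linear_inner_right] by (simp add: o_def)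
  show "((\<lambda>\<tau>. \<epsilon> * K - c) has_integral ((\<epsilon> * K - c) * (v - u))) {u..v}"
   using has_integral_const_real[of "\<epsilon> * K - c" u v] uv(3) by (simp add: mult.commute)
 qed
 show ?thesis
 proof (cases "u = v")
  case False
  show ?thesis
  proof (rule has_integral_le_negligible[OF \<theta> R N])
   fix \<tau> assume \<tau>: "\<tau> \<in> {u..v} - ?N"
   have "norm (X\<^sub>q \<tau> y) \<le> K"
   proof (rule lipschitz_imp_vector_derivative_bound)
    show "((\<lambda>t. x t y) has_vector_derivative X\<^sub>q \<tau> y) (at \<tau> within {u..v})"
     using \<tau> has_vector_derivative_at_within by blast
    show "\<tau> \<in> {u..v}" using \<tau> by blast
    show "u < v" using False uv by simp
    show "norm (x t y - x \<tau> y) \<le> K * \<bar>t - \<tau>\<bar>" if "t \<in> {u..v}" for t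
     using lip_x[of t \<tau> y y] sub \<tau> that y by (auto simp: subset_iff)
   qed
   then have "\<bar>(p \<tau> y - pbar) \<bullet> X\<^sub>q \<tau> y\<bar> \<le> \<epsilon> * K"
    using p[of \<tau>] \<tau> \<epsilon> by (intro order_trans[OF Cauchy_Schwarz_ineq2] mult_mono) auto
   moreover have "c \<le> h \<tau> y" using h \<tau> by blast
   moreover have "L \<tau> y = p \<tau> y \<bullet> X\<^sub>q \<tau> y - h \<tau> y" using \<tau> by blast
   ultimately show "L \<tau> y \<le> pbar \<bullet> X\<^sub>q \<tau> y + (\<epsilon> * K - c)"
    by (simp add: inner_diff_left)
  qed
 qed simp
qed

text \<open>The increment from \<open>u\<close> to \<open>v\<close> is split at the point \<open>(v, Y u)\<close>. The time part and the space part add up to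
  \<open>pbar\<close> times the increment of the position, which is \<open>\<zeta>' (v - u)\<close> to first order, minus the lower
  bound for \<open>h\<close>. All errors are proportional to \<open>v - u\<close> because \<open>Y\<close> moves at most at the rate of the position. The
  hypothesis \<open>good\<close> contains the comparison of \<open>h\<close> with the pre-Hamiltonian near \<open>(s, Y s)\<close>.\<close>
theorem value_along_curve_le:
 assumes ex: "\<And>t y. t \<in> I ==> y \<in> U ==> exact_at t y"
  and ab: "a \<le> b" "{a..b} \<subseteq> I" and Y: "\<And>t. t \<in> {a..b} ==> Y t \<in> U"
  and C: "C \<ge> 0" "\<And>s t. s \<in> {a..b} ==> t \<in> {a..b} ==>
   norm (Y t - Y s) \<le> C * (\<bar>t - s\<bar> + norm (x t (Y t) - x s (Y s)))"
  and ac: "abs_continuous_on {a..b} (\<lambda>t. x t (Y t))"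
  and p_bdd: "\<And>t y. t \<in> I ==> y \<in> U ==> norm (p t y) \<le> B"
  and L_bound: "\<And>s t y. s \<in> I ==> t \<in> I ==> s \<le> t ==> y \<in> U ==> \<bar>\<theta> t y - \<theta> s y\<bar> \<le> B * (t - s)"
  and g: "g integrable_on {a..b}" and N: "negligible N"
  and good: "\<And>s. s \<in> {a..b} - N ==> \<exists>\<zeta>'. ((\<lambda>t. x t (Y t)) has_vector_derivative \<zeta>') (at s within {a..b}) \<and>
   (\<forall>e>0. \<exists>d>0. \<forall>t\<in>I. \<forall>y\<in>U. \<bar>t - s\<bar> < d \<and> norm (y - Y s) < d --> p s (Y s) \<bullet> \<zeta>' - g s - e \<le> h t y)"
 shows "abs_continuous_on {a..b} (\<lambda>t. \<theta> t (Y t))" "\<theta> b (Y b) - \<theta> a (Y a) \<le> integral {a..b} g"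
proof -
 have a: "a \<in> {a..b}" using ab(1) by simp
 have B: "B \<ge> 0" by (rule order_trans[OF norm_ge_zero p_bdd[OF subsetD[OF ab(2) a] Y[OF a]]])
 show AC: "abs_continuous_on {a..b} (\<lambda>t. \<theta> t (Y t))"
 proof (rule abs_continuous_lipschitz_bound[OF ac, where C = "B + B * K * C"])
  show "0 \<le> B + B * K * C" using B K C(1) by simp
  fix s t assume st: "s \<in> {a..b}" "t \<in> {a..b}" "s \<le> t"
  then have I: "s \<in> I" "t \<in> I" using ab by auto
  let ?n = "norm (x t (Y t) - x s (Y s))"
  have "\<bar>\<theta> t (Y t) - \<theta> t (Y s) - 0 \<bullet> (x t (Y t) - x t (Y s))\<bar> \<le> B * K * norm (Y t - Y s)"
   by (rule exact_mean_value[OF I(2) Y[OF st(1)] Y[OF st(2)] ex[OF I(2)]])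
    (use p_bdd[OF I(2)] closed_segment_subset[OF Y[OF st(1)] Y[OF st(2)] U(2)] in auto)
  also have "\<dots> \<le> B * K * (C * (\<bar>t - s\<bar> + ?n))"
   using B K C(2)[OF st(1,2)] by (intro mult_left_mono) auto
  finally have "\<bar>\<theta> t (Y t) - \<theta> t (Y s)\<bar> \<le> B * K * C * (\<bar>t - s\<bar> + ?n)" by simp
  moreover have "\<bar>\<theta> t (Y s) - \<theta> s (Y s)\<bar> \<le> B * (t - s)" by (rule L_bound[OF I st(3) Y[OF st(1)]])
  moreover have "B * (t - s) \<le> B * (\<bar>t - s\<bar> + ?n)" using B st(3) by (intro mult_left_mono) auto
  ultimately have "\<bar>\<theta> t (Y t) - \<theta> s (Y s)\<bar> \<le> B * (\<bar>t - s\<bar> + ?n) + B * K * C * (\<bar>t - s\<bar> + ?n)" by linarith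
  then show "norm (\<theta> t (Y t) - \<theta> s (Y s)) \<le> (B + B * K * C) * (\<bar>t - s\<bar> + ?n)"
   by (simp add: algebra_simps)
 qed
 show "\<theta> b (Y b) - \<theta> a (Y a) \<le> integral {a..b} g"
 proof (rule abs_continuous_increment_le_integral[OF ab(1) AC g N])
  fix s e :: real assume s: "s \<in> {a..b} - N" and e: "e > 0"
  then have sI: "s \<in> I" and sab: "s \<in> {a..b}" using ab by auto
  obtain \<zeta>' where \<zeta>': "((\<lambda>t. x t (Y t)) has_vector_derivative \<zeta>') (at s within {a..b})"
   and low: "\<And>e. e > 0 ==> \<exists>d>0. \<forall>t\<in>I. \<forall>y\<in>U. \<bar>t - s\<bar> < d \<and> norm (y - Y s) < d --> p s (Y s) \<bullet> \<zeta>' - g s - e \<le> h t y"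
   using good[OF s] by (elim exE conjE) (use that in blast)
  define pbar where "pbar = p s (Y s)"
  define M where "M = C * (2 + norm \<zeta>')"
  have M: "M \<ge> 0" using C(1) by (simp add: M_def)
  define W where "W = K + 1 + norm pbar + K * M"
  have W: "W > 0" using K M by (simp add: W_def add_nonneg_pos add_pos_nonneg)
  \<comment> \<open>\<open>W\<close> collects the coefficients of the four error terms: oscillation of \<open>p\<close> against the velocity, lower bound for \<open>h\<close>, remainder of the position, oscillation of \<open>p\<close> against the spatial step.\<close>
  define \<epsilon> where "\<epsilon> = min 1 (e / W)"
  have \<epsilon>: "\<epsilon> > 0" "\<epsilon> \<le> 1" "\<epsilon> * W \<le> e"
  proof -
   show "\<epsilon> > 0" "\<epsilon> \<le> 1" using e W by (auto simp: \<epsilon>_def)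
   have "\<epsilon> * W \<le> e / W * W" using W by (intro mult_right_mono) (auto simp: \<epsilon>_def)
   then show "\<epsilon> * W \<le> e" using W by simp
  qed
  obtain d1 where d1: "d1 > 0" "\<And>t. t \<in> {a..b} ==> \<bar>t - s\<bar> < d1 ==>
    norm (x t (Y t) - x s (Y s) - (t - s) *\<^sub>R \<zeta>') \<le> \<epsilon> * \<bar>t - s\<bar>"
   using has_vector_derivative_increment[OF \<zeta>' \<epsilon>(1)] by blast
  obtain d2 where d2: "d2 > 0" "\<And>t y. t \<in> I ==> y \<in> U ==> \<bar>t - s\<bar> < d2 ==> norm (y - Y s) < d2 ==> pbar \<bullet> \<zeta>' - g s - \<epsilon> \<le> h t y"
   using low[OF \<epsilon>(1)] unfolding pbar_def by (elim exE conjE) (use that in blast)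
  define r where "r = min d2 (\<epsilon> / (2 * (K + 1)))"
  have r: "r > 0" using d2(1) \<epsilon>(1) K by (simp add: r_def)
  define d where "d = min d1 (min r (r / (M + 1)))"
  have d: "d > 0" using d1(1) r M by (simp add: d_def)
  have incr: "norm (x t (Y t) - x s (Y s)) \<le> (norm \<zeta>' + 1) * \<bar>t - s\<bar>" if "t \<in> {a..b}" "\<bar>t - s\<bar> < d1" for t
  proof -
   have "norm (x t (Y t) - x s (Y s)) = norm ((x t (Y t) - x s (Y s) - (t - s) *\<^sub>R \<zeta>') + (t - s) *\<^sub>R \<zeta>')" by simp
   also have "\<dots> \<le> \<epsilon> * \<bar>t - s\<bar> + norm ((t - s) *\<^sub>R \<zeta>')"
    using norm_triangle_ineq d1(2)[OF that] by (meson add_right_mono order_trans)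
   also have "\<dots> \<le> 1 * \<bar>t - s\<bar> + \<bar>t - s\<bar> * norm \<zeta>'" using \<epsilon>(2) by (intro add_mono mult_right_mono) auto
   finally show ?thesis by (simp add: algebra_simps)
  qed
  have Ys: "norm (Y t - Y s) \<le> M * \<bar>t - s\<bar>" if "t \<in> {a..b}" "\<bar>t - s\<bar> < d1" for t
  proof -
   have "norm (Y t - Y s) \<le> C * (\<bar>t - s\<bar> + norm (x t (Y t) - x s (Y s)))" by (rule C(2)[OF sab that(1)])
   also have "\<dots> \<le> C * (\<bar>t - s\<bar> + (norm \<zeta>' + 1) * \<bar>t - s\<bar>)" using incr[OF that] by (intro mult_left_mono C(1)) auto
   finally show ?thesis by (simp add: M_def algebra_simps)
  qed
  have near: "norm (Y t - Y s) < r" if t: "t \<in> {a..b}" "\<bar>t - s\<bar> < d" for t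
  proof -
   have "norm (Y t - Y s) \<le> M * \<bar>t - s\<bar>" by (rule Ys) (use t in \<open>auto simp: d_def\<close>)
   also have "\<dots> \<le> (M + 1) * \<bar>t - s\<bar>" by (intro mult_right_mono) auto
   also have "\<dots> < (M + 1) * (r / (M + 1))" using t M by (intro mult_strict_left_mono) (auto simp: d_def)
   finally show ?thesis using M by simp
  qed
  have pn: "norm (p t y - pbar) \<le> \<epsilon>" if "t \<in> I" "y \<in> U" "\<bar>t - s\<bar> < r" "norm (y - Y s) < r" for t y
  proof -
   have "norm (p t y - pbar) \<le> K * (\<bar>t - s\<bar> + norm (y - Y s))" unfolding pbar_def by (rule lip_p[OF that(1) sI that(2) Y[OF sab]])
   also have "\<dots> \<le> (K + 1) * (r + r)" using that K by (intro mult_mono add_mono) auto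
   also have "\<dots> \<le> (K + 1) * (\<epsilon> / (2 * (K + 1)) + \<epsilon> / (2 * (K + 1)))" using K by (intro mult_left_mono add_mono) (auto simp: r_def)
   also have "\<dots> = \<epsilon>"
   proof -
    have "c * (\<epsilon> / (2 * c) + \<epsilon> / (2 * c)) = \<epsilon>" if "c > 0" for c :: real using that by (simp add: field_simps)
    from this[of "K + 1"] K show ?thesis by simp
   qed
   finally show ?thesis .
  qed
  have "\<theta> v (Y v) - \<theta> u (Y u) \<le> (g s + e) * (v - u)" if uv: "a \<le> u" "u \<le> s" "s \<le> v" "v \<le> b" "s - d < u" "v < s + d" for u v
  proof -
   have m: "u \<in> {a..b}" "v \<in> {a..b}" "\<bar>u - s\<bar> < d" "\<bar>v - s\<bar> < d" "u \<le> v" using uv by auto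
   have I: "u \<in> I" "v \<in> I" using m ab by auto
   have dr: "d \<le> r" "d \<le> d1" "r \<le> d2" by (auto simp: d_def r_def)
   have yu: "norm (Y u - Y s) < r" and yv: "norm (Y v - Y s) < r" using near m by auto
   have YU: "Y u \<in> U" "Y v \<in> U" using Y m by auto
   have "\<bar>\<theta> v (Y v) - \<theta> v (Y u) - pbar \<bullet> (x v (Y v) - x v (Y u))\<bar> \<le> \<epsilon> * K * norm (Y v - Y u)"
   proof (rule exact_mean_value[OF I(2) YU ex[OF I(2)]])
    fix z assume z: "z \<in> closed_segment (Y u) (Y v)"
    then have zU: "z \<in> U" using closed_segment_subset[OF YU U(2)] by blast
    have "closed_segment (Y u) (Y v) \<subseteq> ball (Y s) r"
     by (rule closed_segment_subset) (use yu yv in \<open>auto simp: dist_norm norm_minus_commute\<close>)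
    then have "norm (z - Y s) < r" using z by (auto simp: dist_norm norm_minus_commute)
    then show "norm (p v z - pbar) \<le> \<epsilon>" by (intro pn I zU) (use m dr in auto)
   qed
   moreover have "norm (Y v - Y u) \<le> M * (v - u)"
   proof -
    have "norm (Y v - Y u) \<le> norm (Y v - Y s) + norm (Y u - Y s)" by (metis dist_norm dist_triangle2)
    also have "\<dots> \<le> M * \<bar>v - s\<bar> + M * \<bar>u - s\<bar>" by (intro add_mono Ys m) (use m dr in auto)
    also have "\<dots> = M * (v - u)" using uv by (simp add: algebra_simps)
    finally show ?thesis .
   qed
   then have "\<epsilon> * K * norm (Y v - Y u) \<le> \<epsilon> * K * (M * (v - u))" using \<epsilon>(1) K by (intro mult_left_mono) auto
   moreover have "\<theta> v (Y u) - \<theta> u (Y u) \<le> pbar \<bullet> (x v (Y u) - x u (Y u)) + (\<epsilon> * K - (pbar \<bullet> \<zeta>' - g s - \<epsilon>)) * (v - u)"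
   proof (rule value_increment_at_fixed_base[OF I m(5) YU(1)])
    fix \<tau> assume \<tau>: "\<tau> \<in> {u..v}"
    then have \<tau>': "\<tau> \<in> I" "\<bar>\<tau> - s\<bar> < d" using Icc_sub[OF I] uv by auto
    show "norm (p \<tau> (Y u) - pbar) \<le> \<epsilon>" by (rule pn[OF \<tau>'(1) YU(1) _ yu]) (use \<tau>' dr in auto)
    show "pbar \<bullet> \<zeta>' - g s - \<epsilon> \<le> h \<tau> (Y u)" by (rule d2(2)[OF \<tau>'(1) YU(1)]) (use \<tau>' dr yu in auto)
   qed (use \<epsilon> in simp)
   moreover have "pbar \<bullet> (x v (Y v) - x u (Y u)) \<le> pbar \<bullet> \<zeta>' * (v - u) + norm pbar * (\<epsilon> * (v - u))"
   proof -
    let ?z = "\<lambda>t. x t (Y t) - x s (Y s) - (t - s) *\<^sub>R \<zeta>'"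
    have eq: "x v (Y v) - x u (Y u) = (v - u) *\<^sub>R \<zeta>' + (?z v - ?z u)" by (simp add: algebra_simps)
    have "norm (?z v - ?z u) \<le> norm (?z v) + norm (?z u)" by (rule norm_triangle_ineq4)
    also have "\<dots> \<le> \<epsilon> * \<bar>v - s\<bar> + \<epsilon> * \<bar>u - s\<bar>" by (intro add_mono d1(2) m) (use m dr in auto)
    also have "\<dots> = \<epsilon> * (v - u)" using uv by (simp add: algebra_simps)
    finally have "pbar \<bullet> (?z v - ?z u) \<le> norm pbar * (\<epsilon> * (v - u))"
     by (intro order_trans[OF norm_cauchy_schwarz] mult_left_mono) auto
    then show ?thesis unfolding eq inner_add_right by (simp add: mult.commute)
   qed
   moreover have "pbar \<bullet> (x v (Y v) - x v (Y u)) + pbar \<bullet> (x v (Y u) - x u (Y u)) = pbar \<bullet> (x v (Y v) - x u (Y u))"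
    by (simp add: inner_add_right[symmetric])
   ultimately have "\<theta> v (Y v) - \<theta> u (Y u) \<le> \<epsilon> * K * (M * (v - u)) + (\<epsilon> * K - (pbar \<bullet> \<zeta>' - g s - \<epsilon>)) * (v - u)
     + (pbar \<bullet> \<zeta>' * (v - u) + norm pbar * (\<epsilon> * (v - u)))" by linarith
   also have "\<dots> = (g s + \<epsilon> * W) * (v - u)" by (simp add: W_def algebra_simps)
   also have "\<dots> \<le> (g s + e) * (v - u)" using \<epsilon>(3) m(5) by (intro mult_right_mono) auto
   finally show ?thesis .
  qed
  then show "\<exists>d>0. \<forall>u v. a \<le> u \<and> u \<le> s \<and> s \<le> v \<and> v \<le> b \<and> s - d < u \<and> v < s + d -->
    \<theta> v (Y v) - \<theta> u (Y u) \<le> (g s + e) * (v - u)" using d by blast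
 qed
qed


lemma uniform_bounds:
 assumes bI: "bounded I" and bU: "bounded U" and t0: "t0 \<in> I" and y0: "y0 \<in> U"
 obtains B where "\<And>t y. t \<in> I ==> y \<in> U ==> norm (p t y) \<le> B"
  "\<And>s t y. s \<in> I ==> t \<in> I ==> s \<le> t ==> y \<in> U ==> \<bar>\<theta> t y - \<theta> s y\<bar> \<le> B * (t - s)"
proof -
 obtain R where R: "\<And>t. t \<in> I ==> \<bar>t - t0\<bar> \<le> R"
  using bI unfolding bounded_any_center[of I t0] by (auto simp: dist_real_def abs_minus_commute)
 obtain r where r: "\<And>y. y \<in> U ==> norm (y - y0) \<le> r"
  using bU unfolding bounded_any_center[of U y0] by (auto simp: dist_norm norm_minus_commute)
 obtain C where C: "\<forall>t\<in>I. \<bar>L t y0\<bar> \<le> C" using L_bdd[OF y0] by blast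
 show thesis
 proof (rule that)
  fix t y assume ty: "t \<in> I" "y \<in> U"
  have "norm (p t y) \<le> norm (p t0 y0) + norm (p t y - p t0 y0)" by (rule norm_triangle_sub)
  also have "\<dots> \<le> norm (p t0 y0) + K * (R + r)"
   by (intro add_left_mono order_trans[OF lip_p[OF ty(1) t0 ty(2) y0]] mult_left_mono add_mono R r ty K)
  also have "\<dots> \<le> max (norm (p t0 y0) + K * (R + r)) (C + K * r)" by simp
  finally show "norm (p t y) \<le> max (norm (p t0 y0) + K * (R + r)) (C + K * r)" .
 next
  fix s t y assume st: "s \<in> I" "t \<in> I" "s \<le> t" and y: "y \<in> U"
  have sub: "{s..t} \<subseteq> I" by (rule Icc_sub[OF st(1,2)])
  have "AE \<tau> in lebesgue_on {s..t}. \<forall>y\<in>U. \<forall>y'\<in>U. \<bar>L \<tau> y' - L \<tau> y\<bar> \<le> K * norm (y' - y)"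
   by (rule AE_lebesgue_onI[OF L_lip sub]) simp
  from AE_lebesgue_on_imp_negligible[OF _ this]
  have N: "negligible {\<tau>\<in>{s..t}. \<not> (\<forall>y\<in>U. \<forall>y'\<in>U. \<bar>L \<tau> y' - L \<tau> y\<bar> \<le> K * norm (y' - y))}" (is "negligible ?N") by simp
  have bnd: "\<bar>L \<tau> y\<bar> \<le> C + K * r" if "\<tau> \<in> {s..t} - ?N" for \<tau>
  proof -
   have "\<bar>L \<tau> y - L \<tau> y0\<bar> \<le> K * norm (y - y0)" using that y y0 by blast
   also have "\<dots> \<le> K * r" by (rule mult_left_mono[OF r[OF y] K])
   moreover have "\<bar>L \<tau> y0\<bar> \<le> C" using that C sub by blast
   ultimately show ?thesis by linarith
  qed
  have \<theta>: "((\<lambda>\<tau>. L \<tau> y) has_integral (\<theta> t y - \<theta> s y)) {s..t}"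
   using integrable_integral[OF L_integrable[OF st(1,2) y]] \<theta>_eq[OF st y] by simp
  have c: "((\<lambda>_. k) has_integral (k * (t - s))) {s..t}" for k :: real
   using has_integral_const_real[of k s t] st(3) by (simp add: mult.commute)
  have "\<theta> t y - \<theta> s y \<le> (C + K * r) * (t - s)"
   by (rule has_integral_le_negligible[OF \<theta> c N]) (use bnd in force)
  moreover have "- (C + K * r) * (t - s) \<le> \<theta> t y - \<theta> s y"
   by (rule has_integral_le_negligible[OF c \<theta> N]) (use bnd in force)
  ultimately have "\<bar>\<theta> t y - \<theta> s y\<bar> \<le> (C + K * r) * (t - s)" unfolding mult_minus_left by linarith
  also have "\<dots> \<le> max (norm (p t0 y0) + K * (R + r)) (C + K * r) * (t - s)"
   using st(3) by (intro mult_right_mono) auto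
  finally show "\<bar>\<theta> t y - \<theta> s y\<bar> \<le> max (norm (p t0 y0) + K * (R + r)) (C + K * r) * (t - s)" .
 qed
qed

lemma continuous_on_box:
 assumes "f \<in> {x, p}"
 shows "continuous_on (I \<times> U) (\<lambda>z. f (fst z) (snd z))"
proof (rule lipschitz_on_continuous_on[OF lipschitz_onI])
 fix z z' assume z: "z \<in> I \<times> U" "z' \<in> I \<times> U"
 have "norm (f (fst z) (snd z) - f (fst z') (snd z')) \<le> K * (\<bar>fst z - fst z'\<bar> + norm (snd z - snd z'))"
  using assms lip_x[of "fst z" "fst z'" "snd z" "snd z'"] lip_p[of "fst z" "fst z'" "snd z" "snd z'"] z by (auto simp: mem_Times_iff)
 also have "\<dots> \<le> K * (dist z z' + dist z z')"
  using dist_fst_le[of z z'] dist_snd_le[of z z'] by (intro mult_left_mono add_mono K) (simp_all add: dist_norm)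
 finally show "dist (f (fst z) (snd z)) (f (fst z') (snd z')) \<le> (2 * K) * dist z z'"
  by (simp add: dist_norm algebra_simps)
qed (use K in simp)

lemma sub_box:
 assumes "open U'" "convex U'" "U' \<subseteq> U" "is_interval I'" "I' \<subseteq> I"
 shows "flow_box I' U' K x p X\<^sub>q X\<^sub>p h L \<theta>"
proof
 show "AE t in lebesgue. t \<in> I' --> (\<forall>y\<in>U'. L t y = p t y \<bullet> X\<^sub>q t y - h t y)"
  using L_eq by eventually_elim (use assms in blast)
 show "AE t in lebesgue. t \<in> I' --> (\<forall>y\<in>U'. \<forall>y'\<in>U'. \<bar>L t y' - L t y\<bar> \<le> K * norm (y' - y))"
  using L_lip by eventually_elim (use assms in blast)
 show "AE t in lebesgue. t \<in> I' --> (\<forall>y\<in>U'. \<forall>e>0. \<exists>d>0. \<forall>y'\<in>U'. norm (y' - y) < d -->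
   \<bar>h t y' - h t y - ((p t y' - p t y) \<bullet> X\<^sub>q t y - (x t y' - x t y) \<bullet> X\<^sub>p t y)\<bar> \<le> e * norm (y' - y))"
  using h_diff by eventually_elim (use assms in \<open>meson subsetD\<close>)
 show "AE t in lebesgue. t \<in> I' --> ((\<lambda>t. x t y) has_vector_derivative X\<^sub>q t y) (at t) \<and>
   ((\<lambda>t. p t y) has_vector_derivative X\<^sub>p t y) (at t)" if "y \<in> U'" for y
  using der[OF subsetD[OF assms(3) that]] by eventually_elim (use assms in blast)
 show "\<exists>C. \<forall>t\<in>I'. \<bar>L t y\<bar> \<le> C" if "y \<in> U'" for y
  using L_bdd[OF subsetD[OF assms(3) that]] assms(5) by blast
 show "norm (x t y - x t' y') \<le> K * (\<bar>t - t'\<bar> + norm (y - y'))" "norm (p t y - p t' y') \<le> K * (\<bar>t - t'\<bar> + norm (y - y'))"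
  if "t \<in> I'" "t' \<in> I'" "y \<in> U'" "y' \<in> U'" for t t' y y'
  by (rule lip_x lip_p; rule subsetD[OF assms(5)] subsetD[OF assms(3)], rule that)+
 show "(\<lambda>t. L t y) \<in> borel_measurable (lebesgue_on S)" if "y \<in> U'" "S \<subseteq> I'" "S \<in> sets lebesgue" for y S
  by (rule L_meas[OF subsetD[OF assms(3) that(1)] order_trans[OF that(2) assms(5)] that(3)])
 show "\<theta> t y = \<theta> s y + integral {s..t} (\<lambda>\<tau>. L \<tau> y)" if "s \<in> I'" "t \<in> I'" "s \<le> t" "y \<in> U'" for s t y
  by (rule \<theta>_eq[OF subsetD[OF assms(5) that(1)] subsetD[OF assms(5) that(2)] that(3) subsetD[OF assms(3) that(4)]])
qed (rule assms K)+

end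

section \<open>The field of extremals issued from a Lagrangian graph\<close>

lemma smooth_on_C2:
 fixes f :: "'a::euclidean_space => real"
 assumes "smooth_on S f"
 shows "\<And>x. x \<in> S ==> (f has_derivative frechet_derivative f (at x)) (at x)"
  and "\<And>x b. x \<in> S ==> ((\<lambda>x. frechet_derivative f (at x) b) has_derivative
   frechet_derivative (\<lambda>x. frechet_derivative f (at x) b) (at x)) (at x)"
  and "\<And>b v. continuous_on S (\<lambda>x. frechet_derivative (\<lambda>x. frechet_derivative f (at x) b) (at x) v)"
proof -
 have "Ck_on (Suc (Suc 0)) S f" using assms unfolding smooth_on_def by blast
 then have 1: "\<forall>x\<in>S. f differentiable (at x)"
  and 2: "\<forall>b. \<forall>x\<in>S. (\<lambda>x. frechet_derivative f (at x) b) differentiable (at x)"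
  and 3: "\<forall>b v. continuous_on S (\<lambda>x. frechet_derivative (\<lambda>x. frechet_derivative f (at x) b) (at x) v)"
  by simp_all
 show "\<And>x. x \<in> S ==> (f has_derivative frechet_derivative f (at x)) (at x)"
  using 1 frechet_derivative_works by blast
 show "\<And>x b. x \<in> S ==> ((\<lambda>x. frechet_derivative f (at x) b) has_derivative
   frechet_derivative (\<lambda>x. frechet_derivative f (at x) b) (at x)) (at x)"
  using 2 frechet_derivative_works by blast
 show "\<And>b v. continuous_on S (\<lambda>x. frechet_derivative (\<lambda>x. frechet_derivative f (at x) b) (at x) v)"
  using 3 by blast
qed

lemma C1_imp_lipschitz_on_cball:
 fixes f :: "'a::euclidean_space => 'b::euclidean_space"
 assumes d: "\<And>x. x \<in> cball y r ==> (f has_derivative D x) (at x)"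
  and c: "\<And>v. continuous_on (cball y r) (\<lambda>x. D x v)"
 obtains C where "C \<ge> 0" "\<And>x x'. x \<in> cball y r ==> x' \<in> cball y r ==> norm (f x - f x') \<le> C * norm (x - x')"
proof -
 have "\<exists>M. \<forall>x\<in>cball y r. norm (D x b) \<le> M" for b
  using compact_imp_bounded[OF compact_continuous_image[OF c[of b] compact_cball]]
  by (auto simp: bounded_iff)
 then obtain M where M: "\<And>b x. x \<in> cball y r ==> norm (D x b) \<le> M b" by metis
 define C where "C = (\<Sum>b\<in>(Basis::'a set). \<bar>M b\<bar>)"
 have on: "onorm (D x) \<le> C" if x: "x \<in> cball y r" for x
 proof (rule onorm_bound)
  show "0 \<le> C" by (simp add: C_def sum_nonneg)
  fix v
  have lin: "linear (D x)" using d[OF x] has_derivative_linear by blast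
  have "D x v = (\<Sum>b\<in>Basis. (v \<bullet> b) *\<^sub>R D x b)"
   using linear_sum[OF lin, of "\<lambda>b. (v \<bullet> b) *\<^sub>R b" Basis] by (simp add: euclidean_representation linear_cmul[OF lin])
  then have "norm (D x v) \<le> (\<Sum>b\<in>Basis. norm ((v \<bullet> b) *\<^sub>R D x b))" by (simp only: norm_sum)
  also have "\<dots> \<le> (\<Sum>b\<in>Basis. norm v * \<bar>M b\<bar>)"
  proof (rule sum_mono)
   fix b :: 'a assume b: "b \<in> Basis"
   have "norm (D x b) \<le> \<bar>M b\<bar>" using M[OF x, of b] by linarith
   then show "norm ((v \<bullet> b) *\<^sub>R D x b) \<le> norm v * \<bar>M b\<bar>"
    using Basis_le_norm[OF b, of v] by (auto intro!: mult_mono)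
  qed
  finally show "norm (D x v) \<le> C * norm v" by (simp add: C_def sum_distrib_left mult.commute)
 qed
 show thesis
 proof (rule that)
  show "0 \<le> C" by (simp add: C_def sum_nonneg)
  show "norm (f x - f x') \<le> C * norm (x - x')" if "x \<in> cball y r" "x' \<in> cball y r" for x x'
   by (rule differentiable_bound[OF convex_cball _ on that(1,2)])
    (use d has_derivative_at_withinI in blast)
 qed
qed

text \<open>\<open>W\<close> cuts the graph of \<open>d\<alpha>\<close> down to the part from which the flow starts, and \<open>\<O>\<close> is the domain of the Hamiltonian.\<close>
locale extremal_field = smooth_manifold A
 for A :: "('p, 'e::euclidean_space) chart set" +
 fixes gT :: "(('p, 'e) cot, 'e \<times> 'e) metric_tensor" and \<alpha> :: "'p => real" and V :: "'p set"
  and W \<O> :: "('p, 'e) cot set" and J :: "real set" and H :: "real => ('p, 'e) cot => real"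
  and \<Phi> :: "real => ('p, 'e) cot => ('p, 'e) cot"
 assumes haus: "Hausdorff_space (mtop A)" and conn: "connected_space (mtop A)"
  and metric_T: "riemannian_metric (cot_atlas A) gT"
  and V: "openin (mtop A) V" and \<alpha>: "msmooth_on A V \<alpha>"
  and W: "openin (mtop (cot_atlas A)) W" and \<O>: "openin (mtop (cot_atlas A)) \<O>"
  and J: "open J" "is_interval J"
  and H_diff: "AE t in lebesgue_on J. \<forall>l\<in>\<O>. mdifferentiable_at (cot_atlas A) (H t) l"
  and flow: "is_flow (cot_atlas A) \<O> (\<lambda>t. hamiltonian_vector A (H t)) J (graph_differential A \<alpha> V \<inter> W) \<Phi>"
  and flow_lip: "\<exists>L. \<forall>t\<in>J. \<forall>l\<in>graph_differential A \<alpha> V \<inter> W. \<forall>s\<in>J. \<forall>k\<in>graph_differential A \<alpha> V \<inter> W.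
   riemannian_dist (cot_atlas A) gT (\<Phi> t l) (\<Phi> s k) \<le> L * (\<bar>t - s\<bar> + riemannian_dist (cot_atlas A) gT l k)"
  and lc: "lipschitz_caratheodory (mtop (cot_atlas A)) (riemannian_dist (cot_atlas A) gT) J
   (graph_differential A \<alpha> V \<inter> W) (lagrangian_along A H \<Phi>)"
begin

abbreviation "\<Lambda> \<equiv> graph_differential A \<alpha> V \<inter> W"
abbreviation "dT \<equiv> riemannian_dist (cot_atlas A) gT"
abbreviation "Lag \<equiv> lagrangian_along A H \<Phi>"
abbreviation "\<theta> \<equiv> theta A \<alpha> H \<Phi>"
abbreviation "XH t \<equiv> hamiltonian_vector A (H t)"

sublocale TR: C1_riemannian "cot_atlas A" gT by unfold_locales (rule metric_T)

text \<open>The point of the graph above the point with coordinate \<open>y\<close>; it makes the base chart \<open>c\<close> a parametrisation of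
  the Lagrangian submanifold.\<close>
definition lam :: "('p, 'e) chart => 'e => ('p, 'e) cot" where
 "lam c y = (crd_inv c y, differential A \<alpha> (crd_inv c y))"

abbreviation "pos c c0 t y \<equiv> crd c (fst (\<Phi> t (lam c0 y)))"
abbreviation "imp c c0 t y \<equiv> mom c (\<Phi> t (lam c0 y))"

lemma \<alpha>_diff: "x \<in> V ==> mdifferentiable_at A \<alpha> x"
 unfolding mdifferentiable_at_def
proof (intro ballI impI)
 fix c assume x: "x \<in> V" "x \<in> dom_of c" and c: "c \<in> A"
 have "smooth_on (crd c ` (V \<inter> dom_of c)) (\<alpha> \<circ> crd_inv c)" using \<alpha> c by (simp add: msmooth_on_def)
 from smooth_on_C2(1)[OF this, of "crd c x"] x
 show "(\<alpha> \<circ> crd_inv c) differentiable (at (crd c x))" unfolding differentiable_def by blast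
qed

lemma differential_\<alpha>:
 assumes c: "c \<in> A" "x \<in> V" "x \<in> dom_of c" and v: "v \<in> tangent_space A x"
 shows "differential A \<alpha> x v = frechet_derivative (\<alpha> \<circ> crd_inv c) (at (crd c x)) (v c)"
 by (rule differential_chart[OF \<alpha>_diff c(1,3) v]) (rule c)

lemma \<alpha>_smooth: "c \<in> A ==> smooth_on (crd c ` (V \<inter> dom_of c)) (\<alpha> \<circ> crd_inv c)"
 using \<alpha> by (simp add: msmooth_on_def)

lemma differential_cot:
 assumes c: "c \<in> A" "x \<in> V" "x \<in> dom_of c"
 shows "differential A \<alpha> x = covec c x (\<Sum>b\<in>Basis. frechet_derivative (\<alpha> \<circ> crd_inv c) (at (crd c x)) b *\<^sub>R b)"
proof
 fix v
 let ?D = "frechet_derivative (\<alpha> \<circ> crd_inv c) (at (crd c x))"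
 have lin: "linear ?D"
  using has_derivative_linear[OF smooth_on_C2(1)[OF \<alpha>_smooth[OF c(1)]]] c by blast
 show "differential A \<alpha> x v = covec c x (\<Sum>b\<in>Basis. ?D b *\<^sub>R b) v"
 proof (cases "v \<in> tangent_space A x")
  case True
  have "?D (v c) = (\<Sum>b\<in>Basis. (v c \<bullet> b) * ?D b)" by (rule linear_expand[OF lin])
  also have "\<dots> = (\<Sum>b\<in>Basis. ?D b *\<^sub>R b) \<bullet> v c" by (simp add: inner_sum_left inner_commute[of "v c"] mult.commute)
  finally show ?thesis using differential_\<alpha>[OF c True] True by (simp add: covec_def)
 qed (simp add: differential_def covec_def)
qed

lemma lam_crd: "c \<in> A ==> k \<in> graph_differential A \<alpha> V ==> fst k \<in> dom_of c ==> lam c (crd c (fst k)) = k"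
 by (auto simp: lam_def graph_differential_def)

lemma lam_mem:
 assumes c: "c \<in> A" and y: "y \<in> crd c ` (V \<inter> dom_of c)"
 shows "lam c y \<in> dom_of (cot_chart A c)" "fst (lam c y) = crd_inv c y" "crd c (fst (lam c y)) = y"
  "mom c (lam c y) = (\<Sum>b\<in>Basis. frechet_derivative (\<alpha> \<circ> crd_inv c) (at y) b *\<^sub>R b)"
  "lam c y \<in> graph_differential A \<alpha> V"
proof -
 obtain x where x: "x \<in> V" "x \<in> dom_of c" "y = crd c x" using y by blast
 have ix: "crd_inv c y = x" using c x by simp
 show 1: "fst (lam c y) = crd_inv c y" by (simp add: lam_def)
 show "crd c (fst (lam c y)) = y" unfolding 1 ix using x by simp
 have l: "lam c y = (x, covec c x (\<Sum>b\<in>Basis. frechet_derivative (\<alpha> \<circ> crd_inv c) (at y) b *\<^sub>R b))"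
  unfolding lam_def ix differential_cot[OF c x(1,2)] unfolding x(3) ..
 show "lam c y \<in> dom_of (cot_chart A c)" unfolding l dom_cot_chart using covec_cot[OF c x(2)] x(2) by simp
 show "mom c (lam c y) = (\<Sum>b\<in>Basis. frechet_derivative (\<alpha> \<circ> crd_inv c) (at y) b *\<^sub>R b)"
  unfolding l by (rule mom_covec[OF c x(2)])
 show "lam c y \<in> graph_differential A \<alpha> V" using x(1) by (auto simp: lam_def ix graph_differential_def)
qed

lemma open_base: "c \<in> A ==> open (crd c ` (V \<inter> dom_of c))"
 by (rule open_image_chart[OF V])

lemma mom_lam_lipschitz:
 assumes c: "c \<in> A" and r: "cball y0 r \<subseteq> crd c ` (V \<inter> dom_of c)"
 obtains C where "C \<ge> 0" "\<And>y y'. y \<in> cball y0 r ==> y' \<in> cball y0 r ==>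
  norm (mom c (lam c y) - mom c (lam c y')) \<le> C * norm (y - y')"
proof -
 note sm = smooth_on_C2[OF \<alpha>_smooth[OF c]]
 let ?f = "\<lambda>b y. frechet_derivative (\<alpha> \<circ> crd_inv c) (at y) b"
 obtain C where C: "C \<ge> 0" "\<And>y y'. y \<in> cball y0 r ==> y' \<in> cball y0 r ==>
   norm ((\<Sum>b\<in>Basis. ?f b y *\<^sub>R b) - (\<Sum>b\<in>Basis. ?f b y' *\<^sub>R b)) \<le> C * norm (y - y')"
 proof (rule C1_imp_lipschitz_on_cball)
  show "((\<lambda>y. \<Sum>b\<in>Basis. ?f b y *\<^sub>R b) has_derivative
    (\<lambda>v. \<Sum>b\<in>Basis. frechet_derivative (?f b) (at y) v *\<^sub>R b)) (at y)" if "y \<in> cball y0 r" for y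
   by (intro has_derivative_sum has_derivative_scaleR_left sm(2)) (use that r in blast)
  show "continuous_on (cball y0 r) (\<lambda>y. \<Sum>b\<in>Basis. frechet_derivative (?f b) (at y) v *\<^sub>R b)" for v
   by (intro continuous_intros continuous_on_subset[OF sm(3) r])
 qed blast
 show thesis
 proof (rule that[OF C(1)])
  fix y y' assume y: "y \<in> cball y0 r" "y' \<in> cball y0 r"
  then have "y \<in> crd c ` (V \<inter> dom_of c)" "y' \<in> crd c ` (V \<inter> dom_of c)" using r by auto
  then show "norm (mom c (lam c y) - mom c (lam c y')) \<le> C * norm (y - y')"
   using C(2)[OF y] by (simp add: lam_mem(4)[OF c])
 qed
qed

text \<open>The gradient of \<open>\<alpha>\<close> is of class C1, so that the parametrisation by base coordinates is Lipschitz for the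
  Riemannian distance of the cotangent bundle.\<close>
lemma lam_chart:
 assumes c: "c \<in> A" and k: "k0 \<in> \<Lambda>" "fst k0 \<in> dom_of c"
 obtains r C where "r > 0" "C \<ge> 0" "cball (crd c (fst k0)) r \<subseteq> crd c ` (V \<inter> dom_of c)"
  "\<And>y. y \<in> cball (crd c (fst k0)) r ==> lam c y \<in> \<Lambda>"
  "\<And>y y'. y \<in> cball (crd c (fst k0)) r ==> y' \<in> cball (crd c (fst k0)) r ==>
   norm (mom c (lam c y) - mom c (lam c y')) \<le> C * norm (y - y')"
  "\<And>y y'. y \<in> cball (crd c (fst k0)) r ==> y' \<in> cball (crd c (fst k0)) r ==>
   0 \<le> dT (lam c y) (lam c y') \<and> dT (lam c y) (lam c y') \<le> C * norm (y - y')"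
proof -
 define y0 where "y0 = crd c (fst k0)"
 have kV: "fst k0 \<in> V" using k by (auto simp: graph_differential_def)
 have lam0: "lam c y0 = k0" unfolding y0_def by (rule lam_crd[OF c]) (use k in auto)
 have "y0 \<in> crd c ` (V \<inter> dom_of c)" using kV k(2) by (auto simp: y0_def)
 then obtain r1 where r1: "r1 > 0" "cball y0 r1 \<subseteq> crd c ` (V \<inter> dom_of c)"
  using open_contains_cball_eq[OF open_base[OF c]] by blast
 obtain C1 where C1: "C1 \<ge> 0" "\<And>y y'. y \<in> cball y0 r1 ==> y' \<in> cball y0 r1 ==>
  norm (mom c (lam c y) - mom c (lam c y')) \<le> C1 * norm (y - y')"
  using mom_lam_lipschitz[OF c r1(2)] by blast
 let ?C = "cot_chart A c"
 have C: "?C \<in> cot_atlas A" by (rule cot_chart_in[OF c])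
 have dom: "lam c y \<in> dom_of ?C" "crd c (fst (lam c y)) = y" if "y \<in> cball y0 r1" for y
  using lam_mem(1,3)[OF c] that r1(2) by blast+
 have crd_diff: "norm (crd ?C (lam c y') - crd ?C (lam c y)) \<le> (1 + C1) * norm (y - y')"
  if "y \<in> cball y0 r1" "y' \<in> cball y0 r1" for y y'
 proof -
  have "norm (crd ?C (lam c y') - crd ?C (lam c y)) = norm (y' - y, mom c (lam c y') - mom c (lam c y))"
   by (simp add: crd_cot_chart dom(2)[OF that(1)] dom(2)[OF that(2)])
  also have "\<dots> \<le> norm (y' - y) + norm (mom c (lam c y') - mom c (lam c y))" by (rule norm_Pair_le)
  also have "\<dots> \<le> norm (y' - y) + C1 * norm (y' - y)" using C1(2)[OF that(2,1)] by simp
  finally show ?thesis by (simp add: algebra_simps norm_minus_commute)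
 qed
 have k0C: "k0 \<in> dom_of ?C" using dom(1)[of y0] r1(1) lam0 by simp
 obtain r2 M where r2: "r2 > 0" "M > 0"
  "\<And>v v'. v \<in> dom_of ?C ==> v' \<in> dom_of ?C ==> crd ?C v \<in> ball (crd ?C k0) r2 ==> crd ?C v' \<in> ball (crd ?C k0) r2 ==>
   0 \<le> dT v v' \<and> dT v v' \<le> M * norm (crd ?C v' - crd ?C v)"
  using TR.rdist_upper[OF C k0C] by blast
 have "open (crd ?C ` (W \<inter> dom_of ?C))" by (rule TM.open_image_chart[OF W C])
 moreover have "crd ?C k0 \<in> crd ?C ` (W \<inter> dom_of ?C)" using k k0C by blast
 ultimately obtain r3 where r3: "r3 > 0" "ball (crd ?C k0) r3 \<subseteq> crd ?C ` (W \<inter> dom_of ?C)"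
  using open_contains_ball_eq by blast
 define r where "r = min r1 (min r2 r3 / (2 * (1 + C1)))"
 have r: "r > 0" "r \<le> r1" using r1 r2 r3 C1 by (auto simp: r_def)
 have near: "crd ?C (lam c y) \<in> ball (crd ?C k0) (min r2 r3)" if y: "y \<in> cball y0 r" for y
 proof -
  have "norm (crd ?C (lam c y) - crd ?C k0) \<le> (1 + C1) * norm (y0 - y)"
   using crd_diff[of y0 y] y r lam0 by simp
  also have "\<dots> \<le> (1 + C1) * (min r2 r3 / (2 * (1 + C1)))"
   using y C1(1) by (intro mult_left_mono) (auto simp: r_def dist_norm)
  also have "\<dots> = min r2 r3 / 2" using C1(1) by (simp add: field_simps)
  also have "\<dots> < min r2 r3" using r2 r3 by auto
  finally show ?thesis by (simp add: dist_norm norm_minus_commute)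
 qed
 show thesis
 proof (rule that[of r "max C1 (M * (1 + C1))", folded y0_def])
  show "r > 0" "0 \<le> max C1 (M * (1 + C1))" using r C1 by auto
  show "cball y0 r \<subseteq> crd c ` (V \<inter> dom_of c)" using r1(2) r(2) by auto
  show "lam c y \<in> \<Lambda>" if y: "y \<in> cball y0 r" for y
  proof
   have y1: "y \<in> cball y0 r1" using y r by auto
   then show "lam c y \<in> graph_differential A \<alpha> V" using lam_mem(5)[OF c] r1(2) by blast
   have "crd ?C (lam c y) \<in> crd ?C ` (W \<inter> dom_of ?C)" using near[OF y] r3(2) by auto
   then show "lam c y \<in> W" using inj_onD[OF TM.inj[OF C]] dom(1)[OF y1] by blast
  qed
  fix y y' assume y: "y \<in> cball y0 r" "y' \<in> cball y0 r"
  then have y1: "y \<in> cball y0 r1" "y' \<in> cball y0 r1" using r by auto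
  show "norm (mom c (lam c y) - mom c (lam c y')) \<le> max C1 (M * (1 + C1)) * norm (y - y')"
   using C1(2)[OF y1] by (rule order_trans) (intro mult_right_mono, auto)
  have b: "0 \<le> dT (lam c y) (lam c y') \<and> dT (lam c y) (lam c y') \<le> M * norm (crd ?C (lam c y') - crd ?C (lam c y))"
   by (rule r2(3)[OF dom(1)[OF y1(1)] dom(1)[OF y1(2)]]) (use near[OF y(1)] near[OF y(2)] in auto)
  moreover have "M * norm (crd ?C (lam c y') - crd ?C (lam c y)) \<le> M * ((1 + C1) * norm (y - y'))"
   using crd_diff[OF y1] r2(2) by (intro mult_left_mono) auto
  moreover have "M * ((1 + C1) * norm (y - y')) \<le> max C1 (M * (1 + C1)) * norm (y - y')"
   unfolding mult.assoc[symmetric] by (intro mult_right_mono) auto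
  ultimately show "0 \<le> dT (lam c y) (lam c y') \<and> dT (lam c y) (lam c y') \<le> max C1 (M * (1 + C1)) * norm (y - y')"
   by linarith
 qed
qed

lemma flow_facts:
 assumes "l \<in> \<Lambda>"
 shows "\<Phi> 0 l = l" "solves (cot_atlas A) \<O> XH J (\<lambda>t. \<Phi> t l)"
  "\<And>S \<gamma> t. is_interval S ==> 0 \<in> S ==> S \<subseteq> J ==> solves (cot_atlas A) \<O> XH S \<gamma> ==> \<gamma> 0 = l ==> t \<in> S ==> \<gamma> t = \<Phi> t l"
 using bspec[OF flow[unfolded is_flow_def] assms] by blast+

lemma flow_in: "l \<in> \<Lambda> ==> t \<in> J ==> \<Phi> t l \<in> \<O>"
 using flow_facts(2) unfolding solves_def by blast

lemma dom_carrier: "\<O> \<subseteq> carrier_of (cot_atlas A)"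
 using openin_subset[OF \<O>] by (simp add: TM.topspace_mtop)

lemma flow_dom: "l \<in> \<Lambda> ==> t \<in> J ==> fst (\<Phi> t l) \<in> dom_of c ==> \<Phi> t l \<in> dom_of (cot_chart A c)"
 using subsetD[OF dom_carrier flow_in] unfolding dom_cot_chart carrier_cot by blast

lemma dT_nonneg: "v \<in> carrier_of (cot_atlas A) ==> w \<in> carrier_of (cot_atlas A) ==> TR.lengths v w \<noteq> {} \<and> 0 \<le> dT v w"
 using TR.lengths_nonempty[OF connected_cot[OF conn]] TR.rdist_nonneg by blast

lemma \<Lambda>_carrier: "\<Lambda> \<subseteq> carrier_of (cot_atlas A)"
 using openin_subset[OF W] by (auto simp: TM.topspace_mtop)

lemma flow_lipschitz:
 obtains L where "L \<ge> 0" "\<And>t l s k. t \<in> J ==> l \<in> \<Lambda> ==> s \<in> J ==> k \<in> \<Lambda> ==>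
  0 \<le> dT (\<Phi> t l) (\<Phi> s k) \<and> dT (\<Phi> t l) (\<Phi> s k) \<le> L * (\<bar>t - s\<bar> + dT l k)"
proof -
 obtain L where L: "\<forall>t\<in>J. \<forall>l\<in>\<Lambda>. \<forall>s\<in>J. \<forall>k\<in>\<Lambda>. dT (\<Phi> t l) (\<Phi> s k) \<le> L * (\<bar>t - s\<bar> + dT l k)"
  using flow_lip by blast
 show thesis
 proof (rule that[of "\<bar>L\<bar>"])
  fix t l s k assume m: "t \<in> J" "l \<in> \<Lambda>" "s \<in> J" "k \<in> \<Lambda>"
  have "dT (\<Phi> t l) (\<Phi> s k) \<le> L * (\<bar>t - s\<bar> + dT l k)" using L m by blast
  also have "\<dots> \<le> \<bar>L\<bar> * (\<bar>t - s\<bar> + dT l k)"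
   using dT_nonneg[of l k] \<Lambda>_carrier m by (intro mult_right_mono add_nonneg_nonneg) auto
  finally show "0 \<le> dT (\<Phi> t l) (\<Phi> s k) \<and> dT (\<Phi> t l) (\<Phi> s k) \<le> \<bar>L\<bar> * (\<bar>t - s\<bar> + dT l k)"
   using dT_nonneg flow_in[OF m(2,1)] flow_in[OF m(4,3)] dom_carrier by blast
 qed simp
qed

end

context extremal_field begin

definition vq :: "('p, 'e) chart => ('p, 'e) chart => real => 'e => 'e" where
 "vq c c0 t y = fst (XH t (\<Phi> t (lam c0 y)) (cot_chart A c))"
definition vp :: "('p, 'e) chart => ('p, 'e) chart => real => 'e => 'e" where
 "vp c c0 t y = snd (XH t (\<Phi> t (lam c0 y)) (cot_chart A c))"

lemma J_lebesgue: "J \<in> sets lebesgue"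
 using J(1) by (simp add: borel_open)

lemma AE_J: "AE t in lebesgue_on J. P t ==> AE t in lebesgue. t \<in> J --> P t"
 using J_lebesgue by (simp add: AE_restrict_space_iff)

lemma Lag_measurable:
 assumes "l \<in> \<Lambda>" "S \<subseteq> J"
 shows "(\<lambda>t. Lag t l) \<in> borel_measurable (lebesgue_on S)"
 using lc assms measurable_restrict_mono unfolding lipschitz_caratheodory_def by blast

lemma Lag_bounded: "l \<in> \<Lambda> ==> \<exists>C. \<forall>t\<in>J. \<bar>Lag t l\<bar> \<le> C"
 using lc unfolding lipschitz_caratheodory_def bounded_iff by (simp add: image_iff ball_simps)

lemma Lag_integrable:
 assumes "l \<in> \<Lambda>" "{s..t} \<subseteq> J"
 shows "(\<lambda>\<tau>. Lag \<tau> l) integrable_on {s..t}"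
proof -
 obtain C where C: "\<forall>t\<in>J. \<bar>Lag t l\<bar> \<le> C" using Lag_bounded[OF assms(1)] by blast
 show ?thesis
  by (rule measurable_bounded_by_integrable_imp_integrable[OF Lag_measurable[OF assms], where g = "\<lambda>_. C"])
   (use C assms(2) in \<open>auto simp: subset_iff\<close>)
qed

text \<open>Restricted to nonnegative times, because integrals over \<open>{0..t}\<close> vanish for negative \<open>t\<close>.\<close>
lemma theta_step:
 assumes l: "l \<in> \<Lambda>" and st: "0 \<le> s" "s \<le> t" "0 \<in> J" "t \<in> J"
 shows "\<theta> t l = \<theta> s l + integral {s..t} (\<lambda>\<tau>. Lag \<tau> l)"
proof -
 have "{0..t} \<subseteq> J" using mem_is_interval_1_I[OF J(2) st(3,4)] by auto
 then have "integral {0..s} (\<lambda>\<tau>. Lag \<tau> l) + integral {s..t} (\<lambda>\<tau>. Lag \<tau> l) = integral {0..t} (\<lambda>\<tau>. Lag \<tau> l)"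
  by (intro Henstock_Kurzweil_Integration.integral_combine st Lag_integrable[OF l])
 then show ?thesis by (simp add: theta_def)
qed

lemma Lag_chart:
 assumes l: "l \<in> \<Lambda>" and t: "t \<in> J" and c: "c \<in> A" "fst (\<Phi> t l) \<in> dom_of c"
  and h: "mdifferentiable_at (cot_atlas A) (H t) (\<Phi> t l)"
 shows "Lag t l = mom c (\<Phi> t l) \<bullet> fst (XH t (\<Phi> t l) (cot_chart A c)) - H t (\<Phi> t l)"
proof -
 have d: "\<Phi> t l \<in> dom_of (cot_chart A c)" by (rule flow_dom[OF l t c(2)])
 have X: "XH t (\<Phi> t l) \<in> tangent_space (cot_atlas A) (\<Phi> t l)" by (rule hamiltonian_vector_chart(1)[OF h c(1) d])
 show ?thesis
  unfolding lagrangian_along_def proj_push_eq[OF c(1) d X] pairing[OF c(1) d tvec_of_in[OF c]] tvec_of_self[OF c] ..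
qed

lemma hamiltonian_expansion:
 assumes h: "mdifferentiable_at (cot_atlas A) f l" and c: "c \<in> A" "l \<in> dom_of (cot_chart A c)" and e: "e > 0"
 defines "X \<equiv> hamiltonian_vector A f l (cot_chart A c)"
 obtains d where "d > 0" "\<And>k. k \<in> dom_of (cot_chart A c) ==> norm (crd (cot_chart A c) k - crd (cot_chart A c) l) < d ==>
  \<bar>f k - f l - ((mom c k - mom c l) \<bullet> fst X - (crd c (fst k) - crd c (fst l)) \<bullet> snd X)\<bar>
   \<le> e * norm (crd (cot_chart A c) k - crd (cot_chart A c) l)"
proof -
 let ?C = "cot_chart A c"
 let ?f = "f \<circ> crd_inv ?C"
 have C: "?C \<in> cot_atlas A" by (rule cot_chart_in[OF c(1)])
 have D: "(?f has_derivative (\<lambda>d. snd d \<bullet> fst X - fst d \<bullet> snd X)) (at (crd ?C l))"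
  unfolding X_def by (rule hamiltonian_vector_chart(2)[OF h c])
 have "\<forall>e>0. \<exists>d>0. \<forall>z. norm (z - crd ?C l) < d -->
  norm (?f z - ?f (crd ?C l) - (snd (z - crd ?C l) \<bullet> fst X - fst (z - crd ?C l) \<bullet> snd X)) \<le> e * norm (z - crd ?C l)"
  using D unfolding has_derivative_at_alt by blast
 then have "\<exists>d>0. \<forall>z. norm (z - crd ?C l) < d -->
  norm (?f z - ?f (crd ?C l) - (snd (z - crd ?C l) \<bullet> fst X - fst (z - crd ?C l) \<bullet> snd X)) \<le> e * norm (z - crd ?C l)"
  using e by blast
 then obtain d where d: "d > 0" and dd: "\<And>z. norm (z - crd ?C l) < d ==>
  norm (?f z - ?f (crd ?C l) - (snd (z - crd ?C l) \<bullet> fst X - fst (z - crd ?C l) \<bullet> snd X)) \<le> e * norm (z - crd ?C l)"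
  by (elim exE conjE) (use that in blast)
 show thesis
 proof (rule that[OF d])
  fix k assume k: "k \<in> dom_of ?C" "norm (crd ?C k - crd ?C l) < d"
  from dd[OF k(2)] show "\<bar>f k - f l - ((mom c k - mom c l) \<bullet> fst X - (crd c (fst k) - crd c (fst l)) \<bullet> snd X)\<bar>
   \<le> e * norm (crd ?C k - crd ?C l)"
   unfolding o_def TM.crd_inv_crd[OF C k(1)] TM.crd_inv_crd[OF C c(2)]
   unfolding crd_cot_chart fst_diff snd_diff fst_conv snd_conv real_norm_def .
 qed
qed

text \<open>Distances between flow points are controlled by the Lipschitz bound of the flow, so that nearby
  extremals remain in the chart and \<open>rdist_lower\<close> turns distances into norms.\<close>
lemma flow_chart_lipschitz:
 assumes t0: "t0 \<in> J" and k0: "k0 \<in> \<Lambda>" and c0: "c0 \<in> A" "fst k0 \<in> dom_of c0"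
  and c: "c \<in> A" "fst (\<Phi> t0 k0) \<in> dom_of c"
 obtains \<delta> K where "\<delta> > 0" "K \<ge> 0" "cball (crd c0 (fst k0)) \<delta> \<subseteq> crd c0 ` (V \<inter> dom_of c0)"
  "\<And>y. y \<in> cball (crd c0 (fst k0)) \<delta> ==> lam c0 y \<in> \<Lambda>"
  "\<And>t y. t \<in> J ==> \<bar>t - t0\<bar> < \<delta> ==> y \<in> cball (crd c0 (fst k0)) \<delta> ==> \<Phi> t (lam c0 y) \<in> dom_of (cot_chart A c)"
  "\<And>y y'. y \<in> cball (crd c0 (fst k0)) \<delta> ==> y' \<in> cball (crd c0 (fst k0)) \<delta> ==> dT (lam c0 y) (lam c0 y') \<le> K * norm (y - y')"
  "\<And>y y'. y \<in> cball (crd c0 (fst k0)) \<delta> ==> y' \<in> cball (crd c0 (fst k0)) \<delta> ==> norm (mom c0 (lam c0 y) - mom c0 (lam c0 y')) \<le> K * norm (y - y')"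
  "\<And>t t' y y'. t \<in> J ==> \<bar>t - t0\<bar> < \<delta> ==> t' \<in> J ==> \<bar>t' - t0\<bar> < \<delta> ==>
   y \<in> cball (crd c0 (fst k0)) \<delta> ==> y' \<in> cball (crd c0 (fst k0)) \<delta> ==>
   norm (crd (cot_chart A c) (\<Phi> t (lam c0 y)) - crd (cot_chart A c) (\<Phi> t' (lam c0 y'))) \<le> K * (\<bar>t - t'\<bar> + norm (y - y'))"
proof -
 define y0 where "y0 = crd c0 (fst k0)"
 let ?C = "cot_chart A c"
 have C: "?C \<in> cot_atlas A" by (rule cot_chart_in[OF c(1)])
 obtain L where L: "L \<ge> 0" "\<And>t l s k. t \<in> J ==> l \<in> \<Lambda> ==> s \<in> J ==> k \<in> \<Lambda> ==>
  0 \<le> dT (\<Phi> t l) (\<Phi> s k) \<and> dT (\<Phi> t l) (\<Phi> s k) \<le> L * (\<bar>t - s\<bar> + dT l k)"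
  using flow_lipschitz by blast
 obtain r G where r: "r > 0" "G \<ge> 0" "cball y0 r \<subseteq> crd c0 ` (V \<inter> dom_of c0)"
  "\<And>y. y \<in> cball y0 r ==> lam c0 y \<in> \<Lambda>"
  and rm: "\<And>y y'. y \<in> cball y0 r ==> y' \<in> cball y0 r ==> norm (mom c0 (lam c0 y) - mom c0 (lam c0 y')) \<le> G * norm (y - y')"
  and rd: "\<And>y y'. y \<in> cball y0 r ==> y' \<in> cball y0 r ==> 0 \<le> dT (lam c0 y) (lam c0 y') \<and> dT (lam c0 y) (lam c0 y') \<le> G * norm (y - y')"
  by (rule lam_chart[OF c0(1) k0 c0(2), folded y0_def]) blast
 obtain R e D where R: "R > 0" "e > 0" "D > 0"
  "\<And>v w. v \<in> dom_of ?C ==> crd ?C v \<in> ball (crd ?C (\<Phi> t0 k0)) R ==> TR.lengths v w \<noteq> {} ==> dT v w < e ==>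
   w \<in> dom_of ?C \<and> norm (crd ?C w - crd ?C v) \<le> D * dT v w"
  by (rule TR.rdist_lower[OF Hausdorff_cot[OF haus] C flow_dom[OF k0 t0 c(2)]]) blast
 have lam0: "lam c0 y0 = k0" unfolding y0_def by (rule lam_crd[OF c0(1)]) (use k0 c0 in auto)
 define \<epsilon> where "\<epsilon> = min e (R / D)"
 have \<epsilon>: "\<epsilon> > 0" "\<epsilon> \<le> e" "D * \<epsilon> \<le> R"
  using R by (auto simp: \<epsilon>_def field_simps min_def)
 define Q where "Q = L * (1 + G)"
 have Q: "Q \<ge> 0" using L r by (simp add: Q_def)
 define \<delta> where "\<delta> = min r (\<epsilon> / (4 * (Q + 1)))"
 have \<delta>: "\<delta> > 0" "\<delta> \<le> r" "Q * (4 * \<delta>) < \<epsilon>"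
 proof -
  show "\<delta> > 0" "\<delta> \<le> r" using r \<epsilon> Q by (auto simp: \<delta>_def)
  have "Q * (4 * \<delta>) \<le> Q * (4 * (\<epsilon> / (4 * (Q + 1))))" using Q by (intro mult_left_mono) (auto simp: \<delta>_def)
  also have "\<dots> = \<epsilon> * (Q / (Q + 1))"
  proof -
   have "Q * (4 * (\<epsilon> / (4 * a))) = \<epsilon> * (Q / a)" if "a > 0" for a :: real using that by (simp add: field_simps)
   from this[of "Q + 1"] Q show ?thesis by simp
  qed
  also have "\<dots> < \<epsilon> * 1" using Q \<epsilon> by (intro mult_strict_left_mono) auto
  finally show "Q * (4 * \<delta>) < \<epsilon>" by simp
 qed
 have dist: "TR.lengths (\<Phi> t (lam c0 y)) (\<Phi> t' (lam c0 y')) \<noteq> {} \<and>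
   dT (\<Phi> t (lam c0 y)) (\<Phi> t' (lam c0 y')) \<le> Q * (\<bar>t - t'\<bar> + norm (y - y'))"
  if "t \<in> J" "t' \<in> J" "y \<in> cball y0 \<delta>" "y' \<in> cball y0 \<delta>" for t t' y y'
 proof -
  have y: "y \<in> cball y0 r" "y' \<in> cball y0 r" using that \<delta> by auto
  note l = r(4)[OF y(1)] r(4)[OF y(2)]
  have "dT (\<Phi> t (lam c0 y)) (\<Phi> t' (lam c0 y')) \<le> L * (\<bar>t - t'\<bar> + dT (lam c0 y) (lam c0 y'))"
   using L(2)[OF that(1) l(1) that(2) l(2)] by blast
  also have "\<dots> \<le> L * ((1 + G) * (\<bar>t - t'\<bar> + norm (y - y')))"
  proof (rule mult_left_mono[OF _ L(1)])
   have "dT (lam c0 y) (lam c0 y') \<le> G * norm (y - y')" using rd[OF y] by blast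
   moreover have "0 \<le> G * \<bar>t - t'\<bar>" using r(2) by simp
   ultimately show "\<bar>t - t'\<bar> + dT (lam c0 y) (lam c0 y') \<le> (1 + G) * (\<bar>t - t'\<bar> + norm (y - y'))"
    using norm_ge_zero[of "y - y'"] unfolding distrib_left distrib_right mult_1_left by linarith
  qed
  finally have "dT (\<Phi> t (lam c0 y)) (\<Phi> t' (lam c0 y')) \<le> Q * (\<bar>t - t'\<bar> + norm (y - y'))" by (simp add: Q_def mult.assoc)
  then show ?thesis using dT_nonneg flow_in[OF l(1) that(1)] flow_in[OF l(2) that(2)] dom_carrier by blast
 qed
 have y0\<delta>: "y0 \<in> cball y0 \<delta>" using \<delta> by simp
 have mid: "\<Phi> t (lam c0 y) \<in> dom_of ?C \<and> crd ?C (\<Phi> t (lam c0 y)) \<in> ball (crd ?C (\<Phi> t0 k0)) R"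
  if ty: "t \<in> J" "\<bar>t - t0\<bar> < \<delta>" "y \<in> cball y0 \<delta>" for t y
 proof -
  have "norm (y0 - y) \<le> \<delta>" using ty by (simp add: dist_norm)
  then have "Q * (\<bar>t0 - t\<bar> + norm (y0 - y)) \<le> Q * (4 * \<delta>)" using ty \<delta> by (intro mult_left_mono Q) auto
  moreover note dist[OF t0 ty(1) y0\<delta> ty(3), unfolded lam0]
  ultimately have d: "TR.lengths (\<Phi> t0 k0) (\<Phi> t (lam c0 y)) \<noteq> {}" "dT (\<Phi> t0 k0) (\<Phi> t (lam c0 y)) < \<epsilon>"
   using \<delta>(3) by auto
  then have "dT (\<Phi> t0 k0) (\<Phi> t (lam c0 y)) < e" using \<epsilon> by simp
  from R(4)[OF flow_dom[OF k0 t0 c(2)] _ d(1) this] R(1)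
  have "\<Phi> t (lam c0 y) \<in> dom_of ?C" "norm (crd ?C (\<Phi> t (lam c0 y)) - crd ?C (\<Phi> t0 k0)) \<le> D * dT (\<Phi> t0 k0) (\<Phi> t (lam c0 y))"
   by auto
  moreover have "D * dT (\<Phi> t0 k0) (\<Phi> t (lam c0 y)) < D * \<epsilon>" using d(2) R(3) by simp
  ultimately show ?thesis using \<epsilon>(3) by (simp add: dist_norm norm_minus_commute)
 qed
 have sub: "cball y0 \<delta> \<subseteq> cball y0 r" using \<delta> by auto
 define K where "K = max G (D * Q)"
 have K: "K \<ge> 0" "G \<le> K" "D * Q \<le> K" using r by (auto simp: K_def)
 show thesis
 proof (rule that[of \<delta> K, folded y0_def])
  show "\<delta> > 0" by (rule \<delta>)
  show "K \<ge> 0" by (rule K)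
  show "cball y0 \<delta> \<subseteq> crd c0 ` (V \<inter> dom_of c0)" using r(3) sub by blast
  show "lam c0 y \<in> \<Lambda>" if "y \<in> cball y0 \<delta>" for y using r(4) sub that by blast
  show "\<Phi> t (lam c0 y) \<in> dom_of ?C" if "t \<in> J" "\<bar>t - t0\<bar> < \<delta>" "y \<in> cball y0 \<delta>" for t y using mid[OF that] by blast
  have Gn: "G * norm (y - y') \<le> K * norm (y - y')" for y y' :: 'e by (intro mult_right_mono K) auto
  show "dT (lam c0 y) (lam c0 y') \<le> K * norm (y - y')" if "y \<in> cball y0 \<delta>" "y' \<in> cball y0 \<delta>" for y y'
   using rd[of y y'] sub that Gn[of y y'] order_trans by blast
  show "norm (mom c0 (lam c0 y) - mom c0 (lam c0 y')) \<le> K * norm (y - y')" if "y \<in> cball y0 \<delta>" "y' \<in> cball y0 \<delta>" for y y'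
   using rm[of y y'] sub that Gn[of y y'] order_trans by blast
  fix t t' y y'
  assume t: "t \<in> J" "\<bar>t - t0\<bar> < \<delta>" "t' \<in> J" "\<bar>t' - t0\<bar> < \<delta>" and y: "y \<in> cball y0 \<delta>" "y' \<in> cball y0 \<delta>"
  have "norm (y - y') \<le> norm (y0 - y) + norm (y0 - y')" by (metis dist_norm dist_triangle3 dist_commute)
  then have "norm (y - y') \<le> 2 * \<delta>" using y by (simp add: dist_norm)
  then have "Q * (\<bar>t - t'\<bar> + norm (y - y')) \<le> Q * (4 * \<delta>)" using t by (intro mult_left_mono Q) auto
  then have "dT (\<Phi> t (lam c0 y)) (\<Phi> t' (lam c0 y')) < e"
   using dist[OF t(1,3) y] \<delta>(3) \<epsilon>(2) by linarith
  with mid[OF t(1,2) y(1)] dist[OF t(1,3) y]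
  have "norm (crd ?C (\<Phi> t' (lam c0 y')) - crd ?C (\<Phi> t (lam c0 y))) \<le> D * dT (\<Phi> t (lam c0 y)) (\<Phi> t' (lam c0 y'))"
   using R(4) by blast
  also have "\<dots> \<le> D * (Q * (\<bar>t - t'\<bar> + norm (y - y')))" using dist[OF t(1,3) y] R(3) by (intro mult_left_mono) auto
  also have "\<dots> \<le> K * (\<bar>t - t'\<bar> + norm (y - y'))" unfolding mult.assoc[symmetric] using K by (intro mult_right_mono) auto
  finally show "norm (crd ?C (\<Phi> t (lam c0 y)) - crd ?C (\<Phi> t' (lam c0 y'))) \<le> K * (\<bar>t - t'\<bar> + norm (y - y'))"
   by (simp add: norm_minus_commute)
 qed
qed

end

context extremal_field begin

definition box_times :: "real => real => real set" where
 "box_times t0 \<delta> = {t0 - \<delta><..<t0 + \<delta>} \<inter> J \<inter> {0..}"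

text \<open>The fields of \<open>flow_box\<close> are read off from the assumptions on the flow: the equations of motion from the
  flow property, the expansion of \<open>h\<close> from the canonical form of the Hamiltonian field, and the bounds on \<open>L\<close>
 from the Lipschitz-Caratheodory condition on a compact piece of the submanifold.\<close>
lemma flow_in_box:
 assumes t0: "t0 \<in> J" and k0: "k0 \<in> \<Lambda>" and c0: "c0 \<in> A" "fst k0 \<in> dom_of c0"
  and c: "c \<in> A" "fst (\<Phi> t0 k0) \<in> dom_of c" and J0: "0 \<in> J"
 obtains \<delta> K where "\<delta> > 0"
  "\<And>y. y \<in> ball (crd c0 (fst k0)) \<delta> ==> y \<in> crd c0 ` (V \<inter> dom_of c0) \<and> lam c0 y \<in> \<Lambda>"
  "\<And>t y. t \<in> J ==> \<bar>t - t0\<bar> < \<delta> ==> y \<in> ball (crd c0 (fst k0)) \<delta> ==> \<Phi> t (lam c0 y) \<in> dom_of (cot_chart A c)"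
  "flow_box (box_times t0 \<delta>) (ball (crd c0 (fst k0)) \<delta>) K (pos c c0) (imp c c0) (vq c c0) (vp c c0)
   (\<lambda>t y. H t (\<Phi> t (lam c0 y))) (\<lambda>t y. Lag t (lam c0 y)) (\<lambda>t y. \<theta> t (lam c0 y))"
proof -
 define y0 where "y0 = crd c0 (fst k0)"
 let ?C = "cot_chart A c"
 have C: "?C \<in> cot_atlas A" by (rule cot_chart_in[OF c(1)])
 obtain \<delta> K where \<delta>: "\<delta> > 0" and K: "K \<ge> 0" and r: "cball y0 \<delta> \<subseteq> crd c0 ` (V \<inter> dom_of c0)"
  and \<Lambda>: "\<And>y. y \<in> cball y0 \<delta> ==> lam c0 y \<in> \<Lambda>"
  and dom: "\<And>t y. t \<in> J ==> \<bar>t - t0\<bar> < \<delta> ==> y \<in> cball y0 \<delta> ==> \<Phi> t (lam c0 y) \<in> dom_of ?C"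
  and rd: "\<And>y y'. y \<in> cball y0 \<delta> ==> y' \<in> cball y0 \<delta> ==> dT (lam c0 y) (lam c0 y') \<le> K * norm (y - y')"
  and rm: "\<And>y y'. y \<in> cball y0 \<delta> ==> y' \<in> cball y0 \<delta> ==> norm (mom c0 (lam c0 y) - mom c0 (lam c0 y')) \<le> K * norm (y - y')"
  and lip: "\<And>t t' y y'. t \<in> J ==> \<bar>t - t0\<bar> < \<delta> ==> t' \<in> J ==> \<bar>t' - t0\<bar> < \<delta> ==>
   y \<in> cball y0 \<delta> ==> y' \<in> cball y0 \<delta> ==>
   norm (crd ?C (\<Phi> t (lam c0 y)) - crd ?C (\<Phi> t' (lam c0 y'))) \<le> K * (\<bar>t - t'\<bar> + norm (y - y'))"
  by (rule flow_chart_lipschitz[OF t0 k0 c0 c, folded y0_def]) blast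
 let ?I = "box_times t0 \<delta>" and ?U = "ball y0 \<delta>"
 have I: "t \<in> J" "\<bar>t - t0\<bar> < \<delta>" "0 \<le> t" if "t \<in> ?I" for t
  using that by (auto simp: box_times_def)
 have IJ: "?I \<subseteq> J" by (auto simp: box_times_def)
 have U: "y \<in> cball y0 \<delta>" if "y \<in> ?U" for y using that by auto
 have \<Lambda>U: "lam c0 y \<in> \<Lambda>" if "y \<in> ?U" for y using \<Lambda>[OF U[OF that]] .
 have domU: "\<Phi> t (lam c0 y) \<in> dom_of ?C" if "t \<in> ?I" "y \<in> ?U" for t y
  using dom[OF I(1,2)[OF that(1)] U[OF that(2)]] .
 have domf: "fst (\<Phi> t (lam c0 y)) \<in> dom_of c" if "t \<in> ?I" "y \<in> ?U" for t y
  using domU[OF that] by (simp add: dom_cot_chart)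
 have AE_diff: "AE t in lebesgue. t \<in> J --> (\<forall>l\<in>\<O>. mdifferentiable_at (cot_atlas A) (H t) l)"
  by (rule AE_J[OF H_diff])
 \<comment> \<open>The Lipschitz constant of the Lagrangian is uniform only over compact sets of starting points, hence the closed ball.\<close>
 obtain m where m: "\<exists>C. AE t in lebesgue_on J. \<bar>m t\<bar> \<le> C"
  "AE t in lebesgue_on J. \<forall>l\<in>lam c0 ` cball y0 \<delta>. \<forall>k\<in>lam c0 ` cball y0 \<delta>. dist (Lag t l) (Lag t k) \<le> m t * dT l k"
 proof -
  let ?K = "(\<lambda>y. (y, mom c0 (lam c0 y))) ` cball y0 \<delta>"
  have "continuous_on (cball y0 \<delta>) (\<lambda>y. mom c0 (lam c0 y))"
   by (rule lipschitz_on_continuous_on[OF lipschitz_onI[OF _ K]]) (use rm in \<open>simp add: dist_norm\<close>)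
  then have K1: "compact ?K" by (intro compact_continuous_image continuous_intros) auto
  have C0: "cot_chart A c0 \<in> cot_atlas A" by (rule cot_chart_in[OF c0(1)])
  have lamc: "lam c0 y \<in> dom_of (cot_chart A c0)" "crd (cot_chart A c0) (lam c0 y) = (y, mom c0 (lam c0 y))"
   if "y \<in> cball y0 \<delta>" for y
   using lam_mem(1,3)[OF c0(1) subsetD[OF r that]] by (simp_all add: crd_cot_chart)
  have "?K \<subseteq> crd (cot_chart A c0) ` dom_of (cot_chart A c0)"
  proof (rule image_subsetI)
   fix y assume y: "y \<in> cball y0 \<delta>"
   show "(y, mom c0 (lam c0 y)) \<in> crd (cot_chart A c0) ` dom_of (cot_chart A c0)"
    unfolding lamc(2)[OF y, symmetric] by (rule imageI[OF lamc(1)[OF y]])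
  qed
  from TR.compact_chart_image[OF C0 K1 this]
  have cmp: "compactin (mtop (cot_atlas A)) {v \<in> dom_of (cot_chart A c0). crd (cot_chart A c0) v \<in> ?K}" .
  have "{v \<in> dom_of (cot_chart A c0). crd (cot_chart A c0) v \<in> ?K} = lam c0 ` cball y0 \<delta>"
  proof (intro equalityI subsetI)
   fix v assume v: "v \<in> {v \<in> dom_of (cot_chart A c0). crd (cot_chart A c0) v \<in> ?K}"
   then obtain y where y: "y \<in> cball y0 \<delta>" "crd (cot_chart A c0) v = crd (cot_chart A c0) (lam c0 y)" using lamc(2) by auto
   have "v = lam c0 y" by (rule inj_onD[OF TM.inj[OF C0] y(2)]) (use v lamc(1)[OF y(1)] in blast)+
   then show "v \<in> lam c0 ` cball y0 \<delta>" using y by blast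
  next
   fix v assume "v \<in> lam c0 ` cball y0 \<delta>"
   then obtain y where y: "y \<in> cball y0 \<delta>" "v = lam c0 y" by blast
   show "v \<in> {v \<in> dom_of (cot_chart A c0). crd (cot_chart A c0) v \<in> ?K}"
    unfolding y(2) mem_Collect_eq lamc(2)[OF y(1)] using lamc(1)[OF y(1)] y(1) by blast
  qed
  then have "compactin (mtop (cot_atlas A)) (lam c0 ` cball y0 \<delta>)" using cmp by simp
  moreover have "lam c0 ` cball y0 \<delta> \<subseteq> \<Lambda>" using \<Lambda> by blast
  ultimately have "\<exists>m. (\<exists>C. AE t in lebesgue_on J. \<bar>m t\<bar> \<le> C) \<and>
   (AE t in lebesgue_on J. \<forall>l\<in>lam c0 ` cball y0 \<delta>. \<forall>k\<in>lam c0 ` cball y0 \<delta>. dist (Lag t l) (Lag t k) \<le> m t * dT l k)"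
   using lc[unfolded lipschitz_caratheodory_def] by (elim conjE) blast
  then show thesis using that by (elim exE conjE) blast
 qed
 obtain Cm where Cm: "AE t in lebesgue_on J. \<bar>m t\<bar> \<le> Cm" using m(1) by blast
 define K' where "K' = max K (\<bar>Cm\<bar> * K)"
 have K': "K' \<ge> 0" "K \<le> K'" "\<bar>Cm\<bar> * K \<le> K'" using K by (auto simp: K'_def)
 have lipI: "norm (crd ?C (\<Phi> t (lam c0 y)) - crd ?C (\<Phi> t' (lam c0 y'))) \<le> K' * (\<bar>t - t'\<bar> + norm (y - y'))"
  if "t \<in> ?I" "t' \<in> ?I" "y \<in> ?U" "y' \<in> ?U" for t t' y y'
  using lip[OF I(1,2)[OF that(1)] I(1,2)[OF that(2)] U[OF that(3)] U[OF that(4)]]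
  by (rule order_trans) (intro mult_right_mono K', simp)
 show thesis
 proof (rule that[of \<delta> K', folded y0_def])
  show "\<delta> > 0" by (rule \<delta>)
  show "y \<in> crd c0 ` (V \<inter> dom_of c0) \<and> lam c0 y \<in> \<Lambda>" if "y \<in> ?U" for y
   using \<Lambda>U[OF that] U[OF that] r by blast
  show "\<Phi> t (lam c0 y) \<in> dom_of ?C" if "t \<in> J" "\<bar>t - t0\<bar> < \<delta>" "y \<in> ?U" for t y
   by (rule dom[OF that(1,2) U[OF that(3)]])
  show "flow_box ?I ?U K' (pos c c0) (imp c c0) (vq c c0) (vp c c0)
   (\<lambda>t y. H t (\<Phi> t (lam c0 y))) (\<lambda>t y. Lag t (lam c0 y)) (\<lambda>t y. \<theta> t (lam c0 y))"
  proof
   show "is_interval ?I" unfolding box_times_def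
    by (intro is_interval_Int J(2)) (auto simp: is_interval_1)
   show "open ?U" "convex ?U" "0 \<le> K'" using K' by auto
  next
   fix t t' y y' assume ty: "t \<in> ?I" "t' \<in> ?I" "y \<in> ?U" "y' \<in> ?U"
   have "norm (pos c c0 t y - pos c c0 t' y') \<le> norm (crd ?C (\<Phi> t (lam c0 y)) - crd ?C (\<Phi> t' (lam c0 y')))"
    by (simp only: crd_cot_chart diff_Pair norm_fst_le)
   then show "norm (pos c c0 t y - pos c c0 t' y') \<le> K' * (\<bar>t - t'\<bar> + norm (y - y'))" using lipI[OF ty] by linarith
   have "norm (imp c c0 t y - imp c c0 t' y') \<le> norm (crd ?C (\<Phi> t (lam c0 y)) - crd ?C (\<Phi> t' (lam c0 y')))"
    by (simp only: crd_cot_chart diff_Pair norm_snd_le)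
   then show "norm (imp c c0 t y - imp c c0 t' y') \<le> K' * (\<bar>t - t'\<bar> + norm (y - y'))" using lipI[OF ty] by linarith
  next
   fix y assume y: "y \<in> ?U"
   have "AE t in lebesgue_on J. has_velocity (cot_atlas A) (\<lambda>t. \<Phi> t (lam c0 y)) t (XH t (\<Phi> t (lam c0 y)))"
    using flow_facts(2)[OF \<Lambda>U[OF y]] by (simp add: solves_def)
   from AE_J[OF this]
   show "AE t in lebesgue. t \<in> ?I --> ((\<lambda>t. pos c c0 t y) has_vector_derivative vq c c0 t y) (at t) \<and>
    ((\<lambda>t. imp c c0 t y) has_vector_derivative vp c c0 t y) (at t)"
   proof eventually_elim
    case (elim t)
    show ?case
    proof
     assume t: "t \<in> ?I"
     have "has_velocity (cot_atlas A) (\<lambda>t. \<Phi> t (lam c0 y)) t (XH t (\<Phi> t (lam c0 y)))" using elim I(1)[OF t] by blast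
     then have D: "((crd ?C \<circ> (\<lambda>t. \<Phi> t (lam c0 y))) has_vector_derivative XH t (\<Phi> t (lam c0 y)) ?C) (at t)"
      unfolding has_velocity_def using C domU[OF t y] by blast
     have "((\<lambda>t. fst ((crd ?C \<circ> (\<lambda>t. \<Phi> t (lam c0 y))) t)) has_vector_derivative fst (XH t (\<Phi> t (lam c0 y)) ?C)) (at t)"
      by (rule bounded_linear.has_vector_derivative[OF bounded_linear_fst D])
     moreover have "((\<lambda>t. snd ((crd ?C \<circ> (\<lambda>t. \<Phi> t (lam c0 y))) t)) has_vector_derivative snd (XH t (\<Phi> t (lam c0 y)) ?C)) (at t)"
      by (rule bounded_linear.has_vector_derivative[OF bounded_linear_snd D])
     ultimately show "((\<lambda>t. pos c c0 t y) has_vector_derivative vq c c0 t y) (at t) \<and>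
      ((\<lambda>t. imp c c0 t y) has_vector_derivative vp c c0 t y) (at t)"
      unfolding o_def crd_cot_chart fst_conv snd_conv vq_def vp_def by (rule conjI)
    qed
   qed
   show "\<exists>C. \<forall>t\<in>?I. \<bar>Lag t (lam c0 y)\<bar> \<le> C" using Lag_bounded[OF \<Lambda>U[OF y]] IJ by blast
   show "(\<lambda>t. Lag t (lam c0 y)) \<in> borel_measurable (lebesgue_on S)" if "S \<subseteq> ?I" for S
    by (rule Lag_measurable[OF \<Lambda>U[OF y] order_trans[OF that IJ]])
   show "\<theta> t (lam c0 y) = \<theta> s (lam c0 y) + integral {s..t} (\<lambda>\<tau>. Lag \<tau> (lam c0 y))"
    if "s \<in> ?I" "t \<in> ?I" "s \<le> t" for s t
    by (rule theta_step[OF \<Lambda>U[OF y] I(3)[OF that(1)] that(3) J0 I(1)[OF that(2)]])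
  next
   show "AE t in lebesgue. t \<in> ?I -->
    (\<forall>y\<in>?U. Lag t (lam c0 y) = imp c c0 t y \<bullet> vq c c0 t y - H t (\<Phi> t (lam c0 y)))"
    using AE_diff
   proof eventually_elim
    case (elim t)
    show ?case
    proof (intro impI ballI)
     fix y assume t: "t \<in> ?I" and y: "y \<in> ?U"
     show "Lag t (lam c0 y) = imp c c0 t y \<bullet> vq c c0 t y - H t (\<Phi> t (lam c0 y))" unfolding vq_def
      by (rule Lag_chart[OF \<Lambda>U[OF y] I(1)[OF t] c(1) domf[OF t y]])
       (use elim I(1)[OF t] flow_in[OF \<Lambda>U[OF y] I(1)[OF t]] in blast)
    qed
   qed
   show "AE t in lebesgue. t \<in> ?I --> (\<forall>y\<in>?U. \<forall>y'\<in>?U. \<bar>Lag t (lam c0 y') - Lag t (lam c0 y)\<bar> \<le> K' * norm (y' - y))"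
    using AE_J[OF m(2)] AE_J[OF Cm]
   proof eventually_elim
    case (elim t)
    show ?case
    proof (intro impI ballI)
     fix y y' assume t: "t \<in> ?I" and y: "y \<in> ?U" and y': "y' \<in> ?U"
     have d0: "0 \<le> dT (lam c0 y') (lam c0 y)" using dT_nonneg \<Lambda>U[OF y] \<Lambda>U[OF y'] \<Lambda>_carrier by blast
     have "dist (Lag t (lam c0 y')) (Lag t (lam c0 y)) \<le> m t * dT (lam c0 y') (lam c0 y)"
      using elim(1) I(1)[OF t] U[OF y] U[OF y'] by blast
     also have "\<dots> \<le> \<bar>Cm\<bar> * (K * norm (y' - y))"
      by (rule mult_mono[OF _ rd[OF U[OF y'] U[OF y]]]) (use elim(2) I(1)[OF t] d0 in auto)
     also have "\<dots> \<le> K' * norm (y' - y)" unfolding mult.assoc[symmetric] by (intro mult_right_mono K') simp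
     finally show "\<bar>Lag t (lam c0 y') - Lag t (lam c0 y)\<bar> \<le> K' * norm (y' - y)" by (simp add: dist_real_def)
    qed
   qed
   show "AE t in lebesgue. t \<in> ?I --> (\<forall>y\<in>?U. \<forall>e>0. \<exists>d>0. \<forall>y'\<in>?U. norm (y' - y) < d -->
    \<bar>H t (\<Phi> t (lam c0 y')) - H t (\<Phi> t (lam c0 y)) -
     ((imp c c0 t y' - imp c c0 t y) \<bullet> vq c c0 t y - (pos c c0 t y' - pos c c0 t y) \<bullet> vp c c0 t y)\<bar> \<le> e * norm (y' - y))"
    using AE_diff
   proof eventually_elim
    case (elim t)
    show ?case
    proof (intro impI ballI allI)
     fix y and e :: real assume t: "t \<in> ?I" and y: "y \<in> ?U" and e: "e > 0"
     have Hd: "mdifferentiable_at (cot_atlas A) (H t) (\<Phi> t (lam c0 y))"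
      using elim I(1)[OF t] flow_in[OF \<Lambda>U[OF y] I(1)[OF t]] by blast
     have eK: "e / (K' + 1) > 0" using e K' by simp
     obtain d where d: "d > 0" "\<And>k. k \<in> dom_of ?C ==> norm (crd ?C k - crd ?C (\<Phi> t (lam c0 y))) < d ==>
      \<bar>H t k - H t (\<Phi> t (lam c0 y)) - ((mom c k - imp c c0 t y) \<bullet> vq c c0 t y - (crd c (fst k) - pos c c0 t y) \<bullet> vp c c0 t y)\<bar>
       \<le> e / (K' + 1) * norm (crd ?C k - crd ?C (\<Phi> t (lam c0 y)))"
      unfolding vq_def vp_def
      by (rule hamiltonian_expansion[OF Hd c(1) domU[OF t y] eK]) blast
     have "\<bar>H t (\<Phi> t (lam c0 y')) - H t (\<Phi> t (lam c0 y)) -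
      ((imp c c0 t y' - imp c c0 t y) \<bullet> vq c c0 t y - (pos c c0 t y' - pos c c0 t y) \<bullet> vp c c0 t y)\<bar> \<le> e * norm (y' - y)"
      if y': "y' \<in> ?U" "norm (y' - y) < d / (K' + 1)" for y'
     proof -
      have b: "norm (crd ?C (\<Phi> t (lam c0 y')) - crd ?C (\<Phi> t (lam c0 y))) \<le> (K' + 1) * norm (y' - y)"
       using lipI[OF t t y'(1) y] norm_ge_zero[of "y' - y"] unfolding distrib_right diff_self abs_zero add_0 mult_1_left by linarith
      also have "\<dots> < (K' + 1) * (d / (K' + 1))" using y'(2) K' by (intro mult_strict_left_mono) auto
      also have "\<dots> = d" using K' by simp
      finally have "\<bar>H t (\<Phi> t (lam c0 y')) - H t (\<Phi> t (lam c0 y)) -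
       ((imp c c0 t y' - imp c c0 t y) \<bullet> vq c c0 t y - (pos c c0 t y' - pos c c0 t y) \<bullet> vp c c0 t y)\<bar>
       \<le> e / (K' + 1) * norm (crd ?C (\<Phi> t (lam c0 y')) - crd ?C (\<Phi> t (lam c0 y)))"
       by (rule d(2)[OF domU[OF t y'(1)]])
      also have "\<dots> \<le> e / (K' + 1) * ((K' + 1) * norm (y' - y))" using b eK by (intro mult_left_mono) auto
      also have "\<dots> = e * norm (y' - y)" using K' by simp
      finally show ?thesis .
     qed
     moreover have "d / (K' + 1) > 0" using d K' by simp
     ultimately show "\<exists>d>0. \<forall>y'\<in>?U. norm (y' - y) < d -->
      \<bar>H t (\<Phi> t (lam c0 y')) - H t (\<Phi> t (lam c0 y)) -
      ((imp c c0 t y' - imp c c0 t y) \<bullet> vq c c0 t y - (pos c c0 t y' - pos c c0 t y) \<bullet> vp c c0 t y)\<bar> \<le> e * norm (y' - y)" by blast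
    qed
   qed
  qed
 qed
qed

end

section \<open>Exactness of the action at all times\<close>

lemma has_derivative_zero_compose_lipschitz:
 fixes \<psi> :: "'a::real_normed_vector => real" and f :: "'b::real_normed_vector => 'a"
 assumes \<psi>: "(\<psi> has_derivative (\<lambda>_. 0)) (at (f y))" and \<delta>: "\<delta> > 0" and K: "K \<ge> 0"
  and lip: "\<And>y'. norm (y' - y) < \<delta> ==> norm (f y' - f y) \<le> K * norm (y' - y)"
 shows "((\<lambda>y'. \<psi> (f y')) has_derivative (\<lambda>_. 0)) (at y)"
proof (rule has_derivative_zeroI)
 fix e :: real assume e: "e > 0"
 have eK: "e / (K + 1) > 0" using e K by simp
 obtain d where d: "d > 0" "\<And>z. norm (z - f y) < d ==> \<bar>\<psi> z - \<psi> (f y)\<bar> \<le> e / (K + 1) * norm (z - f y)"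
  using has_derivative_zero_bound[OF \<psi> eK] by blast
 have "\<bar>\<psi> (f y') - \<psi> (f y)\<bar> \<le> e * norm (y' - y)" if y': "norm (y' - y) < min \<delta> (d / (K + 1))" for y'
 proof -
  have "norm (f y' - f y) \<le> K * norm (y' - y)" using lip y' by simp
  then have b: "norm (f y' - f y) \<le> (K + 1) * norm (y' - y)"
   using norm_ge_zero[of "y' - y"] unfolding distrib_right mult_1_left by linarith
  also have "\<dots> < (K + 1) * (d / (K + 1))" using y' K by (intro mult_strict_left_mono) auto
  also have "\<dots> = d" using K by simp
  finally have "\<bar>\<psi> (f y') - \<psi> (f y)\<bar> \<le> e / (K + 1) * norm (f y' - f y)" by (rule d(2))
  also have "\<dots> \<le> e / (K + 1) * ((K + 1) * norm (y' - y))" using b eK by (intro mult_left_mono) auto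
  also have "\<dots> = e * norm (y' - y)" using K by simp
  finally show ?thesis .
 qed
 moreover have "min \<delta> (d / (K + 1)) > 0" using \<delta> d K by simp
 ultimately show "\<exists>d>0. \<forall>y'. norm (y' - y) < d --> \<bar>\<psi> (f y') - \<psi> (f y)\<bar> \<le> e * norm (y' - y)" by blast
qed

context extremal_field begin

text \<open>In coordinates, \<open>d\<theta>\<^sub>t = p d(\<pi> \<H>\<^sub>t)\<close> at the starting point with coordinate \<open>y\<close>. Freezing \<open>p\<close> at this point avoids
  differentiating the Lipschitz map \<open>\<pi> \<H>\<^sub>t\<close>.\<close>
definition exact :: "('p, 'e) chart => ('p, 'e) chart => real => 'e => bool" where
 "exact c c0 t y \<longleftrightarrow> ((\<lambda>y'. \<theta> t (lam c0 y') - imp c c0 t y \<bullet> pos c c0 t y') has_derivative (\<lambda>_. 0)) (at y)"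

lemma mom_transition:
 assumes c: "c \<in> A" "c' \<in> A" and l: "l \<in> dom_of (cot_chart A c)" "fst l \<in> dom_of c'"
 shows "mom c' l \<bullet> Dtr c c' (crd c (fst l)) d = mom c l \<bullet> d"
proof -
 have x: "fst l \<in> dom_of c" using l(1) by (simp add: dom_cot_chart)
 have v: "tvec_of A c (fst l) d \<in> tangent_space A (fst l)" by (rule tvec_of_in[OF c(1) x])
 have "mom c' l \<bullet> tvec_of A c (fst l) d c' = mom c l \<bullet> tvec_of A c (fst l) d c"
  using pairing[OF c(1) l(1) v] pairing[OF c(2) dom_cot_chart_change[OF l] v] by simp
 then show ?thesis unfolding tvec_of_self[OF c(1) x] tvec_of_apply[OF c(2) l(2)] .
qed

text \<open>The one-form \<open>p dx\<close> is invariant, so that the two frozen expressions differ by a function of the position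
  with vanishing derivative, composed with a Lipschitz map.\<close>
lemma exact_change:
 assumes t: "t \<in> J" and y: "lam c0 y \<in> \<Lambda>" "c0 \<in> A" "y \<in> crd c0 ` dom_of c0"
  and c: "c \<in> A" "fst (\<Phi> t (lam c0 y)) \<in> dom_of c" and c': "c' \<in> A" "fst (\<Phi> t (lam c0 y)) \<in> dom_of c'"
  and ex: "exact c c0 t y"
 shows "exact c' c0 t y"
proof -
 let ?l = "\<Phi> t (lam c0 y)"
 have y0: "fst (lam c0 y) \<in> dom_of c0" "crd c0 (fst (lam c0 y)) = y" using y by (auto simp: lam_def)
 obtain \<delta>1 K where 1: "\<delta>1 > 0" "K \<ge> 0"
  "\<And>y'. y' \<in> cball y \<delta>1 ==> \<Phi> t (lam c0 y') \<in> dom_of (cot_chart A c)"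
  "\<And>y'. y' \<in> cball y \<delta>1 ==> norm (crd (cot_chart A c) (\<Phi> t (lam c0 y')) - crd (cot_chart A c) ?l) \<le> K * norm (y' - y)"
 proof (rule flow_chart_lipschitz[OF t y(1,2) y0(1) c, unfolded y0(2)])
  fix \<delta> K assume h: "\<delta> > 0" "K \<ge> 0"
   "\<And>s y'. s \<in> J ==> \<bar>s - t\<bar> < \<delta> ==> y' \<in> cball y \<delta> ==> \<Phi> s (lam c0 y') \<in> dom_of (cot_chart A c)"
   "\<And>s t' y' y''. s \<in> J ==> \<bar>s - t\<bar> < \<delta> ==> t' \<in> J ==> \<bar>t' - t\<bar> < \<delta> ==> y' \<in> cball y \<delta> ==> y'' \<in> cball y \<delta> ==>
    norm (crd (cot_chart A c) (\<Phi> s (lam c0 y')) - crd (cot_chart A c) (\<Phi> t' (lam c0 y''))) \<le> K * (\<bar>s - t'\<bar> + norm (y' - y''))"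
  show thesis
   by (rule that[OF h(1,2)]) (use h(1) h(3)[OF t] h(4)[OF t _ t, of _ y] in auto)
 qed
 obtain \<delta>2 where 2: "\<delta>2 > 0" "\<And>y'. y' \<in> cball y \<delta>2 ==> \<Phi> t (lam c0 y') \<in> dom_of (cot_chart A c')"
 proof (rule flow_chart_lipschitz[OF t y(1,2) y0(1) c', unfolded y0(2)])
  fix \<delta> assume h: "\<delta> > 0"
   "\<And>s y'. s \<in> J ==> \<bar>s - t\<bar> < \<delta> ==> y' \<in> cball y \<delta> ==> \<Phi> s (lam c0 y') \<in> dom_of (cot_chart A c')"
  show thesis by (rule that[OF h(1)]) (use h(1) h(2)[OF t] in auto)
 qed
 \<comment> \<open>The difference of the two frozen expressions as a function of the position.\<close>
 define \<psi> where "\<psi> z = imp c' c0 t y \<bullet> transition c c' z - imp c c0 t y \<bullet> z" for z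
 have "(\<psi> has_derivative (\<lambda>d. imp c' c0 t y \<bullet> Dtr c c' (pos c c0 t y) d - imp c c0 t y \<bullet> d)) (at (pos c c0 t y))"
  unfolding \<psi>_def
  by (intro has_derivative_diff has_derivative_inner_right has_derivative_ident transition_has_derivative c c')
 then have "(\<psi> has_derivative (\<lambda>_. 0)) (at (pos c c0 t y))"
  by (simp add: mom_transition[OF c(1) c'(1) flow_dom[OF y(1) t c(2)] c'(2)])
 then have "((\<lambda>y'. \<psi> (pos c c0 t y')) has_derivative (\<lambda>_. 0)) (at y)"
 proof (rule has_derivative_zero_compose_lipschitz[OF _ 1(1,2)])
  fix y' assume "norm (y' - y) < \<delta>1"
  then have "y' \<in> cball y \<delta>1" by (simp add: dist_norm norm_minus_commute)
  from 1(4)[OF this] show "norm (pos c c0 t y' - pos c c0 t y) \<le> K * norm (y' - y)"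
   by (rule order_trans[rotated]) (simp only: crd_cot_chart diff_Pair norm_fst_le)
 qed
 from has_derivative_diff[OF ex[unfolded exact_def] this]
 have D: "((\<lambda>y'. \<theta> t (lam c0 y') - imp c c0 t y \<bullet> pos c c0 t y' - \<psi> (pos c c0 t y')) has_derivative (\<lambda>_. 0)) (at y)" by simp
 show ?thesis unfolding exact_def
 proof (rule has_derivative_transform_within[OF D])
  show "0 < min \<delta>1 \<delta>2" using 1 2 by simp
  fix y' assume "dist y' y < min \<delta>1 \<delta>2"
  then have m: "y' \<in> cball y \<delta>1" "y' \<in> cball y \<delta>2" by (auto simp: dist_commute)
  have "fst (\<Phi> t (lam c0 y')) \<in> dom_of c" using 1(3)[OF m(1)] by (simp add: dom_cot_chart)
  from transition_crd[OF c(1) this]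
  show "\<theta> t (lam c0 y') - imp c c0 t y \<bullet> pos c c0 t y' - \<psi> (pos c c0 t y') =
   \<theta> t (lam c0 y') - imp c' c0 t y \<bullet> pos c' c0 t y'" by (simp add: \<psi>_def)
 qed simp
qed

text \<open>At time \<open>0\<close> the action is \<open>\<alpha>\<close>, the position is the starting point and the momentum is \<open>d\<alpha>\<close>.\<close>
lemma exact_initially:
 assumes c0: "c0 \<in> A" and r: "\<And>y. y \<in> ball y0 r ==> y \<in> crd c0 ` (V \<inter> dom_of c0) \<and> lam c0 y \<in> \<Lambda>"
  and y: "y \<in> ball y0 r"
 shows "exact c0 c0 0 y"
proof -
 let ?D = "frechet_derivative (\<alpha> \<circ> crd_inv c0) (at y)"
 note y' = conjunct1[OF r[OF y]]
 have D: "(\<alpha> \<circ> crd_inv c0 has_derivative ?D) (at y)" by (rule smooth_on_C2(1)[OF \<alpha>_smooth[OF c0] y'])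
 have "?D v = (\<Sum>b\<in>Basis. ?D b *\<^sub>R b) \<bullet> v" for v
  using linear_expand[OF has_derivative_linear[OF D], of v] by (simp add: inner_sum_left inner_commute[of v] mult.commute)
 then have D': "?D v = mom c0 (lam c0 y) \<bullet> v" for v unfolding lam_mem(4)[OF c0 y'] .
 have "((\<lambda>y'. (\<alpha> \<circ> crd_inv c0) y' - mom c0 (lam c0 y) \<bullet> y') has_derivative (\<lambda>v. ?D v - mom c0 (lam c0 y) \<bullet> v)) (at y)"
  by (intro has_derivative_diff D has_derivative_inner_right has_derivative_ident)
 then have E: "((\<lambda>y'. (\<alpha> \<circ> crd_inv c0) y' - mom c0 (lam c0 y) \<bullet> y') has_derivative (\<lambda>v. 0)) (at y)" by (simp add: D')
 show ?thesis unfolding exact_def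
 proof (rule has_derivative_transform_within_open[OF E open_ball y])
  fix z assume z: "z \<in> ball y0 r"
  note rz = r[OF z] and ry = r[OF y]
  show "(\<alpha> \<circ> crd_inv c0) z - mom c0 (lam c0 y) \<bullet> z = \<theta> 0 (lam c0 z) - imp c0 c0 0 y \<bullet> pos c0 c0 0 z"
   using lam_mem(3)[OF c0, of z] rz ry by (simp add: flow_facts(1) theta_def lam_mem(2)[OF c0])
 qed
qed

text \<open>Each time has a chart in which exactness propagates for a short while, for starting points near \<open>k0\<close>;
  the neighbourhood may shrink from step to step, but finitely many steps suffice.\<close>
lemma exact_everywhere:
 assumes J0: "0 \<in> J" and t: "t \<in> J" "0 \<le> t" and k0: "k0 \<in> \<Lambda>" and c0: "c0 \<in> A" "fst k0 \<in> dom_of c0"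
  and c: "c \<in> A" "fst (\<Phi> t k0) \<in> dom_of c"
 shows "exact c c0 t (crd c0 (fst k0))"
proof -
 define y0 where "y0 = crd c0 (fst k0)"
 have lam0: "lam c0 y0 = k0" unfolding y0_def by (rule lam_crd[OF c0(1)]) (use k0 c0 in auto)
 define Q where "Q s \<longleftrightarrow> (\<exists>c\<in>A. \<exists>r>0. \<forall>y\<in>ball y0 r. y \<in> crd c0 ` (V \<inter> dom_of c0) \<and> lam c0 y \<in> \<Lambda> \<and>
  fst (\<Phi> s (lam c0 y)) \<in> dom_of c \<and> exact c c0 s y)" for s
 have "(0::real) \<le> 0 \<and> t \<le> t --> Q 0 --> Q t"
 proof (rule Bolzano[OF t(2), where P = "\<lambda>a b. 0 \<le> a \<and> b \<le> t --> Q a --> Q b"])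
  fix s assume s: "0 \<le> s" "s \<le> t"
  have sJ: "s \<in> J" using mem_is_interval_1_I[OF J(2) J0 t(1) s] .
  have "fst (\<Phi> s k0) \<in> carrier_of A" using flow_in[OF k0 sJ] dom_carrier unfolding carrier_cot by blast
  then obtain d where d: "d \<in> A" "fst (\<Phi> s k0) \<in> dom_of d" unfolding carrier_of_def by blast
  obtain \<delta> K where \<delta>: "\<delta> > 0" and in\<Lambda>: "\<And>y. y \<in> ball y0 \<delta> ==> y \<in> crd c0 ` (V \<inter> dom_of c0) \<and> lam c0 y \<in> \<Lambda>"
   and dom: "\<And>t y. t \<in> J ==> \<bar>t - s\<bar> < \<delta> ==> y \<in> ball y0 \<delta> ==> \<Phi> t (lam c0 y) \<in> dom_of (cot_chart A d)"
   and box: "flow_box (box_times s \<delta>) (ball y0 \<delta>) K (pos d c0) (imp d c0) (vq d c0) (vp d c0)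
    (\<lambda>t y. H t (\<Phi> t (lam c0 y))) (\<lambda>t y. Lag t (lam c0 y)) (\<lambda>t y. \<theta> t (lam c0 y))"
   by (rule flow_in_box[OF sJ k0 c0 d J0, folded y0_def]) blast
  have "Q b" if ab: "a \<le> s" "s \<le> b" "b - a < \<delta>" "0 \<le> a" "b \<le> t" and Qa: "Q a" for a b
  proof -
   have abJ: "a \<in> J" "b \<in> J"
    using mem_is_interval_1_I[OF J(2) J0 t(1)] ab by auto
   have abI: "a \<in> box_times s \<delta>" "b \<in> box_times s \<delta>" using ab abJ by (auto simp: box_times_def)
   obtain d' r where d': "d' \<in> A" "r > 0" and Qr: "\<And>y. y \<in> ball y0 r ==> y \<in> crd c0 ` (V \<inter> dom_of c0) \<and> lam c0 y \<in> \<Lambda> \<and>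
    fst (\<Phi> a (lam c0 y)) \<in> dom_of d' \<and> exact d' c0 a y"
    using Qa unfolding Q_def by (elim bexE exE conjE) (use that in blast)
   let ?r = "min r \<delta>"
   have domd: "fst (\<Phi> \<tau> (lam c0 y)) \<in> dom_of d" if "y \<in> ball y0 ?r" "\<tau> \<in> box_times s \<delta>" for y \<tau>
    using dom[of \<tau> y] that by (auto simp: dom_cot_chart box_times_def)
   interpret B: flow_box "box_times s \<delta>" "ball y0 ?r" K "pos d c0" "imp d c0" "vq d c0" "vp d c0"
    "\<lambda>t y. H t (\<Phi> t (lam c0 y))" "\<lambda>t y. Lag t (lam c0 y)" "\<lambda>t y. \<theta> t (lam c0 y)"
    by (rule flow_box.sub_box[OF box]) (use flow_box.I[OF box] in auto)
   have exa: "B.exact_at a y" if y: "y \<in> ball y0 ?r" for y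
   proof -
    have yr: "y \<in> ball y0 r" using y by simp
    note q = Qr[OF yr]
    have "exact d c0 a y"
     by (rule exact_change[OF abJ(1) _ c0(1) _ d'(1) _ d(1) domd[OF y abI(1)]]) (use q in blast)+
    then show ?thesis by (simp add: exact_def B.exact_at_def)
   qed
   have "exact d c0 b y" if y: "y \<in> ball y0 ?r" for y
    using B.exactness_propagates[OF abI _ y exa] ab by (simp add: exact_def B.exact_at_def)
   moreover have "?r > 0" using \<delta> d' by simp
   ultimately show "Q b" unfolding Q_def
    by (intro bexI[OF _ d(1)] exI[of _ ?r] conjI ballI) (use in\<Lambda> domd abI in auto)
  qed
  then show "\<exists>\<delta>>0. \<forall>a b. a \<le> s \<and> s \<le> b \<and> b - a < \<delta> --> (0 \<le> a \<and> b \<le> t --> Q a --> Q b)"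
   using \<delta> by blast
 qed auto
 moreover have "Q 0"
 proof -
  obtain r where r: "r > 0" "\<And>y. y \<in> ball y0 r ==> y \<in> crd c0 ` (V \<inter> dom_of c0) \<and> lam c0 y \<in> \<Lambda>"
  proof (rule lam_chart[OF c0(1) k0 c0(2), folded y0_def])
   fix r assume h: "r > 0" "cball y0 r \<subseteq> crd c0 ` (V \<inter> dom_of c0)" "\<And>y. y \<in> cball y0 r ==> lam c0 y \<in> \<Lambda>"
   show thesis
   proof (rule that[OF h(1)])
    fix y assume "y \<in> ball y0 r"
    then have "y \<in> cball y0 r" by simp
    then show "y \<in> crd c0 ` (V \<inter> dom_of c0) \<and> lam c0 y \<in> \<Lambda>" using h by blast
   qed
  qed
  show ?thesis unfolding Q_def
  proof (intro bexI[OF _ c0(1)] exI[of _ r] conjI ballI r(1))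
   fix y assume y: "y \<in> ball y0 r"
   show "y \<in> crd c0 ` (V \<inter> dom_of c0)" using r(2)[OF y] by blast
   show "lam c0 y \<in> \<Lambda>" using r(2)[OF y] by blast
   show "exact c0 c0 0 y" by (rule exact_initially[OF c0(1) r(2) y])
   show "fst (\<Phi> 0 (lam c0 y)) \<in> dom_of c0" unfolding flow_facts(1)[OF conjunct2[OF r(2)[OF y]]]
    using lam_mem(1)[OF c0(1) conjunct1[OF r(2)[OF y]]] by (simp add: dom_cot_chart)
  qed
 qed
 ultimately have "Q t" by simp
 then obtain d r where d: "d \<in> A" "r > 0" "\<forall>y\<in>ball y0 r. y \<in> crd c0 ` (V \<inter> dom_of c0) \<and> lam c0 y \<in> \<Lambda> \<and>
  fst (\<Phi> t (lam c0 y)) \<in> dom_of d \<and> exact d c0 t y" unfolding Q_def by (elim bexE exE conjE) (use that in blast)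
 have y: "y0 \<in> ball y0 r" using d by simp
 note q = bspec[OF d(3) y, unfolded lam0]
 show ?thesis unfolding y0_def[symmetric]
  by (rule exact_change[OF t(1) _ c0(1) _ d(1) _ c(1)]) (use q c(2) k0 in \<open>auto simp: lam0\<close>)
qed

end

section \<open>The value along an admissible trajectory\<close>

lemma abs_continuous_on_cong:
 assumes "abs_continuous_on S f" "\<And>t. t \<in> S ==> f t = g t"
 shows "abs_continuous_on S g"
proof (rule abs_continuous_lipschitz_bound[OF assms(1), where C = 1])
 show "norm (g t - g s) \<le> 1 * (\<bar>t - s\<bar> + norm (f t - f s))" if "s \<in> S" "t \<in> S" for s t
  using assms(2)[OF that(1)] assms(2)[OF that(2)] by simp
qed simp

locale extremal_control = extremal_field "atlas P" gT \<alpha> V W \<O> J H \<Phi>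
 for P :: "('p, 'e::euclidean_space, 'u::euclidean_space) control_problem"
  and gT \<alpha> V W \<O> J H \<Phi> +
 fixes gM :: "('p, 'e) metric_tensor" and p\<^sub>0 T\<^sub>1 :: real
 assumes problem: "control_problem P" and metric_M: "riemannian_metric (atlas P) gM"
  and T\<^sub>1: "{0..T\<^sub>1} \<subseteq> J" "0 < T\<^sub>1"
  and max_le: "\<And>t l. t \<in> J ==> l \<in> \<Lambda> ==> max_ham P p\<^sub>0 (\<Phi> t l) \<le> ereal (H t (\<Phi> t l))"
  and lift_lip: "\<exists>L. \<forall>t\<in>{0..T\<^sub>1}. \<forall>l\<in>\<Lambda>. \<forall>s\<in>{0..T\<^sub>1}. \<forall>k\<in>\<Lambda>.
   \<bar>t - s\<bar> + dT l k \<le> L * (\<bar>t - s\<bar> + riemannian_dist (atlas P) gM (fst (\<Phi> t l)) (fst (\<Phi> s k)))"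
begin

abbreviation "A \<equiv> atlas P"

sublocale MR: C1_riemannian A gM by unfold_locales (rule metric_M)

lemma J0: "0 \<in> J" using T\<^sub>1 by auto

lemma dyn_tangent: "x \<in> carrier_of A ==> u \<in> ctrl_set P ==> dyn P x u \<in> tangent_space A x"
 using problem unfolding control_problem_def by blast

lemma data_continuous:
 assumes c: "c \<in> A" and u: "u \<in> ctrl_set P"
 shows "continuous_on (crd c ` dom_of c) (\<lambda>z. run_cost P (crd_inv c z) u)"
  "continuous_on (crd c ` dom_of c) (\<lambda>z. dyn P (crd_inv c z) u c)"
proof -
 let ?S = "(\<lambda>(x, u). (crd c x, u)) ` {(x, u) \<in> dyn_dom P. x \<in> dom_of c}"
 have sub: "carrier_of A \<times> ctrl_set P \<subseteq> dyn_dom P"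
  and sm: "smooth_on ?S (\<lambda>(z, u). run_cost P (crd_inv c z) u)" "smooth_on ?S (\<lambda>(z, u). dyn P (crd_inv c z) u c)"
  using problem c unfolding control_problem_def by blast+
 have cont: "continuous_on ?S (\<lambda>(z, u). run_cost P (crd_inv c z) u)" "continuous_on ?S (\<lambda>(z, u). dyn P (crd_inv c z) u c)"
  using sm Ck_on.simps(1) unfolding smooth_on_def by blast+
 have pr: "continuous_on (crd c ` dom_of c) (\<lambda>z. (z, u))" by (intro continuous_intros)
 have im: "(\<lambda>z. (z, u)) ` (crd c ` dom_of c) \<subseteq> ?S"
 proof (rule image_subsetI)
  fix z assume "z \<in> crd c ` dom_of c"
  then obtain x where x: "x \<in> dom_of c" "z = crd c x" by blast
  then have "(x, u) \<in> dyn_dom P" using sub u carrierI[OF c] by blast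
  then show "(z, u) \<in> ?S" using x by (intro image_eqI[of _ _ "(x, u)"]) auto
 qed
 show "continuous_on (crd c ` dom_of c) (\<lambda>z. run_cost P (crd_inv c z) u)"
  using continuous_on_compose2[OF cont(1) pr im] by simp
 show "continuous_on (crd c ` dom_of c) (\<lambda>z. dyn P (crd_inv c z) u c)"
  using continuous_on_compose2[OF cont(2) pr im] by simp
qed

lemma pre_ham_chart:
 assumes c: "c \<in> A" and l: "l \<in> dom_of (cot_chart A c)" and u: "u \<in> ctrl_set P"
 shows "pre_ham P p\<^sub>0 l u = mom c l \<bullet> dyn P (crd_inv c (crd c (fst l))) u c - p\<^sub>0 * run_cost P (crd_inv c (crd c (fst l))) u"
proof -
 have x: "fst l \<in> dom_of c" using l by (simp add: dom_cot_chart)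
 show ?thesis unfolding pre_ham_def crd_inv_crd[OF c x] pairing[OF c l dyn_tangent[OF carrierI[OF c x] u]] ..
qed

lemma pre_ham_le: "t \<in> J ==> l \<in> \<Lambda> ==> u \<in> ctrl_set P ==> pre_ham P p\<^sub>0 (\<Phi> t l) u \<le> H t (\<Phi> t l)"
proof -
 assume a: "t \<in> J" "l \<in> \<Lambda>" "u \<in> ctrl_set P"
 have "ereal (pre_ham P p\<^sub>0 (\<Phi> t l) u) \<le> max_ham P p\<^sub>0 (\<Phi> t l)" unfolding max_ham_def by (rule SUP_upper[OF a(3)])
 also have "\<dots> \<le> ereal (H t (\<Phi> t l))" by (rule max_le[OF a(1,2)])
 finally show ?thesis by simp
qed

text \<open>The inverse Lipschitz bound of the projected flow controls the lift \<open>\<rho>\<close> by the curve \<open>\<xi>\<close>, first in Riemannian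
  distance and then, through the two comparisons of distances, in coordinates.\<close>
lemma curve_lift:
 assumes \<xi>: "mcontinuous_curve A {0..T} \<xi>" and T: "T \<le> T\<^sub>1"
  and \<rho>: "\<And>t. t \<in> {0..T} ==> \<rho> t \<in> \<Lambda> \<and> fst (\<Phi> t (\<rho> t)) = \<xi> t"
  and s: "s \<in> {0..T}" and c: "c \<in> A" "\<xi> s \<in> dom_of c" and c0: "c0 \<in> A" "fst (\<rho> s) \<in> dom_of c0" and \<epsilon>: "\<epsilon> > 0"
 obtains d C where "d > 0" "C \<ge> 0"
  "\<And>t. t \<in> {0..T} ==> \<bar>t - s\<bar> < d ==> \<xi> t \<in> dom_of c \<and> fst (\<rho> t) \<in> dom_of c0 \<and>
   crd c0 (fst (\<rho> t)) \<in> ball (crd c0 (fst (\<rho> s))) \<epsilon>"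
  "\<And>t t'. t \<in> {0..T} ==> \<bar>t - s\<bar> < d ==> t' \<in> {0..T} ==> \<bar>t' - s\<bar> < d ==>
   norm (crd c0 (fst (\<rho> t)) - crd c0 (fst (\<rho> t'))) \<le> C * (\<bar>t - t'\<bar> + norm (crd c (\<xi> t) - crd c (\<xi> t')))"
proof -
 let ?C = "cot_chart A c0" and ?\<zeta> = "\<lambda>t. crd c (\<xi> t)"
 have C: "?C \<in> cot_atlas A" by (rule cot_chart_in[OF c0(1)])
 have \<rho>car: "\<rho> t \<in> carrier_of (cot_atlas A)" if "t \<in> {0..T}" for t using \<rho>[OF that] \<Lambda>_carrier by blast
 have \<rho>s: "\<rho> s \<in> dom_of ?C" using \<rho>car[OF s] c0(2) by (simp add: carrier_cot dom_cot_chart)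
 obtain r M where r: "r > 0" "M > 0"
  "\<And>y y'. y \<in> dom_of c ==> y' \<in> dom_of c ==> crd c y \<in> ball (crd c (\<xi> s)) r ==> crd c y' \<in> ball (crd c (\<xi> s)) r ==>
   0 \<le> MR.rdist y y' \<and> MR.rdist y y' \<le> M * norm (crd c y' - crd c y)"
  by (rule MR.rdist_upper[OF c]) blast
 obtain R e D where R: "R > 0" "e > 0" "D > 0"
  "\<And>v w. v \<in> dom_of ?C ==> crd ?C v \<in> ball (crd ?C (\<rho> s)) R ==> TR.lengths v w \<noteq> {} ==> dT v w < e ==>
   w \<in> dom_of ?C \<and> norm (crd ?C w - crd ?C v) \<le> D * dT v w"
  by (rule TR.rdist_lower[OF Hausdorff_cot[OF haus] C \<rho>s]) blast
 obtain L where L: "\<And>t l s k. t \<in> {0..T\<^sub>1} ==> l \<in> \<Lambda> ==> s \<in> {0..T\<^sub>1} ==> k \<in> \<Lambda> ==>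
   \<bar>t - s\<bar> + dT l k \<le> L * (\<bar>t - s\<bar> + MR.rdist (fst (\<Phi> t l)) (fst (\<Phi> s k)))"
  using lift_lip by (elim exE) blast
 define Q where "Q = \<bar>L\<bar> * (1 + M)"
 have Q: "Q \<ge> 0" using r by (simp add: Q_def)
 define \<kappa> where "\<kappa> = min e (min R \<epsilon> / D)"
 have \<kappa>: "\<kappa> > 0" "\<kappa> \<le> e" "D * \<kappa> \<le> min R \<epsilon>"
 proof -
  show "\<kappa> > 0" "\<kappa> \<le> e" using R \<epsilon> by (auto simp: \<kappa>_def)
  have "D * \<kappa> \<le> D * (min R \<epsilon> / D)" using R by (intro mult_left_mono) (auto simp: \<kappa>_def)
  then show "D * \<kappa> \<le> min R \<epsilon>" using R by simp
 qed
 define \<eta> where "\<eta> = min r (\<kappa> / (5 * (Q + 1)))"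
 have \<eta>: "\<eta> > 0" "\<eta> \<le> r" "Q * (4 * \<eta>) < \<kappa>"
 proof -
  show "\<eta> > 0" "\<eta> \<le> r" using r \<kappa> Q by (auto simp: \<eta>_def)
  have "5 * (Q * \<eta>) \<le> 5 * ((Q + 1) * \<eta>)" using \<open>\<eta> > 0\<close> by (intro mult_left_mono mult_right_mono) auto
  also have "\<dots> \<le> 5 * ((Q + 1) * (\<kappa> / (5 * (Q + 1))))" using Q by (intro mult_left_mono) (auto simp: \<eta>_def)
  also have "\<dots> = \<kappa>"
  proof -
   have "5 * (a * (\<kappa> / (5 * a))) = \<kappa>" if "a > 0" for a :: real using that by (simp add: field_simps)
   from this[of "Q + 1"] Q show ?thesis by simp
  qed
  finally have "5 * (Q * \<eta>) \<le> \<kappa>" .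
  moreover have "0 \<le> Q * \<eta>" using Q \<open>\<eta> > 0\<close> by simp
  ultimately show "Q * (4 * \<eta>) < \<kappa>" using \<kappa>(1) by linarith
 qed
 have "openin (mtop A) {x \<in> dom_of c. crd c x \<in> ball (?\<zeta> s) \<eta>}" by (rule openin_chart_preimage[OF c(1) open_ball])
 moreover have "\<xi> s \<in> {x \<in> dom_of c. crd c x \<in> ball (?\<zeta> s) \<eta>}" using c \<eta> by simp
 ultimately obtain d1 where d1: "d1 > 0" "\<And>t. t \<in> {0..T} ==> \<bar>t - s\<bar> < d1 ==> \<xi> t \<in> {x \<in> dom_of c. crd c x \<in> ball (?\<zeta> s) \<eta>}"
  using curve_near[OF \<xi> _ s] by blast
 define d where "d = min d1 \<eta>"
 have near: "\<xi> t \<in> dom_of c \<and> crd c (\<xi> t) \<in> ball (?\<zeta> s) r \<and> norm (?\<zeta> t - ?\<zeta> s) < \<eta>" if "t \<in> {0..T}" "\<bar>t - s\<bar> < d" for t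
  using d1(2)[of t] that \<eta>(2) by (auto simp: d_def dist_norm norm_minus_commute)
 have dist: "TR.lengths (\<rho> t) (\<rho> t') \<noteq> {} \<and> dT (\<rho> t) (\<rho> t') \<le> Q * (\<bar>t - t'\<bar> + norm (?\<zeta> t - ?\<zeta> t'))"
  if t: "t \<in> {0..T}" "\<bar>t - s\<bar> < d" "t' \<in> {0..T}" "\<bar>t' - s\<bar> < d" for t t'
 proof -
  have t1: "t \<in> {0..T\<^sub>1}" "t' \<in> {0..T\<^sub>1}" using t T by auto
  have m: "0 \<le> MR.rdist (\<xi> t) (\<xi> t') \<and> MR.rdist (\<xi> t) (\<xi> t') \<le> M * norm (?\<zeta> t' - ?\<zeta> t)"
   by (rule r(3)) (use near[OF t(1,2)] near[OF t(3,4)] in auto)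
  have "\<bar>t - t'\<bar> + dT (\<rho> t) (\<rho> t') \<le> L * (\<bar>t - t'\<bar> + MR.rdist (\<xi> t) (\<xi> t'))"
   using L[OF t1(1) _ t1(2), of "\<rho> t" "\<rho> t'"] \<rho>[OF t(1)] \<rho>[OF t(3)] by simp
  also have "\<dots> \<le> \<bar>L\<bar> * (\<bar>t - t'\<bar> + MR.rdist (\<xi> t) (\<xi> t'))"
   using m by (intro mult_right_mono add_nonneg_nonneg) auto
  also have "\<dots> \<le> \<bar>L\<bar> * ((1 + M) * (\<bar>t - t'\<bar> + norm (?\<zeta> t - ?\<zeta> t')))"
  proof (rule mult_left_mono)
   have "MR.rdist (\<xi> t) (\<xi> t') \<le> M * norm (?\<zeta> t - ?\<zeta> t')" using m by (simp add: norm_minus_commute)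
   moreover have "0 \<le> M * \<bar>t - t'\<bar>" using r by simp
   ultimately show "\<bar>t - t'\<bar> + MR.rdist (\<xi> t) (\<xi> t') \<le> (1 + M) * (\<bar>t - t'\<bar> + norm (?\<zeta> t - ?\<zeta> t'))"
    using norm_ge_zero[of "?\<zeta> t - ?\<zeta> t'"] unfolding distrib_left distrib_right mult_1_left by linarith
  qed simp
  finally have "dT (\<rho> t) (\<rho> t') \<le> Q * (\<bar>t - t'\<bar> + norm (?\<zeta> t - ?\<zeta> t'))"
   unfolding Q_def mult.assoc using abs_ge_zero[of "t - t'"] by linarith
  then show ?thesis using dT_nonneg[OF \<rho>car[OF t(1)] \<rho>car[OF t(3)]] by blast
 qed
 have ss: "\<bar>s - s\<bar> < d" using d1 \<eta> by (simp add: d_def)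
 have mid: "\<rho> t \<in> dom_of ?C \<and> norm (crd ?C (\<rho> t) - crd ?C (\<rho> s)) < min R \<epsilon>" if t: "t \<in> {0..T}" "\<bar>t - s\<bar> < d" for t
 proof -
  have "Q * (\<bar>s - t\<bar> + norm (?\<zeta> s - ?\<zeta> t)) \<le> Q * (4 * \<eta>)"
   using near[OF t] t \<eta>(1) by (intro mult_left_mono Q) (auto simp: norm_minus_commute d_def)
  then have d': "dT (\<rho> s) (\<rho> t) < \<kappa>" using dist[OF s ss t] \<eta>(3) by linarith
  then have "dT (\<rho> s) (\<rho> t) < e" using \<kappa>(2) by linarith
  from R(4)[OF \<rho>s _ conjunct1[OF dist[OF s ss t]] this] R(1)
  have *: "\<rho> t \<in> dom_of ?C" "norm (crd ?C (\<rho> t) - crd ?C (\<rho> s)) \<le> D * dT (\<rho> s) (\<rho> t)" by auto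
  have "D * dT (\<rho> s) (\<rho> t) < D * \<kappa>" using d' R(3) by simp
  then show ?thesis using * \<kappa>(3) by linarith
 qed
 show thesis
 proof (rule that[of d "D * Q"])
  show "d > 0" using ss by simp
  show "0 \<le> D * Q" using R Q by simp
  fix t assume t: "t \<in> {0..T}" "\<bar>t - s\<bar> < d"
  have "norm (crd c0 (fst (\<rho> t)) - crd c0 (fst (\<rho> s))) \<le> norm (crd ?C (\<rho> t) - crd ?C (\<rho> s))"
   by (simp only: crd_cot_chart diff_Pair norm_fst_le)
  then have "norm (crd c0 (fst (\<rho> t)) - crd c0 (fst (\<rho> s))) < \<epsilon>" using mid[OF t] by linarith
  then show "\<xi> t \<in> dom_of c \<and> fst (\<rho> t) \<in> dom_of c0 \<and> crd c0 (fst (\<rho> t)) \<in> ball (crd c0 (fst (\<rho> s))) \<epsilon>"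
   using near[OF t] mid[OF t] by (simp add: dom_cot_chart dist_norm norm_minus_commute)
  fix t' assume t': "t' \<in> {0..T}" "\<bar>t' - s\<bar> < d"
  have "norm (?\<zeta> t - ?\<zeta> t') \<le> norm (?\<zeta> t - ?\<zeta> s) + norm (?\<zeta> t' - ?\<zeta> s)" by (metis dist_norm dist_triangle2)
  then have "Q * (\<bar>t - t'\<bar> + norm (?\<zeta> t - ?\<zeta> t')) \<le> Q * (4 * \<eta>)"
   using near[OF t] near[OF t'] t t' by (intro mult_left_mono Q) (auto simp: d_def)
  then have "dT (\<rho> t) (\<rho> t') < e" using dist[OF t t'] \<eta>(3) \<kappa>(2) by linarith
  moreover have "crd ?C (\<rho> t) \<in> ball (crd ?C (\<rho> s)) R" using mid[OF t] by (simp add: dist_norm norm_minus_commute)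
  ultimately have "norm (crd ?C (\<rho> t') - crd ?C (\<rho> t)) \<le> D * dT (\<rho> t) (\<rho> t')"
   using R(4) mid[OF t] dist[OF t t'] by blast
  also have "\<dots> \<le> D * (Q * (\<bar>t - t'\<bar> + norm (?\<zeta> t - ?\<zeta> t')))" using dist[OF t t'] R(3) by (intro mult_left_mono) auto
  finally have "norm (crd ?C (\<rho> t) - crd ?C (\<rho> t')) \<le> D * Q * (\<bar>t - t'\<bar> + norm (?\<zeta> t - ?\<zeta> t'))" by (simp add: norm_minus_commute)
  moreover have "norm (crd c0 (fst (\<rho> t)) - crd c0 (fst (\<rho> t'))) \<le> norm (crd ?C (\<rho> t) - crd ?C (\<rho> t'))"
   by (simp only: crd_cot_chart diff_Pair norm_fst_le)
  ultimately show "norm (crd c0 (fst (\<rho> t)) - crd c0 (fst (\<rho> t'))) \<le> D * Q * (\<bar>t - t'\<bar> + norm (?\<zeta> t - ?\<zeta> t'))" by linarith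
 qed
qed

end

context extremal_control begin

text \<open>Near a given time the situation is that of \<open>value_along_curve_le\<close>. The bound for the Hamiltonian comes from
  the pre-Hamiltonian with the control value at the single time \<open>\<tau>\<close>: it is a lower bound at all
  nearby points of the flow and depends continuously on them.\<close>
lemma value_increment_local:
 assumes \<xi>: "mabs_continuous_curve A {0..T} \<xi>" and T: "T \<le> T\<^sub>1"
  and \<rho>: "\<And>t. t \<in> {0..T} ==> \<rho> t \<in> \<Lambda> \<and> fst (\<Phi> t (\<rho> t)) = \<xi> t"
  and N: "negligible N" "\<And>t. t \<in> {0..T} - N ==> has_velocity A \<xi> t (dyn P (\<xi> t) (\<upsilon> t)) \<and> \<upsilon> t \<in> ctrl_set P"
  and int: "(\<lambda>t. run_cost P (\<xi> t) (\<upsilon> t)) integrable_on {0..T}"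
  and s: "s \<in> {0..T}"
 obtains d where "d > 0" "\<And>a b. 0 \<le> a ==> a \<le> s ==> s \<le> b ==> b \<le> T ==> b - a < d ==>
  \<theta> b (\<rho> b) - \<theta> a (\<rho> a) \<le> integral {a..b} (\<lambda>t. p\<^sub>0 * run_cost P (\<xi> t) (\<upsilon> t))"
proof -
 have \<xi>c: "mcontinuous_curve A {0..T} \<xi>" using \<xi> by (simp add: mabs_continuous_curve_def)
 have TJ: "{0..T} \<subseteq> J" using T T\<^sub>1 by auto
 have sJ: "s \<in> J" using s TJ by blast
 note \<rho>s = \<rho>[OF s]
 obtain c where c: "c \<in> A" "\<xi> s \<in> dom_of c"
  using curve_in_carrier[OF \<xi>c s] unfolding carrier_of_def by blast
 have "fst (\<rho> s) \<in> carrier_of A" using \<rho>s \<Lambda>_carrier unfolding carrier_cot by blast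
 then obtain c0 where c0: "c0 \<in> A" "fst (\<rho> s) \<in> dom_of c0" unfolding carrier_of_def by blast
 define y0 where "y0 = crd c0 (fst (\<rho> s))"
 have cs: "fst (\<Phi> s (\<rho> s)) \<in> dom_of c" using \<rho>s c by simp
 obtain \<delta> K where \<delta>: "\<delta> > 0" and in\<Lambda>: "\<And>y. y \<in> ball y0 \<delta> ==> y \<in> crd c0 ` (V \<inter> dom_of c0) \<and> lam c0 y \<in> \<Lambda>"
  and dom: "\<And>t y. t \<in> J ==> \<bar>t - s\<bar> < \<delta> ==> y \<in> ball y0 \<delta> ==> \<Phi> t (lam c0 y) \<in> dom_of (cot_chart A c)"
  and box: "flow_box (box_times s \<delta>) (ball y0 \<delta>) K (pos c c0) (imp c c0) (vq c c0) (vp c c0)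
   (\<lambda>t y. H t (\<Phi> t (lam c0 y))) (\<lambda>t y. Lag t (lam c0 y)) (\<lambda>t y. \<theta> t (lam c0 y))"
  by (rule flow_in_box[OF sJ conjunct1[OF \<rho>s] c0 c(1) cs J0, folded y0_def]) blast
 let ?I = "box_times s \<delta>" and ?U = "ball y0 \<delta>"
 interpret B: flow_box ?I ?U K "pos c c0" "imp c c0" "vq c c0" "vp c c0"
  "\<lambda>t y. H t (\<Phi> t (lam c0 y))" "\<lambda>t y. Lag t (lam c0 y)" "\<lambda>t y. \<theta> t (lam c0 y)"
  by (rule box)
 have I: "t \<in> J" "\<bar>t - s\<bar> < \<delta>" "0 \<le> t" if "t \<in> ?I" for t using that by (auto simp: box_times_def)
 have ex: "B.exact_at t y" if t: "t \<in> ?I" and y: "y \<in> ?U" for t y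
 proof -
  have y': "fst (lam c0 y) \<in> dom_of c0" "crd c0 (fst (lam c0 y)) = y"
   using lam_mem(1,3)[OF c0(1) conjunct1[OF in\<Lambda>[OF y]]] by (simp_all add: dom_cot_chart)
  have "exact c c0 t (crd c0 (fst (lam c0 y)))"
   by (rule exact_everywhere[OF J0 I(1)[OF t] I(3)[OF t] conjunct2[OF in\<Lambda>[OF y]] c0(1) y'(1) c(1)])
    (use dom[OF I(1,2)[OF t] y] in \<open>simp add: dom_cot_chart\<close>)
  then show ?thesis unfolding y'(2) exact_def B.exact_at_def .
 qed
 have sI: "s \<in> ?I" using s \<delta> sJ by (simp add: box_times_def)
 have y0U: "y0 \<in> ?U" using \<delta> by simp
 obtain Bd where Bd: "\<And>t y. t \<in> ?I ==> y \<in> ?U ==> norm (imp c c0 t y) \<le> Bd"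
  "\<And>a t y. a \<in> ?I ==> t \<in> ?I ==> a \<le> t ==> y \<in> ?U ==> \<bar>\<theta> t (lam c0 y) - \<theta> a (lam c0 y)\<bar> \<le> Bd * (t - a)"
 proof (rule B.uniform_bounds[OF _ _ sI y0U])
  show "bounded ?I" unfolding box_times_def
   by (rule bounded_subset[of "{s - \<delta>..s + \<delta>}"]) auto
 qed (auto intro: that)
 obtain d C where d: "d > 0" and C: "C \<ge> 0" and lift: "\<And>t. t \<in> {0..T} ==> \<bar>t - s\<bar> < d ==> \<xi> t \<in> dom_of c \<and>
   fst (\<rho> t) \<in> dom_of c0 \<and> crd c0 (fst (\<rho> t)) \<in> ?U"
  and liftC: "\<And>t t'. t \<in> {0..T} ==> \<bar>t - s\<bar> < d ==> t' \<in> {0..T} ==> \<bar>t' - s\<bar> < d ==>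
   norm (crd c0 (fst (\<rho> t)) - crd c0 (fst (\<rho> t'))) \<le> C * (\<bar>t - t'\<bar> + norm (crd c (\<xi> t) - crd c (\<xi> t')))"
  by (rule curve_lift[OF \<xi>c T \<rho> s c c0 \<delta>, folded y0_def]) blast+
 define Y where "Y t = crd c0 (fst (\<rho> t))" for t
 have lamY: "lam c0 (Y t) = \<rho> t" if "t \<in> {0..T}" "\<bar>t - s\<bar> < d" for t
  unfolding Y_def by (rule lam_crd[OF c0(1)]) (use \<rho>[OF that(1)] lift[OF that] in auto)
 have posY: "pos c c0 t (Y t) = crd c (\<xi> t)" if "t \<in> {0..T}" "\<bar>t - s\<bar> < d" for t
  using lamY[OF that] \<rho>[OF that(1)] by simp
 let ?g = "\<lambda>t. p\<^sub>0 * run_cost P (\<xi> t) (\<upsilon> t)"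
 show thesis
 proof (rule that[of "min d \<delta>"])
  show "0 < min d \<delta>" using d \<delta> by simp
  fix a b assume ab: "0 \<le> a" "a \<le> s" "s \<le> b" "b \<le> T" "b - a < min d \<delta>"
  have t: "t \<in> {0..T}" "\<bar>t - s\<bar> < d" "t \<in> ?I" if "t \<in> {a..b}" for t
  proof -
   show "t \<in> {0..T}" "\<bar>t - s\<bar> < d" using that ab by auto
   then show "t \<in> ?I" using that ab TJ by (auto simp: box_times_def)
  qed
  have "\<theta> b (lam c0 (Y b)) - \<theta> a (lam c0 (Y a)) \<le> integral {a..b} ?g"
  proof (rule B.value_along_curve_le(2)[OF ex _ _ _ C _ _ Bd _ N(1)])
   show "a \<le> b" "{a..b} \<subseteq> ?I" using ab t by auto
   show "Y t \<in> ?U" if "t \<in> {a..b}" for t using lift[OF t(1,2)[OF that]] by (simp add: Y_def)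
   show "norm (Y t - Y t') \<le> C * (\<bar>t - t'\<bar> + norm (pos c c0 t (Y t) - pos c c0 t' (Y t')))"
    if "t' \<in> {a..b}" "t \<in> {a..b}" for t' t
    unfolding posY[OF t(1,2)[OF that(1)]] posY[OF t(1,2)[OF that(2)]] unfolding Y_def
    by (rule liftC[OF t(1,2)[OF that(2)] t(1,2)[OF that(1)]])
   have "abs_continuous_on {a..b} (crd c \<circ> \<xi>)"
    using \<xi> c(1) t(1) lift[OF t(1,2)] unfolding mabs_continuous_curve_def by blast
   then show "abs_continuous_on {a..b} (\<lambda>t. pos c c0 t (Y t))"
    by (rule abs_continuous_on_cong) (simp only: o_def posY[OF t(1,2)])
   show "?g integrable_on {a..b}"
    using integrable_on_cmult_left[OF integrable_on_subinterval[OF int, of a b], of p\<^sub>0] ab by auto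
  next
   fix \<tau> assume \<tau>: "\<tau> \<in> {a..b} - N"
   then have \<tau>ab: "\<tau> \<in> {a..b}" by blast
   note \<tau>t = t[OF \<tau>ab]
   have vel: "has_velocity A \<xi> \<tau> (dyn P (\<xi> \<tau>) (\<upsilon> \<tau>))" and u: "\<upsilon> \<tau> \<in> ctrl_set P" using N(2)[of \<tau>] \<tau> \<tau>t by blast+
   have \<xi>\<tau>: "\<xi> \<tau> \<in> dom_of c" using lift[OF \<tau>t(1,2)] by blast
   define v where "v = dyn P (\<xi> \<tau>) (\<upsilon> \<tau>) c"
   have hv: "((crd c \<circ> \<xi>) has_vector_derivative v) (at \<tau>)" using vel c(1) \<xi>\<tau> unfolding has_velocity_def v_def by blast
   have 1: "((\<lambda>t. pos c c0 t (Y t)) has_vector_derivative v) (at \<tau> within {a..b})"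
    by (rule has_vector_derivative_transform[OF \<tau>ab _ has_vector_derivative_at_within[OF hv]])
     (simp only: o_def posY[OF t(1,2)])
   let ?u = "\<upsilon> \<tau>"
   define F where "F z = imp c c0 (fst z) (snd z) \<bullet> dyn P (crd_inv c (pos c c0 (fst z) (snd z))) ?u c
    - p\<^sub>0 * run_cost P (crd_inv c (pos c c0 (fst z) (snd z))) ?u" for z
   have pos_in: "pos c c0 (fst z) (snd z) \<in> crd c ` dom_of c" if "z \<in> ?I \<times> ?U" for z
    using dom[OF I(1,2)] that by (auto simp: dom_cot_chart)
   have "continuous_on (?I \<times> ?U) F" unfolding F_def
    by (intro continuous_intros B.continuous_on_box continuous_on_compose2[OF data_continuous(1)[OF c(1) u]]
      continuous_on_compose2[OF data_continuous(2)[OF c(1) u]]) (use pos_in in auto)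
   moreover have z: "(\<tau>, Y \<tau>) \<in> ?I \<times> ?U" using \<tau>t lift[OF \<tau>t(1,2)] by (simp add: Y_def)
   ultimately have cF: "\<forall>e>0. \<exists>d>0. \<forall>z\<in>?I \<times> ?U. dist z (\<tau>, Y \<tau>) < d --> dist (F z) (F (\<tau>, Y \<tau>)) < e"
    unfolding continuous_on_iff by blast
   have F\<tau>: "F (\<tau>, Y \<tau>) = imp c c0 \<tau> (Y \<tau>) \<bullet> v - ?g \<tau>"
    unfolding F_def fst_conv snd_conv posY[OF \<tau>t(1,2)] v_def crd_inv_crd[OF c(1) \<xi>\<tau>] ..
   have FH: "F (t, y) \<le> H t (\<Phi> t (lam c0 y))" if "t \<in> ?I" "y \<in> ?U" for t y
    using pre_ham_le[OF I(1)[OF that(1)] conjunct2[OF in\<Lambda>[OF that(2)]] u]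
    unfolding pre_ham_chart[OF c(1) dom[OF I(1,2)[OF that(1)] that(2)] u] F_def fst_conv snd_conv .
   have 2: "\<exists>d>0. \<forall>t\<in>?I. \<forall>y\<in>?U. \<bar>t - \<tau>\<bar> < d \<and> norm (y - Y \<tau>) < d -->
    imp c c0 \<tau> (Y \<tau>) \<bullet> v - ?g \<tau> - e \<le> H t (\<Phi> t (lam c0 y))" if e: "e > 0" for e
   proof -
    obtain d where dd: "d > 0" "\<And>z. z \<in> ?I \<times> ?U ==> dist z (\<tau>, Y \<tau>) < d ==> dist (F z) (F (\<tau>, Y \<tau>)) < e"
     using cF[rule_format, OF e] by (elim exE conjE) (use that in blast)
    have "imp c c0 \<tau> (Y \<tau>) \<bullet> v - ?g \<tau> - e \<le> H t (\<Phi> t (lam c0 y))"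
     if ty: "t \<in> ?I" "y \<in> ?U" "\<bar>t - \<tau>\<bar> < d / 2" "norm (y - Y \<tau>) < d / 2" for t y
    proof -
     have "dist (t, y) (\<tau>, Y \<tau>) \<le> \<bar>t - \<tau>\<bar> + norm (y - Y \<tau>)"
      unfolding dist_norm diff_Pair real_norm_def[symmetric] by (rule norm_Pair_le)
     also have "\<dots> < d" using ty(3,4) by linarith
     finally have "dist (F (t, y)) (F (\<tau>, Y \<tau>)) < e" by (intro dd(2)) (use ty in auto)
     then have "F (\<tau>, Y \<tau>) - e \<le> F (t, y)" by (simp add: dist_real_def)
     then show ?thesis using FH[OF ty(1,2)] unfolding F\<tau> by linarith
    qed
    moreover have "d / 2 > 0" using dd by simp
    ultimately show ?thesis by blast
   qed
   show "\<exists>\<zeta>'. ((\<lambda>t. pos c c0 t (Y t)) has_vector_derivative \<zeta>') (at \<tau> within {a..b}) \<and>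
    (\<forall>e>0. \<exists>d>0. \<forall>t\<in>?I. \<forall>y\<in>?U. \<bar>t - \<tau>\<bar> < d \<and> norm (y - Y \<tau>) < d -->
     imp c c0 \<tau> (Y \<tau>) \<bullet> \<zeta>' - ?g \<tau> - e \<le> H t (\<Phi> t (lam c0 y)))"
    by (rule exI[of _ v], rule conjI[OF 1]) (intro allI impI 2)
  qed
  then show "\<theta> b (\<rho> b) - \<theta> a (\<rho> a) \<le> integral {a..b} ?g"
   using lamY[of a] lamY[of b] t[of a] t[of b] ab by simp
 qed
qed

theorem value_increment_le_cost:
 assumes \<xi>: "solves A (carrier_of A) (\<lambda>t x. dyn P x (\<upsilon> t)) {0..T} \<xi>" and T: "0 \<le> T" "T \<le> T\<^sub>1"
  and \<rho>: "\<And>t. t \<in> {0..T} ==> \<rho> t \<in> \<Lambda> \<and> fst (\<Phi> t (\<rho> t)) = \<xi> t"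
  and \<upsilon>: "AE t in lebesgue_on {0..T}. \<upsilon> t \<in> ctrl_set P"
  and int: "(\<lambda>t. run_cost P (\<xi> t) (\<upsilon> t)) integrable_on {0..T}"
 shows "\<theta> T (\<rho> T) - \<theta> 0 (\<rho> 0) \<le> p\<^sub>0 * integral {0..T} (\<lambda>t. run_cost P (\<xi> t) (\<upsilon> t))"
proof -
 let ?g = "\<lambda>t. p\<^sub>0 * run_cost P (\<xi> t) (\<upsilon> t)"
 have ac: "mabs_continuous_curve A {0..T} \<xi>" and vel: "AE t in lebesgue_on {0..T}. has_velocity A \<xi> t (dyn P (\<xi> t) (\<upsilon> t))"
  using \<xi> by (simp_all add: solves_def)
 have good: "AE t in lebesgue_on {0..T}. has_velocity A \<xi> t (dyn P (\<xi> t) (\<upsilon> t)) \<and> \<upsilon> t \<in> ctrl_set P"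
  using vel \<upsilon> by eventually_elim simp
 define N where "N = {t\<in>{0..T}. \<not> (has_velocity A \<xi> t (dyn P (\<xi> t) (\<upsilon> t)) \<and> \<upsilon> t \<in> ctrl_set P)}"
 have N: "negligible N" unfolding N_def by (rule AE_lebesgue_on_imp_negligible[OF _ good]) simp
 have gint: "?g integrable_on {0..T}" using integrable_on_cmult_left[OF int, of p\<^sub>0] by simp
 have "(0::real) \<le> 0 \<and> T \<le> T --> \<theta> T (\<rho> T) - \<theta> 0 (\<rho> 0) \<le> integral {0..T} ?g"
 proof (rule Bolzano[OF T(1), where P = "\<lambda>a b. 0 \<le> a \<and> b \<le> T --> \<theta> b (\<rho> b) - \<theta> a (\<rho> a) \<le> integral {a..b} ?g"])
  fix a b c :: real
  assume 1: "0 \<le> a \<and> b \<le> T --> \<theta> b (\<rho> b) - \<theta> a (\<rho> a) \<le> integral {a..b} ?g"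
   and 2: "0 \<le> b \<and> c \<le> T --> \<theta> c (\<rho> c) - \<theta> b (\<rho> b) \<le> integral {b..c} ?g" and abc: "a \<le> b" "b \<le> c"
  show "0 \<le> a \<and> c \<le> T --> \<theta> c (\<rho> c) - \<theta> a (\<rho> a) \<le> integral {a..c} ?g"
  proof
   assume ac: "0 \<le> a \<and> c \<le> T"
   have "?g integrable_on {a..c}" by (rule integrable_on_subinterval[OF gint]) (use ac in auto)
   from Henstock_Kurzweil_Integration.integral_combine[OF abc this] 1 2 abc ac
   show "\<theta> c (\<rho> c) - \<theta> a (\<rho> a) \<le> integral {a..c} ?g" by linarith
  qed
 next
  fix s assume "0 \<le> s" "s \<le> T"
  then have s: "s \<in> {0..T}" by simp
  obtain d where d: "d > 0" "\<And>a b. 0 \<le> a ==> a \<le> s ==> s \<le> b ==> b \<le> T ==> b - a < d ==>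
   \<theta> b (\<rho> b) - \<theta> a (\<rho> a) \<le> integral {a..b} ?g"
   by (rule value_increment_local[OF ac T(2) \<rho> N _ int s]) (auto simp: N_def)
  then show "\<exists>d>0. \<forall>a b. a \<le> s \<and> s \<le> b \<and> b - a < d --> (0 \<le> a \<and> b \<le> T -->
   \<theta> b (\<rho> b) - \<theta> a (\<rho> a) \<le> integral {a..b} ?g)" by blast
 qed
 then show ?thesis by simp
qed

end

section \<open>The reference extremal and the cost comparison\<close>

lemma Ck_on_subset: "Ck_on k S f ==> T \<subseteq> S ==> Ck_on k T f"
 by (induction k arbitrary: f) (auto intro: continuous_on_subset)

lemma AE_lebesgue_on_subset:
 assumes "AE t in lebesgue_on S. P t" "T \<subseteq> S" "S \<in> sets lebesgue" "T \<in> sets lebesgue"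
 shows "AE t in lebesgue_on T. P t"
 by (rule AE_lebesgue_onI[OF _ assms(2,4)]) (use assms(1,3) in \<open>simp add: AE_restrict_space_iff\<close>)

context C1_atlas begin

lemma mabs_continuous_curve_subset:
 "mabs_continuous_curve A S \<gamma> ==> T \<subseteq> S ==> mabs_continuous_curve A T \<gamma>"
 using mcontinuous_curve_subset unfolding mabs_continuous_curve_def by blast

lemma curves_agree_at_limit:
 assumes haus: "Hausdorff_space (mtop A)" and \<gamma>: "mcontinuous_curve A S \<gamma>" "mcontinuous_curve A S \<gamma>'"
  and x: "x \<in> S" "\<And>d. d > 0 ==> \<exists>s\<in>S. \<bar>s - x\<bar> < d \<and> \<gamma> s = \<gamma>' s"
 shows "\<gamma> x = \<gamma>' x"
proof (rule ccontr)
 assume "\<gamma> x \<noteq> \<gamma>' x"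
 then obtain U1 U2 where U: "openin (mtop A) U1" "openin (mtop A) U2" "\<gamma> x \<in> U1" "\<gamma>' x \<in> U2" "disjnt U1 U2"
  using haus curve_in_carrier[OF \<gamma>(1) x(1)] curve_in_carrier[OF \<gamma>(2) x(1)]
  unfolding Hausdorff_space_def topspace_mtop by meson
 obtain d1 where d1: "d1 > 0" "\<And>s. s \<in> S ==> \<bar>s - x\<bar> < d1 ==> \<gamma> s \<in> U1"
  using curve_near[OF \<gamma>(1) U(1) x(1) U(3)] by blast
 obtain d2 where d2: "d2 > 0" "\<And>s. s \<in> S ==> \<bar>s - x\<bar> < d2 ==> \<gamma>' s \<in> U2"
  using curve_near[OF \<gamma>(2) U(2) x(1) U(4)] by blast
 obtain s where s: "s \<in> S" "\<bar>s - x\<bar> < min d1 d2" "\<gamma> s = \<gamma>' s" using x(2)[of "min d1 d2"] d1 d2 by auto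
 then have "\<gamma> s \<in> U1 \<inter> U2" using d1(2)[of s] d2(2)[of s] by auto
 then show False using U(5) by (auto simp: disjnt_def)
qed

lemma has_velocity_unique:
 assumes "has_velocity A \<gamma> t v" "has_velocity A \<gamma> t w"
 shows "v = w"
proof
 fix c
 show "v c = w c"
 proof (cases "c \<in> A \<and> \<gamma> t \<in> dom_of c")
  case True
  then have c: "c \<in> A" "\<gamma> t \<in> dom_of c" by blast+
  have "((crd c \<circ> \<gamma>) has_vector_derivative u c) (at t)" if u: "has_velocity A \<gamma> t u" for u
   by (rule mp[OF bspec[OF conjunct2[OF u[unfolded has_velocity_def]] c(1)] c(2)])
  from this[OF assms(1)] this[OF assms(2)] show ?thesis by (rule vector_derivative_unique_at)
 next
  case False
  have "u c = 0" if u: "has_velocity A \<gamma> t u" for u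
   by (rule mp[OF spec[OF conjunct2[OF conjunct1[OF u[unfolded has_velocity_def tangent_space_def mem_Collect_eq]]]] False])
  from this[OF assms(1)] this[OF assms(2)] show ?thesis by simp
 qed
qed

lemma has_velocity_cong:
 assumes "has_velocity A \<gamma> t v" "t \<in> interior S" "\<And>s. s \<in> S ==> \<gamma> s = \<gamma>' s"
 shows "has_velocity A \<gamma>' t v"
proof -
 have t: "t \<in> S" using assms(2) interior_subset by blast
 show ?thesis unfolding has_velocity_def
 proof (intro conjI ballI impI)
  show "v \<in> tangent_space A (\<gamma>' t)" using assms(1) unfolding has_velocity_def assms(3)[OF t] by blast
  fix c assume c: "c \<in> A" "\<gamma>' t \<in> dom_of c"
  then have "((crd c \<circ> \<gamma>) has_vector_derivative v c) (at t)" using assms(1) assms(3)[OF t] unfolding has_velocity_def by simp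
  then show "((crd c \<circ> \<gamma>') has_vector_derivative v c) (at t)"
   by (rule has_vector_derivative_transform_within_open[OF _ open_interior assms(2)])
    (use assms(3) subsetD[OF interior_subset[of S]] in auto)
 qed
qed

end

context extremal_field begin

text \<open>Uniqueness holds only for solutions in \<open>\<O>\<close>, and \<open>\<eta>\<close> is not known to stay there. As long as \<open>\<eta>\<close> agrees with the
  flow it is in \<open>\<O>\<close>, hence in \<open>\<O>\<close> a little longer; agreement passes to limits by the Hausdorff property.\<close>
lemma trajectory_follows_flow:
 assumes \<eta>: "mabs_continuous_curve (cot_atlas A) {0..S} \<eta>"
  and vel: "AE t in lebesgue_on {0..S}. has_velocity (cot_atlas A) \<eta> t (XH t (\<eta> t))"
  and start: "\<eta> 0 \<in> \<Lambda>" and S: "{0..S} \<subseteq> J" and t: "t \<in> {0..S}"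
 shows "\<Phi> t (\<eta> 0) = \<eta> t"
proof -
 have S0: "0 \<le> S" using t by simp
 have \<eta>c: "mcontinuous_curve (cot_atlas A) {0..S} \<eta>" using \<eta> by (simp add: mabs_continuous_curve_def)
 have "mcontinuous_curve (cot_atlas A) J (\<lambda>t. \<Phi> t (\<eta> 0))"
  using flow_facts(2)[OF start] by (simp add: solves_def mabs_continuous_curve_def)
 then have \<Phi>c: "mcontinuous_curve (cot_atlas A) {0..S} (\<lambda>t. \<Phi> t (\<eta> 0))" by (rule TM.mcontinuous_curve_subset[OF _ S])
 define Q where "Q t \<longleftrightarrow> (\<forall>s\<in>{0..t}. \<Phi> s (\<eta> 0) = \<eta> s)" for t
 have "(0::real) \<le> 0 \<and> S \<le> S --> Q 0 --> Q S"
 proof (rule Bolzano[OF S0, where P = "\<lambda>a b. 0 \<le> a \<and> b \<le> S --> Q a --> Q b"])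
  fix x assume x: "0 \<le> x" "x \<le> S"
  show "\<exists>d>0. \<forall>a b. a \<le> x \<and> x \<le> b \<and> b - a < d --> (0 \<le> a \<and> b \<le> S --> Q a --> Q b)"
  proof (cases "Q x")
   case True
   then have "\<Phi> x (\<eta> 0) = \<eta> x" using x by (simp add: Q_def)
   then have "\<eta> x \<in> \<O>" using flow_in[OF start, of x] S x by auto
   then obtain d where d: "d > 0" "\<And>s. s \<in> {0..S} ==> \<bar>s - x\<bar> < d ==> \<eta> s \<in> \<O>"
    using TM.curve_near[OF \<eta>c \<O>, of x] x by auto
   have "Q b" if ab: "a \<le> x" "x \<le> b" "b - a < d" "0 \<le> a" "b \<le> S" and Qa: "Q a" for a b
    unfolding Q_def
   proof
    fix s assume s: "s \<in> {0..b}"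
    have bS: "{0..b} \<subseteq> {0..S}" using ab by auto
    have "\<eta> ` {0..b} \<subseteq> \<O>"
    proof (rule image_subsetI)
     fix r assume r: "r \<in> {0..b}"
     show "\<eta> r \<in> \<O>"
     proof (cases "r \<le> a")
      case True
      then have "\<Phi> r (\<eta> 0) = \<eta> r" using Qa r by (simp add: Q_def)
      moreover have "r \<in> J" using r bS S by blast
      ultimately show ?thesis using flow_in[OF start, of r] by simp
     next
      case False
      then show ?thesis using d(2)[of r] r ab by auto
     qed
    qed
    moreover have "AE t in lebesgue_on {0..b}. has_velocity (cot_atlas A) \<eta> t (XH t (\<eta> t))"
     by (rule AE_lebesgue_on_subset[OF vel bS]) auto
    ultimately have "solves (cot_atlas A) \<O> XH {0..b} \<eta>"
     unfolding solves_def using TM.mabs_continuous_curve_subset[OF \<eta> bS] by blast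
    then show "\<Phi> s (\<eta> 0) = \<eta> s"
     using flow_facts(3)[OF start _ _ order_trans[OF bS S], of \<eta> s] s ab by (simp add: is_interval_cc)
   qed
   then show ?thesis using d(1) by blast
  next
   case False
   \<comment> \<open>Agreement on \<open>{0..<x}\<close> would extend to \<open>x\<close>; hence it fails strictly before \<open>x\<close>, and no \<open>a\<close> close to \<open>x\<close> needs to be considered.\<close>
   have "\<exists>s\<in>{0..<x}. \<Phi> s (\<eta> 0) \<noteq> \<eta> s"
   proof (rule ccontr)
    assume "\<not> ?thesis"
    then have eq: "\<And>s. 0 \<le> s ==> s < x ==> \<Phi> s (\<eta> 0) = \<eta> s" by auto
    have "\<Phi> x (\<eta> 0) = \<eta> x"
    proof (cases "x = 0")
     case True
     then show ?thesis using flow_facts(1)[OF start] by simp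
    next
     case False
     show ?thesis
     proof (rule TM.curves_agree_at_limit[OF Hausdorff_cot[OF haus] \<Phi>c \<eta>c])
      show "x \<in> {0..S}" using x by simp
      fix d :: real assume "d > 0"
      then show "\<exists>s\<in>{0..S}. \<bar>s - x\<bar> < d \<and> \<Phi> s (\<eta> 0) = \<eta> s"
       using False x by (intro bexI[of _ "max 0 (x - d / 2)"] conjI eq) auto
     qed
    qed
    then have "Q x" unfolding Q_def using eq by (metis atLeastAtMost_iff order_le_less)
    then show False using \<open>\<not> Q x\<close> by simp
   qed
   then obtain s where s: "0 \<le> s" "s < x" "\<Phi> s (\<eta> 0) \<noteq> \<eta> s" by auto
   have "\<not> Q a" if "a \<le> x" "x \<le> b" "b - a < x - s" for a b
    using s that by (auto simp: Q_def intro!: bexI[of _ s])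
   then show ?thesis using s(2) by (intro exI[of _ "x - s"]) auto
  qed
 qed auto
 moreover have "Q 0" using flow_facts(1)[OF start] by (simp add: Q_def)
 ultimately show ?thesis using t by (simp add: Q_def)
qed

end

context extremal_control begin

text \<open>Along the reference extremal the projection of the Hamiltonian field is the velocity of \<open>\<xi>\<close>, that is the
  dynamics, so the pairings in the Lagrangian cancel and leave the running cost.\<close>
lemma reference_value:
 assumes \<eta>: "mabs_continuous_curve (cot_atlas A) {0..S} \<eta>" and start: "\<eta> 0 \<in> \<Lambda>" and S: "0 \<le> S" "{0..S} \<subseteq> J"
  and vel: "AE t in lebesgue_on {0..S}. has_velocity (cot_atlas A) \<eta> t (XH t (\<eta> t))"
  and H_eq: "AE t in lebesgue_on {0..S}. H t (\<eta> t) = pre_ham P p\<^sub>0 (\<eta> t) (\<upsilon> t)"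
  and proj: "\<And>t. t \<in> {0..S} ==> fst (\<eta> t) = \<xi> t"
  and \<xi>: "AE t in lebesgue_on {0..S}. has_velocity A \<xi> t (dyn P (\<xi> t) (\<upsilon> t))"
 shows "\<theta> S (\<eta> 0) = \<alpha> (\<xi> 0) + p\<^sub>0 * integral {0..S} (\<lambda>t. run_cost P (\<xi> t) (\<upsilon> t))"
proof -
 have \<eta>c: "mcontinuous_curve (cot_atlas A) {0..S} \<eta>" using \<eta> by (simp add: mabs_continuous_curve_def)
 have "AE t in lebesgue_on {0..S}. has_velocity (cot_atlas A) \<eta> t (XH t (\<eta> t)) \<and>
  H t (\<eta> t) = pre_ham P p\<^sub>0 (\<eta> t) (\<upsilon> t) \<and> has_velocity A \<xi> t (dyn P (\<xi> t) (\<upsilon> t))"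
  using vel H_eq \<xi> by eventually_elim blast
 from AE_lebesgue_on_imp_negligible[OF _ this]
 have N: "negligible {t\<in>{0..S}. \<not> (has_velocity (cot_atlas A) \<eta> t (XH t (\<eta> t)) \<and>
  H t (\<eta> t) = pre_ham P p\<^sub>0 (\<eta> t) (\<upsilon> t) \<and> has_velocity A \<xi> t (dyn P (\<xi> t) (\<upsilon> t)))}" (is "negligible ?N") by simp
 have N': "negligible (?N \<union> {0, S})" using N by (intro negligible_Un) auto
 have "integral {0..S} (\<lambda>t. Lag t (\<eta> 0)) = integral {0..S} (\<lambda>t. p\<^sub>0 * run_cost P (\<xi> t) (\<upsilon> t))"
 proof (rule integral_spike[OF N'])
  fix t assume t: "t \<in> {0..S} - (?N \<union> {0, S})"
  then have tS: "t \<in> {0..S}" "t \<in> interior {0..S}" by (auto simp: interior_atLeastAtMost_real)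
  have v: "has_velocity (cot_atlas A) \<eta> t (XH t (\<eta> t))" and h: "H t (\<eta> t) = pre_ham P p\<^sub>0 (\<eta> t) (\<upsilon> t)"
   and x: "has_velocity A \<xi> t (dyn P (\<xi> t) (\<upsilon> t))" using t by blast+
  have "has_velocity A (\<lambda>s. fst (\<eta> s)) t (proj_push A (\<eta> t) (XH t (\<eta> t)))"
   by (rule has_velocity_projection[OF v \<eta>c tS(2)])
  then have "has_velocity A \<xi> t (proj_push A (\<eta> t) (XH t (\<eta> t)))"
   by (rule has_velocity_cong[OF _ tS(2) proj])
  then have "proj_push A (\<eta> t) (XH t (\<eta> t)) = dyn P (\<xi> t) (\<upsilon> t)" by (rule has_velocity_unique[OF _ x])
  then show "p\<^sub>0 * run_cost P (\<xi> t) (\<upsilon> t) = Lag t (\<eta> 0)"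
   unfolding lagrangian_along_def trajectory_follows_flow[OF \<eta> vel start S(2) tS(1)] h pre_ham_def proj[OF tS(1)] by simp
 qed
 then show ?thesis using proj[of 0] S by (simp add: theta_def)
qed

end

theorem theorem3p9:
 fixes P :: "('p, 'e::euclidean_space, 'u::euclidean_space) control_problem"
  and g\<^sub>M :: "('p, 'e) metric_tensor"
  and g\<^sub>T :: "(('p, 'e) cot, 'e \<times> 'e) metric_tensor"
  and p\<^sub>0 T T\<^sub>h T\<^sub>1 :: real
  and \<xi> \<xi>\<^sub>h :: "real \<Rightarrow> 'p"
  and \<upsilon> \<upsilon>\<^sub>h :: "real \<Rightarrow> 'u"
  and \<eta>\<^sub>h :: "real \<Rightarrow> ('p, 'e) cot"
  and \<alpha> \<beta> :: "'p \<Rightarrow> real"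
  and D\<^sub>\<alpha> D\<^sub>\<beta> V :: "'p set"
  and J :: "real set"
  and \<O> \<O>' \<Lambda> :: "('p, 'e) cot set"
  and H :: "real \<Rightarrow> ('p, 'e) cot \<Rightarrow> real"
  and \<H> :: "real \<Rightarrow> ('p, 'e) cot \<Rightarrow> ('p, 'e) cot"
  and \<U> :: "(real \<times> 'p) set"
 defines "M \<equiv> atlas P"
  and "TM \<equiv> cot_atlas (atlas P)"
  and "d\<^sub>M \<equiv> riemannian_dist (atlas P) g\<^sub>M"
  and "d\<^sub>T \<equiv> riemannian_dist (cot_atlas (atlas P)) g\<^sub>T"
  and "X\<^sub>H \<equiv> \<lambda>t. hamiltonian_vector (atlas P) (H t)"
  and "X\<^sub>h \<equiv> \<lambda>t. hamiltonian_vector (atlas P) (\<lambda>l. pre_ham P p\<^sub>0 l (\<upsilon>\<^sub>h t))"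
  and "\<theta> \<equiv> theta (atlas P) \<alpha> H \<H>"
 assumes problem: "control_problem P"
  and metrics: "riemannian_metric M g\<^sub>M" "riemannian_metric TM g\<^sub>T"
  and reference: "admissible P T\<^sub>h \<xi>\<^sub>h \<upsilon>\<^sub>h" "pmp_extremal P p\<^sub>0 T\<^sub>h \<xi>\<^sub>h \<upsilon>\<^sub>h \<eta>\<^sub>h"
  and alpha:
   "openin (mtop M) D\<^sub>\<alpha>" "\<xi>\<^sub>h 0 \<in> D\<^sub>\<alpha>" "msmooth_on M D\<^sub>\<alpha> \<alpha>"
   "\<forall>x\<in>init_mfd P \<inter> D\<^sub>\<alpha>. \<alpha> x = p\<^sub>0 * init_cost P x"
   "differential M \<alpha> (\<xi>\<^sub>h 0) = snd (\<eta>\<^sub>h 0)"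
  and beta:
   "openin (mtop M) D\<^sub>\<beta>" "\<xi>\<^sub>h T\<^sub>h \<in> D\<^sub>\<beta>" "msmooth_on M D\<^sub>\<beta> \<beta>"
   "\<forall>x\<in>final_mfd P \<inter> D\<^sub>\<beta>. \<beta> x = p\<^sub>0 * final_cost P x"
   "differential M \<beta> (\<xi>\<^sub>h T\<^sub>h) = (\<lambda>v. - snd (\<eta>\<^sub>h T\<^sub>h) v)"
  and Lambda:
   "openin (mtop M) V" "\<xi>\<^sub>h 0 \<in> V" "V \<subseteq> D\<^sub>\<alpha>" "contractible_space (subtopology (mtop M) V)"
   "openin (mtop TM) \<O>'" "\<eta>\<^sub>h 0 \<in> \<O>'"
   "\<Lambda> = graph_differential M \<alpha> V \<inter> \<O>'"
  and times: "open J" "is_interval J" "{0..T\<^sub>1} \<subseteq> J" "T\<^sub>h < T\<^sub>1"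
  and hamiltonian:
   "openin (mtop TM) \<O>" "\<Lambda> \<subseteq> \<O>"
   "AE t in lebesgue_on J. \<forall>l\<in>\<O>. mdifferentiable_at TM (H t) l"
  and A1:
   "is_flow TM \<O> X\<^sub>H J \<Lambda> \<H>"
   "\<exists>L. \<forall>t\<in>J. \<forall>l\<in>\<Lambda>. \<forall>s\<in>J. \<forall>k\<in>\<Lambda>. d\<^sub>T (\<H> t l) (\<H> s k) \<le> L * (\<bar>t - s\<bar> + d\<^sub>T l k)"
   "lipschitz_caratheodory (mtop TM) d\<^sub>T J \<Lambda> (lagrangian_along M H \<H>)"
  and A2:
   "\<forall>t\<in>J. \<forall>l\<in>\<Lambda>. max_ham P p\<^sub>0 (\<H> t l) \<le> ereal (H t (\<H> t l))"
   "AE t in lebesgue_on {0..T\<^sub>h}. \<eta>\<^sub>h t \<in> \<O> \<and>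
     H t (\<eta>\<^sub>h t) = pre_ham P p\<^sub>0 (\<eta>\<^sub>h t) (\<upsilon>\<^sub>h t) \<and>
     ereal (pre_ham P p\<^sub>0 (\<eta>\<^sub>h t) (\<upsilon>\<^sub>h t)) = max_ham P p\<^sub>0 (\<eta>\<^sub>h t) \<and>
     X\<^sub>H t (\<eta>\<^sub>h t) = X\<^sub>h t (\<eta>\<^sub>h t)"
  and reference_flow: "\<exists>\<Psi>. is_flow TM (carrier_of TM) X\<^sub>h {0..T\<^sub>h} \<Lambda> \<Psi>"
  and A3:
   "bij_betw (\<lambda>(t, l). (t, fst (\<H> t l))) ({0..T\<^sub>1} \<times> \<Lambda>) \<U>"
   "\<exists>L. \<forall>t\<in>{0..T\<^sub>1}. \<forall>l\<in>\<Lambda>. \<forall>s\<in>{0..T\<^sub>1}. \<forall>k\<in>\<Lambda>.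
     \<bar>t - s\<bar> + d\<^sub>M (fst (\<H> t l)) (fst (\<H> s k)) \<le> L * (\<bar>t - s\<bar> + d\<^sub>T l k)"
   "\<exists>L. \<forall>t\<in>{0..T\<^sub>1}. \<forall>l\<in>\<Lambda>. \<forall>s\<in>{0..T\<^sub>1}. \<forall>k\<in>\<Lambda>.
     \<bar>t - s\<bar> + d\<^sub>T l k \<le> L * (\<bar>t - s\<bar> + d\<^sub>M (fst (\<H> t l)) (fst (\<H> s k)))"
   "openin (prod_topology (top_of_set {0..T\<^sub>1}) (mtop M)) \<U>"
   "\<forall>t\<in>{0..T\<^sub>h}. (t, \<xi>\<^sub>h t) \<in> \<U>"
  and well_defined_costs: "finite_cost P T \<xi> \<upsilon>" "finite_cost P T\<^sub>h \<xi>\<^sub>h \<upsilon>\<^sub>h"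
  and trajectory:
   "admissible P T \<xi> \<upsilon>"
   "\<forall>t\<in>{0..T}. (t, \<xi> t) \<in> \<U>"
   "\<xi> T \<in> D\<^sub>\<beta>"
 defines "\<rho> \<equiv> \<lambda>t. inv_into \<Lambda> (\<lambda>l. fst (\<H> t l)) (\<xi> t)"
 shows "p\<^sub>0 * (cost P T \<xi> \<upsilon> - cost P T\<^sub>h \<xi>\<^sub>h \<upsilon>\<^sub>h)
      \<ge> \<beta> (\<xi> T) + \<theta> T (\<rho> T) - \<beta> (\<xi>\<^sub>h T\<^sub>h) - \<theta> T\<^sub>h (\<eta>\<^sub>h 0)"
proof -
 have smooth: "smooth_atlas (atlas P)" and haus: "Hausdorff_space (mtop (atlas P))" and conn: "connected_space (mtop (atlas P))"
  using problem by (simp_all add: control_problem_def connected_paracompact_manifold_def)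
 have \<alpha>V: "msmooth_on (atlas P) V \<alpha>"
  unfolding msmooth_on_def smooth_on_def
 proof (intro ballI allI)
  fix c k assume "c \<in> atlas P"
  then have "Ck_on k (crd c ` (D\<^sub>\<alpha> \<inter> dom_of c)) (\<alpha> \<circ> crd_inv c)"
   using alpha(3) by (simp add: M_def msmooth_on_def smooth_on_def)
  then show "Ck_on k (crd c ` (V \<inter> dom_of c)) (\<alpha> \<circ> crd_inv c)"
   by (rule Ck_on_subset) (use Lambda(3) in blast)
 qed
 have \<xi>s: "solves (atlas P) (carrier_of (atlas P)) (\<lambda>t x. dyn P x (\<upsilon> t)) {0..T} \<xi>" and T0: "0 < T"
  and \<upsilon>: "AE t in lebesgue_on {0..T}. \<upsilon> t \<in> ctrl_set P" and ends: "\<xi> 0 \<in> init_mfd P" "\<xi> T \<in> final_mfd P"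
  using trajectory(1) by (simp_all add: admissible_def control_fun_def)
 have \<xi>hs: "solves (atlas P) (carrier_of (atlas P)) (\<lambda>t x. dyn P x (\<upsilon>\<^sub>h t)) {0..T\<^sub>h} \<xi>\<^sub>h" and Th0: "0 < T\<^sub>h"
  and endsh: "\<xi>\<^sub>h 0 \<in> init_mfd P" "\<xi>\<^sub>h T\<^sub>h \<in> final_mfd P"
  using reference(1) by (simp_all add: admissible_def)
 have proj: "\<forall>t\<in>{0..T\<^sub>h}. fst (\<eta>\<^sub>h t) = \<xi>\<^sub>h t"
  and \<eta>s: "solves (cot_atlas (atlas P)) (carrier_of (cot_atlas (atlas P))) X\<^sub>h {0..T\<^sub>h} \<eta>\<^sub>h"
  using reference(2) by (simp_all add: pmp_extremal_def X\<^sub>h_def)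
 interpret extremal_control P g\<^sub>T \<alpha> V \<O>' \<O> J H \<H> g\<^sub>M p\<^sub>0 T\<^sub>1
 proof
  show "smooth_atlas (atlas P)" "Hausdorff_space (mtop (atlas P))" "connected_space (mtop (atlas P))"
   "msmooth_on (atlas P) V \<alpha>" "control_problem P" by (fact smooth haus conn \<alpha>V problem)+
  show "riemannian_metric (cot_atlas (atlas P)) g\<^sub>T" "riemannian_metric (atlas P) g\<^sub>M"
   using metrics by (simp_all add: M_def TM_def)
  show "openin (mtop (atlas P)) V" "openin (mtop (cot_atlas (atlas P))) \<O>'" "openin (mtop (cot_atlas (atlas P))) \<O>"
   using Lambda(1,5) hamiltonian(1) by (simp_all add: M_def TM_def)
  show "open J" "is_interval J" "{0..T\<^sub>1} \<subseteq> J" "0 < T\<^sub>1" using times Th0 by auto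
  show "AE t in lebesgue_on J. \<forall>l\<in>\<O>. mdifferentiable_at (cot_atlas (atlas P)) (H t) l"
   using hamiltonian(3) by (simp add: TM_def)
  show "is_flow (cot_atlas (atlas P)) \<O> (\<lambda>t. hamiltonian_vector (atlas P) (H t)) J
    (graph_differential (atlas P) \<alpha> V \<inter> \<O>') \<H>"
   using A1(1) unfolding Lambda(7) X\<^sub>H_def TM_def M_def .
  show "\<exists>L. \<forall>t\<in>J. \<forall>l\<in>graph_differential (atlas P) \<alpha> V \<inter> \<O>'. \<forall>s\<in>J. \<forall>k\<in>graph_differential (atlas P) \<alpha> V \<inter> \<O>'.
    riemannian_dist (cot_atlas (atlas P)) g\<^sub>T (\<H> t l) (\<H> s k) \<le> L * (\<bar>t - s\<bar> + riemannian_dist (cot_atlas (atlas P)) g\<^sub>T l k)"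
   using A1(2) unfolding Lambda(7) d\<^sub>T_def M_def .
  show "lipschitz_caratheodory (mtop (cot_atlas (atlas P))) (riemannian_dist (cot_atlas (atlas P)) g\<^sub>T) J
    (graph_differential (atlas P) \<alpha> V \<inter> \<O>') (lagrangian_along (atlas P) H \<H>)"
   using A1(3) unfolding Lambda(7) d\<^sub>T_def TM_def M_def .
  show "max_ham P p\<^sub>0 (\<H> t l) \<le> ereal (H t (\<H> t l))" if "t \<in> J" "l \<in> graph_differential (atlas P) \<alpha> V \<inter> \<O>'" for t l
   using A2(1) that unfolding Lambda(7) M_def by blast
  show "\<exists>L. \<forall>t\<in>{0..T\<^sub>1}. \<forall>l\<in>graph_differential (atlas P) \<alpha> V \<inter> \<O>'. \<forall>s\<in>{0..T\<^sub>1}. \<forall>k\<in>graph_differential (atlas P) \<alpha> V \<inter> \<O>'.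
    \<bar>t - s\<bar> + riemannian_dist (cot_atlas (atlas P)) g\<^sub>T l k
     \<le> L * (\<bar>t - s\<bar> + riemannian_dist (atlas P) g\<^sub>M (fst (\<H> t l)) (fst (\<H> s k)))"
   using A3(3) unfolding Lambda(7) d\<^sub>T_def d\<^sub>M_def M_def .
 qed
 have \<Lambda>_eq: "\<Lambda> = graph_differential (atlas P) \<alpha> V \<inter> \<O>'" using Lambda(7) by (simp add: M_def)
 have \<U>: "\<U> = (\<lambda>(t, l). (t, fst (\<H> t l))) ` ({0..T\<^sub>1} \<times> \<Lambda>)" using A3(1) by (simp add: bij_betw_def)
 have lift: "t \<in> {0..T\<^sub>1} \<and> \<rho> t \<in> graph_differential (atlas P) \<alpha> V \<inter> \<O>' \<and> fst (\<H> t (\<rho> t)) = \<xi> t" if "t \<in> {0..T}" for t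
 proof -
  have "(t, \<xi> t) \<in> \<U>" using trajectory(2) that by blast
  then have t: "t \<in> {0..T\<^sub>1}" "\<xi> t \<in> (\<lambda>l. fst (\<H> t l)) ` \<Lambda>" unfolding \<U> by auto
  then have "\<rho> t \<in> \<Lambda>" "fst (\<H> t (\<rho> t)) = \<xi> t"
   unfolding \<rho>_def using inv_into_into[of "\<xi> t" "\<lambda>l. fst (\<H> t l)" \<Lambda>] f_inv_into_f[of "\<xi> t" "\<lambda>l. fst (\<H> t l)" \<Lambda>] by blast+
  then show ?thesis using t(1) \<Lambda>_eq by simp
 qed
 have T1: "T \<le> T\<^sub>1" using lift[of T] T0 by simp
 have int: "(\<lambda>t. run_cost P (\<xi> t) (\<upsilon> t)) integrable_on {0..T}"
  using well_defined_costs(1) by (simp add: finite_cost_def absolutely_integrable_on_def)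
 have upper: "\<theta> T (\<rho> T) - \<theta> 0 (\<rho> 0) \<le> p\<^sub>0 * integral {0..T} (\<lambda>t. run_cost P (\<xi> t) (\<upsilon> t))"
  unfolding \<theta>_def
  by (rule value_increment_le_cost[OF \<xi>s less_imp_le[OF T0] T1 _ \<upsilon> int]) (use lift in blast)
 have \<rho>0: "fst (\<rho> 0) = \<xi> 0" "\<xi> 0 \<in> V"
 proof -
  have 0: "\<rho> 0 \<in> graph_differential (atlas P) \<alpha> V \<inter> \<O>'" "fst (\<H> 0 (\<rho> 0)) = \<xi> 0" using lift[of 0] T0 by auto
  then show 1: "fst (\<rho> 0) = \<xi> 0" using flow_facts(1)[OF 0(1)] by simp
  show "\<xi> 0 \<in> V" using 0(1) unfolding 1[symmetric] by (auto simp: graph_differential_def)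
 qed
 have start: "\<theta> 0 (\<rho> 0) = p\<^sub>0 * init_cost P (\<xi> 0)"
  using \<rho>0 alpha(4) ends(1) Lambda(3) by (auto simp: \<theta>_def theta_def)
 have \<eta>0: "\<eta>\<^sub>h 0 \<in> graph_differential (atlas P) \<alpha> V \<inter> \<O>'"
 proof -
  have "\<eta>\<^sub>h 0 = (\<xi>\<^sub>h 0, differential (atlas P) \<alpha> (\<xi>\<^sub>h 0))"
   using alpha(5) proj Th0 by (simp add: M_def prod_eq_iff)
  then show ?thesis using Lambda(2,6) by (simp add: graph_differential_def)
 qed
 have "AE t in lebesgue_on {0..T\<^sub>h}. has_velocity (cot_atlas (atlas P)) \<eta>\<^sub>h t (X\<^sub>h t (\<eta>\<^sub>h t))"
  using \<eta>s by (simp add: solves_def)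
 with A2(2) have "AE t in lebesgue_on {0..T\<^sub>h}. has_velocity (cot_atlas (atlas P)) \<eta>\<^sub>h t (X\<^sub>H t (\<eta>\<^sub>h t)) \<and>
   H t (\<eta>\<^sub>h t) = pre_ham P p\<^sub>0 (\<eta>\<^sub>h t) (\<upsilon>\<^sub>h t)"
  by eventually_elim simp
 then have velh: "AE t in lebesgue_on {0..T\<^sub>h}. has_velocity (cot_atlas (atlas P)) \<eta>\<^sub>h t (hamiltonian_vector (atlas P) (H t) (\<eta>\<^sub>h t))"
  and Hh: "AE t in lebesgue_on {0..T\<^sub>h}. H t (\<eta>\<^sub>h t) = pre_ham P p\<^sub>0 (\<eta>\<^sub>h t) (\<upsilon>\<^sub>h t)"
  unfolding X\<^sub>H_def by (auto elim: eventually_mono)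
 have "\<theta> T\<^sub>h (\<eta>\<^sub>h 0) = \<alpha> (\<xi>\<^sub>h 0) + p\<^sub>0 * integral {0..T\<^sub>h} (\<lambda>t. run_cost P (\<xi>\<^sub>h t) (\<upsilon>\<^sub>h t))"
  unfolding \<theta>_def
 proof (rule reference_value[OF _ \<eta>0 _ _ velh Hh])
  show "mabs_continuous_curve (cot_atlas (atlas P)) {0..T\<^sub>h} \<eta>\<^sub>h" using \<eta>s by (simp add: solves_def)
  show "0 \<le> T\<^sub>h" using Th0 by simp
  show "{0..T\<^sub>h} \<subseteq> J" using times by auto
  show "AE t in lebesgue_on {0..T\<^sub>h}. has_velocity (atlas P) \<xi>\<^sub>h t (dyn P (\<xi>\<^sub>h t) (\<upsilon>\<^sub>h t))" using \<xi>hs by (simp add: solves_def)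
 qed (use proj in blast)
 moreover have "\<alpha> (\<xi>\<^sub>h 0) = p\<^sub>0 * init_cost P (\<xi>\<^sub>h 0)" using alpha(2,4) endsh(1) by blast
 moreover have "\<beta> (\<xi>\<^sub>h T\<^sub>h) = p\<^sub>0 * final_cost P (\<xi>\<^sub>h T\<^sub>h)" using beta(2,4) endsh(2) by blast
 moreover have "\<beta> (\<xi> T) = p\<^sub>0 * final_cost P (\<xi> T)" using beta(4) trajectory(3) ends(2) by blast
 ultimately show ?thesis using upper start unfolding cost_def by (simp add: algebra_simps)
qed

end
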